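(* Let $\mathcal{K}$ be a locally presentable category and $\mathcal{X}$ a set of morphisms of $\mathcal{K}$. Then $\operatorname{cof}(\mathcal{X})$, regarded as a full subcategory of $\mathcal{K}^{\to}$, is a split idempotent completion of a full image of an accessible functor $\mathcal{M}\to\mathcal{K}^{\to}$.
   Context: $\mathcal{K}^{\to}$ is the category whose objects are the morphisms of $\mathcal{K}$ and whose morphisms are commutative squares. $\operatorname{cof}(\mathcal{X})$ is the smallest class of morphisms containing $\mathcal{X}$ and all isomorphisms and (a) stable under pushout (along arbitrary morphisms), (b) closed under transfinite composition, (c) closed under retracts in $\mathcal{K}^{\to}$. A class $\mathcal{L}$ is closed under transfinite composition if it is closed under composition and, for every chain $(f_{ij}:A_i\to A_j)_{i\le j\le\lambda}$ with $\lambda$ a limit ordinal which is smooth (for each limit ordinal $j\le\lambda$, $(f_{ij})_{i<j}$ is a colimit cocone) and has $f_{ij}\in\mathcal{L}$ for all $i\le j<\lambda$, one has $f_{0\lambda}\in\mathcal{L}$. A category is $\lambda$-accessible ($\lambda$ a regular cardinal) if it has $\lambda$-directed colimits and a set $\mathcal{A}$ of $\lambda$-presentable objects such that every object is a $\lambda$-directed colimit of objects from $\mathcal{A}$; accessible means $\lambda$-accessible for some regular $\lambda$; locally presentable means cocomplete and accessible. A functor is accessible if its domain and codomain are accessible categories and it preserves $\lambda$-directed colimits for some regular cardinal $\lambda$. The full image of an accessible functor $F:\mathcal{M}\to\mathcal{N}$ is the full subcategory of $\mathcal{N}$ consisting of the objects $FM$, $M\in\mathcal{M}$. An idempotent $f:K\to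 K$ splits if there are $i:X\to K$, $p:K\to X$ with $pi=\mathrm{id}_X$, $ip=f$. A split idempotent completion of a category $\mathcal{L}$ is a functor $H:\mathcal{L}\to\tilde{\mathcal{L}}$, where all idempotents split in $\tilde{\mathcal{L}}$, such that every functor $G:\mathcal{L}\to\mathcal{N}$ into a category where all idempotents split admits a functor $G':\tilde{\mathcal{L}}\to\mathcal{N}$, unique up to isomorphism, with $G'H\cong G$. If $\mathcal{L}$ is a full subcategory of a category in which all idempotents split (e.g. an accessible category), then $\tilde{\mathcal{L}}$ is the closure of $\mathcal{L}$ under retracts in that category. *)

theory Defs
  imports Main "HOL-Library.FuncSet"
begin

unbundle cardinal_syntax

text \<open>
  Size. The type \<open>'u\<close> plays the role of the universe of sets: sets are the subsets of
  cardinality less than \<open>'u\<close>, and classes are arbitrary subsets of \<open>'u\<close>.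
  For this reading the cardinality of \<open>'u\<close> has to be strongly inaccessible. A category whose
  objects and morphisms form classes is then a category of type \<open>('u, 'u) category\<close>, up to
  renaming of objects and morphisms.
\<close>

definition universe :: "'u itself \<Rightarrow> bool" where
  "universe U \<longleftrightarrow>
     natLeq <o |UNIV :: 'u set| \<and>
     regularCard |UNIV :: 'u set| \<and>
     (\<forall>A :: 'u set. |A| <o |UNIV :: 'u set| \<longrightarrow> |Pow A| <o |UNIV :: 'u set| )"

definition small :: "'u itself \<Rightarrow> 'x set \<Rightarrow> bool" where
  "small U A \<longleftrightarrow> |A| <o |UNIV :: 'u set|"

definition regular_cardinal :: "'u rel \<Rightarrow> bool" where
  "regular_cardinal lam \<longleftrightarrow>
     Cinfinite lam \<and> regularCard lam \<and> small TYPE('u) (Field lam)"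


section \<open>Categories and functors\<close>

record ('o, 'a) category =
  Obj :: "'o set"
  Arr :: "'a set"
  Dom :: "'a \<Rightarrow> 'o"
  Cod :: "'a \<Rightarrow> 'o"
  Id :: "'o \<Rightarrow> 'a"
  Comp :: "'a \<Rightarrow> 'a \<Rightarrow> 'a"  (infixl "\<cdot>\<index>" 70)

definition hom :: "('o, 'a) category \<Rightarrow> 'o \<Rightarrow> 'o \<Rightarrow> 'a set" where
  "hom C a b = {f \<in> Arr C. Dom C f = a \<and> Cod C f = b}"

definition is_category :: "('o, 'a) category \<Rightarrow> bool" where
  "is_category C \<longleftrightarrow>
     (\<forall>f \<in> Arr C. Dom C f \<in> Obj C \<and> Cod C f \<in> Obj C) \<and>
     (\<forall>a \<in> Obj C. Id C a \<in> hom C a a) \<and>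
     (\<forall>f \<in> Arr C. \<forall>g \<in> Arr C. Cod C f = Dom C g \<longrightarrow>
        g \<cdot>\<^bsub>C\<^esub> f \<in> hom C (Dom C f) (Cod C g)) \<and>
     (\<forall>f \<in> Arr C. f \<cdot>\<^bsub>C\<^esub> Id C (Dom C f) = f \<and> Id C (Cod C f) \<cdot>\<^bsub>C\<^esub> f = f) \<and>
     (\<forall>f \<in> Arr C. \<forall>g \<in> Arr C. \<forall>h \<in> Arr C. Cod C f = Dom C g \<and> Cod C g = Dom C h \<longrightarrow>
        h \<cdot>\<^bsub>C\<^esub> (g \<cdot>\<^bsub>C\<^esub> f) = h \<cdot>\<^bsub>C\<^esub> g \<cdot>\<^bsub>C\<^esub> f)"

definition small_category :: "'u itself \<Rightarrow> ('o, 'a) category \<Rightarrow> bool" where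
  "small_category U C \<longleftrightarrow> is_category C \<and> small U (Obj C) \<and> small U (Arr C)"

definition locally_small :: "'u itself \<Rightarrow> ('o, 'a) category \<Rightarrow> bool" where
  "locally_small U C \<longleftrightarrow> is_category C \<and> (\<forall>a \<in> Obj C. \<forall>b \<in> Obj C. small U (hom C a b))"

definition is_iso :: "('o, 'a) category \<Rightarrow> 'a \<Rightarrow> bool" where
  "is_iso C f \<longleftrightarrow> f \<in> Arr C \<and>
     (\<exists>g \<in> hom C (Cod C f) (Dom C f).
        g \<cdot>\<^bsub>C\<^esub> f = Id C (Dom C f) \<and> f \<cdot>\<^bsub>C\<^esub> g = Id C (Cod C f))"

definition full_subcategory :: "('o, 'a) category \<Rightarrow> 'o set \<Rightarrow> ('o, 'a) category" where
  "full_subcategory C S = C\<lparr>Obj := S, Arr := {f \<in> Arr C. Dom C f \<in> S \<and> Cod C f \<in> S}\<rparr>"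

definition poset_category :: "'i rel \<Rightarrow> ('i, 'i \<times> 'i) category" where
  "poset_category r =
     \<lparr>Obj = Field r, Arr = r, Dom = fst, Cod = snd, Id = (\<lambda>i. (i, i)),
      Comp = (\<lambda>q p. (fst p, snd q))\<rparr>"

text \<open>
  A morphism \<open>f \<rightarrow> g\<close> of the arrow category is a commutative square \<open>v \<cdot> f = g \<cdot> u\<close>,
  recorded as \<open>(f, u, v, g)\<close>.
\<close>

definition arrow_category :: "('o, 'a) category \<Rightarrow> ('a, 'a \<times> 'a \<times> 'a \<times> 'a) category" where
  "arrow_category C =
     \<lparr>Obj = Arr C,
      Arr = {(f, u, v, g). f \<in> Arr C \<and> g \<in> Arr C \<and>
               u \<in> hom C (Dom C f) (Dom C g) \<and> v \<in> hom C (Cod C f) (Cod C g) \<and>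
               v \<cdot>\<^bsub>C\<^esub> f = g \<cdot>\<^bsub>C\<^esub> u},
      Dom = (\<lambda>(f, u, v, g). f),
      Cod = (\<lambda>(f, u, v, g). g),
      Id = (\<lambda>f. (f, Id C (Dom C f), Id C (Cod C f), f)),
      Comp = (\<lambda>(g, u', v', h) (f, u, v, g'). (f, u' \<cdot>\<^bsub>C\<^esub> u, v' \<cdot>\<^bsub>C\<^esub> v, h))\<rparr>"

text \<open>
  The category of small subsets of \<open>'x\<close> and maps between them. If \<open>'x\<close> has the cardinality
  of the universe, this is equivalent to the category of all sets.
\<close>

definition set_category :: "'u itself \<Rightarrow> ('x set, 'x set \<times> ('x \<Rightarrow> 'x) \<times> 'x set) category" where
  "set_category U =
     \<lparr>Obj = {A. small U A},
      Arr = {(A, f, B). small U A \<and> small U B \<and> f \<in> A \<rightarrow>\<^sub>E B},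
      Dom = (\<lambda>(A, f, B). A),
      Cod = (\<lambda>(A, f, B). B),
      Id = (\<lambda>A. (A, \<lambda>x\<in>A. x, A)),
      Comp = (\<lambda>(B, g, D) (A, f, B'). (A, compose A g f, D))\<rparr>"

record ('o, 'a, 'p, 'b) cat_functor =
  Fobj :: "'o \<Rightarrow> 'p"
  Farr :: "'a \<Rightarrow> 'b"

definition is_functor ::
  "('o, 'a) category \<Rightarrow> ('p, 'b) category \<Rightarrow> ('o, 'a, 'p, 'b) cat_functor \<Rightarrow> bool" where
  "is_functor C D F \<longleftrightarrow> is_category C \<and> is_category D \<and>
     (\<forall>a \<in> Obj C. Fobj F a \<in> Obj D) \<and>
     (\<forall>f \<in> Arr C. Farr F f \<in> hom D (Fobj F (Dom C f)) (Fobj F (Cod C f))) \<and>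
     (\<forall>a \<in> Obj C. Farr F (Id C a) = Id D (Fobj F a)) \<and>
     (\<forall>f \<in> Arr C. \<forall>g \<in> Arr C. Cod C f = Dom C g \<longrightarrow>
        Farr F (g \<cdot>\<^bsub>C\<^esub> f) = Farr F g \<cdot>\<^bsub>D\<^esub> Farr F f)"

definition functor_comp ::
  "('p, 'b, 'q, 'c) cat_functor \<Rightarrow> ('o, 'a, 'p, 'b) cat_functor \<Rightarrow> ('o, 'a, 'q, 'c) cat_functor"
  where "functor_comp G F = \<lparr>Fobj = Fobj G \<circ> Fobj F, Farr = Farr G \<circ> Farr F\<rparr>"

definition inclusion_functor :: "('o, 'a, 'o, 'a) cat_functor" where
  "inclusion_functor = \<lparr>Fobj = id, Farr = id\<rparr>"

definition naturally_isomorphic ::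
  "('o, 'a) category \<Rightarrow> ('p, 'b) category \<Rightarrow>
   ('o, 'a, 'p, 'b) cat_functor \<Rightarrow> ('o, 'a, 'p, 'b) cat_functor \<Rightarrow> bool" where
  "naturally_isomorphic C D F G \<longleftrightarrow>
     (\<exists>t. (\<forall>a \<in> Obj C. t a \<in> hom D (Fobj F a) (Fobj G a) \<and> is_iso D (t a)) \<and>
          (\<forall>f \<in> Arr C. Farr G f \<cdot>\<^bsub>D\<^esub> t (Dom C f) = t (Cod C f) \<cdot>\<^bsub>D\<^esub> Farr F f))"

definition hom_functor ::
  "('o, 'a) category \<Rightarrow> 'o \<Rightarrow> ('o, 'a, 'a set, 'a set \<times> ('a \<Rightarrow> 'a) \<times> 'a set) cat_functor" where
  "hom_functor C a =
     \<lparr>Fobj = hom C a,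
      Farr = (\<lambda>g. (hom C a (Dom C g), \<lambda>f \<in> hom C a (Dom C g). g \<cdot>\<^bsub>C\<^esub> f, hom C a (Cod C g)))\<rparr>"


section \<open>Colimits\<close>

definition is_cocone ::
  "('j, 'k) category \<Rightarrow> ('o, 'a) category \<Rightarrow> ('j, 'k, 'o, 'a) cat_functor \<Rightarrow>
   'o \<Rightarrow> ('j \<Rightarrow> 'a) \<Rightarrow> bool" where
  "is_cocone J C D c t \<longleftrightarrow> c \<in> Obj C \<and>
     (\<forall>j \<in> Obj J. t j \<in> hom C (Fobj D j) c) \<and>
     (\<forall>k \<in> Arr J. t (Cod J k) \<cdot>\<^bsub>C\<^esub> Farr D k = t (Dom J k))"

definition is_colimit ::
  "('j, 'k) category \<Rightarrow> ('o, 'a) category \<Rightarrow> ('j, 'k, 'o, 'a) cat_functor \<Rightarrow>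
   'o \<Rightarrow> ('j \<Rightarrow> 'a) \<Rightarrow> bool" where
  "is_colimit J C D c t \<longleftrightarrow> is_functor J C D \<and> is_cocone J C D c t \<and>
     (\<forall>c' t'. is_cocone J C D c' t' \<longrightarrow>
        (\<exists>!h. h \<in> hom C c c' \<and> (\<forall>j \<in> Obj J. h \<cdot>\<^bsub>C\<^esub> t j = t' j)))"

definition cocomplete :: "'u itself \<Rightarrow> ('o, 'a) category \<Rightarrow> bool" where
  "cocomplete U C \<longleftrightarrow>
     (\<forall>(J :: ('u, 'u) category) D. small_category U J \<and> is_functor J C D \<longrightarrow>
        (\<exists>c t. is_colimit J C D c t))"

definition is_pushout :: "('o, 'a) category \<Rightarrow> 'a \<Rightarrow> 'a \<Rightarrow> 'a \<Rightarrow> 'a \<Rightarrow> bool" where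
  "is_pushout C f g f' g' \<longleftrightarrow>
     f \<in> Arr C \<and> g \<in> Arr C \<and> f' \<in> Arr C \<and> g' \<in> Arr C \<and>
     Dom C f = Dom C g \<and> Dom C g' = Cod C f \<and> Dom C f' = Cod C g \<and> Cod C f' = Cod C g' \<and>
     g' \<cdot>\<^bsub>C\<^esub> f = f' \<cdot>\<^bsub>C\<^esub> g \<and>
     (\<forall>p \<in> Arr C. \<forall>q \<in> Arr C.
        Dom C p = Cod C f \<and> Dom C q = Cod C g \<and> Cod C p = Cod C q \<and> p \<cdot>\<^bsub>C\<^esub> f = q \<cdot>\<^bsub>C\<^esub> g \<longrightarrow>
        (\<exists>!h. h \<in> hom C (Cod C f') (Cod C p) \<and> h \<cdot>\<^bsub>C\<^esub> g' = p \<and> h \<cdot>\<^bsub>C\<^esub> f' = q))"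


section \<open>Accessible and locally presentable categories\<close>

definition directed_poset :: "'u rel \<Rightarrow> 'u rel \<Rightarrow> bool" where
  "directed_poset lam r \<longleftrightarrow> Partial_order r \<and> small TYPE('u) (Field r) \<and>
     (\<forall>S \<subseteq> Field r. |S| <o lam \<longrightarrow> (\<exists>u \<in> Field r. \<forall>s \<in> S. (s, u) \<in> r))"

definition has_directed_colimits :: "'u rel \<Rightarrow> ('o, 'a) category \<Rightarrow> bool" where
  "has_directed_colimits lam C \<longleftrightarrow>
     (\<forall>r D. directed_poset lam r \<and> is_functor (poset_category r) C D \<longrightarrow>
        (\<exists>c t. is_colimit (poset_category r) C D c t))"

definition preserves_directed_colimits ::
  "'u rel \<Rightarrow> ('o, 'a) category \<Rightarrow> ('p, 'b) category \<Rightarrow> ('o, 'a, 'p, 'b) cat_functor \<Rightarrow> bool" where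
  "preserves_directed_colimits lam C D F \<longleftrightarrow>
     (\<forall>r X c t. directed_poset lam r \<and> is_colimit (poset_category r) C X c t \<longrightarrow>
        is_colimit (poset_category r) D (functor_comp F X) (Fobj F c) (\<lambda>i. Farr F (t i)))"

definition presentable_object :: "'u rel \<Rightarrow> ('o, 'a) category \<Rightarrow> 'o \<Rightarrow> bool" where
  "presentable_object lam C a \<longleftrightarrow> a \<in> Obj C \<and>
     preserves_directed_colimits lam C (set_category TYPE('u)) (hom_functor C a)"

definition lam_accessible :: "'u rel \<Rightarrow> ('o, 'a) category \<Rightarrow> bool" where
  "lam_accessible lam C \<longleftrightarrow>
     locally_small TYPE('u) C \<and> has_directed_colimits lam C \<and>
     (\<exists>A. small TYPE('u) A \<and> (\<forall>a \<in> A. presentable_object lam C a) \<and>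
        (\<forall>c \<in> Obj C. \<exists>r D t. directed_poset lam r \<and> (\<forall>i \<in> Field r. Fobj D i \<in> A) \<and>
           is_colimit (poset_category r) C D c t))"

definition accessible_category :: "'u itself \<Rightarrow> ('o, 'a) category \<Rightarrow> bool" where
  "accessible_category U C \<longleftrightarrow> (\<exists>lam :: 'u rel. regular_cardinal lam \<and> lam_accessible lam C)"

definition locally_presentable :: "'u itself \<Rightarrow> ('o, 'a) category \<Rightarrow> bool" where
  "locally_presentable U C \<longleftrightarrow> cocomplete U C \<and> accessible_category U C"

definition accessible_functor ::
  "'u itself \<Rightarrow> ('o, 'a) category \<Rightarrow> ('p, 'b) category \<Rightarrow> ('o, 'a, 'p, 'b) cat_functor \<Rightarrow> bool"
  where
  "accessible_functor U C D F \<longleftrightarrow>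
     accessible_category U C \<and> accessible_category U D \<and> is_functor C D F \<and>
     (\<exists>lam :: 'u rel. regular_cardinal lam \<and> preserves_directed_colimits lam C D F)"

definition full_image ::
  "('o, 'a) category \<Rightarrow> ('p, 'b) category \<Rightarrow> ('o, 'a, 'p, 'b) cat_functor \<Rightarrow> ('p, 'b) category"
  where "full_image C D F = full_subcategory D (Fobj F ` Obj C)"


section \<open>The class \<open>cof(X)\<close>\<close>

definition is_retract :: "('o, 'a) category \<Rightarrow> 'o \<Rightarrow> 'o \<Rightarrow> bool" where
  "is_retract C a b \<longleftrightarrow> a \<in> Obj C \<and> b \<in> Obj C \<and>
     (\<exists>i \<in> hom C a b. \<exists>p \<in> hom C b a. p \<cdot>\<^bsub>C\<^esub> i = Id C a)"

definition limit_element :: "'i rel \<Rightarrow> 'i \<Rightarrow> bool" where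
  "limit_element r j \<longleftrightarrow> j \<in> Field r \<and> underS r j \<noteq> {} \<and>
     (\<forall>i \<in> underS r j. \<exists>k \<in> underS r j. i \<in> underS r k)"

text \<open>
  A chain indexed by the ordinals up to and including a limit ordinal \<open>\<lambda>\<close> is a functor on a
  well-order \<open>r\<close> with a greatest element \<open>l\<close> (corresponding to \<open>\<lambda>\<close>) that is a limit element.
\<close>

definition smooth_chain ::
  "('o, 'a) category \<Rightarrow> 'i rel \<Rightarrow> 'i \<Rightarrow> ('i, 'i \<times> 'i, 'o, 'a) cat_functor \<Rightarrow> bool" where
  "smooth_chain C r l A \<longleftrightarrow>
     Well_order r \<and> limit_element r l \<and> (\<forall>i \<in> Field r. (i, l) \<in> r) \<and>
     is_functor (poset_category r) C A \<and>
     (\<forall>j. limit_element r j \<longrightarrow>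
        is_colimit (poset_category (Restr r (underS r j))) C A (Fobj A j) (\<lambda>i. Farr A (i, j)))"

definition closed_transfinite_composition ::
  "'u itself \<Rightarrow> ('o, 'a) category \<Rightarrow> 'a set \<Rightarrow> bool" where
  "closed_transfinite_composition U C L \<longleftrightarrow>
     (\<forall>f \<in> L. \<forall>g \<in> L. Cod C f = Dom C g \<longrightarrow> g \<cdot>\<^bsub>C\<^esub> f \<in> L) \<and>
     (\<forall>(r :: 'u rel) l A z.
        small U (Field r) \<and> smooth_chain C r l A \<and>
        (\<forall>i j. (i, j) \<in> r \<and> j \<noteq> l \<longrightarrow> Farr A (i, j) \<in> L) \<and>
        z \<in> Field r \<and> (\<forall>i \<in> Field r. (z, i) \<in> r) \<longrightarrow>
        Farr A (z, l) \<in> L)"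

definition stable_under_pushout :: "('o, 'a) category \<Rightarrow> 'a set \<Rightarrow> bool" where
  "stable_under_pushout C L \<longleftrightarrow> (\<forall>f g f' g'. f \<in> L \<and> is_pushout C f g f' g' \<longrightarrow> f' \<in> L)"

definition closed_under_retracts :: "('o, 'a) category \<Rightarrow> 'a set \<Rightarrow> bool" where
  "closed_under_retracts C L \<longleftrightarrow>
     (\<forall>f g. g \<in> L \<and> is_retract (arrow_category C) f g \<longrightarrow> f \<in> L)"

definition cof :: "'u itself \<Rightarrow> ('o, 'a) category \<Rightarrow> 'a set \<Rightarrow> 'a set" where
  "cof U C X =
     \<Inter> {L. L \<subseteq> Arr C \<and> X \<subseteq> L \<and> {f. is_iso C f} \<subseteq> L \<and>
          stable_under_pushout C L \<and> closed_transfinite_composition U C L \<and>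
          closed_under_retracts C L}"


section \<open>Split idempotent completions\<close>

definition idempotents_split :: "('o, 'a) category \<Rightarrow> bool" where
  "idempotents_split C \<longleftrightarrow>
     (\<forall>k \<in> Obj C. \<forall>f \<in> hom C k k. f \<cdot>\<^bsub>C\<^esub> f = f \<longrightarrow>
        (\<exists>x \<in> Obj C. \<exists>i \<in> hom C x k. \<exists>p \<in> hom C k x. p \<cdot>\<^bsub>C\<^esub> i = Id C x \<and> i \<cdot>\<^bsub>C\<^esub> p = f))"

definition split_idempotent_completion ::
  "'u itself \<Rightarrow> ('o, 'a) category \<Rightarrow> ('p, 'b) category \<Rightarrow> ('o, 'a, 'p, 'b) cat_functor \<Rightarrow> bool"
  where
  "split_idempotent_completion U L L' H \<longleftrightarrow>
     is_functor L L' H \<and> idempotents_split L' \<and>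
     (\<forall>(N :: ('u, 'u) category) G. idempotents_split N \<and> is_functor L N G \<longrightarrow>
        (\<exists>G'. is_functor L' N G' \<and> naturally_isomorphic L N (functor_comp G' H) G \<and>
           (\<forall>G''. is_functor L' N G'' \<and> naturally_isomorphic L N (functor_comp G'' H) G \<longrightarrow>
              naturally_isomorphic L' N G'' G')))"

end

theory Submission
  imports Defs
begin

text \<open>
  Regard \<open>x : a \<rightarrow> b\<close> in \<open>X\<close> as a morphism \<open>x \<rightarrow> id\<^sub>b\<close> of the arrow category. An object \<open>g\<close> of the
  arrow category is injective with respect to these morphisms iff \<open>g\<close> has the right lifting
  property against \<open>X\<close>. The arrow category is accessible and cocomplete, so for a large enough
  regular cardinal \<open>\<mu>\<close> the small object argument, performed with functorial choices and iterated up
  to an ordinal of cofinality at least \<open>\<mu>\<close>, produces a functor \<open>R\<close> preserving \<open>\<mu>\<close>-directed colimits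
  and a natural transformation \<open>\<rho> : Id \<rightarrow> R\<close> with \<open>R f\<close> injective. The codomain part of \<open>\<rho> f\<close> is
  invertible and its domain part lies in \<open>cof(X)\<close>. Taking the domain part of \<open>\<rho> f\<close> is therefore an
  accessible endofunctor of the arrow category with values in \<open>cof(X)\<close>, and by the retract argument
  every \<open>f\<close> in \<open>cof(X)\<close> is a retract of its value at \<open>f\<close>. A full subcategory whose idempotents split
  is a split idempotent completion of any full subcategory of which all its objects are retracts.
\<close>

section \<open>Small sets and regular cardinals\<close>

text \<open>The codomain parts of the morphisms \<open>x \<rightarrow> id\<close> are identities,
  and pushouts and chains of the arrow category are computed separately in domains and codomains.
  Isomorphisms survive both operations, so only domains change, and they change within cof(X).
  Lifting exhibits a member of cof(X) merely as a retract of a value of the functor, whence the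
  split idempotent completion in place of a full image.

  Functoriality and accessibility shape the construction. Each step attaches all possible cells at
  once, without selection, and the iteration takes place among endofunctors, where connecting maps
  are natural by construction. The cardinal \<mu> is taken so large that each \<open>x\<close> in
  \<open>X\<close>, as an object of the arrow category, is \<mu>-presentable: maps out of
  \<open>x\<close> then commute with \<mu>-directed colimits, hence so do cell attachment and its
  iterates. Sizes are the remaining obstacle: \<open>'u\<close> is the universe, so index posets,
  ordinals and the source category have to be coded on \<open>'u\<close>.\<close>

lemma small_subset: "small U B \<Longrightarrow> A \<subseteq> B \<Longrightarrow> small U A"
  unfolding small_def using card_of_mono1 ordLeq_ordLess_trans by blast

lemma small_image: "small U A \<Longrightarrow> small U (f ` A)"
  unfolding small_def using card_of_image ordLeq_ordLess_trans by blast

lemma small_inj: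
  assumes "small TYPE('u) (A :: 'x set)"
  obtains e :: "'x \<Rightarrow> 'u" where "inj_on e A"
proof -
  have "|A| \<le>o |UNIV :: 'u set|" using assms unfolding small_def by (rule ordLess_imp_ordLeq)
  then show ?thesis using that unfolding card_of_ordLeq[symmetric] by blast
qed

locale univ =
  fixes U :: "'u itself"
  assumes universe: "universe TYPE('u)"
begin

lemma natLeq_less: "natLeq <o |UNIV :: 'u set|"
  using universe by (auto simp: universe_def)

lemma infinite_univ: "infinite (UNIV :: 'u set)"
  using natLeq_less ordLess_imp_ordLeq infinite_iff_natLeq_ordLeq by blast

lemma Cinfinite_univ: "Cinfinite |UNIV :: 'u set|"
  using infinite_univ by (simp add: cinfinite_def Field_card_of card_of_card_order_on)

lemma regular_univ: "regularCard |UNIV :: 'u set|"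
  using universe by (auto simp: universe_def)

lemma finite_small: "finite A \<Longrightarrow> small TYPE('u) A"
  using infinite_univ finite_ordLess_infinite[of "|A|" "|UNIV :: 'u set|"]
  by (auto simp: small_def Field_card_of card_of_well_order_on)

lemma small_UN:
  assumes "small TYPE('u) I" "\<And>i. i \<in> I \<Longrightarrow> small TYPE('u) (A i)"
  shows "small TYPE('u) (\<Union>i\<in>I. A i)"
  using assms card_of_UNION_ordLess_infinite_Field_regularCard[OF regular_univ Cinfinite_univ]
  unfolding small_def by auto

lemma small_Un: "small TYPE('u) A \<Longrightarrow> small TYPE('u) B \<Longrightarrow> small TYPE('u) (A \<union> B)"
  unfolding small_def using card_of_Un_ordLess_infinite[OF infinite_univ] by blast

lemma small_insert: "small TYPE('u) A \<Longrightarrow> small TYPE('u) (insert a A)"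
  using small_Un[of "{a}" A] finite_small[of "{a}"] by simp

lemma small_Sigma:
  assumes "small TYPE('u) I" "\<And>i. i \<in> I \<Longrightarrow> small TYPE('u) (A i)"
  shows "small TYPE('u) (Sigma I A)"
proof -
  have "Sigma I A = (\<Union>i\<in>I. Pair i ` A i)" by auto
  then show ?thesis using small_UN[OF assms(1), of "\<lambda>i. Pair i ` A i"] assms(2) small_image by metis
qed

lemma small_Times: "small TYPE('u) A \<Longrightarrow> small TYPE('u) B \<Longrightarrow> small TYPE('u) (A \<times> B)"
  by (rule small_Sigma)

lemma small_relation: "small TYPE('u) (Field r) \<Longrightarrow> small TYPE('u) r"
  by (rule small_subset[OF small_Times[of "Field r" "Field r"]]) (auto simp: Field_def)

text \<open>The strong limit property in \<open>universe\<close> concerns subsets of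
  \<open>'u\<close> only, so \<open>A\<close> is moved into \<open>'u\<close> by an injection and
  its subsets are recovered as preimages.\<close>

lemma small_Pow:
  assumes "small TYPE('u) (A :: 'x set)"
  shows "small TYPE('u) (Pow A)"
proof -
  obtain e :: "'x \<Rightarrow> 'u" where e: "inj_on e A" using assms small_inj universe 
    by (metis small_def)
  have "small TYPE('u) (e ` A)" using assms by (rule small_image)
  then have "small TYPE('u) (Pow (e ` A))" using universe by (auto simp: universe_def small_def)
  moreover have "Pow A = (\<lambda>B. A \<inter> e -` B) ` Pow (e ` A)"
  proof (intro equalityI subsetI)
    fix B assume "B \<in> Pow A"
    then have "B = A \<inter> e -` (e ` B)" using e by (auto simp: inj_on_def)
    then show "B \<in> (\<lambda>B. A \<inter> e -` B) ` Pow (e ` A)" using \<open>B \<in> Pow A\<close> by blast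
  qed auto
  ultimately show ?thesis by (metis small_image)
qed

lemma pairing_inj:
  obtains e :: "'u \<times> 'u \<Rightarrow> 'u" where "inj e"
proof -
  have "|UNIV \<times> UNIV :: ('u \<times> 'u) set| \<le>o |UNIV :: 'u set|"
    using card_of_Times_same_infinite[OF infinite_univ] ordIso_iff_ordLeq by blast
  then show ?thesis using that unfolding card_of_ordLeq[symmetric] by auto
qed

text \<open>Successor cardinals are regular, and the successor of a small cardinal stays small
  because it is bounded by the power set. The result is realized as \<open>|C|\<close> with
  \<open>C\<close> a subset of \<open>'u\<close>, since the cardinals of accessibility have type
  \<open>'u rel\<close>.\<close>

lemma regular_above:
  fixes A :: "'x set"
  assumes "small TYPE('u) A"
  obtains mu :: "'u rel" where "regular_cardinal mu" "|A| <o mu"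
proof -
  obtain e :: "'x \<Rightarrow> 'u" where e: "inj_on e A" using assms small_inj 
    by (metis small_def)
  have nat_small: "small TYPE('u) (UNIV :: nat set)"
    using natLeq_less card_of_nat ordIso_ordLess_trans unfolding small_def by blast
  then obtain e' :: "nat \<Rightarrow> 'u" where e': "inj e'" using small_inj by (metis small_def)
  \<comment> \<open>The copy of the natural numbers makes \<open>?B\<close> infinite, which
    regularity of its successor requires.\<close>
  let ?B = "e ` A \<union> range e'"
  have B: "small TYPE('u) ?B" using assms nat_small by (intro small_Un small_image)
  have "infinite ?B" using e' by (simp add: finite_image_iff)
  then have ci: "Cinfinite |?B|" by (simp add: cinfinite_def Field_card_of card_of_card_order_on)
  let ?S = "cardSuc |?B|"
  have "?S \<le>o |Pow ?B|"
    by (rule cardSuc_least) (auto simp: card_of_card_order_on card_of_Card_order card_of_Pow)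
  moreover have "|Pow ?B| <o |UNIV :: 'u set|" using small_Pow[OF B] by (simp add: small_def)
  ultimately have less: "?S <o |UNIV :: 'u set|" by (rule ordLeq_ordLess_trans)
  have S: "Cinfinite ?S" "regularCard ?S"
    using ci Cinfinite_cardSuc regularCard_cardSuc by blast+
  \<comment> \<open>\<open>cardSuc\<close> lives on sets of elements of \<open>'u\<close>; being
    below the size of \<open>'u\<close>, it is isomorphic to a relation on
    \<open>'u\<close>.\<close>
  obtain p :: "'u rel" where p: "?S =o p"
    using internalize_ordLeq[of ?S "|UNIV :: 'u set|"] ordLess_imp_ordLeq[OF less] by blast
  then have "|Field p| =o p" using S(1) Card_order_ordIso2 card_of_Field_ordIso by blast
  then obtain C :: "'u set" where C: "|C| =o ?S"
    using p ordIso_symmetric ordIso_transitive by blast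
  have "regular_cardinal |C|"
  proof -
    have "Cinfinite |C|" using Cinfinite_cong[OF ordIso_symmetric[OF C]] S(1) by blast
    moreover have "regularCard |C|" using regularCard_ordIso[OF ordIso_symmetric[OF C]] S by blast
    moreover have "small TYPE('u) (Field |C| )"
      using ordIso_ordLess_trans[OF C less] by (simp add: small_def Field_card_of)
    ultimately show ?thesis unfolding regular_cardinal_def by blast
  qed
  moreover have "|A| <o |C|"
  proof -
    have "|A| =o |e ` A|" using e card_of_ordIsoI[of e A "e ` A"] by (simp add: bij_betw_def)
    moreover have "|e ` A| \<le>o |?B|" by (rule card_of_mono1) auto
    moreover have "|?B| <o ?S" by (rule cardSuc_greater) (rule card_of_Card_order)
    ultimately show ?thesis
      using C by (meson ordIso_ordLess_trans ordIso_symmetric ordLeq_ordLess_trans ordLess_ordIso_trans)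
  qed
  ultimately show ?thesis by (rule that)
qed

end

text \<open>A cofinal set in a regular cardinal has full size, so \<open>S\<close> is not cofinal;
  an element with no member of \<open>S\<close> strictly above it bounds \<open>S\<close> by
  totality.\<close>

lemma regular_cardinal_bound:
  assumes "regular_cardinal lam" "|S| <o lam" "S \<subseteq> Field lam"
  obtains b where "b \<in> Field lam" "\<And>s. s \<in> S \<Longrightarrow> (s, b) \<in> lam"
proof -
  have lam: "Card_order lam" "regularCard lam" using assms(1) by (auto simp: regular_cardinal_def)
  interpret wo_rel lam using lam(1) by (simp add: wo_rel_def card_order_on_def)
  have "\<not> cofinal S lam"
    using assms(2,3) lam not_ordLess_ordIso unfolding regularCard_def by blast
  then obtain b where b: "b \<in> Field lam" "\<And>s. s \<in> S \<Longrightarrow> b = s \<or> (b, s) \<notin> lam"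
    unfolding cofinal_def by blast
  have "(s, b) \<in> lam" if "s \<in> S" for s
    using that b assms(3) TOTALS REFL by (metis refl_on_def subsetD)
  then show ?thesis using b that by blast
qed

lemma regular_cardinal_finite_less:
  assumes "regular_cardinal lam" "finite S"
  shows "|S| <o lam"
  using assms finite_ordLess_infinite[of "|S|" lam]
  by (auto simp: regular_cardinal_def cinfinite_def Field_card_of card_of_well_order_on card_order_on_def)

section \<open>Categories, functors and colimits\<close>

lemma hom_iff: "f \<in> hom C a b \<longleftrightarrow> f \<in> Arr C \<and> Dom C f = a \<and> Cod C f = b"
  by (auto simp: hom_def)

locale cat =
  fixes C :: "('o, 'a) category" (structure)
  assumes cat: "is_category C"
begin

lemma Dom_Obj [simp]: "f \<in> Arr C \<Longrightarrow> Dom C f \<in> Obj C"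
  and Cod_Obj [simp]: "f \<in> Arr C \<Longrightarrow> Cod C f \<in> Obj C"
  and Id_Arr [simp]: "a \<in> Obj C \<Longrightarrow> Id C a \<in> Arr C"
  and Dom_Id [simp]: "a \<in> Obj C \<Longrightarrow> Dom C (Id C a) = a"
  and Cod_Id [simp]: "a \<in> Obj C \<Longrightarrow> Cod C (Id C a) = a"
  and comp_Arr [simp]: "f \<in> Arr C \<Longrightarrow> g \<in> Arr C \<Longrightarrow> Cod C f = Dom C g \<Longrightarrow> g \<cdot> f \<in> Arr C"
  and Dom_comp [simp]: "f \<in> Arr C \<Longrightarrow> g \<in> Arr C \<Longrightarrow> Cod C f = Dom C g \<Longrightarrow> Dom C (g \<cdot> f) = Dom C f"
  and Cod_comp [simp]: "f \<in> Arr C \<Longrightarrow> g \<in> Arr C \<Longrightarrow> Cod C f = Dom C g \<Longrightarrow> Cod C (g \<cdot> f) = Cod C g"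
  and comp_Id [simp]: "f \<in> Arr C \<Longrightarrow> Dom C f = a \<Longrightarrow> f \<cdot> Id C a = f"
  and Id_comp [simp]: "f \<in> Arr C \<Longrightarrow> Cod C f = a \<Longrightarrow> Id C a \<cdot> f = f"
  using cat by (auto simp: is_category_def hom_def)

lemma comp_assoc [simp]:
  assumes "f \<in> Arr C" "g \<in> Arr C" "h \<in> Arr C" "Cod C f = Dom C g" "Cod C g = Dom C h"
  shows "h \<cdot> g \<cdot> f = h \<cdot> (g \<cdot> f)"
  using cat assms by (simp add: is_category_def)

lemma hom_comp: "f \<in> hom C a b \<Longrightarrow> g \<in> hom C b c \<Longrightarrow> g \<cdot> f \<in> hom C a c"
  by (simp add: hom_iff)

text \<open>The simplifier nests composites to the right, so an equation for
  \<open>g \<cdot> f\<close> no longer matches inside \<open>g \<cdot> (f \<cdot> x)\<close>; this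
  rule applies it there.\<close>

lemma comp_assoc_eq:
  assumes "g \<cdot> f = k" "f \<in> Arr C" "g \<in> Arr C" "x \<in> Arr C" "Cod C f = Dom C g" "Cod C x = Dom C f"
  shows "g \<cdot> (f \<cdot> x) = k \<cdot> x"
  using comp_assoc[of x f g] assms by simp

lemma is_iso_comp:
  assumes "is_iso C f" "is_iso C g" "Cod C f = Dom C g"
  shows "is_iso C (g \<cdot> f)"
proof -
  obtain f' where f': "f' \<in> hom C (Cod C f) (Dom C f)" "f' \<cdot> f = Id C (Dom C f)" "f \<cdot> f' = Id C (Cod C f)"
    using assms(1) by (auto simp: is_iso_def)
  obtain g' where g': "g' \<in> hom C (Cod C g) (Dom C g)" "g' \<cdot> g = Id C (Dom C g)" "g \<cdot> g' = Id C (Cod C g)"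
    using assms(2) by (auto simp: is_iso_def)
  have fg: "f \<in> Arr C" "g \<in> Arr C" using assms by (auto simp: is_iso_def)
  have 1: "g' \<cdot> (g \<cdot> f) = f"
    using comp_assoc_eq[OF g'(2), of f] fg g' assms(3) by (simp add: hom_iff)
  have 2: "f \<cdot> (f' \<cdot> g') = g'"
    using comp_assoc_eq[OF f'(3), of g'] fg g' f' assms(3) by (simp add: hom_iff)
  have "f' \<cdot> g' \<cdot> (g \<cdot> f) = Id C (Dom C f)" "g \<cdot> f \<cdot> (f' \<cdot> g') = Id C (Cod C g)"
    using fg f' g' 1 2 assms(3) by (simp_all add: hom_iff)
  then show ?thesis
    unfolding is_iso_def using fg f' g' assms(3)
    by (intro conjI bexI[of _ "f' \<cdot> g'"]) (simp_all add: hom_iff)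
qed

lemma is_iso_Id [simp]: "a \<in> Obj C \<Longrightarrow> is_iso C (Id C a)"
  unfolding is_iso_def by (auto simp: hom_iff intro!: bexI[of _ "Id C a"])

end

lemma functorD:
  assumes "is_functor C D F"
  shows "is_category C" "is_category D"
    and "a \<in> Obj C \<Longrightarrow> Fobj F a \<in> Obj D"
    and "f \<in> Arr C \<Longrightarrow> Farr F f \<in> Arr D"
    and "f \<in> Arr C \<Longrightarrow> Dom D (Farr F f) = Fobj F (Dom C f)"
    and "f \<in> Arr C \<Longrightarrow> Cod D (Farr F f) = Fobj F (Cod C f)"
    and "a \<in> Obj C \<Longrightarrow> Farr F (Id C a) = Id D (Fobj F a)"
    and "f \<in> Arr C \<Longrightarrow> g \<in> Arr C \<Longrightarrow> Cod C f = Dom C g \<Longrightarrow>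
      Farr F (g \<cdot>\<^bsub>C\<^esub> f) = Farr F g \<cdot>\<^bsub>D\<^esub> Farr F f"
  using assms by (auto simp: is_functor_def hom_def)

lemma functor_comp_simps [simp]:
  "Fobj (functor_comp G F) a = Fobj G (Fobj F a)" "Farr (functor_comp G F) f = Farr G (Farr F f)"
  by (simp_all add: functor_comp_def)

lemma inclusion_functor_simps [simp]:
  "Fobj inclusion_functor a = a" "Farr inclusion_functor f = f"
  by (simp_all add: inclusion_functor_def)

lemma functor_compI:
  assumes F: "is_functor C D F" and G: "is_functor D E G"
  shows "is_functor C E (functor_comp G F)"
proof -
  note [simp] = functorD[OF F] functorD[OF G]
  show ?thesis by (simp add: is_functor_def hom_iff)
qed

lemma functor_cong:
  assumes "is_functor J C D" "\<And>j. j \<in> Obj J \<Longrightarrow> Fobj D j = Fobj D' j"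
    and "\<And>k. k \<in> Arr J \<Longrightarrow> Farr D k = Farr D' k"
  shows "is_functor J C D'"
proof -
  interpret J: cat J using functorD(1)[OF assms(1)] by unfold_locales
  show ?thesis
    unfolding is_functor_def
  proof (intro conjI ballI impI)
    fix f g assume "f \<in> Arr J" "g \<in> Arr J" "Cod J f = Dom J g"
    then show "Farr D' (g \<cdot>\<^bsub>J\<^esub> f) = Farr D' g \<cdot>\<^bsub>C\<^esub> Farr D' f"
      using functorD(8)[OF assms(1), of f g] assms(3) by simp
  qed (use functorD[OF assms(1)] in \<open>simp_all add: hom_iff flip: assms(2,3)\<close>)
qed

lemma cocone_cong:
  assumes "is_category J" "\<And>j. j \<in> Obj J \<Longrightarrow> Fobj D j = Fobj D' j"
    "\<And>k. k \<in> Arr J \<Longrightarrow> Farr D k = Farr D' k" "\<And>j. j \<in> Obj J \<Longrightarrow> t j = t' j"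
  shows "is_cocone J C D c t \<longleftrightarrow> is_cocone J C D' c t'"
proof -
  interpret J: cat J using assms(1) by unfold_locales
  show ?thesis using assms(2-) by (auto simp: is_cocone_def)
qed

lemma colimit_cong:
  assumes "is_category J" "\<And>j. j \<in> Obj J \<Longrightarrow> Fobj D j = Fobj D' j"
    "\<And>k. k \<in> Arr J \<Longrightarrow> Farr D k = Farr D' k" "\<And>j. j \<in> Obj J \<Longrightarrow> t j = t' j"
  shows "is_colimit J C D c t \<longleftrightarrow> is_colimit J C D' c t'"
proof -
  have "is_functor J C D \<longleftrightarrow> is_functor J C D'"
    using functor_cong[of J C D D'] functor_cong[of J C D' D] assms by auto
  moreover have "is_cocone J C D c' s \<longleftrightarrow> is_cocone J C D' c' s" for c' s
    using assms by (intro cocone_cong) auto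
  moreover have "is_cocone J C D' c t \<longleftrightarrow> is_cocone J C D' c t'"
    using assms by (intro cocone_cong) auto
  ultimately show ?thesis using assms(4) by (simp add: is_colimit_def)
qed

lemma colimitD:
  assumes "is_colimit J C D c t"
  shows "is_functor J C D" "is_cocone J C D c t"
  using assms by (auto simp: is_colimit_def)

lemma coconeD:
  assumes "is_cocone J C D c t"
  shows "c \<in> Obj C" "j \<in> Obj J \<Longrightarrow> t j \<in> Arr C" "j \<in> Obj J \<Longrightarrow> Dom C (t j) = Fobj D j"
    "j \<in> Obj J \<Longrightarrow> Cod C (t j) = c"
    "k \<in> Arr J \<Longrightarrow> t (Cod J k) \<cdot>\<^bsub>C\<^esub> Farr D k = t (Dom J k)"
  using assms by (auto simp: is_cocone_def hom_iff)

lemma colimit_factor: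
  assumes "is_colimit J C D c t" "is_cocone J C D c' t'"
  obtains h where "h \<in> hom C c c'" "\<And>j. j \<in> Obj J \<Longrightarrow> h \<cdot>\<^bsub>C\<^esub> t j = t' j"
  using assms unfolding is_colimit_def by blast

lemma cocone_comp:
  assumes "is_functor J C D" "is_cocone J C D c t" "h \<in> hom C c d"
  shows "is_cocone J C D d (\<lambda>j. h \<cdot>\<^bsub>C\<^esub> t j)"
proof -
  interpret C: cat C using functorD(2)[OF assms(1)] by unfold_locales
  interpret J: cat J using functorD(1)[OF assms(1)] by unfold_locales
  note [simp] = functorD[OF assms(1)] coconeD[OF assms(2)]
  show ?thesis using assms(3) by (auto simp: is_cocone_def hom_iff)
qed

lemma colimit_eqI:
  assumes "is_colimit J C D c t" "h \<in> hom C c d" "h' \<in> hom C c d"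
    and "\<And>j. j \<in> Obj J \<Longrightarrow> h \<cdot>\<^bsub>C\<^esub> t j = h' \<cdot>\<^bsub>C\<^esub> t j"
  shows "h = h'"
proof -
  have "is_cocone J C D d (\<lambda>j. h \<cdot>\<^bsub>C\<^esub> t j)"
    using cocone_comp[OF colimitD[OF assms(1)] assms(2)] .
  then show ?thesis using assms unfolding is_colimit_def by metis
qed

lemma colimitI:
  assumes "is_functor J C D" "is_cocone J C D c t"
    and "\<And>c' t'. is_cocone J C D c' t' \<Longrightarrow> \<exists>h. h \<in> hom C c c' \<and> (\<forall>j \<in> Obj J. h \<cdot>\<^bsub>C\<^esub> t j = t' j)"
    and "\<And>d h h'. h \<in> hom C c d \<Longrightarrow> h' \<in> hom C c d \<Longrightarrow>
      (\<And>j. j \<in> Obj J \<Longrightarrow> h \<cdot>\<^bsub>C\<^esub> t j = h' \<cdot>\<^bsub>C\<^esub> t j) \<Longrightarrow> h = h'"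
  shows "is_colimit J C D c t"
  unfolding is_colimit_def
proof (intro conjI allI impI)
  fix c' t' assume "is_cocone J C D c' t'"
  then obtain h where h: "h \<in> hom C c c'" "\<forall>j \<in> Obj J. h \<cdot>\<^bsub>C\<^esub> t j = t' j"
    using assms(3) by blast
  show "\<exists>!h. h \<in> hom C c c' \<and> (\<forall>j\<in>Obj J. h \<cdot>\<^bsub>C\<^esub> t j = t' j)"
  proof (rule ex1I[of _ h])
    fix h' assume "h' \<in> hom C c c' \<and> (\<forall>j\<in>Obj J. h' \<cdot>\<^bsub>C\<^esub> t j = t' j)"
    then show "h' = h" using h assms(4)[of h' c' h] by simp
  qed (use h in simp)
qed (use assms in auto)

lemma colimit_unique:
  assumes "is_colimit J C D c t" "is_colimit J C D c' t'"
  obtains h where "h \<in> hom C c c'" "is_iso C h" "\<And>j. j \<in> Obj J \<Longrightarrow> h \<cdot>\<^bsub>C\<^esub> t j = t' j"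
proof -
  note F = colimitD(1)[OF assms(1)]
  interpret C: cat C using functorD(2)[OF F] by unfold_locales
  obtain h where h: "h \<in> hom C c c'" "\<And>j. j \<in> Obj J \<Longrightarrow> h \<cdot>\<^bsub>C\<^esub> t j = t' j"
    using colimit_factor[OF assms(1) colimitD(2)[OF assms(2)]] by blast
  obtain k where k: "k \<in> hom C c' c" "\<And>j. j \<in> Obj J \<Longrightarrow> k \<cdot>\<^bsub>C\<^esub> t' j = t j"
    using colimit_factor[OF assms(2) colimitD(2)[OF assms(1)]] by blast
  note [simp] = coconeD[OF colimitD(2)[OF assms(1)]] coconeD[OF colimitD(2)[OF assms(2)]]
  have "k \<cdot>\<^bsub>C\<^esub> h = Id C c"
    using h k by - (rule colimit_eqI[OF assms(1), of _ c]; (auto simp: hom_iff))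
  moreover have "h \<cdot>\<^bsub>C\<^esub> k = Id C c'"
    using h k by - (rule colimit_eqI[OF assms(2), of _ c']; (auto simp: hom_iff))
  ultimately have "is_iso C h" using h k by (auto simp: is_iso_def hom_iff)
  with h show ?thesis using that by blast
qed

lemma colimit_iso_transfer:
  assumes colim: "is_colimit J C D c t" and h: "is_iso C h" "h \<in> hom C c c'"
    and t': "\<And>j. j \<in> Obj J \<Longrightarrow> t' j = h \<cdot>\<^bsub>C\<^esub> t j"
  shows "is_colimit J C D c' t'"
proof -
  note F = colimitD(1)[OF colim]
  interpret C: cat C using functorD(2)[OF F] by unfold_locales
  interpret J: cat J using functorD(1)[OF F] by unfold_locales
  note [simp] = coconeD[OF colimitD(2)[OF colim]] functorD[OF F]
  obtain k where k: "k \<in> hom C c' c" "k \<cdot>\<^bsub>C\<^esub> h = Id C c" "h \<cdot>\<^bsub>C\<^esub> k = Id C c'"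
    using h by (auto simp: is_iso_def hom_iff)
  have kt: "k \<cdot>\<^bsub>C\<^esub> t' j = t j" if "j \<in> Obj J" for j
    using C.comp_assoc_eq[OF k(2), of "t j"] that t' h(2) k(1) by (simp add: hom_iff)
  have "is_colimit J C D c' (\<lambda>j. h \<cdot>\<^bsub>C\<^esub> t j)"
  proof (rule colimitI)
    fix d s assume "is_cocone J C D d s"
    then obtain g where g: "g \<in> hom C c d" "\<And>j. j \<in> Obj J \<Longrightarrow> g \<cdot>\<^bsub>C\<^esub> t j = s j"
      using colimit_factor[OF colim] by blast
    then show "\<exists>g. g \<in> hom C c' d \<and> (\<forall>j\<in>Obj J. g \<cdot>\<^bsub>C\<^esub> (h \<cdot>\<^bsub>C\<^esub> t j) = s j)"
      using k h(2) kt t' by (intro exI[of _ "g \<cdot>\<^bsub>C\<^esub> k"]) (auto simp: hom_iff)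
  next
    fix d g g' assume g: "g \<in> hom C c' d" "g' \<in> hom C c' d"
      "\<And>j. j \<in> Obj J \<Longrightarrow> g \<cdot>\<^bsub>C\<^esub> (h \<cdot>\<^bsub>C\<^esub> t j) = g' \<cdot>\<^bsub>C\<^esub> (h \<cdot>\<^bsub>C\<^esub> t j)"
    then have "g \<cdot>\<^bsub>C\<^esub> h = g' \<cdot>\<^bsub>C\<^esub> h"
      using h(2) by - (rule colimit_eqI[OF colim, of _ d]; (auto simp: hom_iff))
    moreover have "x \<cdot>\<^bsub>C\<^esub> h \<cdot>\<^bsub>C\<^esub> k = x" if "x \<in> hom C c' d" for x
      using that h(2) k(1,3) by (simp add: hom_iff)
    ultimately show "g = g'" using g(1,2) by metis
  qed (use F cocone_comp[OF F colimitD(2)[OF colim] h(2)] in auto)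
  then show ?thesis using colimit_cong[OF functorD(1)[OF F], of D D t' "\<lambda>j. h \<cdot>\<^bsub>C\<^esub> t j"] t' by simp
qed

subsection \<open>Isomorphisms of categories\<close>

text \<open>Inverse functors are compared on \<open>Obj\<close> and \<open>Arr\<close> only, since
  the underlying functions are total and arbitrary elsewhere.\<close>

definition cat_isomorphism where
  "cat_isomorphism C D F G \<longleftrightarrow> is_functor C D F \<and> is_functor D C G \<and>
     (\<forall>a \<in> Obj C. Fobj G (Fobj F a) = a) \<and> (\<forall>a \<in> Obj D. Fobj F (Fobj G a) = a) \<and>
     (\<forall>f \<in> Arr C. Farr G (Farr F f) = f) \<and> (\<forall>f \<in> Arr D. Farr F (Farr G f) = f)"

lemma cat_isomorphism_sym: "cat_isomorphism C D F G \<Longrightarrow> cat_isomorphism D C G F"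
  by (auto simp: cat_isomorphism_def)

text \<open>Cocones under the image diagram are pulled back along \<open>G\<close>, factored in
  \<open>C\<close> and pushed forward again.\<close>

lemma colimit_image_iso:
  assumes iso: "cat_isomorphism C D F G" and colim: "is_colimit J C X c t"
  shows "is_colimit J D (functor_comp F X) (Fobj F c) (\<lambda>j. Farr F (t j))"
proof (rule colimitI)
  have F: "is_functor C D F" and G: "is_functor D C G" using iso by (auto simp: cat_isomorphism_def)
  note X = colimitD(1)[OF colim]
  interpret C: cat C using functorD(1)[OF F] by unfold_locales
  interpret D: cat D using functorD(2)[OF F] by unfold_locales
  interpret J: cat J using functorD(1)[OF X] by unfold_locales
  note [simp] = functorD[OF F] functorD[OF G] functorD[OF X] coconeD[OF colimitD(2)[OF colim]]
  have [simp]: "\<And>a. a \<in> Obj C \<Longrightarrow> Fobj G (Fobj F a) = a" "\<And>a. a \<in> Obj D \<Longrightarrow> Fobj F (Fobj G a) = a"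
    "\<And>f. f \<in> Arr C \<Longrightarrow> Farr G (Farr F f) = f" "\<And>f. f \<in> Arr D \<Longrightarrow> Farr F (Farr G f) = f"
    using iso by (auto simp: cat_isomorphism_def)
  show "is_functor J D (functor_comp F X)" using X F by (rule functor_compI)
  show "is_cocone J D (functor_comp F X) (Fobj F c) (\<lambda>j. Farr F (t j))"
    by (auto simp: is_cocone_def hom_iff simp flip: functorD(8)[OF F])
  fix d s assume "is_cocone J D (functor_comp F X) d s"
  note s = coconeD[OF this]
  have "is_cocone J C X (Fobj G d) (\<lambda>j. Farr G (s j))"
    unfolding is_cocone_def
  proof (intro conjI ballI)
    fix k assume k: "k \<in> Arr J"
    have "Farr G (s (Cod J k) \<cdot>\<^bsub>D\<^esub> Farr F (Farr X k)) = Farr G (s (Dom J k))"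
      using s(5)[OF k] by simp
    then show "Farr G (s (Cod J k)) \<cdot>\<^bsub>C\<^esub> Farr X k = Farr G (s (Dom J k))"
      using k s by (simp add: functorD(8)[OF G])
  qed (use s in \<open>auto simp: hom_iff\<close>)
  then obtain h where h: "h \<in> hom C c (Fobj G d)" "\<And>j. j \<in> Obj J \<Longrightarrow> h \<cdot>\<^bsub>C\<^esub> t j = Farr G (s j)"
    using colimit_factor[OF colim] by blast
  have "Farr F h \<cdot>\<^bsub>D\<^esub> Farr F (t j) = s j" if "j \<in> Obj J" for j
    using h s(2,3,4) that by (auto simp: hom_iff simp flip: functorD(8)[OF F])
  then show "\<exists>h. h \<in> hom D (Fobj F c) d \<and> (\<forall>j\<in>Obj J. h \<cdot>\<^bsub>D\<^esub> Farr F (t j) = s j)"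
    using h s(1) by (intro exI[of _ "Farr F h"]) (auto simp: hom_iff)
next
  have F: "is_functor C D F" and G: "is_functor D C G" using iso by (auto simp: cat_isomorphism_def)
  note [simp] = functorD[OF F] functorD[OF G] coconeD[OF colimitD(2)[OF colim]]
  have [simp]: "\<And>a. a \<in> Obj C \<Longrightarrow> Fobj G (Fobj F a) = a" 
    "\<And>f. f \<in> Arr C \<Longrightarrow> Farr G (Farr F f) = f" 
    using iso by (auto simp: cat_isomorphism_def)
  fix d h h' assume h: "h \<in> hom D (Fobj F c) d" "h' \<in> hom D (Fobj F c) d"
    and eq: "\<And>j. j \<in> Obj J \<Longrightarrow> h \<cdot>\<^bsub>D\<^esub> Farr F (t j) = h' \<cdot>\<^bsub>D\<^esub> Farr F (t j)"
  have "Farr G h \<cdot>\<^bsub>C\<^esub> t j = Farr G h' \<cdot>\<^bsub>C\<^esub> t j" if "j \<in> Obj J" for j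
    using arg_cong[OF eq[OF that], of "Farr G"] h that by (simp add: hom_iff)
  then have "Farr G h = Farr G h'"
    using h by - (rule colimit_eqI[OF colim, of _ "Fobj G d"]; (auto simp: hom_iff))
  then show "h = h'" using h iso by (metis cat_isomorphism_def hom_iff)
qed

text \<open>Lets a colimit found over a coded copy \<open>J'\<close> of the index category serve
  over \<open>J\<close> itself.\<close>

lemma colimit_reindex_iso:
  assumes iso: "cat_isomorphism J' J F G" and X: "is_functor J C X"
    and colim: "is_colimit J' C (functor_comp X F) c t"
  shows "is_colimit J C X c (\<lambda>j. t (Fobj G j))"
proof (rule colimitI)
  have F: "is_functor J' J F" and G: "is_functor J J' G" using iso by (auto simp: cat_isomorphism_def)
  interpret J': cat J' using functorD(1)[OF F] by unfold_locales
  interpret J: cat J using functorD(1)[OF X] by unfold_locales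
  have inv: "\<And>a. a \<in> Obj J' \<Longrightarrow> Fobj G (Fobj F a) = a" "\<And>a. a \<in> Obj J \<Longrightarrow> Fobj F (Fobj G a) = a"
    "\<And>f. f \<in> Arr J' \<Longrightarrow> Farr G (Farr F f) = f" "\<And>f. f \<in> Arr J \<Longrightarrow> Farr F (Farr G f) = f"
    using iso by (auto simp: cat_isomorphism_def)
  note [simp] = functorD[OF F] functorD[OF G] functorD[OF X] inv
  show "is_cocone J C X c (\<lambda>j. t (Fobj G j))"
    unfolding is_cocone_def
  proof (intro conjI ballI)
    fix k assume k: "k \<in> Arr J"
    show "t (Fobj G (Cod J k)) \<cdot>\<^bsub>C\<^esub> Farr X k = t (Fobj G (Dom J k))"
      using coconeD(5)[OF colimitD(2)[OF colim], of "Farr G k"] k by simp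
  qed (use coconeD[OF colimitD(2)[OF colim]] in \<open>auto simp: hom_iff\<close>)
  show "\<exists>h. h \<in> hom C c d \<and> (\<forall>j\<in>Obj J. h \<cdot>\<^bsub>C\<^esub> t (Fobj G j) = s j)" if s: "is_cocone J C X d s" for d s
  proof -
    have "is_cocone J' C (functor_comp X F) d (\<lambda>j. s (Fobj F j))"
      unfolding is_cocone_def
    proof (intro conjI ballI)
      fix k assume k: "k \<in> Arr J'"
      show "s (Fobj F (Cod J' k)) \<cdot>\<^bsub>C\<^esub> Farr (functor_comp X F) k = s (Fobj F (Dom J' k))"
        using coconeD(5)[OF s, of "Farr F k"] k by simp
    qed (use coconeD[OF s] in \<open>auto simp: hom_iff\<close>)
    from colimit_factor[OF colim this] obtain h where
      h: "h \<in> hom C c d" "\<And>j. j \<in> Obj J' \<Longrightarrow> h \<cdot>\<^bsub>C\<^esub> t j = s (Fobj F j)" by blast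
    then show ?thesis by (intro exI[of _ h]) auto
  qed
  show "h = h'" if "h \<in> hom C c d" "h' \<in> hom C c d"
    "\<And>j. j \<in> Obj J \<Longrightarrow> h \<cdot>\<^bsub>C\<^esub> t (Fobj G j) = h' \<cdot>\<^bsub>C\<^esub> t (Fobj G j)" for d h h'
    using that by - (rule colimit_eqI[OF colim that(1,2)]; metis functorD(3)[OF F] inv(1))
qed (rule X)

text \<open>A copy of \<open>C\<close> on other types, along maps \<open>e\<close> and
  \<open>e'\<close> meant to be injective on objects and arrows. It brings small index categories,
  and later the arrow category, onto \<open>'u\<close>.\<close>

definition recode :: "('o \<Rightarrow> 'p) \<Rightarrow> ('a \<Rightarrow> 'b) \<Rightarrow> ('o, 'a) category \<Rightarrow> ('p, 'b) category" where
  "recode e e' C =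
     \<lparr>Obj = e ` Obj C, Arr = e' ` Arr C,
      Dom = (\<lambda>f. e (Dom C (inv_into (Arr C) e' f))), Cod = (\<lambda>f. e (Cod C (inv_into (Arr C) e' f))),
      Id = (\<lambda>a. e' (Id C (inv_into (Obj C) e a))),
      Comp = (\<lambda>g f. e' (inv_into (Arr C) e' g \<cdot>\<^bsub>C\<^esub> inv_into (Arr C) e' f))\<rparr>"

lemma recode_isomorphism:
  assumes C: "is_category C" and e: "inj_on e (Obj C)" "inj_on e' (Arr C)"
  shows "cat_isomorphism (recode e e' C) C
    \<lparr>Fobj = inv_into (Obj C) e, Farr = inv_into (Arr C) e'\<rparr> \<lparr>Fobj = e, Farr = e'\<rparr>"
proof -
  interpret cat C using C by unfold_locales
  have [simp]: "\<And>a. a \<in> Obj C \<Longrightarrow> inv_into (Obj C) e (e a) = a"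
    "\<And>f. f \<in> Arr C \<Longrightarrow> inv_into (Arr C) e' (e' f) = f" using e by (auto simp: inv_into_f_f)
  have "is_category (recode e e' C)"
    unfolding is_category_def by (auto simp: recode_def hom_iff inj_on_eq_iff[OF e(1)])
  then show ?thesis
    using C unfolding cat_isomorphism_def is_functor_def 
    by (auto simp: recode_def hom_iff inj_on_eq_iff[OF e(1)])
qed

text \<open>\<open>cocomplete\<close> quantifies over index categories on \<open>'u\<close> only; a
  small \<open>J\<close> on any types has a copy there.\<close>

lemma cocomplete_colimit:
  fixes C :: "('o, 'a) category" and J :: "('j, 'k) category"
  assumes "cocomplete TYPE('u) C" "small_category TYPE('u) J" and D: "is_functor J C D"
  obtains c t where "is_colimit J C D c t"
proof -
  have J: "is_category J" "small TYPE('u) (Obj J)" "small TYPE('u) (Arr J)"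
    using assms(2) by (auto simp: small_category_def)
  obtain e :: "'j \<Rightarrow> 'u" where e: "inj_on e (Obj J)" using small_inj[OF J(2)] by blast
  obtain e' :: "'k \<Rightarrow> 'u" where e': "inj_on e' (Arr J)" using small_inj[OF J(3)] by blast
  note iso = recode_isomorphism[OF J(1) e e']
  let ?F = "\<lparr>Fobj = inv_into (Obj J) e, Farr = inv_into (Arr J) e'\<rparr>"
  have F: "is_functor (recode e e' J) J ?F" using iso by (simp add: cat_isomorphism_def)
  have "small_category TYPE('u) (recode e e' J)"
    using J functorD(1)[OF F] by (simp add: small_category_def recode_def small_image)
  then obtain c t where "is_colimit (recode e e' J) C (functor_comp D ?F) c t"
    using assms(1) functor_compI[OF F D] unfolding cocomplete_def by blast
  from colimit_reindex_iso[OF iso D this] show ?thesis using that by blast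
qed

subsection \<open>Diagrams over posets\<close>

lemma poset_category_simps [simp]:
  "Obj (poset_category r) = Field r" "Arr (poset_category r) = r"
  "Dom (poset_category r) p = fst p" "Cod (poset_category r) p = snd p"
  "Id (poset_category r) i = (i, i)" "Comp (poset_category r) q p = (fst p, snd q)"
  by (simp_all add: poset_category_def)

lemma poset_category_category: "Refl r \<Longrightarrow> trans r \<Longrightarrow> is_category (poset_category r)"
  by (auto simp: is_category_def hom_iff refl_on_def Field_def dest: transD)

lemma diagramD:
  assumes "is_functor (poset_category r) C D"
  shows "i \<in> Field r \<Longrightarrow> Fobj D i \<in> Obj C"
    and "(i, j) \<in> r \<Longrightarrow> Farr D (i, j) \<in> Arr C"
    and "(i, j) \<in> r \<Longrightarrow> Dom C (Farr D (i, j)) = Fobj D i"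
    and "(i, j) \<in> r \<Longrightarrow> Cod C (Farr D (i, j)) = Fobj D j"
    and "i \<in> Field r \<Longrightarrow> Farr D (i, i) = Id C (Fobj D i)"
    and "(i, j) \<in> r \<Longrightarrow> (j, k) \<in> r \<Longrightarrow> Farr D (j, k) \<cdot>\<^bsub>C\<^esub> Farr D (i, j) = Farr D (i, k)"
    and "is_category C"
  using functorD[OF assms] functorD(7)[OF assms, of i] functorD(8)[OF assms, of "(i, j)" "(j, k)"]
  by auto

lemma diagramI:
  assumes "is_category C" "Refl r" "trans r" "\<And>i. i \<in> Field r \<Longrightarrow> Fobj D i \<in> Obj C"
    and "\<And>i j. (i, j) \<in> r \<Longrightarrow> Farr D (i, j) \<in> hom C (Fobj D i) (Fobj D j)"
    and "\<And>i. i \<in> Field r \<Longrightarrow> Farr D (i, i) = Id C (Fobj D i)"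
    and "\<And>i j k. (i, j) \<in> r \<Longrightarrow> (j, k) \<in> r \<Longrightarrow> Farr D (j, k) \<cdot>\<^bsub>C\<^esub> Farr D (i, j) = Farr D (i, k)"
  shows "is_functor (poset_category r) C D"
  using assms poset_category_category[of r] by (auto simp: is_functor_def)

lemma cocone_poset_iff:
  "is_cocone (poset_category r) C D c t \<longleftrightarrow> c \<in> Obj C \<and> (\<forall>i \<in> Field r. t i \<in> hom C (Fobj D i) c) \<and>
    (\<forall>i j. (i, j) \<in> r \<longrightarrow> t j \<cdot>\<^bsub>C\<^esub> Farr D (i, j) = t i)"
  by (auto simp: is_cocone_def)

lemma cocone_posetD:
  assumes "is_cocone (poset_category r) C D c t"
  shows "c \<in> Obj C" "i \<in> Field r \<Longrightarrow> t i \<in> Arr C" "i \<in> Field r \<Longrightarrow> Dom C (t i) = Fobj D i"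
    "i \<in> Field r \<Longrightarrow> Cod C (t i) = c"
    "(i, j) \<in> r \<Longrightarrow> t j \<cdot>\<^bsub>C\<^esub> Farr D (i, j) = t i"
  using assms by (auto simp: cocone_poset_iff hom_iff)

lemma colimit_poset_cong:
  assumes "is_functor (poset_category r) C D" "\<And>i. i \<in> Field r \<Longrightarrow> Fobj D i = Fobj D' i"
    "\<And>i j. (i, j) \<in> r \<Longrightarrow> Farr D (i, j) = Farr D' (i, j)" "\<And>i. i \<in> Field r \<Longrightarrow> t i = t' i"
  shows "is_colimit (poset_category r) C D c t \<longleftrightarrow> is_colimit (poset_category r) C D' c t'"
  using assms by (intro colimit_cong functorD(1)[OF assms(1)]) auto

context univ
begin

lemma cocomplete_poset_colimit:
  fixes C :: "('o, 'a) category" and r :: "'i rel"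
  assumes "cocomplete TYPE('u) C" "small TYPE('u) (Field r)" and D: "is_functor (poset_category r) C D"
  obtains c t where "is_colimit (poset_category r) C D c t"
proof -
  have "small_category TYPE('u) (poset_category r)"
    using functorD(1)[OF D] assms(2) small_relation[OF assms(2)] by (simp add: small_category_def)
  from cocomplete_colimit[OF assms(1) this D] show ?thesis using that by blast
qed

end

section \<open>Directed posets and presentable objects\<close>

lemma directed_posetD:
  assumes "directed_poset lam r"
  shows "Partial_order r" "Refl r" "trans r" "antisym r" "small TYPE('u) (Field (r :: 'u rel))"
    "is_category (poset_category r)"
  using assms by (auto simp: directed_poset_def partial_order_on_def preorder_on_def
      intro: poset_category_category)

lemma directed_poset_bound:
  assumes "directed_poset lam r" "S \<subseteq> Field r" "|S| <o lam"
  shows "\<exists>u. u \<in> Field r \<and> (\<forall>s \<in> S. (s, u) \<in> r)"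
  using assms unfolding directed_poset_def by blast

lemma directed_poset_bound2:
  assumes "regular_cardinal lam" "directed_poset lam r" "i \<in> Field r" "j \<in> Field r"
  obtains k where "k \<in> Field r" "(i, k) \<in> r" "(j, k) \<in> r"
proof -
  have "|{i, j}| <o lam" by (rule regular_cardinal_finite_less[OF assms(1)]) simp
  then show ?thesis using directed_poset_bound[OF assms(2), of "{i, j}"] assms(3,4) that by auto
qed

lemma directed_poset_nonempty:
  assumes "regular_cardinal lam" "directed_poset lam r"
  obtains k where "k \<in> Field r"
  using directed_poset_bound[OF assms(2), of "{}"] regular_cardinal_finite_less[OF assms(1), of "{}"]
  by auto

lemma directed_poset_mono:
  assumes "directed_poset mu r" "lam \<le>o mu"
  shows "directed_poset lam r"
  using assms ordLess_ordLeq_trans unfolding directed_poset_def by metis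

text \<open>Presentability spelled out in terms of elements of hom-sets, see \<open>presentable_iff_compact\<close> below.\<close>

definition compact_object :: "'u rel \<Rightarrow> ('o, 'a) category \<Rightarrow> 'o \<Rightarrow> bool" where
  "compact_object lam C a \<longleftrightarrow> a \<in> Obj C \<and>
     (\<forall>r D c t. directed_poset lam r \<and> is_colimit (poset_category r) C D c t \<longrightarrow>
        (\<forall>f \<in> hom C a c. \<exists>i \<in> Field r. \<exists>g \<in> hom C a (Fobj D i). t i \<cdot>\<^bsub>C\<^esub> g = f) \<and>
        (\<forall>i \<in> Field r. \<forall>g \<in> hom C a (Fobj D i). \<forall>g' \<in> hom C a (Fobj D i).
           t i \<cdot>\<^bsub>C\<^esub> g = t i \<cdot>\<^bsub>C\<^esub> g' \<longrightarrow>
           (\<exists>j. (i, j) \<in> r \<and> Farr D (i, j) \<cdot>\<^bsub>C\<^esub> g = Farr D (i, j) \<cdot>\<^bsub>C\<^esub> g')))"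

lemma compact_factor:
  assumes "compact_object lam C a" "directed_poset lam r" "is_colimit (poset_category r) C D c t"
    "f \<in> hom C a c"
  obtains i g where "i \<in> Field r" "g \<in> hom C a (Fobj D i)" "t i \<cdot>\<^bsub>C\<^esub> g = f"
  using assms unfolding compact_object_def by meson

lemma compact_merge:
  assumes "compact_object lam C a" "directed_poset lam r" "is_colimit (poset_category r) C D c t"
    "i \<in> Field r" "g \<in> hom C a (Fobj D i)" "g' \<in> hom C a (Fobj D i)" "t i \<cdot>\<^bsub>C\<^esub> g = t i \<cdot>\<^bsub>C\<^esub> g'"
  obtains j where "(i, j) \<in> r" "Farr D (i, j) \<cdot>\<^bsub>C\<^esub> g = Farr D (i, j) \<cdot>\<^bsub>C\<^esub> g'"
  using assms unfolding compact_object_def by meson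

text \<open>Both representatives move to a common stage \<open>m\<close>, where the one-stage form
  of merging applies.\<close>

lemma compact_merge2:
  assumes lam: "regular_cardinal lam" and a: "compact_object lam C a" and r: "directed_poset lam r"
    and colim: "is_colimit (poset_category r) C D c t"
    and g: "i \<in> Field r" "j \<in> Field r" "g \<in> hom C a (Fobj D i)" "g' \<in> hom C a (Fobj D j)"
    and eq: "t i \<cdot>\<^bsub>C\<^esub> g = t j \<cdot>\<^bsub>C\<^esub> g'"
  obtains k where "(i, k) \<in> r" "(j, k) \<in> r" "Farr D (i, k) \<cdot>\<^bsub>C\<^esub> g = Farr D (j, k) \<cdot>\<^bsub>C\<^esub> g'"
proof -
  note D = diagramD[OF colimitD(1)[OF colim]] and t = cocone_posetD[OF colimitD(2)[OF colim]]
  interpret cat C using D(7) by unfold_locales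
  obtain m where m: "m \<in> Field r" "(i, m) \<in> r" "(j, m) \<in> r"
    using directed_poset_bound2[OF lam r g(1,2)] by blast
  have "t m \<cdot>\<^bsub>C\<^esub> (Farr D (i, m) \<cdot>\<^bsub>C\<^esub> g) = t m \<cdot>\<^bsub>C\<^esub> (Farr D (j, m) \<cdot>\<^bsub>C\<^esub> g')"
    using comp_assoc_eq[OF t(5)[OF m(2)], of g] comp_assoc_eq[OF t(5)[OF m(3)], of g'] m g eq D t
    by (simp add: hom_iff)
  then obtain k where k: "(m, k) \<in> r"
    "Farr D (m, k) \<cdot>\<^bsub>C\<^esub> (Farr D (i, m) \<cdot>\<^bsub>C\<^esub> g) = Farr D (m, k) \<cdot>\<^bsub>C\<^esub> (Farr D (j, m) \<cdot>\<^bsub>C\<^esub> g')"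
    using compact_merge[OF a r colim m(1), of "Farr D (i, m) \<cdot>\<^bsub>C\<^esub> g" "Farr D (j, m) \<cdot>\<^bsub>C\<^esub> g'"]
      m g D(2,3,4) by (auto simp: hom_iff)
  then have "Farr D (i, k) \<cdot>\<^bsub>C\<^esub> g = Farr D (j, k) \<cdot>\<^bsub>C\<^esub> g'"
    using comp_assoc_eq[OF D(6)[OF m(2) k(1)], of g] comp_assoc_eq[OF D(6)[OF m(3) k(1)], of g'] m g
      D(2,3,4) by (simp add: hom_iff)
  moreover have "(i, k) \<in> r" "(j, k) \<in> r"
    using m k(1) directed_posetD(3)[OF r] by (meson transD)+
  ultimately show ?thesis using that by blast
qed

text \<open>Every \<open>mu\<close>-directed poset is \<open>lam\<close>-directed, so for
  \<open>mu\<close> fewer diagrams test compactness.\<close>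

lemma compact_object_mono:
  fixes lam mu :: "'u rel"
  assumes "compact_object lam C a" "lam \<le>o mu"
  shows "compact_object mu C a"
  unfolding compact_object_def
proof (intro conjI allI impI ballI)
  show "a \<in> Obj C" using assms(1) by (simp add: compact_object_def)
  fix r D c t assume r: "directed_poset mu r \<and> is_colimit (poset_category r) C D c t"
  then have r': "directed_poset lam r" using directed_poset_mono assms(2) by blast
  show "\<exists>i \<in> Field r. \<exists>g \<in> hom C a (Fobj D i). t i \<cdot>\<^bsub>C\<^esub> g = f" if "f \<in> hom C a c" for f
    using compact_factor[OF assms(1) r' conjunct2[OF r] that] by metis
  show "\<exists>j. (i, j) \<in> r \<and> Farr D (i, j) \<cdot>\<^bsub>C\<^esub> g = Farr D (i, j) \<cdot>\<^bsub>C\<^esub> g'"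
    if "i \<in> Field r" "g \<in> hom C a (Fobj D i)" "g' \<in> hom C a (Fobj D i)" "t i \<cdot>\<^bsub>C\<^esub> g = t i \<cdot>\<^bsub>C\<^esub> g'" for i g g'
    using compact_merge[OF assms(1) r' conjunct2[OF r] that] by metis
qed

text \<open>A map out of the colimit is a compatible family of maps out of fewer than
  \<open>mu\<close> compact objects. Each member factors through some stage and each compatibility
  holds from some stage on; fewer than \<open>mu\<close> stages have a common bound. The hypothesis
  bounds \<open>|r|\<close> because there is one compatibility for every pair in
  \<open>r\<close>.\<close>

lemma compact_colimit:
  assumes mu: "regular_cardinal mu" and r: "Refl r" "|r| <o mu"
    and x: "is_colimit (poset_category r) C D x d"
    and D_compact: "\<And>i. i \<in> Field r \<Longrightarrow> compact_object mu C (Fobj D i)"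
  shows "compact_object mu C x"
  unfolding compact_object_def
proof (intro conjI allI impI ballI)
  note D = diagramD[OF colimitD(1)[OF x]] and d = cocone_posetD[OF colimitD(2)[OF x]]
  show "x \<in> Obj C" by (rule d)
  interpret cat C using D(7) by unfold_locales
  have "Field r = fst ` r" using r(1) by (force simp: Field_def refl_on_def)
  then have less: "|Field r| <o mu" using r(2) card_of_image ordLeq_ordLess_trans by metis
  fix s G c t assume "directed_poset mu s \<and> is_colimit (poset_category s) C G c t"
  then have s: "directed_poset mu s" and c: "is_colimit (poset_category s) C G c t" by auto
  note G = diagramD[OF colimitD(1)[OF c]] and t = cocone_posetD[OF colimitD(2)[OF c]]
  have strans: "\<And>i j k. (i, j) \<in> s \<Longrightarrow> (j, k) \<in> s \<Longrightarrow> (i, k) \<in> s"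
    using directed_posetD(3)[OF s] by (meson transD)
  have sField: "\<And>i j. (i, j) \<in> s \<Longrightarrow> i \<in> Field s \<and> j \<in> Field s" by (auto simp: Field_def)
  have rField: "\<And>i j. (i, j) \<in> r \<Longrightarrow> i \<in> Field r \<and> j \<in> Field r" by (auto simp: Field_def)
  {
    fix f assume f: "f \<in> hom C x c"
    have "\<exists>k g. k \<in> Field s \<and> g \<in> hom C (Fobj D i) (Fobj G k) \<and> t k \<cdot>\<^bsub>C\<^esub> g = f \<cdot>\<^bsub>C\<^esub> d i"
      if i: "i \<in> Field r" for i
    proof -
      have "f \<cdot>\<^bsub>C\<^esub> d i \<in> hom C (Fobj D i) c" using f d i by (simp add: hom_iff)
      from compact_factor[OF D_compact[OF i] s c this] show ?thesis by metis
    qed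
    then obtain k g where k: "\<And>i. i \<in> Field r \<Longrightarrow> k i \<in> Field s"
      and g: "\<And>i. i \<in> Field r \<Longrightarrow> g i \<in> hom C (Fobj D i) (Fobj G (k i))"
        "\<And>i. i \<in> Field r \<Longrightarrow> t (k i) \<cdot>\<^bsub>C\<^esub> g i = f \<cdot>\<^bsub>C\<^esub> d i" by metis
    have "|k ` Field r| <o mu" using less card_of_image ordLeq_ordLess_trans by blast
    then obtain m where m: "m \<in> Field s" "\<And>i. i \<in> Field r \<Longrightarrow> (k i, m) \<in> s"
      using directed_poset_bound[OF s, of "k ` Field r"] k by auto
    \<comment> \<open>All factorizations are moved to the common stage \<open>m\<close>; they are
      known to be compatible with the arrows of \<open>D\<close> only after composition with
      \<open>t m\<close>.\<close>
    define g' where "g' i = Farr G (k i, m) \<cdot>\<^bsub>C\<^esub> g i" for i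
    have g': "g' i \<in> hom C (Fobj D i) (Fobj G m)" "t m \<cdot>\<^bsub>C\<^esub> g' i = f \<cdot>\<^bsub>C\<^esub> d i" if i: "i \<in> Field r" for i
      using g[OF i] m(2)[OF i] G(2,3,4) t m(1) comp_assoc_eq[OF t(5)[OF m(2)[OF i]], of "g i"]
      by (simp_all add: g'_def hom_iff)
    have "\<exists>n. (m, n) \<in> s \<and> Farr G (m, n) \<cdot>\<^bsub>C\<^esub> (g' j \<cdot>\<^bsub>C\<^esub> Farr D (i, j)) = Farr G (m, n) \<cdot>\<^bsub>C\<^esub> g' i"
      if ij: "(i, j) \<in> r" for i j
    proof -
      have i: "i \<in> Field r" "j \<in> Field r" using ij rField by auto
      have h: "g' j \<cdot>\<^bsub>C\<^esub> Farr D (i, j) \<in> hom C (Fobj D i) (Fobj G m)"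
        using g'(1)[OF i(2)] D(2,3,4)[OF ij] by (simp add: hom_iff)
      have "t m \<cdot>\<^bsub>C\<^esub> (g' j \<cdot>\<^bsub>C\<^esub> Farr D (i, j)) = f \<cdot>\<^bsub>C\<^esub> d j \<cdot>\<^bsub>C\<^esub> Farr D (i, j)"
        using g'[OF i(2)] D(2,3,4)[OF ij] t m(1) by (intro comp_assoc_eq) (simp_all add: hom_iff)
      also have "\<dots> = f \<cdot>\<^bsub>C\<^esub> d i"
        using d(2,3,4)[OF i(2)] d(5)[OF ij] f D(2,3,4)[OF ij] by (simp add: hom_iff)
      finally have "t m \<cdot>\<^bsub>C\<^esub> (g' j \<cdot>\<^bsub>C\<^esub> Farr D (i, j)) = t m \<cdot>\<^bsub>C\<^esub> g' i" using g'(2)[OF i(1)] by simp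
      from compact_merge[OF D_compact[OF i(1)] s c m(1) h g'(1)[OF i(1)] this] show ?thesis by blast
    qed
    then obtain n where n: "\<And>i j. (i, j) \<in> r \<Longrightarrow> (m, n i j) \<in> s"
      "\<And>i j. (i, j) \<in> r \<Longrightarrow>
        Farr G (m, n i j) \<cdot>\<^bsub>C\<^esub> (g' j \<cdot>\<^bsub>C\<^esub> Farr D (i, j)) = Farr G (m, n i j) \<cdot>\<^bsub>C\<^esub> g' i" by metis
    \<comment> \<open>One stage per arrow of the diagram; the bound \<open>p\<close> of all of them
      also lies above \<open>m\<close>, so the family becomes a cocone at \<open>p\<close>.\<close>
    have "|case_prod n ` r| <o mu" using r(2) card_of_image ordLeq_ordLess_trans by blast
    then have "|insert m (case_prod n ` r)| <o mu"
      using card_of_Un_ordLess_infinite_Field[of mu "{m}" "case_prod n ` r"] mu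
        regular_cardinal_finite_less[OF mu, of "{m}"] by (auto simp: regular_cardinal_def cinfinite_def)
    moreover have "case_prod n ` r \<subseteq> Field s" using n(1) sField by auto
    ultimately obtain p where p0: "p \<in> Field s" "\<forall>x \<in> insert m (case_prod n ` r). (x, p) \<in> s"
      using directed_poset_bound[OF s, of "insert m (case_prod n ` r)"] m(1) by blast
    have p: "p \<in> Field s" "(m, p) \<in> s" using p0 by simp_all
    have p3: "(n i j, p) \<in> s" if "(i, j) \<in> r" for i j using bspec[OF p0(2), of "n i j"] that by force
    have "is_cocone (poset_category r) C D (Fobj G p) (\<lambda>i. Farr G (m, p) \<cdot>\<^bsub>C\<^esub> g' i)"
      unfolding cocone_poset_iff
    proof (intro conjI allI impI ballI)
      fix i j assume ij: "(i, j) \<in> r"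
      have i: "i \<in> Field r" "j \<in> Field r" using ij rField by auto
      note [simp] = G(2,3,4)[OF n(1)[OF ij]] G(2,3,4)[OF p3[OF ij]] D(2,3,4)[OF ij]
      have "Farr G (m, p) = Farr G (n i j, p) \<cdot>\<^bsub>C\<^esub> Farr G (m, n i j)"
        using G(6)[OF n(1)[OF ij] p3[OF ij]] by simp
      then show "Farr G (m, p) \<cdot>\<^bsub>C\<^esub> g' j \<cdot>\<^bsub>C\<^esub> Farr D (i, j) = Farr G (m, p) \<cdot>\<^bsub>C\<^esub> g' i"
        using g'(1)[OF i(1)] g'(1)[OF i(2)] n(2)[OF ij] by (simp add: hom_iff)
    qed (use G(1)[OF p(1)] G(2,3,4)[OF p(2)] g'(1) in \<open>auto simp: hom_iff\<close>)
    from colimit_factor[OF x this] obtain h where h: "h \<in> hom C x (Fobj G p)"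
      "\<And>i. i \<in> Field r \<Longrightarrow> h \<cdot>\<^bsub>C\<^esub> d i = Farr G (m, p) \<cdot>\<^bsub>C\<^esub> g' i" by auto
    have "t p \<cdot>\<^bsub>C\<^esub> h = f"
    proof (rule colimit_eqI[OF x])
      fix i assume "i \<in> Obj (poset_category r)"
      then have i: "i \<in> Field r" by simp
      have "t p \<cdot>\<^bsub>C\<^esub> (Farr G (m, p) \<cdot>\<^bsub>C\<^esub> g' i) = t m \<cdot>\<^bsub>C\<^esub> g' i"
        using g'(1)[OF i] G(2,3,4)[OF p(2)] t p(1)
        by (intro comp_assoc_eq[OF t(5)[OF p(2)]]) (simp_all add: hom_iff)
      then show "t p \<cdot>\<^bsub>C\<^esub> h \<cdot>\<^bsub>C\<^esub> d i = f \<cdot>\<^bsub>C\<^esub> d i"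
        using h(1) h(2)[OF i] g'(2)[OF i] t p(1) d i by (simp add: hom_iff)
    qed (use f h t p(1) in \<open>auto simp: hom_iff\<close>)
    then show "\<exists>k \<in> Field s. \<exists>g \<in> hom C x (Fobj G k). t k \<cdot>\<^bsub>C\<^esub> g = f"
      using p(1) h(1) by blast
  }
  fix k g g' assume k: "k \<in> Field s" and g: "g \<in> hom C x (Fobj G k)" "g' \<in> hom C x (Fobj G k)"
    and eq: "t k \<cdot>\<^bsub>C\<^esub> g = t k \<cdot>\<^bsub>C\<^esub> g'"
  \<comment> \<open>The two maps are compared on each \<open>Fobj D i\<close> and merged there; the
    bound \<open>p\<close> of these stages merges them on the colimit.\<close>
  have "\<exists>n. (k, n) \<in> s \<and> Farr G (k, n) \<cdot>\<^bsub>C\<^esub> (g \<cdot>\<^bsub>C\<^esub> d i) = Farr G (k, n) \<cdot>\<^bsub>C\<^esub> (g' \<cdot>\<^bsub>C\<^esub> d i)"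
    if i: "i \<in> Field r" for i
  proof -
    have "t k \<cdot>\<^bsub>C\<^esub> (g \<cdot>\<^bsub>C\<^esub> d i) = t k \<cdot>\<^bsub>C\<^esub> (g' \<cdot>\<^bsub>C\<^esub> d i)"
      using g k i d t comp_assoc_eq[OF eq, of "d i"] by (simp add: hom_iff)
    moreover have "g \<cdot>\<^bsub>C\<^esub> d i \<in> hom C (Fobj D i) (Fobj G k)" "g' \<cdot>\<^bsub>C\<^esub> d i \<in> hom C (Fobj D i) (Fobj G k)"
      using g d i by (simp_all add: hom_iff)
    ultimately show ?thesis using compact_merge[OF D_compact[OF i] s c k] by metis
  qed
  then obtain n where n: "\<And>i. i \<in> Field r \<Longrightarrow> (k, n i) \<in> s"
    "\<And>i. i \<in> Field r \<Longrightarrow> Farr G (k, n i) \<cdot>\<^bsub>C\<^esub> (g \<cdot>\<^bsub>C\<^esub> d i) = Farr G (k, n i) \<cdot>\<^bsub>C\<^esub> (g' \<cdot>\<^bsub>C\<^esub> d i)" by metis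
  have "|n ` Field r| <o mu" using less card_of_image ordLeq_ordLess_trans by blast
  then have "|insert k (n ` Field r)| <o mu"
    using card_of_Un_ordLess_infinite_Field[of mu "{k}" "n ` Field r"] mu
      regular_cardinal_finite_less[OF mu, of "{k}"] by (auto simp: regular_cardinal_def cinfinite_def)
  moreover have "n ` Field r \<subseteq> Field s" using n(1) sField by auto
  ultimately obtain p where p: "p \<in> Field s" "(k, p) \<in> s" "\<And>i. i \<in> Field r \<Longrightarrow> (n i, p) \<in> s"
    using directed_poset_bound[OF s, of "insert k (n ` Field r)"] n(1) k sField by auto
  have "Farr G (k, p) \<cdot>\<^bsub>C\<^esub> g = Farr G (k, p) \<cdot>\<^bsub>C\<^esub> g'"
  proof (rule colimit_eqI[OF x])
    fix i assume "i \<in> Obj (poset_category r)"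
    then have i: "i \<in> Field r" by simp
    have "Farr G (k, p) = Farr G (n i, p) \<cdot>\<^bsub>C\<^esub> Farr G (k, n i)"
      using G(6)[OF n(1)[OF i] p(3)[OF i]] by simp
    then show "Farr G (k, p) \<cdot>\<^bsub>C\<^esub> g \<cdot>\<^bsub>C\<^esub> d i = Farr G (k, p) \<cdot>\<^bsub>C\<^esub> g' \<cdot>\<^bsub>C\<^esub> d i"
      using G(2,3,4)[OF n(1)[OF i]] G(2,3,4)[OF p(3)[OF i]] g d i n(2)[OF i] by (simp add: hom_iff)
  qed (use G(2,3,4)[OF p(2)] g in \<open>auto simp: hom_iff\<close>)
  then show "\<exists>j. (k, j) \<in> s \<and> Farr G (k, j) \<cdot>\<^bsub>C\<^esub> g = Farr G (k, j) \<cdot>\<^bsub>C\<^esub> g'" using p(2) by blast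
qed

section \<open>Presentability tested by colimits of hom-sets\<close>

lemma set_category_simps [simp]:
  "A \<in> Obj (set_category U) \<longleftrightarrow> small U A"
  "(A, f, B) \<in> Arr (set_category U) \<longleftrightarrow> small U A \<and> small U B \<and> f \<in> A \<rightarrow>\<^sub>E B"
  "Dom (set_category U) (A, f, B) = A" "Cod (set_category U) (A, f, B) = B"
  "Id (set_category U) A = (A, \<lambda>x\<in>A. x, A)"
  "Comp (set_category U) (B, g, D) (A, f, B') = (A, compose A g f, D)"
  by (simp_all add: set_category_def)

lemma set_category_category: "is_category (set_category U)"
  unfolding is_category_def
  by (auto simp: set_category_def hom_def compose_def fun_eq_iff PiE_def extensional_def Pi_def)

lemma hom_functor_simps [simp]:
  "Fobj (hom_functor C a) b = hom C a b"
  "Farr (hom_functor C a) g =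
     (hom C a (Dom C g), \<lambda>f \<in> hom C a (Dom C g). g \<cdot>\<^bsub>C\<^esub> f, hom C a (Cod C g))"
  by (simp_all add: hom_functor_def)

lemma hom_functor_functor:
  assumes "locally_small U C" "a \<in> Obj C"
  shows "is_functor C (set_category U) (hom_functor C a)"
proof -
  interpret cat C using assms(1) by (simp add: locally_small_def cat_def)
  have small: "small U (hom C a b)" if "b \<in> Obj C" for b
    using assms that by (simp add: locally_small_def)
  show ?thesis
    unfolding is_functor_def
    by (auto simp: cat set_category_category hom_functor_def hom_iff small[simplified hom_iff] compose_def
        fun_eq_iff intro: small)
qed

context
  fixes C :: "('o, 'a) category" and a :: 'o and r :: "'u rel" and D :: "('u, 'u \<times> 'u, 'o, 'a) cat_functor"
    and lam :: "'u rel"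
  assumes C: "locally_small TYPE('u) C" and a: "a \<in> Obj C" and lam: "regular_cardinal lam"
    and r: "directed_poset lam r" and D: "is_functor (poset_category r) C D"
begin

interpretation cat C using C by (simp add: locally_small_def cat_def)

text \<open>Arrows of \<open>set_category\<close> carry their domain and codomain in a triple; this
  form strips a cocone down to the underlying functions \<open>\<tau> i\<close>.\<close>

lemma hom_cocone_iff:
  "is_cocone (poset_category r) (set_category TYPE('u)) (functor_comp (hom_functor C a) D) Z s \<longleftrightarrow>
     small TYPE('u) Z \<and>
     (\<exists>\<tau>. (\<forall>i \<in> Field r. s i = (hom C a (Fobj D i), \<tau> i, Z) \<and> \<tau> i \<in> hom C a (Fobj D i) \<rightarrow>\<^sub>E Z) \<and>
       (\<forall>i j. (i, j) \<in> r \<longrightarrow> (\<forall>g \<in> hom C a (Fobj D i). \<tau> j (Farr D (i, j) \<cdot>\<^bsub>C\<^esub> g) = \<tau> i g)))"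
  (is "?L \<longleftrightarrow> ?R")
proof
  note D' = diagramD[OF D]
  have rField: "\<And>i j. (i, j) \<in> r \<Longrightarrow> i \<in> Field r \<and> j \<in> Field r" by (auto simp: Field_def)
  {
    assume ?L
    note s = this[unfolded cocone_poset_iff]
    have "s i = (hom C a (Fobj D i), fst (snd (s i)), Z)
        \<and> fst (snd (s i)) \<in> hom C a (Fobj D i) \<rightarrow>\<^sub>E Z" if "i \<in> Field r" for i
    proof -
      obtain A f B where si: "s i = (A, f, B)" by (metis prod_cases3)
      have "s i \<in> hom (set_category TYPE('u)) (hom C a (Fobj D i)) Z" using s that by simp
      then show ?thesis by (auto simp: si hom_iff[of _ "set_category TYPE('u)"])
    qed
    moreover have "fst (snd (s j)) (Farr D (i, j) \<cdot>\<^bsub>C\<^esub> g) = fst (snd (s i)) g"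
      if ij: "(i, j) \<in> r" and g: "g \<in> hom C a (Fobj D i)" for i j g
    proof -
      obtain p q where pq: "s j = (hom C a (Fobj D j), p, Z)" "s i = (hom C a (Fobj D i), q, Z)"
        using calculation rField[OF ij] by metis
      have "s j \<cdot>\<^bsub>set_category TYPE('u)\<^esub> Farr (functor_comp (hom_functor C a) D) (i, j) = s i"
        using s ij by blast
      then have "compose (hom C a (Fobj D i)) p (\<lambda>f\<in>hom C a (Fobj D i). Farr D (i, j) \<cdot>\<^bsub>C\<^esub> f) = q"
        using D'(2,3,4)[OF ij] by (simp add: pq)
      from fun_cong[OF this, of g] show ?thesis using g by (simp add: pq compose_def)
    qed
    ultimately show ?R using s by (intro conjI exI[of _ "\<lambda>i. fst (snd (s i))"]) auto
  }
  assume ?R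
  then obtain \<tau> where Z: "small TYPE('u) Z"
    and s: "\<And>i. i \<in> Field r \<Longrightarrow> s i = (hom C a (Fobj D i), \<tau> i, Z)"
      "\<And>i. i \<in> Field r \<Longrightarrow> \<tau> i \<in> hom C a (Fobj D i) \<rightarrow>\<^sub>E Z"
      "\<And>i j g. (i, j) \<in> r \<Longrightarrow> g \<in> hom C a (Fobj D i) \<Longrightarrow> \<tau> j (Farr D (i, j) \<cdot>\<^bsub>C\<^esub> g) = \<tau> i g"
    by blast
  have small: "small TYPE('u) (hom C a b)" if "b \<in> Obj C" for b
    using C a that by (simp add: locally_small_def)
  show ?L
    unfolding cocone_poset_iff
  proof (intro conjI ballI allI impI)
    fix i j assume ij: "(i, j) \<in> r"
    have "compose (hom C a (Fobj D i)) (\<tau> j) (\<lambda>f\<in>hom C a (Fobj D i). Farr D (i, j) \<cdot>\<^bsub>C\<^esub> f) = \<tau> i"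
      using s(2)[of i] s(3)[OF ij] rField[OF ij] by (auto simp: compose_def fun_eq_iff PiE_def extensional_def)
    then show "s j \<cdot>\<^bsub>set_category TYPE('u)\<^esub> Farr (functor_comp (hom_functor C a) D) (i, j) = s i"
      using s(1) rField[OF ij] D'(2,3,4)[OF ij] by simp
  qed (use Z s(1,2) small D'(1) in \<open>auto simp: hom_iff[of _ "set_category TYPE('u)"]\<close>)
qed

text \<open>A two-element set serves as test object: the constant map and the indicator of the maps
  that factor through a stage agree after each \<open>t i\<close>, hence are equal. The test set has
  to live in the type of arrows, which is why \<open>y0\<close> and \<open>y1\<close> are
  given.\<close>

lemma set_colimit_surjective:
  fixes y0 y1 :: 'a
  assumes "is_colimit (poset_category r) (set_category TYPE('u)) (functor_comp (hom_functor C a) D)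
      (hom C a c) (\<lambda>i. Farr (hom_functor C a) (t i))"
    and t: "is_cocone (poset_category r) C D c t"
    and f: "f \<in> hom C a c" and y: "y0 \<noteq> y1" "small TYPE('u) {y0, y1}"
  shows "\<exists>i \<in> Field r. \<exists>g \<in> hom C a (Fobj D i). t i \<cdot>\<^bsub>C\<^esub> g = f"
proof -
  note t = cocone_posetD[OF t]
  let ?P = "\<lambda>f. \<exists>i \<in> Field r. \<exists>g \<in> hom C a (Fobj D i). t i \<cdot>\<^bsub>C\<^esub> g = f"
  let ?h = "(hom C a c, \<lambda>f\<in>hom C a c. y0, {y0, y1})"
  let ?h' = "(hom C a c, \<lambda>f\<in>hom C a c. if ?P f then y0 else y1, {y0, y1})"
  have c: "small TYPE('u) (hom C a c)" using C a t(1) by (simp add: locally_small_def)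
  have "?h = ?h'"
  proof (rule colimit_eqI[OF assms(1)])
    show "?h \<in> hom (set_category TYPE('u)) (hom C a c) {y0, y1}"
      "?h' \<in> hom (set_category TYPE('u)) (hom C a c) {y0, y1}"
      using c y by (auto simp: hom_iff[of _ "set_category TYPE('u)"])
    show "?h \<cdot>\<^bsub>set_category TYPE('u)\<^esub> Farr (hom_functor C a) (t i) = ?h' \<cdot>\<^bsub>set_category TYPE('u)\<^esub> Farr (hom_functor C a) (t i)"
      if i: "i \<in> Obj (poset_category r)" for i
    proof -
      have "t i \<cdot>\<^bsub>C\<^esub> g \<in> hom C a c \<and> ?P (t i \<cdot>\<^bsub>C\<^esub> g)" if "g \<in> hom C a (Fobj D i)" for g
        using i that t(2,3,4)[of i] by (intro conjI) (simp add: hom_iff, auto)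
      then show ?thesis using i t(3,4)[of i] by (simp add: compose_def fun_eq_iff)
    qed
  qed
  then have "(if ?P f then y0 else y1) = y0" using f by (auto simp: fun_eq_iff split: if_splits)
  then show ?thesis using y(1) by (auto split: if_splits)
qed

text \<open>The indicators of agreeing with \<open>g\<close> at some later stage form a cocone on a
  two-element set. The induced map takes one value on \<open>t i \<cdot> g\<close> and
  \<open>t i \<cdot> g'\<close>, so \<open>g'\<close> also agrees with \<open>g\<close>
  eventually.\<close>

lemma set_colimit_merge:
  fixes y0 y1 :: 'a
  assumes colim: "is_colimit (poset_category r) (set_category TYPE('u)) (functor_comp (hom_functor C a) D)
      (hom C a c) (\<lambda>i. Farr (hom_functor C a) (t i))"
    and t: "is_cocone (poset_category r) C D c t"
    and i: "i \<in> Field r" and g: "g \<in> hom C a (Fobj D i)" "g' \<in> hom C a (Fobj D i)"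
    and eq: "t i \<cdot>\<^bsub>C\<^esub> g = t i \<cdot>\<^bsub>C\<^esub> g'" and y: "y0 \<noteq> y1" "small TYPE('u) {y0, y1}"
  shows "\<exists>j. (i, j) \<in> r \<and> Farr D (i, j) \<cdot>\<^bsub>C\<^esub> g = Farr D (i, j) \<cdot>\<^bsub>C\<^esub> g'"
proof -
  note t = cocone_posetD[OF t] and D' = diagramD[OF D]
  have rField: "\<And>i j. (i, j) \<in> r \<Longrightarrow> i \<in> Field r \<and> j \<in> Field r" by (auto simp: Field_def)
  have rtrans: "\<And>i j k. (i, j) \<in> r \<Longrightarrow> (j, k) \<in> r \<Longrightarrow> (i, k) \<in> r"
    using directed_posetD(3)[OF r] by (meson transD)
  define P where "P k z \<longleftrightarrow> (\<exists>m. (i, m) \<in> r \<and> (k, m) \<in> r \<and> Farr D (i, m) \<cdot>\<^bsub>C\<^esub> g = Farr D (k, m) \<cdot>\<^bsub>C\<^esub> z)" for k z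
  define \<tau> where "\<tau> k = (\<lambda>z\<in>hom C a (Fobj D k). if P k z then y1 else y0)" for k
  have P: "P k' (Farr D (k, k') \<cdot>\<^bsub>C\<^esub> z) \<longleftrightarrow> P k z" if k: "(k, k') \<in> r" and z: "z \<in> hom C a (Fobj D k)" for k k' z
  proof
    have comp: "Farr D (k', m) \<cdot>\<^bsub>C\<^esub> (Farr D (k, k') \<cdot>\<^bsub>C\<^esub> z) = Farr D (k, m) \<cdot>\<^bsub>C\<^esub> z" if "(k', m) \<in> r" for m
      using that k z D'(2,3,4) by (intro comp_assoc_eq[OF D'(6)]) (auto simp: hom_iff)
    show "P k z" if "P k' (Farr D (k, k') \<cdot>\<^bsub>C\<^esub> z)"
      using that comp k rtrans unfolding P_def by metis
    assume "P k z"
    then obtain m where m: "(i, m) \<in> r" "(k, m) \<in> r" "Farr D (i, m) \<cdot>\<^bsub>C\<^esub> g = Farr D (k, m) \<cdot>\<^bsub>C\<^esub> z"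
      unfolding P_def by blast
    \<comment> \<open>Directedness supplies a stage above both \<open>m\<close> and
      \<open>k'\<close>, so the indicator is unchanged by moving \<open>z\<close> forward.\<close>
    obtain n where n: "(m, n) \<in> r" "(k', n) \<in> r"
      using directed_poset_bound2[OF lam r] rField[OF m(1)] rField[OF k] by metis
    have "Farr D (i, n) \<cdot>\<^bsub>C\<^esub> g = Farr D (m, n) \<cdot>\<^bsub>C\<^esub> (Farr D (i, m) \<cdot>\<^bsub>C\<^esub> g)"
      using comp_assoc_eq[OF D'(6)[OF m(1) n(1)], of g] g D'(2,3,4)[OF m(1)] D'(2,3,4)[OF n(1)] by (simp add: hom_iff)
    moreover have "Farr D (k, n) \<cdot>\<^bsub>C\<^esub> z = Farr D (m, n) \<cdot>\<^bsub>C\<^esub> (Farr D (k, m) \<cdot>\<^bsub>C\<^esub> z)"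
      using comp_assoc_eq[OF D'(6)[OF m(2) n(1)], of z] z D'(2,3,4)[OF m(2)] D'(2,3,4)[OF n(1)] by (simp add: hom_iff)
    ultimately show "P k' (Farr D (k, k') \<cdot>\<^bsub>C\<^esub> z)"
      using m n comp[OF n(2)] rtrans unfolding P_def by metis
  qed
  have "is_cocone (poset_category r) (set_category TYPE('u)) (functor_comp (hom_functor C a) D) {y0, y1}
      (\<lambda>i. (hom C a (Fobj D i), \<tau> i, {y0, y1}))"
    unfolding hom_cocone_iff
  proof (intro conjI exI[of _ \<tau>] allI impI ballI)
    fix k k' z assume "(k, k') \<in> r" "z \<in> hom C a (Fobj D k)"
    then show "\<tau> k' (Farr D (k, k') \<cdot>\<^bsub>C\<^esub> z) = \<tau> k z" using P D'(2,3,4) by (auto simp: \<tau>_def hom_iff)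
  qed (use y in \<open>auto simp: \<tau>_def\<close>)
  from colimit_factor[OF colim this] obtain h where
    h: "h \<in> hom (set_category TYPE('u)) (hom C a c) {y0, y1}"
      "\<And>k. k \<in> Field r \<Longrightarrow> h \<cdot>\<^bsub>set_category TYPE('u)\<^esub> Farr (hom_functor C a) (t k) = (hom C a (Fobj D k), \<tau> k, {y0, y1})"
    by auto
  obtain h' where h': "h = (hom C a c, h', {y0, y1})" using h(1) by (cases h) (auto simp: hom_iff)
  have "h' (t i \<cdot>\<^bsub>C\<^esub> z) = \<tau> i z" if "z \<in> hom C a (Fobj D i)" for z
  proof -
    have "compose (hom C a (Fobj D i)) h' (\<lambda>z\<in>hom C a (Fobj D i). t i \<cdot>\<^bsub>C\<^esub> z) = \<tau> i"
      using h(2)[OF i] t(2,3,4)[OF i] by (simp add: h')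
    from fun_cong[OF this, of z] show ?thesis using that by (simp add: compose_def)
  qed
  then have \<tau>: "\<tau> i g = \<tau> i g'" using g eq by metis
  have "(i, i) \<in> r" using i directed_posetD(2)[OF r] by (simp add: refl_on_def)
  then have "P i g" unfolding P_def by blast
  then have "P i g'" using \<tau> g y(1) by (auto simp: \<tau>_def split: if_splits)
  then show ?thesis unfolding P_def by blast
qed

text \<open>In sets a directed colimit is recognized by elements: the comparison map is defined
  through chosen representatives and is well defined because two representatives merge.\<close>

lemma set_colimitI:
  assumes t: "is_cocone (poset_category r) C D c t"
    and surj: "\<And>f. f \<in> hom C a c \<Longrightarrow> \<exists>i \<in> Field r. \<exists>g \<in> hom C a (Fobj D i). t i \<cdot>\<^bsub>C\<^esub> g = f"
    and merge: "\<And>i j g g'. i \<in> Field r \<Longrightarrow> j \<in> Field r \<Longrightarrow> g \<in> hom C a (Fobj D i) \<Longrightarrow> g' \<in> hom C a (Fobj D j) \<Longrightarrow>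
      t i \<cdot>\<^bsub>C\<^esub> g = t j \<cdot>\<^bsub>C\<^esub> g' \<Longrightarrow> \<exists>k. (i, k) \<in> r \<and> (j, k) \<in> r \<and> Farr D (i, k) \<cdot>\<^bsub>C\<^esub> g = Farr D (j, k) \<cdot>\<^bsub>C\<^esub> g'"
  shows "is_colimit (poset_category r) (set_category TYPE('u)) (functor_comp (hom_functor C a) D)
      (hom C a c) (\<lambda>i. Farr (hom_functor C a) (t i))"
proof (rule colimitI)
  note t' = cocone_posetD[OF t] and D' = diagramD[OF D]
  have c: "small TYPE('u) (hom C a c)" using C a t'(1) by (simp add: locally_small_def)
  show "is_functor (poset_category r) (set_category TYPE('u)) (functor_comp (hom_functor C a) D)"
    using D hom_functor_functor[OF C a] by (rule functor_compI)
  show "is_cocone (poset_category r) (set_category TYPE('u)) (functor_comp (hom_functor C a) D)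
      (hom C a c) (\<lambda>i. Farr (hom_functor C a) (t i))"
    unfolding hom_cocone_iff
  proof (intro conjI exI[of _ "\<lambda>i. \<lambda>f \<in> hom C a (Fobj D i). t i \<cdot>\<^bsub>C\<^esub> f"] allI impI ballI c)
    fix i j g assume ij: "(i, j) \<in> r" and g: "g \<in> hom C a (Fobj D i)"
    have "t j \<cdot>\<^bsub>C\<^esub> (Farr D (i, j) \<cdot>\<^bsub>C\<^esub> g) = t i \<cdot>\<^bsub>C\<^esub> g"
      using ij g D'(2,3,4)[OF ij] t'(2,3,4)[OF FieldI2[OF ij]]
      by (intro comp_assoc_eq[OF t'(5)[OF ij]]) (auto simp: hom_iff)
    then show "(\<lambda>f \<in> hom C a (Fobj D j). t j \<cdot>\<^bsub>C\<^esub> f) (Farr D (i, j) \<cdot>\<^bsub>C\<^esub> g) = (\<lambda>f \<in> hom C a (Fobj D i). t i \<cdot>\<^bsub>C\<^esub> f) g"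
      using g D'(2,3,4)[OF ij] by (auto simp: hom_iff)
  qed (use t' in \<open>auto simp: hom_iff\<close>)
  fix Z s assume "is_cocone (poset_category r) (set_category TYPE('u)) (functor_comp (hom_functor C a) D) Z s"
  then obtain \<tau> where Z: "small TYPE('u) Z"
    and s: "\<And>i. i \<in> Field r \<Longrightarrow> s i = (hom C a (Fobj D i), \<tau> i, Z)"
      "\<And>i. i \<in> Field r \<Longrightarrow> \<tau> i \<in> hom C a (Fobj D i) \<rightarrow>\<^sub>E Z"
      "\<And>i j g. (i, j) \<in> r \<Longrightarrow> g \<in> hom C a (Fobj D i) \<Longrightarrow> \<tau> j (Farr D (i, j) \<cdot>\<^bsub>C\<^esub> g) = \<tau> i g"
    unfolding hom_cocone_iff by blast
  obtain I g where Ig: "\<And>f. f \<in> hom C a c \<Longrightarrow> I f \<in> Field r"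
    "\<And>f. f \<in> hom C a c \<Longrightarrow> g f \<in> hom C a (Fobj D (I f))"
    "\<And>f. f \<in> hom C a c \<Longrightarrow> t (I f) \<cdot>\<^bsub>C\<^esub> g f = f" using surj by metis
  have well: "\<tau> (I (t i \<cdot>\<^bsub>C\<^esub> z)) (g (t i \<cdot>\<^bsub>C\<^esub> z)) = \<tau> i z" if i: "i \<in> Field r" and z: "z \<in> hom C a (Fobj D i)" for i z
  proof -
    have f: "t i \<cdot>\<^bsub>C\<^esub> z \<in> hom C a c" using t'(2,3,4)[OF i] z by (simp add: hom_iff)
    obtain k where "(I (t i \<cdot>\<^bsub>C\<^esub> z), k) \<in> r" "(i, k) \<in> r"
      "Farr D (I (t i \<cdot>\<^bsub>C\<^esub> z), k) \<cdot>\<^bsub>C\<^esub> g (t i \<cdot>\<^bsub>C\<^esub> z) = Farr D (i, k) \<cdot>\<^bsub>C\<^esub> z"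
      using merge[OF Ig(1)[OF f] i Ig(2)[OF f] z Ig(3)[OF f]] by blast
    then show ?thesis using s(3) Ig(2)[OF f] z by metis
  qed
  let ?h = "(hom C a c, \<lambda>f\<in>hom C a c. \<tau> (I f) (g f), Z)"
  have "?h \<in> hom (set_category TYPE('u)) (hom C a c) Z"
    using Z c s(2)[OF Ig(1)] Ig(2) by (auto simp: hom_iff[of _ "set_category TYPE('u)"])
  moreover have "?h \<cdot>\<^bsub>set_category TYPE('u)\<^esub> Farr (hom_functor C a) (t i) = s i" if i: "i \<in> Field r" for i
    using t'(2,3,4)[OF i] s(2)[OF i] well[OF i] s(1)[OF i]
    by (auto simp: compose_def fun_eq_iff hom_iff PiE_def extensional_def)
  ultimately show "\<exists>h. h \<in> hom (set_category TYPE('u)) (hom C a c) Z \<and>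
      (\<forall>j\<in>Obj (poset_category r). h \<cdot>\<^bsub>set_category TYPE('u)\<^esub> Farr (hom_functor C a) (t j) = s j)"
    by (intro exI[of _ ?h]) auto
next
  note t' = cocone_posetD[OF t]
  fix Z h h' assume h: "h \<in> hom (set_category TYPE('u)) (hom C a c) Z" "h' \<in> hom (set_category TYPE('u)) (hom C a c) Z"
    and eq: "\<And>j. j \<in> Obj (poset_category r) \<Longrightarrow>
      h \<cdot>\<^bsub>set_category TYPE('u)\<^esub> Farr (hom_functor C a) (t j) = h' \<cdot>\<^bsub>set_category TYPE('u)\<^esub> Farr (hom_functor C a) (t j)"
  obtain k k' where k: "h = (hom C a c, k, Z)" "h' = (hom C a c, k', Z)" "k \<in> hom C a c \<rightarrow>\<^sub>E Z" "k' \<in> hom C a c \<rightarrow>\<^sub>E Z"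
    using h by (cases h, cases h') (auto simp: hom_iff[of _ "set_category TYPE('u)"])
  have "k f = k' f" if f: "f \<in> hom C a c" for f
  proof -
    obtain i g where i: "i \<in> Field r" "g \<in> hom C a (Fobj D i)" "t i \<cdot>\<^bsub>C\<^esub> g = f" using surj[OF f] by blast
    have "compose (hom C a (Fobj D i)) k (\<lambda>z\<in>hom C a (Fobj D i). t i \<cdot>\<^bsub>C\<^esub> z)
        = compose (hom C a (Fobj D i)) k' (\<lambda>z\<in>hom C a (Fobj D i). t i \<cdot>\<^bsub>C\<^esub> z)"
      using eq[of i] i(1) t'(2,3,4)[OF i(1)] by (simp add: k)
    from fun_cong[OF this, of g] show ?thesis using i by (simp add: compose_def)
  qed
  then show "h = h'" using k by (auto intro: PiE_ext)
qed

end

context univ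
begin

text \<open>Preservation of colimits by \<open>hom_functor\<close> becomes the elementwise condition
  used from here on. The distinct \<open>y0\<close> and \<open>y1\<close> guarantee a two-element
  test set in the arrow type.\<close>

lemma presentable_iff_compact:
  fixes C :: "('o, 'a) category" and lam :: "'u rel" and y0 y1 :: 'a
  assumes C: "locally_small TYPE('u) C" and lam: "regular_cardinal lam" and y: "y0 \<noteq> y1"
  shows "presentable_object lam C a \<longleftrightarrow> compact_object lam C a"
proof
  assume "presentable_object lam C a"
  then have a: "a \<in> Obj C" and pres: "preserves_directed_colimits lam C (set_category TYPE('u)) (hom_functor C a)"
    by (auto simp: presentable_object_def)
  have y': "small TYPE('u) {y0, y1}" by (simp add: finite_small)
  show "compact_object lam C a"
    unfolding compact_object_def
  proof (intro conjI a allI impI ballI)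
    fix r D c t assume "directed_poset lam r \<and> is_colimit (poset_category r) C D c t"
    then have r: "directed_poset lam r" and c: "is_colimit (poset_category r) C D c t" by auto
    have colim: "is_colimit (poset_category r) (set_category TYPE('u)) (functor_comp (hom_functor C a) D)
        (hom C a c) (\<lambda>i. Farr (hom_functor C a) (t i))"
      using pres r c by (force simp: preserves_directed_colimits_def)
    {
      fix f assume "f \<in> hom C a c"
      from set_colimit_surjective[OF C a lam r colimitD(1)[OF c] colim colimitD(2)[OF c] this y y']
      show "\<exists>i \<in> Field r. \<exists>g \<in> hom C a (Fobj D i). t i \<cdot>\<^bsub>C\<^esub> g = f" .
    }
    fix i g g' assume "i \<in> Field r" "g \<in> hom C a (Fobj D i)" "g' \<in> hom C a (Fobj D i)" "t i \<cdot>\<^bsub>C\<^esub> g = t i \<cdot>\<^bsub>C\<^esub> g'"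
    from set_colimit_merge[OF C a lam r colimitD(1)[OF c] colim colimitD(2)[OF c] this y y']
    show "\<exists>j. (i, j) \<in> r \<and> Farr D (i, j) \<cdot>\<^bsub>C\<^esub> g = Farr D (i, j) \<cdot>\<^bsub>C\<^esub> g'" .
  qed
next
  assume compact: "compact_object lam C a"
  then have a: "a \<in> Obj C" by (simp add: compact_object_def)
  have "is_colimit (poset_category r) (set_category TYPE('u)) (functor_comp (hom_functor C a) D)
        (hom C a c) (\<lambda>i. Farr (hom_functor C a) (t i))"
    if r: "directed_poset lam r" and c: "is_colimit (poset_category r) C D c t" for r D c t
  proof (rule set_colimitI[OF C a lam r colimitD[OF c]])
    fix f assume "f \<in> hom C a c"
    from compact_factor[OF compact r c this] show "\<exists>i \<in> Field r. \<exists>g \<in> hom C a (Fobj D i). t i \<cdot>\<^bsub>C\<^esub> g = f" by metis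
  next
    fix i j g g' assume "i \<in> Field r" "j \<in> Field r" "g \<in> hom C a (Fobj D i)" "g' \<in> hom C a (Fobj D j)"
      "t i \<cdot>\<^bsub>C\<^esub> g = t j \<cdot>\<^bsub>C\<^esub> g'"
    from compact_merge2[OF lam compact r c this]
    show "\<exists>k. (i, k) \<in> r \<and> (j, k) \<in> r \<and> Farr D (i, k) \<cdot>\<^bsub>C\<^esub> g = Farr D (j, k) \<cdot>\<^bsub>C\<^esub> g'" by metis
  qed
  then show "presentable_object lam C a"
    using a unfolding presentable_object_def preserves_directed_colimits_def by simp
qed

end

section \<open>Cofinal diagrams\<close>

text \<open>A cocone over \<open>R\<close> is extended to \<open>r\<close> by sending
  \<open>i\<close> through any \<open>x\<close> with \<open>i\<close> below \<open>I x\<close>;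
  upper bounds in \<open>R\<close> make the outcome independent of \<open>x\<close>. It serves to
  reindex presentations of arrows and to cut initial segments off chains.\<close>

lemma colimit_cofinal:
  assumes colim: "is_colimit (poset_category r) C D c t"
    and R: "Refl R" "trans R" "\<And>x y. x \<in> Field R \<Longrightarrow> y \<in> Field R \<Longrightarrow> \<exists>z. (x, z) \<in> R \<and> (y, z) \<in> R"
    and I: "\<And>x y. (x, y) \<in> R \<Longrightarrow> (I x, I y) \<in> r" "\<And>i. i \<in> Field r \<Longrightarrow> \<exists>x \<in> Field R. (i, I x) \<in> r"
    and D': "\<And>x. x \<in> Field R \<Longrightarrow> Fobj D' x = Fobj D (I x)"
      "\<And>x y. (x, y) \<in> R \<Longrightarrow> Farr D' (x, y) = Farr D (I x, I y)"
  shows "is_colimit (poset_category R) C D' c (\<lambda>x. t (I x))"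
proof (rule colimitI)
  note D = diagramD[OF colimitD(1)[OF colim]] and t = cocone_posetD[OF colimitD(2)[OF colim]]
  interpret cat C using D(7) by unfold_locales
  have RField: "\<And>x y. (x, y) \<in> R \<Longrightarrow> x \<in> Field R \<and> y \<in> Field R" by (auto simp: Field_def)
  have rField: "\<And>x y. (x, y) \<in> r \<Longrightarrow> x \<in> Field r \<and> y \<in> Field r" by (auto simp: Field_def)
  have Rrefl: "\<And>x. x \<in> Field R \<Longrightarrow> (x, x) \<in> R" using R(1) by (simp add: refl_on_def)
  have IField: "\<And>x. x \<in> Field R \<Longrightarrow> I x \<in> Field r" using I(1) Rrefl rField by blast
  show "is_functor (poset_category R) C D'"
  proof (rule diagramI[OF cat R(1,2)])
    show "Farr D' (y, z) \<cdot>\<^bsub>C\<^esub> Farr D' (x, y) = Farr D' (x, z)" if "(x, y) \<in> R" "(y, z) \<in> R" for x y z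
      using D(6)[OF I(1)[OF that(1)] I(1)[OF that(2)]] D'(2) that transD[OF R(2) that] by simp
  qed (use D IField RField I(1) D' Rrefl in \<open>auto simp: hom_iff\<close>)
  show "is_cocone (poset_category R) C D' c (\<lambda>x. t (I x))"
    using t D' I(1) IField RField by (auto simp: cocone_poset_iff hom_iff)
  {
    fix d s assume "is_cocone (poset_category R) C D' d s"
    note s = cocone_posetD[OF this]
    obtain \<phi> where \<phi>: "\<And>i. i \<in> Field r \<Longrightarrow> \<phi> i \<in> Field R" "\<And>i. i \<in> Field r \<Longrightarrow> (i, I (\<phi> i)) \<in> r"
      using I(2) by metis
    have step: "s x \<cdot>\<^bsub>C\<^esub> Farr D (i, I x) = s z \<cdot>\<^bsub>C\<^esub> Farr D (i, I z)" if "(x, z) \<in> R" "(i, I x) \<in> r" for i x z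
    proof -
      have "s x \<cdot>\<^bsub>C\<^esub> Farr D (i, I x) = s z \<cdot>\<^bsub>C\<^esub> Farr D (I x, I z) \<cdot>\<^bsub>C\<^esub> Farr D (i, I x)"
        using s(5)[OF that(1)] D'(2)[OF that(1)] by simp
      also have "\<dots> = s z \<cdot>\<^bsub>C\<^esub> (Farr D (I x, I z) \<cdot>\<^bsub>C\<^esub> Farr D (i, I x))"
        using that D(2,3,4)[OF that(2)] D(2,3,4)[OF I(1)[OF that(1)]] s(2,3)[of z] RField[OF that(1)] D'(1)[of z]
        by (intro comp_assoc) auto
      finally show ?thesis using D(6)[OF that(2) I(1)[OF that(1)]] by simp
    qed
    \<comment> \<open>Both choices are compared with a common upper bound in
      \<open>R\<close>.\<close>
    have indep: "s x \<cdot>\<^bsub>C\<^esub> Farr D (i, I x) = s y \<cdot>\<^bsub>C\<^esub> Farr D (i, I y)"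
      if "x \<in> Field R" "y \<in> Field R" "(i, I x) \<in> r" "(i, I y) \<in> r" for i x y
      using R(3)[OF that(1,2)] step that(3,4) by metis
    have rtrans: "(i, k) \<in> r" if "(i, j) \<in> r" "(j, k) \<in> r" for i j k
    proof -
      interpret r: cat "poset_category r" using functorD(1)[OF colimitD(1)[OF colim]] by unfold_locales
      show ?thesis using r.comp_Arr[of "(i, j)" "(j, k)"] that by simp
    qed
    have "is_cocone (poset_category r) C D d (\<lambda>i. s (\<phi> i) \<cdot>\<^bsub>C\<^esub> Farr D (i, I (\<phi> i)))"
      unfolding cocone_poset_iff
    proof (intro conjI allI impI ballI)
      fix i j assume ij: "(i, j) \<in> r"
      have ij': "i \<in> Field r" "j \<in> Field r" using rField ij by auto
      note [simp] = D(2,3,4)[OF ij] D(2,3,4)[OF \<phi>(2)[OF ij'(2)]]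
      have "s (\<phi> j) \<cdot>\<^bsub>C\<^esub> Farr D (j, I (\<phi> j)) \<cdot>\<^bsub>C\<^esub> Farr D (i, j) = s (\<phi> j) \<cdot>\<^bsub>C\<^esub> (Farr D (j, I (\<phi> j)) \<cdot>\<^bsub>C\<^esub> Farr D (i, j))"
        using s(2,3,4)[OF \<phi>(1)[OF ij'(2)]] D'(1)[OF \<phi>(1)[OF ij'(2)]] by (intro comp_assoc) auto
      also have "\<dots> = s (\<phi> j) \<cdot>\<^bsub>C\<^esub> Farr D (i, I (\<phi> j))"
        using D(6)[OF ij \<phi>(2)[OF ij'(2)]] by simp
      also have "\<dots> = s (\<phi> i) \<cdot>\<^bsub>C\<^esub> Farr D (i, I (\<phi> i))"
        using \<phi> ij' rtrans[OF ij] by (intro indep) auto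
      finally show "s (\<phi> j) \<cdot>\<^bsub>C\<^esub> Farr D (j, I (\<phi> j)) \<cdot>\<^bsub>C\<^esub> Farr D (i, j) = s (\<phi> i) \<cdot>\<^bsub>C\<^esub> Farr D (i, I (\<phi> i))" .
    qed (use s(1) s(2,3,4)[OF \<phi>(1)] D(2,3,4)[OF \<phi>(2)] D'(1)[OF \<phi>(1)] in \<open>auto simp: hom_iff\<close>)
    from colimit_factor[OF colim this] obtain h where h: "h \<in> hom C c d"
      "\<And>i. i \<in> Field r \<Longrightarrow> h \<cdot>\<^bsub>C\<^esub> t i = s (\<phi> i) \<cdot>\<^bsub>C\<^esub> Farr D (i, I (\<phi> i))" by auto
    have "h \<cdot>\<^bsub>C\<^esub> t (I x) = s x" if x: "x \<in> Field R" for x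
    proof -
      have "h \<cdot>\<^bsub>C\<^esub> t (I x) = s x \<cdot>\<^bsub>C\<^esub> Farr D (I x, I x)"
        using h(2)[OF IField[OF x]] indep[OF \<phi>(1)[OF IField[OF x]] x \<phi>(2)[OF IField[OF x]]] I(1)[OF Rrefl[OF x]] by simp
      then show ?thesis using D(5)[OF IField[OF x]] s(2,3)[OF x] D'(1)[OF x] by simp
    qed
    then show "\<exists>h. h \<in> hom C c d \<and> (\<forall>x \<in> Obj (poset_category R). h \<cdot>\<^bsub>C\<^esub> t (I x) = s x)"
      using h(1) by auto
  }
  fix d h h' assume h: "h \<in> hom C c d" "h' \<in> hom C c d"
    and eq: "\<And>x. x \<in> Obj (poset_category R) \<Longrightarrow> h \<cdot>\<^bsub>C\<^esub> t (I x) = h' \<cdot>\<^bsub>C\<^esub> t (I x)"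
  show "h = h'"
  proof (rule colimit_eqI[OF colim h])
    fix i assume "i \<in> Obj (poset_category r)"
    then obtain x where x: "x \<in> Field R" "(i, I x) \<in> r" using I(2) by auto
    have "y \<cdot>\<^bsub>C\<^esub> t i = y \<cdot>\<^bsub>C\<^esub> t (I x) \<cdot>\<^bsub>C\<^esub> Farr D (i, I x)" if "y \<in> hom C c d" for y
      using that t(2,3,4)[OF IField[OF x(1)]] t(5)[OF x(2)] D(2,3,4)[OF x(2)] by (simp add: hom_iff)
    then show "h \<cdot>\<^bsub>C\<^esub> t i = h' \<cdot>\<^bsub>C\<^esub> t i" using h eq[of x] x(1) by simp
  qed
qed

section \<open>The arrow category\<close>

definition dom_part :: "'a \<times> 'a \<times> 'a \<times> 'a \<Rightarrow> 'a" where "dom_part w = fst (snd w)"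
definition cod_part :: "'a \<times> 'a \<times> 'a \<times> 'a \<Rightarrow> 'a" where "cod_part w = fst (snd (snd w))"

lemma part_simps [simp]: "dom_part (f, u, v, g) = u" "cod_part (f, u, v, g) = v"
  by (simp_all add: dom_part_def cod_part_def)

lemma arrow_category_simps [simp]:
  "Obj (arrow_category C) = Arr C"
  "(f, u, v, g) \<in> Arr (arrow_category C) \<longleftrightarrow> f \<in> Arr C \<and> g \<in> Arr C \<and>
     u \<in> hom C (Dom C f) (Dom C g) \<and> v \<in> hom C (Cod C f) (Cod C g) \<and> v \<cdot>\<^bsub>C\<^esub> f = g \<cdot>\<^bsub>C\<^esub> u"
  "Dom (arrow_category C) (f, u, v, g) = f" "Cod (arrow_category C) (f, u, v, g) = g"
  "Id (arrow_category C) f = (f, Id C (Dom C f), Id C (Cod C f), f)"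
  "(g', u', v', h) \<cdot>\<^bsub>arrow_category C\<^esub> (f, u, v, g) = (f, u' \<cdot>\<^bsub>C\<^esub> u, v' \<cdot>\<^bsub>C\<^esub> v, h)"
  by (auto simp: arrow_category_def)

lemma arrow_category_eqI:
  assumes "Dom (arrow_category C) w = Dom (arrow_category C) w'" "Cod (arrow_category C) w = Cod (arrow_category C) w'"
    "dom_part w = dom_part w'" "cod_part w = cod_part w'"
  shows "w = w'"
  using assms by (cases w, cases w') simp

lemma arrow_part_comp [simp]:
  "dom_part (w' \<cdot>\<^bsub>arrow_category C\<^esub> w) = dom_part w' \<cdot>\<^bsub>C\<^esub> dom_part w"
  "cod_part (w' \<cdot>\<^bsub>arrow_category C\<^esub> w) = cod_part w' \<cdot>\<^bsub>C\<^esub> cod_part w"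
  by (cases w, cases w', simp)+

lemma arrow_category_Arr_iff:
  "w \<in> Arr (arrow_category C) \<longleftrightarrow> Dom (arrow_category C) w \<in> Arr C \<and> Cod (arrow_category C) w \<in> Arr C \<and>
     dom_part w \<in> hom C (Dom C (Dom (arrow_category C) w)) (Dom C (Cod (arrow_category C) w)) \<and>
     cod_part w \<in> hom C (Cod C (Dom (arrow_category C) w)) (Cod C (Cod (arrow_category C) w)) \<and>
     cod_part w \<cdot>\<^bsub>C\<^esub> Dom (arrow_category C) w = Cod (arrow_category C) w \<cdot>\<^bsub>C\<^esub> dom_part w"
  by (cases w) simp

lemma arrow_ArrD:
  assumes "w \<in> Arr (arrow_category C)"
  shows "dom_part w \<in> Arr C" "Dom C (dom_part w) = Dom C (Dom (arrow_category C) w)"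
    "Cod C (dom_part w) = Dom C (Cod (arrow_category C) w)"
    "cod_part w \<in> Arr C" "Dom C (cod_part w) = Cod C (Dom (arrow_category C) w)"
    "Cod C (cod_part w) = Cod C (Cod (arrow_category C) w)"
    "cod_part w \<cdot>\<^bsub>C\<^esub> Dom (arrow_category C) w = Cod (arrow_category C) w \<cdot>\<^bsub>C\<^esub> dom_part w"
    "Dom (arrow_category C) w \<in> Arr C" "Cod (arrow_category C) w \<in> Arr C"
  using assms unfolding arrow_category_Arr_iff by (auto simp: hom_iff)

definition dom_functor :: "('o, 'a) category \<Rightarrow> ('a, 'a \<times> 'a \<times> 'a \<times> 'a, 'o, 'a) cat_functor" where
  "dom_functor C = \<lparr>Fobj = Dom C, Farr = dom_part\<rparr>"

definition cod_functor :: "('o, 'a) category \<Rightarrow> ('a, 'a \<times> 'a \<times> 'a \<times> 'a, 'o, 'a) cat_functor" where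
  "cod_functor C = \<lparr>Fobj = Cod C, Farr = cod_part\<rparr>"

lemma part_functor_simps [simp]:
  "Fobj (dom_functor C) = Dom C" "Farr (dom_functor C) = dom_part"
  "Fobj (cod_functor C) = Cod C" "Farr (cod_functor C) = cod_part"
  by (simp_all add: dom_functor_def cod_functor_def)

context cat
begin

abbreviation "arrows \<equiv> arrow_category C"

lemma arrow_category_category: "is_category arrows"
proof -
  have *: "v' \<cdot> v \<cdot> f = h \<cdot> (u' \<cdot> u)"
    if "f \<in> Arr C" "g \<in> Arr C" "h \<in> Arr C" "u \<in> hom C (Dom C f) (Dom C g)" "v \<in> hom C (Cod C f) (Cod C g)"
      "u' \<in> hom C (Dom C g) (Dom C h)" "v' \<in> hom C (Cod C g) (Cod C h)" "v \<cdot> f = g \<cdot> u" "v' \<cdot> g = h \<cdot> u'"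
    for f g h u v u' v'
  proof -
    have "v' \<cdot> v \<cdot> f = v' \<cdot> (g \<cdot> u)" using that by (simp add: hom_iff)
    also have "\<dots> = h \<cdot> u' \<cdot> u" using that by (intro comp_assoc_eq) (auto simp: hom_iff)
    also have "\<dots> = h \<cdot> (u' \<cdot> u)" using that by (simp add: hom_iff)
    finally show ?thesis .
  qed
  show ?thesis
    unfolding is_category_def
  proof (intro conjI ballI impI)
    fix w w' assume w: "w \<in> Arr arrows" "w' \<in> Arr arrows" "Cod arrows w = Dom arrows w'"
    obtain f u v g where w1: "w = (f, u, v, g)" by (cases w)
    obtain u' v' h where w2: "w' = (g, u', v', h)" using w(3) w1 by (cases w') simp
    have "v' \<cdot> v \<cdot> f = h \<cdot> (u' \<cdot> u)" using w by (intro *[where g = g]) (simp_all add: w1 w2)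
    moreover have "f \<in> Arr C" "h \<in> Arr C" "u' \<cdot> u \<in> hom C (Dom C f) (Dom C h)" "v' \<cdot> v \<in> hom C (Cod C f) (Cod C h)"
      using w(1,2) by (simp_all add: w1 w2 hom_iff)
    ultimately show "w' \<cdot>\<^bsub>arrows\<^esub> w \<in> hom arrows (Dom arrows w) (Cod arrows w')"
      unfolding w1 w2 hom_iff[of _ arrows] by simp
  next
    fix w w' w'' assume w: "w \<in> Arr arrows" "w' \<in> Arr arrows" "w'' \<in> Arr arrows"
      "Cod arrows w = Dom arrows w' \<and> Cod arrows w' = Dom arrows w''"
    obtain f u v g where w1: "w = (f, u, v, g)" by (cases w)
    obtain u' v' h where w2: "w' = (g, u', v', h)" using w(4) w1 by (cases w') simp
    obtain u'' v'' k where w3: "w'' = (h, u'', v'', k)" using w(4) w2 by (cases w'') simp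
    show "w'' \<cdot>\<^bsub>arrows\<^esub> (w' \<cdot>\<^bsub>arrows\<^esub> w) = w'' \<cdot>\<^bsub>arrows\<^esub> w' \<cdot>\<^bsub>arrows\<^esub> w"
      using w(1-3) by (simp add: w1 w2 w3 hom_iff)
  qed (auto simp: hom_iff)
qed

interpretation arr: cat arrows by unfold_locales (rule arrow_category_category)

lemma dom_functor_functor: "is_functor arrows C (dom_functor C)"
  and cod_functor_functor: "is_functor arrows C (cod_functor C)"
  unfolding is_functor_def by (auto simp: arrow_category_category cat arrow_ArrD hom_iff)

lemma arrow_iso_parts:
  assumes "is_iso arrows w"
  shows "is_iso C (dom_part w)" "is_iso C (cod_part w)"
proof -
  obtain w' where w: "w \<in> Arr arrows" and w': "w' \<in> Arr arrows" "Dom arrows w' = Cod arrows w" "Cod arrows w' = Dom arrows w"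
    and eq: "w' \<cdot>\<^bsub>arrows\<^esub> w = Id arrows (Dom arrows w)" "w \<cdot>\<^bsub>arrows\<^esub> w' = Id arrows (Cod arrows w)"
    using assms by (auto simp: is_iso_def hom_iff)
  note [simp] = arrow_ArrD[OF w] arrow_ArrD[OF w'(1)]
  have "dom_part w' \<cdot> dom_part w = Id C (Dom C (Dom arrows w))" "dom_part w \<cdot> dom_part w' = Id C (Dom C (Cod arrows w))"
    "cod_part w' \<cdot> cod_part w = Id C (Cod C (Dom arrows w))" "cod_part w \<cdot> cod_part w' = Id C (Cod C (Cod arrows w))"
    using arg_cong[OF eq(1), of dom_part] arg_cong[OF eq(2), of dom_part]
      arg_cong[OF eq(1), of cod_part] arg_cong[OF eq(2), of cod_part] by simp_all
  moreover have "dom_part w' \<in> hom C (Cod C (dom_part w)) (Dom C (dom_part w))"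
    "cod_part w' \<in> hom C (Cod C (cod_part w)) (Dom C (cod_part w))"
    using w'(2,3) by (simp_all add: hom_iff)
  ultimately show "is_iso C (dom_part w)" "is_iso C (cod_part w)"
    unfolding is_iso_def by auto
qed

text \<open>The maps induced on domains and on codomains form a square because both ways around
  agree after every \<open>dom_part (t j)\<close>, and the domains form a colimit.\<close>

lemma arrow_colimit_of_parts:
  assumes D: "is_functor J arrows D" and t: "is_cocone J arrows D g t"
    and dom: "is_colimit J C (functor_comp (dom_functor C) D) (Dom C g) (\<lambda>j. dom_part (t j))"
    and cod: "is_colimit J C (functor_comp (cod_functor C) D) (Cod C g) (\<lambda>j. cod_part (t j))"
  shows "is_colimit J arrows D g t"
proof (rule colimitI[OF D t])
  note t' = coconeD[OF t] and D' = functorD[OF D]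
  have g: "g \<in> Arr C" using t'(1) by simp
  {
    fix g' s assume s: "is_cocone J arrows D g' s"
    note s' = coconeD[OF s]
    have g': "g' \<in> Arr C" using s'(1) by simp
    have cocone: "is_cocone J C (functor_comp F D) (Fobj F g') (\<lambda>j. Farr F (s j))"
      if F: "is_functor arrows C F" for F
    proof -
      have "Farr F (s (Cod J k)) \<cdot> Farr F (Farr D k) = Farr F (s (Dom J k))" if k: "k \<in> Arr J" for k
      proof -
        interpret J: cat J using functorD(1)[OF D] by unfold_locales
        show ?thesis
          using functorD(8)[OF F, of "Farr D k" "s (Cod J k)"] s'(5)[OF k] k D'(4,5,6) s'(2,3) by simp
      qed
      then show ?thesis
        using s' functorD[OF F] by (auto simp: is_cocone_def hom_iff)
    qed
    obtain p where p: "p \<in> hom C (Dom C g) (Dom C g')" "\<And>j. j \<in> Obj J \<Longrightarrow> p \<cdot> dom_part (t j) = dom_part (s j)"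
      using colimit_factor[OF dom cocone[OF dom_functor_functor, simplified]] by blast
    obtain q where q: "q \<in> hom C (Cod C g) (Cod C g')" "\<And>j. j \<in> Obj J \<Longrightarrow> q \<cdot> cod_part (t j) = cod_part (s j)"
      using colimit_factor[OF cod cocone[OF cod_functor_functor, simplified]] by blast
    have "q \<cdot> g = g' \<cdot> p"
    proof (rule colimit_eqI[OF dom])
      fix j assume j: "j \<in> Obj J"
      note [simp] = arrow_ArrD[OF t'(2)[OF j]] arrow_ArrD[OF s'(2)[OF j]] t'(2,3,4)[OF j] s'(2,3,4)[OF j]
      have Dj: "Fobj D j \<in> Arr C" using D'(3)[OF j] by simp
      have "q \<cdot> g \<cdot> dom_part (t j) = q \<cdot> (cod_part (t j) \<cdot> Fobj D j)"
        using q(1) g arrow_ArrD(7)[OF t'(2)[OF j]] by (simp add: hom_iff)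
      also have "\<dots> = cod_part (s j) \<cdot> Fobj D j"
        using q Dj j by (intro comp_assoc_eq[OF q(2)[OF j]]) (auto simp: hom_iff)
      also have "\<dots> = g' \<cdot> dom_part (s j)" using arrow_ArrD(7)[OF s'(2)[OF j]] by simp
      also have "\<dots> = g' \<cdot> p \<cdot> dom_part (t j)" using p(1) p(2)[OF j] g' by (simp add: hom_iff)
      finally show "q \<cdot> g \<cdot> dom_part (t j) = g' \<cdot> p \<cdot> dom_part (t j)" .
    qed (use p q g g' in \<open>auto simp: hom_iff\<close>)
    then have "(g, p, q, g') \<in> hom arrows g g'" using g g' p(1) q(1) by (simp add: hom_iff)
    moreover have "(g, p, q, g') \<cdot>\<^bsub>arrows\<^esub> t j = s j" if j: "j \<in> Obj J" for j
      using p(2)[OF j] q(2)[OF j] t'(2,3,4)[OF j] s'(2,3,4)[OF j]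
      by (cases "t j", cases "s j") (auto simp: hom_iff)
    ultimately show "\<exists>h. h \<in> hom arrows g g' \<and> (\<forall>j\<in>Obj J. h \<cdot>\<^bsub>arrows\<^esub> t j = s j)" by blast
  }
  fix d h h' assume h: "h \<in> hom arrows g d" "h' \<in> hom arrows g d"
    and eq: "\<And>j. j \<in> Obj J \<Longrightarrow> h \<cdot>\<^bsub>arrows\<^esub> t j = h' \<cdot>\<^bsub>arrows\<^esub> t j"
  have eq': "dom_part h \<cdot> dom_part (t j) = dom_part h' \<cdot> dom_part (t j)"
    "cod_part h \<cdot> cod_part (t j) = cod_part h' \<cdot> cod_part (t j)" if "j \<in> Obj J" for j
    using arg_cong[OF eq[OF that], of dom_part] arg_cong[OF eq[OF that], of cod_part] by simp_all
  have hA: "h \<in> Arr arrows" "h' \<in> Arr arrows" using h by (auto simp: hom_iff)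
  note [simp] = arrow_ArrD[OF hA(1)] arrow_ArrD[OF hA(2)]
  have "dom_part h = dom_part h'"
    using h eq' by - (rule colimit_eqI[OF dom, of _ "Dom C d"]; simp add: hom_iff)
  moreover have "cod_part h = cod_part h'"
    using h eq' by - (rule colimit_eqI[OF cod, of _ "Cod C d"]; simp add: hom_iff)
  ultimately show "h = h'" using h by (intro arrow_category_eqI[of C]) (auto simp: hom_iff)
qed

text \<open>The universal property on domains induces the arrow \<open>g\<close> between the
  component colimits.\<close>

lemma arrow_colimit_exists:
  assumes D: "is_functor J arrows D"
    and dom: "is_colimit J C (functor_comp (dom_functor C) D) a \<alpha>"
    and cod: "is_colimit J C (functor_comp (cod_functor C) D) b \<beta>"
  obtains g where "g \<in> hom C a b" "is_colimit J arrows D g (\<lambda>j. (Fobj D j, \<alpha> j, \<beta> j, g))"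
proof -
  note D' = functorD[OF D] and \<alpha> = coconeD[OF colimitD(2)[OF dom]] and \<beta> = coconeD[OF colimitD(2)[OF cod]]
  interpret J: cat J using D'(1) by unfold_locales
  have D_Arr: "\<And>j. j \<in> Obj J \<Longrightarrow> Fobj D j \<in> Arr C" using D'(3) by simp
  have "is_cocone J C (functor_comp (dom_functor C) D) b (\<lambda>j. \<beta> j \<cdot> Fobj D j)"
    unfolding is_cocone_def
  proof (intro conjI ballI)
    fix k assume k: "k \<in> Arr J"
    note [simp] = arrow_ArrD[OF D'(4)[OF k]] D'(5,6)[OF k]
    have "\<beta> (Cod J k) \<cdot> Fobj D (Cod J k) \<cdot> dom_part (Farr D k) = \<beta> (Cod J k) \<cdot> (cod_part (Farr D k) \<cdot> Fobj D (Dom J k))"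
      using arrow_ArrD(7)[OF D'(4)[OF k]] \<beta>(2,3,4)[of "Cod J k"] D_Arr k by simp
    also have "\<dots> = \<beta> (Dom J k) \<cdot> Fobj D (Dom J k)"
      using \<beta>(5)[OF k] \<beta>(2,3,4)[of "Cod J k"] D_Arr k by (intro comp_assoc_eq) auto
    finally show "\<beta> (Cod J k) \<cdot> Fobj D (Cod J k) \<cdot> Farr (functor_comp (dom_functor C) D) k = \<beta> (Dom J k) \<cdot> Fobj D (Dom J k)"
      by simp
  qed (use \<beta> D_Arr in \<open>auto simp: hom_iff\<close>)
  from colimit_factor[OF dom this] obtain g where g: "g \<in> hom C a b" "\<And>j. j \<in> Obj J \<Longrightarrow> g \<cdot> \<alpha> j = \<beta> j \<cdot> Fobj D j" by metis
  have "is_colimit J arrows D g (\<lambda>j. (Fobj D j, \<alpha> j, \<beta> j, g))"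
  proof (rule arrow_colimit_of_parts[OF D])
    have "(Fobj D (Cod J k), \<alpha> (Cod J k), \<beta> (Cod J k), g) \<cdot>\<^bsub>arrows\<^esub> Farr D k = (Fobj D (Dom J k), \<alpha> (Dom J k), \<beta> (Dom J k), g)"
      if k: "k \<in> Arr J" for k
      using \<alpha>(5)[OF k] \<beta>(5)[OF k] D'(5)[OF k] by (cases "Farr D k") auto
    then show "is_cocone J arrows D g (\<lambda>j. (Fobj D j, \<alpha> j, \<beta> j, g))"
      using g \<alpha> \<beta> D_Arr by (auto simp: is_cocone_def hom_iff)
  qed (use dom cod g(1) in \<open>auto simp: hom_iff\<close>)
  then show ?thesis using g(1) that by blast
qed

text \<open>With the component colimits given, any colimit in the arrow category is isomorphic to
  the one built from them, and an isomorphism of arrows has invertible parts.\<close>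

lemma arrow_colimit_parts:
  assumes colim: "is_colimit J arrows D g t"
    and dom: "is_colimit J C (functor_comp (dom_functor C) D) a \<alpha>"
    and cod: "is_colimit J C (functor_comp (cod_functor C) D) b \<beta>"
  shows "is_colimit J C (functor_comp (dom_functor C) D) (Dom C g) (\<lambda>j. dom_part (t j))"
    and "is_colimit J C (functor_comp (cod_functor C) D) (Cod C g) (\<lambda>j. cod_part (t j))"
proof -
  obtain g' where g': "g' \<in> hom C a b" "is_colimit J arrows D g' (\<lambda>j. (Fobj D j, \<alpha> j, \<beta> j, g'))"
    using arrow_colimit_exists[OF colimitD(1)[OF colim] dom cod] by blast
  obtain h where h: "h \<in> hom arrows g' g" "is_iso arrows h" "\<And>j. j \<in> Obj J \<Longrightarrow> h \<cdot>\<^bsub>arrows\<^esub> (Fobj D j, \<alpha> j, \<beta> j, g') = t j"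
    using colimit_unique[OF g'(2) colim] by metis
  have "dom_part (t j) = dom_part h \<cdot> \<alpha> j" "cod_part (t j) = cod_part h \<cdot> \<beta> j" if "j \<in> Obj J" for j
    using h(3)[OF that] by (metis arrow_part_comp part_simps)+
  moreover have "dom_part h \<in> hom C a (Dom C g)" "cod_part h \<in> hom C b (Cod C g)"
    using h(1) g'(1) arrow_ArrD[of h] by (auto simp: hom_iff)
  ultimately show "is_colimit J C (functor_comp (dom_functor C) D) (Dom C g) (\<lambda>j. dom_part (t j))"
    "is_colimit J C (functor_comp (cod_functor C) D) (Cod C g) (\<lambda>j. cod_part (t j))"
    by (auto intro: colimit_iso_transfer[OF dom arrow_iso_parts(1)[OF h(2)]]
        colimit_iso_transfer[OF cod arrow_iso_parts(2)[OF h(2)]])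
qed

lemma arrow_cocomplete:
  assumes "cocomplete TYPE('u) C"
  shows "cocomplete TYPE('u) arrows"
  unfolding cocomplete_def
proof (intro allI impI)
  fix J :: "('u, 'u) category" and D assume J: "small_category TYPE('u) J \<and> is_functor J arrows D"
  obtain a \<alpha> where a: "is_colimit J C (functor_comp (dom_functor C) D) a \<alpha>"
    using cocomplete_colimit[OF assms] J functor_compI[OF _ dom_functor_functor] by blast
  obtain b \<beta> where b: "is_colimit J C (functor_comp (cod_functor C) D) b \<beta>"
    using cocomplete_colimit[OF assms] J functor_compI[OF _ cod_functor_functor] by blast
  show "\<exists>c t. is_colimit J arrows D c t"
    using arrow_colimit_exists[OF conjunct2[OF J] a b] by blast
qed

lemma arrow_directed_colimit_parts:
  assumes "has_directed_colimits lam C" "directed_poset lam r" "is_colimit (poset_category r) arrows D g t"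
  shows "is_colimit (poset_category r) C (functor_comp (dom_functor C) D) (Dom C g) (\<lambda>j. dom_part (t j))"
    and "is_colimit (poset_category r) C (functor_comp (cod_functor C) D) (Cod C g) (\<lambda>j. cod_part (t j))"
proof -
  note D = colimitD(1)[OF assms(3)]
  obtain a \<alpha> where a: "is_colimit (poset_category r) C (functor_comp (dom_functor C) D) a \<alpha>"
    using assms(1,2) functor_compI[OF D dom_functor_functor] unfolding has_directed_colimits_def by blast
  obtain b \<beta> where b: "is_colimit (poset_category r) C (functor_comp (cod_functor C) D) b \<beta>"
    using assms(1,2) functor_compI[OF D cod_functor_functor] unfolding has_directed_colimits_def by blast
  show "is_colimit (poset_category r) C (functor_comp (dom_functor C) D) (Dom C g) (\<lambda>j. dom_part (t j))"
    and "is_colimit (poset_category r) C (functor_comp (cod_functor C) D) (Cod C g) (\<lambda>j. cod_part (t j))"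
    using arrow_colimit_parts[OF assms(3) a b] by blast+
qed

lemma arrow_has_directed_colimits:
  assumes "has_directed_colimits lam C"
  shows "has_directed_colimits lam arrows"
  unfolding has_directed_colimits_def
proof (intro allI impI)
  fix r D assume rD: "directed_poset lam r \<and> is_functor (poset_category r) arrows D"
  obtain a \<alpha> where a: "is_colimit (poset_category r) C (functor_comp (dom_functor C) D) a \<alpha>"
    using assms rD functor_compI[OF _ dom_functor_functor] unfolding has_directed_colimits_def by blast
  obtain b \<beta> where b: "is_colimit (poset_category r) C (functor_comp (cod_functor C) D) b \<beta>"
    using assms rD functor_compI[OF _ cod_functor_functor] unfolding has_directed_colimits_def by blast
  show "\<exists>c t. is_colimit (poset_category r) arrows D c t"
    using arrow_colimit_exists[OF conjunct2[OF rD] a b] by blast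
qed

end

section \<open>Accessibility of the arrow category\<close>

context cat
begin

interpretation arr: cat arrows by unfold_locales (rule arrow_category_category)

lemma arrow_locally_small:
  assumes "universe TYPE('u)" "locally_small TYPE('u) C"
  shows "locally_small TYPE('u) arrows"
proof -
  interpret univ "TYPE('u)" by unfold_locales (rule assms)
  have "small TYPE('u) (hom arrows f g)" if "f \<in> Arr C" "g \<in> Arr C" for f g
  proof (rule small_subset)
    show "small TYPE('u) ({f} \<times> hom C (Dom C f) (Dom C g) \<times> hom C (Cod C f) (Cod C g) \<times> {g})"
      using assms(2) that by (intro small_Times) (auto simp: locally_small_def finite_small)
  qed (auto simp: hom_iff)
  then show ?thesis by (simp add: locally_small_def arrow_category_category)
qed

text \<open>The two parts of a square factor through stages separately. At a common stage the
  factorizations need not form a square, but they do after passing to the colimit, so compactness of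
  \<open>Dom C f\<close> makes them one at a later stage.\<close>

lemma compact_arrow:
  assumes lam: "regular_cardinal lam" and C: "has_directed_colimits lam C"
    and f: "f \<in> Arr C" "compact_object lam C (Dom C f)" "compact_object lam C (Cod C f)"
  shows "compact_object lam arrows f"
  unfolding compact_object_def
proof (intro conjI allI impI ballI)
  show "f \<in> Obj arrows" using f(1) by simp
  fix r D c t assume "directed_poset lam r \<and> is_colimit (poset_category r) arrows D c t"
  then have r: "directed_poset lam r" and colim: "is_colimit (poset_category r) arrows D c t" by auto
  note dom = arrow_directed_colimit_parts(1)[OF C r colim] and cod = arrow_directed_colimit_parts(2)[OF C r colim]
  note D = diagramD[OF colimitD(1)[OF colim]] and t = cocone_posetD[OF colimitD(2)[OF colim]]
  note dt = cocone_posetD[OF colimitD(2)[OF dom]] and ct = cocone_posetD[OF colimitD(2)[OF cod]]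
  note dD = diagramD[OF colimitD(1)[OF dom]] and cD = diagramD[OF colimitD(1)[OF cod]]
  have rField: "\<And>i j. (i, j) \<in> r \<Longrightarrow> i \<in> Field r \<and> j \<in> Field r" by (auto simp: Field_def)
  have rtrans: "\<And>i j k. (i, j) \<in> r \<Longrightarrow> (j, k) \<in> r \<Longrightarrow> (i, k) \<in> r"
    using directed_posetD(3)[OF r] by (meson transD)
  have DArr: "\<And>i. i \<in> Field r \<Longrightarrow> Fobj D i \<in> Arr C" using D(1) by simp
  {
    fix w assume w: "w \<in> hom arrows f c"
    have wA: "w \<in> Arr arrows" using w by (simp add: hom_iff)
    note w' = arrow_ArrD[OF wA]
    have pw: "dom_part w \<in> hom C (Dom C f) (Dom C c)" "cod_part w \<in> hom C (Cod C f) (Cod C c)"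
      "cod_part w \<cdot> f = c \<cdot> dom_part w" using w w' by (auto simp: hom_iff)
    obtain i p where p: "i \<in> Field r" "p \<in> hom C (Dom C f) (Dom C (Fobj D i))" "dom_part (t i) \<cdot> p = dom_part w"
      using compact_factor[OF f(2) r dom pw(1)] by auto
    obtain j q where q: "j \<in> Field r" "q \<in> hom C (Cod C f) (Cod C (Fobj D j))" "cod_part (t j) \<cdot> q = cod_part w"
      using compact_factor[OF f(3) r cod pw(2)] by auto
    obtain m where m: "m \<in> Field r" "(i, m) \<in> r" "(j, m) \<in> r"
      using directed_poset_bound2[OF lam r p(1) q(1)] by blast
    define p' where "p' = dom_part (Farr D (i, m)) \<cdot> p"
    define q' where "q' = cod_part (Farr D (j, m)) \<cdot> q"
    have p': "p' \<in> hom C (Dom C f) (Dom C (Fobj D m))" "dom_part (t m) \<cdot> p' = dom_part w"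
      using p dD(2,3,4)[OF m(2)] dt(2,3)[OF m(1)] comp_assoc_eq[OF dt(5)[OF m(2)], of p]
      by (simp_all add: p'_def hom_iff)
    have q': "q' \<in> hom C (Cod C f) (Cod C (Fobj D m))" "cod_part (t m) \<cdot> q' = cod_part w"
      using q cD(2,3,4)[OF m(3)] ct(2,3)[OF m(1)] comp_assoc_eq[OF ct(5)[OF m(3)], of q]
      by (simp_all add: q'_def hom_iff)
    have tm: "cod_part (t m) \<cdot> Fobj D m = c \<cdot> dom_part (t m)" "c \<in> Arr C"
      using arrow_ArrD(7,9)[OF t(2)[OF m(1)]] t(3,4)[OF m(1)] by auto
    have ctm: "cod_part (t m) \<in> Arr C" "Dom C (cod_part (t m)) = Cod C (Fobj D m)" using ct(2,3)[OF m(1)] by auto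
    have dtm: "dom_part (t m) \<in> Arr C" "Dom C (dom_part (t m)) = Dom C (Fobj D m)" "Cod C (dom_part (t m)) = Dom C c" using dt(2,3,4)[OF m(1)] by auto
    have "cod_part (t m) \<cdot> (q' \<cdot> f) = cod_part w \<cdot> f"
      using q' f(1) ctm by (intro comp_assoc_eq) (auto simp: hom_iff)
    also have "\<dots> = c \<cdot> (dom_part (t m) \<cdot> p')" using pw(3) p'(2) by simp
    also have "\<dots> = cod_part (t m) \<cdot> (Fobj D m \<cdot> p')"
      using comp_assoc_eq[OF tm(1), of p'] DArr[OF m(1)] ctm p'(1) tm(2) dtm by (simp add: hom_iff)
    finally have eq: "cod_part (t m) \<cdot> (q' \<cdot> f) = cod_part (t m) \<cdot> (Fobj D m \<cdot> p')" .
    have qf: "q' \<cdot> f \<in> hom C (Dom C f) (Cod C (Fobj D m))" "Fobj D m \<cdot> p' \<in> hom C (Dom C f) (Cod C (Fobj D m))"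
      using q' p' f(1) DArr[OF m(1)] by (auto simp: hom_iff)
    obtain n where n: "(m, n) \<in> r"
      "cod_part (Farr D (m, n)) \<cdot> (q' \<cdot> f) = cod_part (Farr D (m, n)) \<cdot> (Fobj D m \<cdot> p')"
      using compact_merge[OF f(2) r cod m(1), of "q' \<cdot> f" "Fobj D m \<cdot> p'"] qf eq by auto
    have nF: "n \<in> Field r" using rField[OF n(1)] by blast
    note [simp] = dD(2,3,4)[OF n(1), simplified] cD(2,3,4)[OF n(1), simplified] DArr[OF nF] DArr[OF m(1)] f(1)
    have sq: "cod_part (Farr D (m, n)) \<cdot> Fobj D m = Fobj D n \<cdot> dom_part (Farr D (m, n))"
      using arrow_ArrD(7)[OF D(2)[OF n(1)]] D(3,4)[OF n(1)] by simp
    let ?w = "(f, dom_part (Farr D (m, n)) \<cdot> p', cod_part (Farr D (m, n)) \<cdot> q', Fobj D n)"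
    have "cod_part (Farr D (m, n)) \<cdot> (Fobj D m \<cdot> p') = Fobj D n \<cdot> (dom_part (Farr D (m, n)) \<cdot> p')"
      using comp_assoc_eq[OF sq, of p'] p'(1) by (simp add: hom_iff)
    then have w1: "?w \<in> hom arrows f (Fobj D n)"
      using p'(1) q'(1) n(2) by (simp add: hom_iff)
    have "dom_part (t n) \<cdot> (dom_part (Farr D (m, n)) \<cdot> p') = dom_part w"
      using comp_assoc_eq[OF dt(5)[OF n(1)], of p'] p' dt(2,3)[OF nF] by (simp add: hom_iff)
    moreover have "cod_part (t n) \<cdot> (cod_part (Farr D (m, n)) \<cdot> q') = cod_part w"
      using comp_assoc_eq[OF ct(5)[OF n(1)], of q'] q' ct(2,3)[OF nF] by (simp add: hom_iff)
    moreover have "t n \<in> hom arrows (Fobj D n) c" using t(2,3,4)[OF nF] by (simp add: hom_iff)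
    ultimately have "t n \<cdot>\<^bsub>arrows\<^esub> ?w = w" using w w1 by (intro arrow_category_eqI[of C]) (simp_all add: hom_iff[of _ arrows])
    then show "\<exists>i\<in>Field r. \<exists>g\<in>hom arrows f (Fobj D i). t i \<cdot>\<^bsub>arrows\<^esub> g = w" using nF w1 by blast
  }
  fix i w w' assume i: "i \<in> Field r" and w: "w \<in> hom arrows f (Fobj D i)" "w' \<in> hom arrows f (Fobj D i)"
    and eq: "t i \<cdot>\<^bsub>arrows\<^esub> w = t i \<cdot>\<^bsub>arrows\<^esub> w'"
  have wA: "w \<in> Arr arrows" "w' \<in> Arr arrows" using w by (auto simp: hom_iff)
  have parts: "dom_part w \<in> hom C (Dom C f) (Dom C (Fobj D i))" "cod_part w \<in> hom C (Cod C f) (Cod C (Fobj D i))"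
    "dom_part w' \<in> hom C (Dom C f) (Dom C (Fobj D i))" "cod_part w' \<in> hom C (Cod C f) (Cod C (Fobj D i))"
    using arrow_ArrD[OF wA(1)] arrow_ArrD[OF wA(2)] w by (auto simp: hom_iff)
  have eqp: "dom_part (t i) \<cdot> dom_part w = dom_part (t i) \<cdot> dom_part w'"
    "cod_part (t i) \<cdot> cod_part w = cod_part (t i) \<cdot> cod_part w'"
    using arg_cong[OF eq, of dom_part] arg_cong[OF eq, of cod_part] by simp_all
  obtain j where j: "(i, j) \<in> r" "dom_part (Farr D (i, j)) \<cdot> dom_part w = dom_part (Farr D (i, j)) \<cdot> dom_part w'"
    using compact_merge[OF f(2) r dom i, of "dom_part w" "dom_part w'"] parts eqp(1) by auto
  obtain k where k: "(i, k) \<in> r" "cod_part (Farr D (i, k)) \<cdot> cod_part w = cod_part (Farr D (i, k)) \<cdot> cod_part w'"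
    using compact_merge[OF f(3) r cod i, of "cod_part w" "cod_part w'"] parts eqp(2) by auto
  obtain l where l: "(j, l) \<in> r" "(k, l) \<in> r"
    using directed_poset_bound2[OF lam r] rField[OF j(1)] rField[OF k(1)] by metis
  have "dom_part (Farr D (i, l)) \<cdot> dom_part w = dom_part (Farr D (i, l)) \<cdot> dom_part w'"
    using comp_assoc_eq[OF dD(6)[OF j(1) l(1)], of "dom_part w"] comp_assoc_eq[OF dD(6)[OF j(1) l(1)], of "dom_part w'"]
      dD(2,3,4)[OF j(1)] dD(2,3,4)[OF l(1)] parts j(2) by (simp add: hom_iff)
  moreover have "cod_part (Farr D (i, l)) \<cdot> cod_part w = cod_part (Farr D (i, l)) \<cdot> cod_part w'"
    using comp_assoc_eq[OF cD(6)[OF k(1) l(2)], of "cod_part w"] comp_assoc_eq[OF cD(6)[OF k(1) l(2)], of "cod_part w'"]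
      cD(2,3,4)[OF k(1)] cD(2,3,4)[OF l(2)] parts k(2) by (simp add: hom_iff)
  moreover have il: "(i, l) \<in> r" using rtrans[OF j(1) l(1)] .
  ultimately have "Farr D (i, l) \<cdot>\<^bsub>arrows\<^esub> w = Farr D (i, l) \<cdot>\<^bsub>arrows\<^esub> w'"
    using w D(2,3,4)[OF il] by (intro arrow_category_eqI[of C]) (simp_all add: hom_iff[of _ arrows])
  then show "\<exists>j. (i, j) \<in> r \<and> Farr D (i, j) \<cdot>\<^bsub>arrows\<^esub> w = Farr D (i, j) \<cdot>\<^bsub>arrows\<^esub> w'" using il by blast
qed

text \<open>
  A morphism between two \<open>lam\<close>-directed colimits is the \<open>lam\<close>-directed colimit of all its
  restrictions \<open>u\<close> to a map from a stage \<open>i\<close> of the first diagram to a stage \<open>j\<close> of the second.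
\<close>

lemma arrow_directed_presentation:
  fixes r s :: "'u rel"
  assumes univ: "universe TYPE('u)" and lam: "regular_cardinal lam" and C: "locally_small TYPE('u) C"
    and r: "directed_poset lam r" and X: "is_colimit (poset_category r) C X (Dom C g) \<delta>"
    and s: "directed_poset lam s" and Y: "is_colimit (poset_category s) C Y (Cod C g) \<epsilon>"
    and g: "g \<in> Arr C" and compact: "\<And>i. i \<in> Field r \<Longrightarrow> compact_object lam C (Fobj X i)"
  obtains R :: "'u rel" and D t where "directed_poset lam R" "is_colimit (poset_category R) arrows D g t"
    "\<And>x. x \<in> Field R \<Longrightarrow> \<exists>i \<in> Field r. \<exists>j \<in> Field s. Fobj D x \<in> hom C (Fobj X i) (Fobj Y j)"
proof -
  interpret univ "TYPE('u)" by unfold_locales (rule univ)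
  note X' = diagramD[OF colimitD(1)[OF X]] and \<delta> = cocone_posetD[OF colimitD(2)[OF X]]
  note Y' = diagramD[OF colimitD(1)[OF Y]] and \<epsilon> = cocone_posetD[OF colimitD(2)[OF Y]]
  have rField: "\<And>i j. (i, j) \<in> r \<Longrightarrow> i \<in> Field r \<and> j \<in> Field r" by (auto simp: Field_def)
  have sField: "\<And>i j. (i, j) \<in> s \<Longrightarrow> i \<in> Field s \<and> j \<in> Field s" by (auto simp: Field_def)
  have rtrans: "\<And>i j k. (i, j) \<in> r \<Longrightarrow> (j, k) \<in> r \<Longrightarrow> (i, k) \<in> r"
    using directed_posetD(3)[OF r] by (meson transD)
  have strans: "\<And>i j k. (i, j) \<in> s \<Longrightarrow> (j, k) \<in> s \<Longrightarrow> (i, k) \<in> s"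
    using directed_posetD(3)[OF s] by (meson transD)
  have rrefl: "\<And>i. i \<in> Field r \<Longrightarrow> (i, i) \<in> r" using directed_posetD(2)[OF r] by (simp add: refl_on_def)
  have srefl: "\<And>i. i \<in> Field s \<Longrightarrow> (i, i) \<in> s" using directed_posetD(2)[OF s] by (simp add: refl_on_def)
  have [simp]: "Dom C g \<in> Obj C" "Cod C g \<in> Obj C" using g by simp_all
  \<comment> \<open>An element is a stage \<open>i\<close> of the source, a stage \<open>j\<close>
    of the target and a map \<open>u\<close> between them that represents \<open>g\<close>. The set
    is coded by \<open>e\<close> below, since index posets live on \<open>'u\<close>.\<close>
  define P0 where "P0 = {(i, j, u). i \<in> Field r \<and> j \<in> Field s \<and> u \<in> hom C (Fobj X i) (Fobj Y j) \<and> \<epsilon> j \<cdot> u = g \<cdot> \<delta> i}"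
  have "small TYPE('u) P0"
  proof (rule small_subset)
    show "small TYPE('u) (SIGMA i:Field r. SIGMA j:Field s. hom C (Fobj X i) (Fobj Y j))"
      using C X'(1) Y'(1) directed_posetD(5)[OF r] directed_posetD(5)[OF s]
      by (intro small_Sigma) (auto simp: locally_small_def)
  qed (auto simp: P0_def)
  then obtain e :: "'u \<times> 'u \<times> 'a \<Rightarrow> 'u" where e: "inj_on e P0" using small_inj by blast
  define P where "P = e ` P0"
  define I where "I x = fst (inv_into P0 e x)" for x
  define J where "J x = fst (snd (inv_into P0 e x))" for x
  define V where "V x = snd (snd (inv_into P0 e x))" for x
  have smallP: "small TYPE('u) P" using \<open>small TYPE('u) P0\<close> by (simp add: P_def small_image)
  have P: "I x \<in> Field r" "J x \<in> Field s" "V x \<in> Arr C" "Dom C (V x) = Fobj X (I x)" "Cod C (V x) = Fobj Y (J x)"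
    "\<epsilon> (J x) \<cdot> V x = g \<cdot> \<delta> (I x)" if "x \<in> P" for x
    using that e by (auto simp: P_def P0_def I_def J_def V_def inv_into_f_f hom_iff)
  have P_ex: "\<exists>x \<in> P. I x = i \<and> J x = j \<and> V x = u"
    if "i \<in> Field r" "j \<in> Field s" "u \<in> hom C (Fobj X i) (Fobj Y j)" "\<epsilon> j \<cdot> u = g \<cdot> \<delta> i" for i j u
  proof -
    have "(i, j, u) \<in> P0" using that by (simp add: P0_def)
    then show ?thesis using e by (auto simp: P_def I_def J_def V_def inv_into_f_f intro!: bexI[of _ "(i, j, u)"])
  qed
  have P_eq: "x = y" if "x \<in> P" "y \<in> P" "I x = I y" "J x = J y" "V x = V y" for x y
    using that unfolding P_def I_def J_def V_def by (metis e inv_into_into prod.collapse f_inv_into_f)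
  define R where "R = {(x, y). x \<in> P \<and> y \<in> P \<and> (I x, I y) \<in> r \<and> (J x, J y) \<in> s \<and>
    Farr Y (J x, J y) \<cdot> V x = V y \<cdot> Farr X (I x, I y)}"
  have RD: "x \<in> P" "y \<in> P" "(I x, I y) \<in> r" "(J x, J y) \<in> s"
    "Farr Y (J x, J y) \<cdot> V x = V y \<cdot> Farr X (I x, I y)" if "(x, y) \<in> R" for x y
    using that by (auto simp: R_def)
  have Rrefl: "(x, x) \<in> R" if "x \<in> P" for x
    using that P[OF that] rrefl srefl X'(5) Y'(5) by (simp add: R_def)
  have FieldR: "Field R = P" using Rrefl by (auto simp: Field_def R_def)
  have "Refl R" using Rrefl FieldR by (auto simp: refl_on_def R_def)
  have Rtrans: "(x, z) \<in> R" if "(x, y) \<in> R" "(y, z) \<in> R" for x y z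
  proof -
    note [simp] = RD[OF that(1)] RD[OF that(2)] P[OF RD(1)[OF that(1)]] P[OF RD(2)[OF that(1)]] P[OF RD(2)[OF that(2)]]
    note [simp] = X'(2,3,4)[OF RD(3)[OF that(1)]] X'(2,3,4)[OF RD(3)[OF that(2)]]
      Y'(2,3,4)[OF RD(4)[OF that(1)]] Y'(2,3,4)[OF RD(4)[OF that(2)]]
    have "Farr Y (J x, J z) \<cdot> V x = Farr Y (J y, J z) \<cdot> (Farr Y (J x, J y) \<cdot> V x)"
      using comp_assoc_eq[OF Y'(6)[OF RD(4)[OF that(1)] RD(4)[OF that(2)]], of "V x"] by simp
    also have "\<dots> = Farr Y (J y, J z) \<cdot> V y \<cdot> Farr X (I x, I y)"
      unfolding RD(5)[OF that(1)] by (rule comp_assoc[symmetric]) simp_all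
    also have "\<dots> = V z \<cdot> Farr X (I y, I z) \<cdot> Farr X (I x, I y)"
      by (simp only: RD(5)[OF that(2)])
    also have "\<dots> = V z \<cdot> (Farr X (I y, I z) \<cdot> Farr X (I x, I y))" by simp
    also have "\<dots> = V z \<cdot> Farr X (I x, I z)"
      using X'(6)[OF RD(3)[OF that(1)] RD(3)[OF that(2)]] by simp
    finally show ?thesis
      using rtrans[OF RD(3)[OF that(1)] RD(3)[OF that(2)]] strans[OF RD(4)[OF that(1)] RD(4)[OF that(2)]]
      by (simp add: R_def)
  qed
  then have "trans R" by (meson transI)
  \<comment> \<open>If \<open>x\<close> and \<open>y\<close> are below each other, their stages
    coincide, the transition maps are identities, and the compatibility square forces
    \<open>V x = V y\<close>.\<close>
  have "antisym R"
  proof (rule antisymI)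
    fix x y assume xy: "(x, y) \<in> R" "(y, x) \<in> R"
    have eq: "I x = I y" "J x = J y"
      using RD(3,4)[OF xy(1)] RD(3,4)[OF xy(2)] directed_posetD(4)[OF r] directed_posetD(4)[OF s] by (auto dest: antisymD)
    have "V x = V y" using RD(5)[OF xy(1)] P[OF RD(1)[OF xy(1)]] P[OF RD(2)[OF xy(1)]] X'(5) Y'(5) by (simp add: eq)
    then show "x = y" using P_eq eq RD(1,2)[OF xy(1)] by blast
  qed
  \<comment> \<open>Directedness with extra control: the bound also lies above prescribed stages
    \<open>i0\<close> and \<open>j0\<close>, so the case of empty \<open>S\<close> gives cofinality
    of both projections later.\<close>
  have bound: "\<exists>x \<in> P. (i0, I x) \<in> r \<and> (j0, J x) \<in> s \<and> (\<forall>y \<in> S. (y, x) \<in> R)"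
    if S: "S \<subseteq> P" "|S| <o lam" and i0: "i0 \<in> Field r" and j0: "j0 \<in> Field s" for S i0 j0
  proof -
    have less: "|insert m (f ` S)| <o lam" for m :: 'u and f
      using card_of_Un_ordLess_infinite_Field[of lam "{m}" "f ` S"] lam
        regular_cardinal_finite_less[OF lam, of "{m}"] ordLeq_ordLess_trans[OF card_of_image S(2)]
      by (auto simp: regular_cardinal_def cinfinite_def)
    have "insert i0 (I ` S) \<subseteq> Field r" "insert j0 (J ` S) \<subseteq> Field s" using S(1) P i0 j0 by auto
    then obtain i j1 where i: "i \<in> Field r" "\<forall>x \<in> insert i0 (I ` S). (x, i) \<in> r"
      and j1: "j1 \<in> Field s" "\<forall>x \<in> insert j0 (J ` S). (x, j1) \<in> s"
      using directed_poset_bound[OF r _ less] directed_poset_bound[OF s _ less] by metis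
    \<comment> \<open>Compactness of \<open>Fobj X i\<close> yields some representative
      \<open>w\<close> of \<open>g\<close> on stage \<open>i\<close>. It is compatible with the maps
      \<open>V x\<close> only in the colimit; a further merge for each \<open>x\<close> in
      \<open>S\<close> repairs this.\<close>
    have "g \<cdot> \<delta> i \<in> hom C (Fobj X i) (Cod C g)" using g \<delta>(2,3,4)[OF i(1)] by (simp add: hom_iff)
    from compact_factor[OF compact[OF i(1)] s Y this] obtain j2 w where
      j2: "j2 \<in> Field s" and w: "w \<in> hom C (Fobj X i) (Fobj Y j2)" "\<epsilon> j2 \<cdot> w = g \<cdot> \<delta> i" by blast
    obtain j3 where j3: "(j1, j3) \<in> s" "(j2, j3) \<in> s"
      using directed_poset_bound2[OF lam s j1(1) j2] by blast
    have j3F: "j3 \<in> Field s" using sField[OF j3(1)] by blast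
    define w' where "w' = Farr Y (j2, j3) \<cdot> w"
    have w': "w' \<in> hom C (Fobj X i) (Fobj Y j3)" "\<epsilon> j3 \<cdot> w' = g \<cdot> \<delta> i"
      using w Y'(2,3,4)[OF j3(2)] \<epsilon>(2,3)[OF j3F] comp_assoc_eq[OF \<epsilon>(5)[OF j3(2)], of w]
      by (simp_all add: w'_def hom_iff)
    have "\<exists>n. (j3, n) \<in> s \<and> Farr Y (j3, n) \<cdot> (Farr Y (J x, j3) \<cdot> V x) = Farr Y (j3, n) \<cdot> (w' \<cdot> Farr X (I x, i))"
      if x: "x \<in> S" for x
    proof -
      have xP: "x \<in> P" and xi: "(I x, i) \<in> r" and xj: "(J x, j3) \<in> s"
        using x S(1) i(2) j1(2) strans[OF _ j3(1)] by auto
      note [simp] = P[OF xP] X'(2,3,4)[OF xi] Y'(2,3,4)[OF xj]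
      have "\<epsilon> j3 \<cdot> (Farr Y (J x, j3) \<cdot> V x) = g \<cdot> \<delta> (I x)"
        using comp_assoc_eq[OF \<epsilon>(5)[OF xj], of "V x"] \<epsilon>(2,3)[OF j3F] by simp
      also have "\<dots> = g \<cdot> \<delta> i \<cdot> Farr X (I x, i)"
        using \<delta>(5)[OF xi] \<delta>(2,3,4)[OF i(1)] g by simp
      also have "\<dots> = \<epsilon> j3 \<cdot> (w' \<cdot> Farr X (I x, i))"
        using comp_assoc_eq[OF w'(2), of "Farr X (I x, i)"] w'(1) \<epsilon>(2,3)[OF j3F] by (simp add: hom_iff)
      finally have "\<epsilon> j3 \<cdot> (Farr Y (J x, j3) \<cdot> V x) = \<epsilon> j3 \<cdot> (w' \<cdot> Farr X (I x, i))" .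
      moreover have "Farr Y (J x, j3) \<cdot> V x \<in> hom C (Fobj X (I x)) (Fobj Y j3)"
        "w' \<cdot> Farr X (I x, i) \<in> hom C (Fobj X (I x)) (Fobj Y j3)" using w'(1) by (auto simp: hom_iff)
      ultimately show ?thesis using compact_merge[OF compact[OF P(1)[OF xP]] s Y j3F] by metis
    qed
    then obtain n where n: "\<And>x. x \<in> S \<Longrightarrow> (j3, n x) \<in> s"
      "\<And>x. x \<in> S \<Longrightarrow> Farr Y (j3, n x) \<cdot> (Farr Y (J x, j3) \<cdot> V x) = Farr Y (j3, n x) \<cdot> (w' \<cdot> Farr X (I x, i))" by metis
    have "insert j3 (n ` S) \<subseteq> Field s" using n(1) sField j3F by auto
    then obtain k where k: "k \<in> Field s" "\<forall>x \<in> insert j3 (n ` S). (x, k) \<in> s"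
      using directed_poset_bound[OF s _ less] by metis
    have j3k: "(j3, k) \<in> s" using k(2) by simp
    define v where "v = Farr Y (j3, k) \<cdot> w'"
    have v: "v \<in> hom C (Fobj X i) (Fobj Y k)" "\<epsilon> k \<cdot> v = g \<cdot> \<delta> i"
      using w' Y'(2,3,4)[OF j3k] \<epsilon>(2,3)[OF k(1)] comp_assoc_eq[OF \<epsilon>(5)[OF j3k], of w']
      by (simp_all add: v_def hom_iff)
    obtain x where x: "x \<in> P" "I x = i" "J x = k" "V x = v" using P_ex[OF i(1) k(1) v] by blast
    have "(y, x) \<in> R" if y: "y \<in> S" for y
    proof -
      have yP: "y \<in> P" and yi: "(I y, i) \<in> r" and yj: "(J y, j3) \<in> s" and nk: "(n y, k) \<in> s"
        using y S(1) i(2) j1(2) strans[OF _ j3(1)] k(2) by auto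
      note [simp] = P[OF yP] X'(2,3,4)[OF yi] Y'(2,3,4)[OF yj] Y'(2,3,4)[OF n(1)[OF y]] Y'(2,3,4)[OF nk] Y'(2,3,4)[OF j3k]
      have "Farr Y (J y, k) \<cdot> V y = Farr Y (j3, k) \<cdot> (Farr Y (J y, j3) \<cdot> V y)"
        using comp_assoc_eq[OF Y'(6)[OF yj j3k], of "V y"] by simp
      also have "\<dots> = Farr Y (n y, k) \<cdot> (Farr Y (j3, n y) \<cdot> (Farr Y (J y, j3) \<cdot> V y))"
        using comp_assoc_eq[OF Y'(6)[OF n(1)[OF y] nk], of "Farr Y (J y, j3) \<cdot> V y"] by simp
      also have "\<dots> = Farr Y (n y, k) \<cdot> (Farr Y (j3, n y) \<cdot> (w' \<cdot> Farr X (I y, i)))" using n(2)[OF y] by simp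
      also have "\<dots> = Farr Y (j3, k) \<cdot> (w' \<cdot> Farr X (I y, i))"
        using comp_assoc_eq[OF Y'(6)[OF n(1)[OF y] nk], of "w' \<cdot> Farr X (I y, i)"] w'(1) by (simp add: hom_iff)
      also have "\<dots> = v \<cdot> Farr X (I y, i)" using w'(1) by (simp add: v_def hom_iff)
      finally show ?thesis using yP x yi strans[OF yj j3k] by (simp add: R_def)
    qed
    moreover have "(i0, I x) \<in> r" "(j0, J x) \<in> s" using i(2) j1(2) x strans[OF strans[OF _ j3(1)] j3k] by auto
    ultimately show ?thesis using x(1) by blast
  qed
  obtain i1 j1 where i1: "i1 \<in> Field r" and j1: "j1 \<in> Field s"
    using directed_poset_nonempty[OF lam r] directed_poset_nonempty[OF lam s] by metis
  have R: "directed_poset lam R"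
    unfolding directed_poset_def FieldR
  proof (intro conjI allI impI)
    have "R \<subseteq> Field R \<times> Field R" by (auto simp: Field_def)
    then show "partial_order_on P R"
      using \<open>Refl R\<close> \<open>trans R\<close> \<open>antisym R\<close> by (simp add: partial_order_on_def preorder_on_def FieldR)
    show "\<exists>u\<in>P. \<forall>x\<in>S. (x, u) \<in> R" if "S \<subseteq> P" "|S| <o lam" for S
      using bound[OF that i1 j1] by blast
  qed (rule smallP)
  define D where "D = \<lparr>Fobj = V, Farr = (\<lambda>(x, y). (V x, Farr X (I x, I y), Farr Y (J x, J y), V y))\<rparr>"
  have D: "is_functor (poset_category R) arrows D"
  proof (rule diagramI[OF arrow_category_category \<open>Refl R\<close> \<open>trans R\<close>])
    show "Fobj D x \<in> Obj arrows" if "x \<in> Field R" for x using that P FieldR by (simp add: D_def)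
    show "Farr D (x, x) = Id arrows (Fobj D x)" if "x \<in> Field R" for x
      using that P[of x] FieldR X'(5) Y'(5) by (simp add: D_def)
    show "Farr D (x, y) \<in> hom arrows (Fobj D x) (Fobj D y)" if "(x, y) \<in> R" for x y
      using RD[OF that] P[of x] P[of y] X'(2,3,4)[of "I x" "I y"] Y'(2,3,4)[of "J x" "J y"]
      by (simp add: D_def hom_iff)
    show "Farr D (y, z) \<cdot>\<^bsub>arrows\<^esub> Farr D (x, y) = Farr D (x, z)" if "(x, y) \<in> R" "(y, z) \<in> R" for x y z
      using RD(3,4)[OF that(1)] RD(3,4)[OF that(2)] X'(6) Y'(6) by (simp add: D_def)
  qed
  define t where "t x = (V x, \<delta> (I x), \<epsilon> (J x), g)" for x
  have dir: "\<exists>z. (x, z) \<in> R \<and> (y, z) \<in> R" if "x \<in> Field R" "y \<in> Field R" for x y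
    using directed_poset_bound2[OF lam R that] by metis
  have cofin: "\<exists>x\<in>Field R. (i, I x) \<in> r \<and> (j, J x) \<in> s" if "i \<in> Field r" "j \<in> Field s" for i j
    using bound[of "{}" i j] that regular_cardinal_finite_less[OF lam, of "{}"] FieldR by auto
  have cofinr: "\<exists>x\<in>Field R. (i, I x) \<in> r" if "i \<in> Field r" for i using cofin[OF that j1] by blast
  have cofins: "\<exists>x\<in>Field R. (j, J x) \<in> s" if "j \<in> Field s" for j using cofin[OF i1 that] by blast
  have "is_colimit (poset_category R) arrows D g t"
  proof (rule arrow_colimit_of_parts[OF D])
    show "is_cocone (poset_category R) arrows D g t"
      unfolding cocone_poset_iff
    proof (intro conjI ballI allI impI)
      show "t x \<in> hom arrows (Fobj D x) g" if "x \<in> Field R" for x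
        using that P[of x] FieldR \<delta>(2,3,4)[of "I x"] \<epsilon>(2,3,4)[of "J x"] g by (simp add: t_def D_def hom_iff)
      show "t y \<cdot>\<^bsub>arrows\<^esub> Farr D (x, y) = t x" if "(x, y) \<in> R" for x y
        using RD(3,4)[OF that] \<delta>(5) \<epsilon>(5) by (simp add: t_def D_def)
    qed (use g in simp)
    show "is_colimit (poset_category R) C (functor_comp (dom_functor C) D) (Dom C g) (\<lambda>x. dom_part (t x))"
      unfolding t_def part_simps
      by (rule colimit_cofinal[OF X \<open>Refl R\<close> \<open>trans R\<close>])
        (use dir cofinr RD(3) P(4) FieldR in \<open>auto simp: D_def\<close>)
    show "is_colimit (poset_category R) C (functor_comp (cod_functor C) D) (Cod C g) (\<lambda>x. cod_part (t x))"
      unfolding t_def part_simps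
      by (rule colimit_cofinal[OF Y \<open>Refl R\<close> \<open>trans R\<close>])
        (use dir cofins RD(4) P(5) FieldR in \<open>auto simp: D_def\<close>)
  qed
  moreover have "\<exists>i \<in> Field r. \<exists>j \<in> Field s. Fobj D x \<in> hom C (Fobj X i) (Fobj Y j)" if "x \<in> Field R" for x
    using that P[of x] FieldR by (auto simp: D_def hom_iff)
  ultimately show ?thesis using R that by blast
qed

end

context univ
begin

text \<open>The arrows between members of \<open>A\<close> are the presentable generators, with the
  same \<open>lam\<close>: they are compact because their ends are, and every arrow is a directed
  colimit of them.\<close>

lemma arrow_accessible:
  fixes C :: "('o, 'a) category"
  assumes lam: "regular_cardinal lam" and C: "lam_accessible (lam :: 'u rel) C" and y: "y0 \<noteq> (y1 :: 'a)"
  shows "lam_accessible lam (arrow_category C)"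
proof -
  have ls: "locally_small TYPE('u) C" and dir: "has_directed_colimits lam C"
    using C by (auto simp: lam_accessible_def)
  interpret cat C using ls by (simp add: locally_small_def cat_def)
  obtain A where A: "small TYPE('u) A" "\<And>a. a \<in> A \<Longrightarrow> presentable_object lam C a"
    "\<And>c. c \<in> Obj C \<Longrightarrow> \<exists>r D t. directed_poset lam r \<and> (\<forall>i \<in> Field r. Fobj D i \<in> A) \<and>
           is_colimit (poset_category r) C D c t"
    using C unfolding lam_accessible_def by blast
  have A_compact: "compact_object lam C a" if "a \<in> A" for a
    using A(2)[OF that] presentable_iff_compact[OF ls lam y] by simp
  then have A_Obj: "A \<subseteq> Obj C" by (auto simp: compact_object_def)
  have ls': "locally_small TYPE('u) arrows" by (rule arrow_locally_small[OF universe ls])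
  define B where "B = {u \<in> Arr C. Dom C u \<in> A \<and> Cod C u \<in> A}"
  have "B = (\<Union>a\<in>A. \<Union>b\<in>A. hom C a b)" by (auto simp: B_def hom_iff)
  then have "small TYPE('u) B" using A(1) A_Obj ls by (auto intro!: small_UN simp: locally_small_def)
  moreover have "presentable_object lam arrows u" if "u \<in> B" for u
  proof -
    have "compact_object lam arrows u"
      using that A_compact by (intro compact_arrow[OF lam dir]) (auto simp: B_def)
    then show ?thesis
      using presentable_iff_compact[OF ls' lam, of "(y0, y0, y0, y0)" "(y1, y0, y0, y0)"] y by simp
  qed
  moreover have "\<exists>r D t. directed_poset lam r \<and> (\<forall>i \<in> Field r. Fobj D i \<in> B) \<and>
      is_colimit (poset_category r) arrows D g t" if "g \<in> Obj arrows" for g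
  proof -
    have g: "g \<in> Arr C" using that by simp
    obtain r X \<delta> where X: "directed_poset lam r" "\<forall>i \<in> Field r. Fobj X i \<in> A" "is_colimit (poset_category r) C X (Dom C g) \<delta>"
      using A(3)[of "Dom C g"] g by auto
    obtain s Y \<epsilon> where Y: "directed_poset lam s" "\<forall>i \<in> Field s. Fobj Y i \<in> A" "is_colimit (poset_category s) C Y (Cod C g) \<epsilon>"
      using A(3)[of "Cod C g"] g by auto
    obtain R D t where "directed_poset lam R" "is_colimit (poset_category R) arrows D g t"
      "\<And>x. x \<in> Field R \<Longrightarrow> \<exists>i \<in> Field r. \<exists>j \<in> Field s. Fobj D x \<in> hom C (Fobj X i) (Fobj Y j)"
      using arrow_directed_presentation[OF universe lam ls X(1,3) Y(1,3) g] A_compact X(2) by metis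
    then show ?thesis using X(2) Y(2) by (fastforce simp: B_def hom_iff)
  qed
  ultimately show ?thesis
    using ls' arrow_has_directed_colimits[OF dir] unfolding lam_accessible_def by blast
qed

text \<open>Each object of \<open>S\<close> is a colimit of \<open>lam\<close>-compact objects over
  a small poset; once \<open>mu\<close> exceeds the sizes of these posets, the object itself is
  \<open>mu\<close>-compact.\<close>

lemma accessible_compact_bound:
  fixes E :: "('o, 'a) category"
  assumes lam: "regular_cardinal lam" and E: "lam_accessible (lam :: 'u rel) E" and y: "y0 \<noteq> (y1 :: 'a)"
    and S: "small TYPE('u) S" "S \<subseteq> Obj E"
  obtains mu :: "'u rel" where "regular_cardinal mu" "lam \<le>o mu" "\<And>x. x \<in> S \<Longrightarrow> compact_object mu E x"
proof -
  have ls: "locally_small TYPE('u) E" using E by (auto simp: lam_accessible_def)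
  obtain A where "small TYPE('u) A" and A: "\<And>a. a \<in> A \<Longrightarrow> presentable_object lam E a"
    "\<And>c. c \<in> Obj E \<Longrightarrow> \<exists>r D t. directed_poset lam r \<and> (\<forall>i \<in> Field r. Fobj D i \<in> A) \<and>
           is_colimit (poset_category r) E D c t"
    using E unfolding lam_accessible_def by blast
  have "\<exists>r D t. directed_poset lam r \<and> (\<forall>i \<in> Field r. Fobj D i \<in> A) \<and> is_colimit (poset_category r) E D c t"
    if "c \<in> S" for c using A(2) that S(2) by blast
  then obtain r D t where r: "\<And>c. c \<in> S \<Longrightarrow> directed_poset lam (r c)"
    "\<And>c i. c \<in> S \<Longrightarrow> i \<in> Field (r c) \<Longrightarrow> Fobj (D c) i \<in> A"
    "\<And>c. c \<in> S \<Longrightarrow> is_colimit (poset_category (r c)) E (D c) c (t c)" by metis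
  \<comment> \<open>A disjoint union, so that the single bound \<open>|B| <o mu\<close> controls
    \<open>lam\<close> and all the relations \<open>r c\<close> together.\<close>
  define B where "B = Inl ` Field lam \<union> Inr ` (SIGMA c:S. r c)"
  have "small TYPE('u) B"
    unfolding B_def using lam r(1) S(1)
    by (intro small_Un small_image small_Sigma small_relation)
      (auto simp: regular_cardinal_def intro: directed_posetD(5))
  then obtain mu :: "'u rel" where mu: "regular_cardinal mu" "|B| <o mu" using regular_above by blast
  have sub: "|Z| <o mu" if "inj_on f Z" "f ` Z \<subseteq> B" for f :: "'z \<Rightarrow> _" and Z
  proof -
    have "|Z| \<le>o |B|" using that card_of_ordLeqI by blast
    then show ?thesis using mu(2) ordLeq_ordLess_trans by blast
  qed
  have "|Field lam| <o mu" by (rule sub[of Inl]) (auto simp: B_def)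
  moreover have "|Field lam| =o lam" using lam card_of_Field_ordIso by (auto simp: regular_cardinal_def)
  ultimately have less: "lam \<le>o mu" using ordIso_ordLess_trans ordIso_symmetric ordLess_imp_ordLeq by blast
  have "compact_object mu E c" if c: "c \<in> S" for c
  proof (rule compact_colimit[OF mu(1) _ _ r(3)[OF c]])
    show "Refl (r c)" using directed_posetD(2)[OF r(1)[OF c]] .
    show "|r c| <o mu" by (rule sub[of "\<lambda>p. Inr (c, p)"]) (auto simp: B_def inj_on_def c)
    fix i assume "i \<in> Field (r c)"
    then have "compact_object lam E (Fobj (D c) i)"
      using A(1) r(2)[OF c] presentable_iff_compact[OF ls lam y] by simp
    then show "compact_object mu E (Fobj (D c) i)" by (rule compact_object_mono[OF _ less])
  qed
  then show ?thesis using mu(1) less that by blast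
qed

end

section \<open>Transfinite composition\<close>

definition is_succ :: "'i rel \<Rightarrow> 'i \<Rightarrow> 'i \<Rightarrow> bool" where
  "is_succ r i j \<longleftrightarrow> i \<in> underS r j \<and> (\<forall>k \<in> underS r j. (k, i) \<in> r)"

lemma underS_iff: "i \<in> underS r j \<longleftrightarrow> i \<noteq> j \<and> (i, j) \<in> r"
  by (simp add: underS_def)

lemma well_order_cases:
  assumes "Well_order r" "j \<in> Field r"
  obtains (zero) "underS r j = {}" | (succ) i where "is_succ r i j" | (limit) "limit_element r j"
proof -
  interpret r: wo_rel r using assms(1) by (simp add: wo_rel_def)
  have "\<exists>i. is_succ r i j" if i: "i \<in> underS r j" "\<forall>k \<in> underS r j. i \<notin> underS r k" for i
  proof -
    have "(k, i) \<in> r" if "k \<in> underS r j" for k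
    proof -
      have "k \<in> Field r" "i \<in> Field r" using that i(1) by (auto simp: underS_iff Field_def)
      then have "(i, k) \<in> r \<or> (k, i) \<in> r" using r.TOTALS by blast
      moreover have "(i, i) \<in> r" using r.REFL \<open>i \<in> Field r\<close> by (simp add: refl_on_def)
      ultimately show ?thesis using i(2) that by (auto simp: underS_iff)
    qed
    then show ?thesis using i(1) by (auto simp: is_succ_def)
  qed
  then show ?thesis using that assms(2) unfolding limit_element_def by blast
qed

context univ
begin

text \<open>
  All proper initial segments of the cardinal order on \<open>'u\<close> are small, so its elements serve as the
  small ordinals.
\<close>

definition ordinals :: "'u rel" where "ordinals = |UNIV :: 'u set|"

lemma ordinals_Card_order: "Card_order ordinals"
  by (simp add: ordinals_def card_of_Card_order)

lemma Field_ordinals [simp]: "Field ordinals = UNIV"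
  by (simp add: ordinals_def Field_card_of)

lemma ordinals_Well_order: "Well_order ordinals"
  using ordinals_Card_order unfolding card_order_on_def by blast

interpretation W: wo_rel ordinals by (unfold wo_rel_def) (rule ordinals_Well_order)

lemma ordinals_refl [simp]: "(i, i) \<in> ordinals"
  using W.REFL by (simp add: refl_on_def)

lemma ordinals_trans: "(i, j) \<in> ordinals \<Longrightarrow> (j, k) \<in> ordinals \<Longrightarrow> (i, k) \<in> ordinals"
  using W.TRANS by (meson transD)

lemma ordinals_antisym: "(i, j) \<in> ordinals \<Longrightarrow> (j, i) \<in> ordinals \<Longrightarrow> i = j"
  using W.ANTISYM by (meson antisymD)

lemma ordinals_total: "(i, j) \<in> ordinals \<or> (j, i) \<in> ordinals"
  using W.TOTALS by auto

lemma ordinals_wf: "wf (ordinals - Relation.Id)"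
  by (rule W.WF)

lemma ordinals_underS_trans: "i \<in> underS ordinals j \<Longrightarrow> (j, k) \<in> ordinals \<Longrightarrow> i \<in> underS ordinals k"
  "(i, j) \<in> ordinals \<Longrightarrow> j \<in> underS ordinals k \<Longrightarrow> i \<in> underS ordinals k"
  using ordinals_trans ordinals_antisym by (auto simp: underS_iff)

lemma ordinals_not_le: "(i, j) \<notin> ordinals \<Longrightarrow> j \<in> underS ordinals i"
  using ordinals_total by (auto simp: underS_iff)

lemma ordinals_induct [case_names less]:
  assumes "\<And>j. (\<And>i. i \<in> underS ordinals j \<Longrightarrow> P i) \<Longrightarrow> P j"
  shows "P j"
  using ordinals_wf by (induction j rule: wf_induct_rule) (auto intro: assms simp: underS_iff)

lemma small_underS: "small TYPE('u) (underS ordinals j)"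
  using card_of_underS[OF ordinals_Card_order, of j, unfolded Field_ordinals]
  by (simp add: small_def flip: ordinals_def)

lemma ordinals_zero: "\<exists>z. \<forall>i. (z, i) \<in> ordinals"
  using W.minim_least[of UNIV] by auto

text \<open>An infinite cardinal order has no greatest element, and the least element above
  \<open>i\<close> is its successor.\<close>

lemma ordinals_succ: "\<exists>j. is_succ ordinals i j"
proof -
  have "infinite (Field ordinals)" using infinite_univ by simp
  then obtain k where k: "i \<in> underS ordinals k"
    using infinite_Card_order_limit[OF ordinals_Card_order, of i] by (auto simp: underS_iff)
  define Q where "Q = {j. i \<in> underS ordinals j}"
  have Q: "Q \<subseteq> Field ordinals" "Q \<noteq> {}" using k by (auto simp: Q_def)
  define j where "j = W.minim Q"
  have j: "i \<in> underS ordinals j" "\<And>y. y \<in> underS ordinals j \<Longrightarrow> i \<notin> underS ordinals y"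
    using W.minim_in[OF Q] W.minim_least[OF Q(1)] ordinals_antisym
    by (auto simp: j_def Q_def underS_iff)
  have "(k, i) \<in> ordinals" if "k \<in> underS ordinals j" for k
  proof (rule ccontr)
    assume "(k, i) \<notin> ordinals"
    then have "i \<in> underS ordinals k" by (rule ordinals_not_le)
    then show False using j(2) that by blast
  qed
  then show ?thesis using j(1) by (auto simp: is_succ_def)
qed

lemma ordinals_cases:
  obtains (zero) "underS ordinals j = {}" | (succ) i where "is_succ ordinals i j" | (limit) "limit_element ordinals j"
  using well_order_cases[OF ordinals_Well_order, of j] by auto

text \<open>Regularity of the universe: a small set of ordinals is not cofinal, and passing to a
  successor makes the bound strict.\<close>

lemma small_bounded:
  assumes "small TYPE('u) S"
  shows "\<exists>l. S \<subseteq> underS ordinals l"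
proof -
  have "|S| <o ordinals" using assms by (simp add: small_def ordinals_def)
  then have "\<not> cofinal S ordinals"
    using regular_univ not_ordLess_ordIso unfolding regularCard_def ordinals_def[symmetric] by auto
  then obtain b where b: "\<And>s. s \<in> S \<Longrightarrow> b = s \<or> (b, s) \<notin> ordinals" unfolding cofinal_def by auto
  obtain l where "is_succ ordinals b l" using ordinals_succ by blast
  then have l: "b \<in> underS ordinals l" by (simp add: is_succ_def)
  have "s \<in> underS ordinals l" if "s \<in> S" for s
  proof -
    have "(s, b) \<in> ordinals" using b[OF that] ordinals_total[of s b] by auto
    then show ?thesis using l ordinals_underS_trans(2) by blast
  qed
  then show ?thesis by blast
qed

lemma Field_Restr_ordinals [simp]: "Field (Restr ordinals S) = S"
  by (auto simp: Field_def intro: ordinals_refl)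

lemma Refl_Restr_ordinals: "Refl (Restr ordinals S)"
  unfolding Field_Restr_ordinals by (auto simp: refl_on_def)

lemma trans_Restr_ordinals: "trans (Restr ordinals S)"
  by (auto intro!: transI dest: ordinals_trans)

text \<open>As a well-order, \<open>mu\<close> is isomorphic to the ordinals below some
  \<open>l\<close>. Regularity makes this segment \<open>mu\<close>-directed, and infinity makes
  \<open>l\<close> a limit. It becomes the length of the iteration in the small object
  argument.\<close>

lemma directed_underS:
  assumes mu: "regular_cardinal (mu :: 'u rel)"
  obtains l where "limit_element ordinals l" "directed_poset mu (Restr ordinals (underS ordinals l))"
proof -
  have mu': "Card_order mu" "infinite (Field mu)" "Well_order mu"
    using mu by (auto simp: regular_cardinal_def cinfinite_def card_order_on_def)
  have "|Field mu| <o ordinals" using mu by (simp add: regular_cardinal_def small_def ordinals_def)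
  then have "mu <o ordinals" using card_of_Field_ordIso[OF mu'(1)] ordIso_symmetric ordIso_ordLess_trans by blast
  then obtain l where "mu =o Restr ordinals (underS ordinals l)"
    using ordLess_iff_ordIso_Restr[OF ordinals_Well_order mu'(3)] by blast
  then obtain f where "iso mu (Restr ordinals (underS ordinals l)) f" unfolding ordIso_def by blast
  then have bij: "bij_betw f (Field mu) (underS ordinals l)"
    and f: "\<And>a b. a \<in> Field mu \<Longrightarrow> b \<in> Field mu \<Longrightarrow>
      (a, b) \<in> mu \<longleftrightarrow> (f a, f b) \<in> Restr ordinals (underS ordinals l)"
    by (auto simp: iso_iff2)
  have fF: "f a \<in> underS ordinals l" if "a \<in> Field mu" for a using bij that by (auto simp: bij_betw_def)
  have surj: "\<exists>a \<in> Field mu. f a = i" if "i \<in> underS ordinals l" for i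
    using bij_betw_imp_surj_on[OF bij] that by (metis imageE)
  have "limit_element ordinals l"
    unfolding limit_element_def
  proof (intro conjI ballI)
    have "Field mu \<noteq> {}" using mu'(2) by auto
    then show "underS ordinals l \<noteq> {}" using fF by blast
    fix i assume "i \<in> underS ordinals l"
    then obtain a where a: "a \<in> Field mu" "f a = i" using surj by blast
    obtain b where b: "b \<in> Field mu" "a \<noteq> b" "(a, b) \<in> mu"
      using infinite_Card_order_limit[OF mu'(1,2) a(1)] by blast
    have "f a \<noteq> f b" using bij a b by (auto simp: bij_betw_def inj_on_def)
    then have "i \<in> underS ordinals (f b)" using f[OF a(1) b(1)] b(3) a(2) by (auto simp: underS_iff)
    then show "\<exists>k\<in>underS ordinals l. i \<in> underS ordinals k" using fF[OF b(1)] by blast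
  qed simp
  moreover have "directed_poset mu (Restr ordinals (underS ordinals l))"
    unfolding directed_poset_def
  proof (intro conjI allI impI)
    show "Partial_order (Restr ordinals (underS ordinals l))"
      using ordinals_Well_order
      by (intro Partial_order_Restr) (simp add: well_order_on_def linear_order_on_def)
    show "small TYPE('u) (Field (Restr ordinals (underS ordinals l)))" using small_underS by simp
    fix S assume S: "S \<subseteq> Field (Restr ordinals (underS ordinals l))" "|S| <o mu"
    define S' where "S' = {a \<in> Field mu. f a \<in> S}"
    have "inj_on f S'" "f ` S' \<subseteq> S" using bij by (auto simp: S'_def bij_betw_def inj_on_def)
    then have "|S'| <o mu" using S(2) card_of_ordLeqI[of f S' S] ordLeq_ordLess_trans by blast
    then obtain b where b: "b \<in> Field mu" "\<And>s. s \<in> S' \<Longrightarrow> (s, b) \<in> mu"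
      using regular_cardinal_bound[OF mu, of S'] by (auto simp: S'_def)
    have "(s, f b) \<in> Restr ordinals (underS ordinals l)" if s: "s \<in> S" for s
    proof -
      have "s \<in> underS ordinals l" using S(1) s by auto
      then obtain a where a: "a \<in> Field mu" "f a = s" using surj by blast
      then have "(a, b) \<in> mu" using b(2) s by (simp add: S'_def)
      then show ?thesis using f[OF a(1) b(1)] a(2) by simp
    qed
    then show "\<exists>u\<in>Field (Restr ordinals (underS ordinals l)). \<forall>s\<in>S. (s, u) \<in> Restr ordinals (underS ordinals l)"
      using fF[OF b(1)] by auto
  qed
  ultimately show ?thesis using that by blast
qed

text \<open>Indexing by all small ordinals postpones the choice of a length; closed intervals are
  cut out when a chain in the sense of \<open>smooth_chain\<close> is required.\<close>

definition smooth_sequence :: "('o, 'a) category \<Rightarrow> ('u, 'u \<times> 'u, 'o, 'a) cat_functor \<Rightarrow> bool" where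
  "smooth_sequence C A \<longleftrightarrow> is_functor (poset_category ordinals) C A \<and>
     (\<forall>j. limit_element ordinals j \<longrightarrow>
        is_colimit (poset_category (Restr ordinals (underS ordinals j))) C A (Fobj A j) (\<lambda>i. Farr A (i, j)))"

text \<open>The limit elements \<open>k\<close> of the interval are limit ordinals above
  \<open>i\<close>, and the ordinals from \<open>i\<close> up to \<open>k\<close> are cofinal among
  all ordinals below \<open>k\<close>, so smoothness is inherited.\<close>

lemma smooth_sequence_interval:
  assumes A: "smooth_sequence C A" and i: "i \<in> underS ordinals j" and j: "limit_element ordinals j"
  shows "smooth_chain C (Restr ordinals {k. (i, k) \<in> ordinals \<and> (k, j) \<in> ordinals}) j A"
proof -
  define B where "B = {k. (i, k) \<in> ordinals \<and> (k, j) \<in> ordinals}"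
  define r where "r = Restr ordinals B"
  have F: "is_functor (poset_category ordinals) C A" using A by (simp add: smooth_sequence_def)
  note A' = diagramD[OF F]
  have [simp]: "Field r = B" by (simp add: r_def)
  have underS_r: "underS r k = {x. (i, x) \<in> ordinals \<and> x \<in> underS ordinals k}" if "k \<in> B" for k
  proof -
    have "(x, j) \<in> ordinals" if "(x, k) \<in> ordinals" for x
      using ordinals_trans[OF that, of j] \<open>k \<in> B\<close> by (simp add: B_def)
    then show ?thesis using that by (auto simp: underS_iff r_def B_def)
  qed
  have jB: "j \<in> B" using i by (simp add: B_def underS_iff)
  have "smooth_chain C r j A"
    unfolding smooth_chain_def
  proof (intro conjI ballI allI impI)
    show "Well_order r" using ordinals_Well_order Well_order_Restr unfolding r_def by blast
    show "limit_element r j"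
      unfolding limit_element_def
    proof (intro conjI ballI)
      show "underS r j \<noteq> {}" using i underS_r[OF jB] by auto
      fix k assume "k \<in> underS r j"
      then have k: "(i, k) \<in> ordinals" "k \<in> underS ordinals j" using underS_r[OF jB] by auto
      obtain m where m: "m \<in> underS ordinals j" "k \<in> underS ordinals m"
        using j k(2) by (auto simp: limit_element_def)
      have mB: "m \<in> B" using m k(1) ordinals_trans[of i k m] by (auto simp: B_def underS_iff)
      then show "\<exists>m\<in>underS r j. k \<in> underS r m"
        using m k underS_r[OF jB] underS_r[OF mB] by (intro bexI[of _ m]) (auto simp: B_def)
    qed (simp add: jB)
    show "(k, j) \<in> r" if "k \<in> Field r" for k using that jB by (auto simp: r_def B_def)
    show "is_functor (poset_category r) C A"
      using A' Refl_Restr_ordinals[of B] trans_Restr_ordinals[of B]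
      by (intro diagramI) (auto simp: r_def hom_iff)
    fix k assume k: "limit_element r k"
    then have kB: "k \<in> B" by (simp add: limit_element_def)
    note Sk = underS_r[OF kB]
    \<comment> \<open>A limit element is not least, so \<open>k\<close> lies strictly above
      \<open>i\<close>.\<close>
    have ik: "i \<in> underS ordinals k"
      using k Sk ordinals_underS_trans(2) by (auto simp: limit_element_def)
    have "limit_element ordinals k"
      unfolding limit_element_def
    proof (intro conjI ballI)
      show "underS ordinals k \<noteq> {}" using ik by blast
      fix m assume m: "m \<in> underS ordinals k"
      show "\<exists>n\<in>underS ordinals k. m \<in> underS ordinals n"
      proof (cases "(i, m) \<in> ordinals")
        case True
        then have "m \<in> underS r k" using m Sk by simp
        then obtain n where n: "n \<in> underS r k" "m \<in> underS r n" using k unfolding limit_element_def by blast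
        then show ?thesis using Sk by (auto simp: r_def underS_iff)
      next
        case False
        then show ?thesis using ik ordinals_not_le by blast
      qed
    qed simp
    then have colim: "is_colimit (poset_category (Restr ordinals (underS ordinals k))) C A (Fobj A k) (\<lambda>i. Farr A (i, k))"
      using A by (simp add: smooth_sequence_def)
    have R: "Restr r (underS r k) = Restr ordinals (underS r k)"
    proof -
      have "(x, j) \<in> ordinals" if "(x, k) \<in> ordinals" for x
        using ordinals_trans[OF that, of j] kB by (simp add: B_def)
      then show ?thesis unfolding Sk by (auto simp: r_def B_def underS_iff)
    qed
    show "is_colimit (poset_category (Restr r (underS r k))) C A (Fobj A k) (\<lambda>i. Farr A (i, k))"
      unfolding R
    proof (rule colimit_cofinal[OF colim Refl_Restr_ordinals trans_Restr_ordinals, where I = "\<lambda>x. x"])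
      fix x y assume xy: "x \<in> Field (Restr ordinals (underS r k))" "y \<in> Field (Restr ordinals (underS r k))"
      show "\<exists>z. (x, z) \<in> Restr ordinals (underS r k) \<and> (y, z) \<in> Restr ordinals (underS r k)"
        using ordinals_total[of x y] xy by (auto intro: exI[of _ x] exI[of _ y])
    next
      fix m assume "m \<in> Field (Restr ordinals (underS ordinals k))"
      then have m: "m \<in> underS ordinals k" by simp
      show "\<exists>x\<in>Field (Restr ordinals (underS r k)). (m, x) \<in> Restr ordinals (underS ordinals k)"
        using m ik Sk ordinals_total[of m i] ordinals_refl by auto
    qed (auto simp: Sk)
  qed
  then show ?thesis by (simp add: r_def B_def)
qed

text \<open>Induction on the upper end: identities are isomorphisms, a successor adds one
  composition, and at a limit the interval from \<open>i\<close> to \<open>j\<close> is a smooth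
  chain all of whose earlier maps lie in \<open>L\<close> by the induction hypothesis.\<close>

lemma smooth_sequence_composition:
  assumes A: "smooth_sequence C A" and L: "closed_transfinite_composition TYPE('u) C L" "{f. is_iso C f} \<subseteq> L"
    and succ: "\<And>i j. is_succ ordinals i j \<Longrightarrow> Farr A (i, j) \<in> L"
  shows "(i, j) \<in> ordinals \<Longrightarrow> Farr A (i, j) \<in> L"
proof (induction j arbitrary: i rule: ordinals_induct)
  case (less j)
  have F: "is_functor (poset_category ordinals) C A" using A by (simp add: smooth_sequence_def)
  note A' = diagramD[OF F]
  interpret cat C using A'(7) by unfold_locales
  show ?case
  proof (cases "i = j")
    case True
    then show ?thesis using A'(5)[of j] A'(1)[of j] L(2) by auto
  next
    case False
    then have ij: "i \<in> underS ordinals j" using less.prems by (simp add: underS_iff)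
    show ?thesis
    proof (cases j rule: ordinals_cases)
      case zero
      then show ?thesis using ij by simp
    next
      case (succ k)
      then have k: "k \<in> underS ordinals j" "(i, k) \<in> ordinals" "(k, j) \<in> ordinals"
        using ij by (auto simp: is_succ_def underS_iff)
      have "Farr A (i, k) \<in> L" "Farr A (k, j) \<in> L" using less.IH k assms(4)[OF succ] by auto
      then have "Farr A (k, j) \<cdot>\<^bsub>C\<^esub> Farr A (i, k) \<in> L"
        using L(1) A'(3)[OF k(3)] A'(4)[OF k(2)] by (simp add: closed_transfinite_composition_def)
      then show ?thesis using A'(6)[OF k(2,3)] by simp
    next
      case limit
      define r where "r = Restr ordinals {k. (i, k) \<in> ordinals \<and> (k, j) \<in> ordinals}"
      have "Field r \<subseteq> insert j (underS ordinals j)" by (auto simp: r_def underS_iff)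
      then have "small TYPE('u) (Field r)" using small_subset small_insert[OF small_underS] by blast
      moreover have "smooth_chain C r j A" using smooth_sequence_interval[OF A ij limit] by (simp add: r_def)
      moreover have "Farr A (k, m) \<in> L" if "(k, m) \<in> r" "m \<noteq> j" for k m
        using that less.IH[of m k] by (auto simp: r_def underS_iff)
      moreover have "i \<in> Field r" "\<forall>k \<in> Field r. (i, k) \<in> r" using less.prems by (auto simp: r_def)
      ultimately show ?thesis using L(1) unfolding closed_transfinite_composition_def by blast
    qed
  qed
qed

end

section \<open>Attaching cells\<close>

definition attaching :: "('o, 'a) category \<Rightarrow> 'o \<Rightarrow> 'i set \<Rightarrow> ('i \<Rightarrow> 'a) \<Rightarrow> ('i \<Rightarrow> 'a) \<Rightarrow> bool" where
  "attaching C f I y s \<longleftrightarrow> f \<in> Obj C \<and> (\<forall>i \<in> I. y i \<in> Arr C \<and> s i \<in> hom C (Dom C (y i)) f)"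

definition extends_cells where
  "extends_cells C f I y s c g k \<longleftrightarrow> g \<in> hom C f c \<and>
     (\<forall>i \<in> I. k i \<in> hom C (Cod C (y i)) c \<and> k i \<cdot>\<^bsub>C\<^esub> y i = g \<cdot>\<^bsub>C\<^esub> s i)"

text \<open>
  \<open>\<rho> : f \<rightarrow> c\<close> is the pushout of the coproduct of the \<open>y i\<close> along the morphism induced by the
  \<open>s i\<close>; no coproduct has to be chosen.
\<close>

definition attaches where
  "attaches C f I y s c \<rho> \<kappa> \<longleftrightarrow> attaching C f I y s \<and> extends_cells C f I y s c \<rho> \<kappa> \<and>
     (\<forall>d g k. extends_cells C f I y s d g k \<longrightarrow>
        (\<exists>!h. h \<in> hom C c d \<and> h \<cdot>\<^bsub>C\<^esub> \<rho> = g \<and> (\<forall>i \<in> I. h \<cdot>\<^bsub>C\<^esub> \<kappa> i = k i)))"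

lemma extends_cellsD:
  assumes "extends_cells C f I y s c g k"
  shows "g \<in> Arr C" "Dom C g = f" "Cod C g = c"
    "i \<in> I \<Longrightarrow> k i \<in> Arr C" "i \<in> I \<Longrightarrow> Dom C (k i) = Cod C (y i)" "i \<in> I \<Longrightarrow> Cod C (k i) = c"
    "i \<in> I \<Longrightarrow> k i \<cdot>\<^bsub>C\<^esub> y i = g \<cdot>\<^bsub>C\<^esub> s i"
  using assms by (auto simp: extends_cells_def hom_iff)

lemma attachingD:
  assumes "attaching C f I y s"
  shows "f \<in> Obj C" "i \<in> I \<Longrightarrow> y i \<in> Arr C" "i \<in> I \<Longrightarrow> s i \<in> Arr C"
    "i \<in> I \<Longrightarrow> Dom C (s i) = Dom C (y i)" "i \<in> I \<Longrightarrow> Cod C (s i) = f"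
  using assms by (auto simp: attaching_def hom_iff)

lemma attachesD:
  assumes "attaches C f I y s c \<rho> \<kappa>"
  shows "attaching C f I y s" "extends_cells C f I y s c \<rho> \<kappa>"
  using assms by (auto simp: attaches_def)

lemma attaches_factor:
  assumes "attaches C f I y s c \<rho> \<kappa>" "extends_cells C f I y s d g k"
  obtains h where "h \<in> hom C c d" "h \<cdot>\<^bsub>C\<^esub> \<rho> = g" "\<And>i. i \<in> I \<Longrightarrow> h \<cdot>\<^bsub>C\<^esub> \<kappa> i = k i"
  using assms unfolding attaches_def by blast

text \<open>
  The shape of the attaching diagram: \<open>None\<close> stands for the base, \<open>Some (i, False)\<close> and
  \<open>Some (i, True)\<close> for domain and codomain of the \<open>i\<close>-th cell.
\<close>

definition cell_poset :: "'i set \<Rightarrow> ('i \<times> bool) option rel" where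
  "cell_poset I = Id_on (insert None (Some ` (I \<times> UNIV))) \<union>
     (\<lambda>i. (Some (i, False), None)) ` I \<union> (\<lambda>i. (Some (i, False), Some (i, True))) ` I"

lemma cell_poset_cases:
  assumes "(p, q) \<in> cell_poset I"
  obtains (None) "p = None" "q = None" | (refl) i b where "i \<in> I" "p = Some (i, b)" "q = Some (i, b)"
    | (base) i where "i \<in> I" "p = Some (i, False)" "q = None"
    | (cell) i where "i \<in> I" "p = Some (i, False)" "q = Some (i, True)"
  using assms by (auto simp: cell_poset_def)

lemma Field_cell_poset: "Field (cell_poset I) = insert None (Some ` (I \<times> UNIV))"
  by (auto simp: cell_poset_def Field_def)

context cat
begin

lemma extends_cells_comp:
  assumes "attaching C f I y s" "extends_cells C f I y s c g k" "h \<in> hom C c d"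
  shows "extends_cells C f I y s d (h \<cdot> g) (\<lambda>i. h \<cdot> k i)"
proof -
  note [simp] = attachingD[OF assms(1)] extends_cellsD[OF assms(2)]
  show ?thesis
    using assms(3) by (auto simp: extends_cells_def hom_iff)
qed

lemma attaches_eqI:
  assumes "attaches C f I y s c \<rho> \<kappa>" "h \<in> hom C c d" "h' \<in> hom C c d" "h \<cdot> \<rho> = h' \<cdot> \<rho>"
    and "\<And>i. i \<in> I \<Longrightarrow> h \<cdot> \<kappa> i = h' \<cdot> \<kappa> i"
  shows "h = h'"
proof -
  have "extends_cells C f I y s d (h \<cdot> \<rho>) (\<lambda>i. h \<cdot> \<kappa> i)"
    using extends_cells_comp[OF attachesD[OF assms(1)] assms(2)] .
  then have "\<exists>!x. x \<in> hom C c d \<and> x \<cdot> \<rho> = h \<cdot> \<rho> \<and> (\<forall>i \<in> I. x \<cdot> \<kappa> i = h \<cdot> \<kappa> i)"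
    using assms(1) unfolding attaches_def by blast
  then show ?thesis using assms by metis
qed

lemma attachesI:
  assumes "attaching C f I y s" "extends_cells C f I y s c \<rho> \<kappa>"
    and "\<And>d g k. extends_cells C f I y s d g k \<Longrightarrow>
      \<exists>h. h \<in> hom C c d \<and> h \<cdot> \<rho> = g \<and> (\<forall>i \<in> I. h \<cdot> \<kappa> i = k i)"
    and "\<And>d h h'. h \<in> hom C c d \<Longrightarrow> h' \<in> hom C c d \<Longrightarrow> h \<cdot> \<rho> = h' \<cdot> \<rho> \<Longrightarrow>
      (\<And>i. i \<in> I \<Longrightarrow> h \<cdot> \<kappa> i = h' \<cdot> \<kappa> i) \<Longrightarrow> h = h'"
  shows "attaches C f I y s c \<rho> \<kappa>"
  unfolding attaches_def
proof (intro conjI allI impI)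
  fix d g k assume "extends_cells C f I y s d g k"
  then obtain h where h: "h \<in> hom C c d" "h \<cdot> \<rho> = g" "\<forall>i \<in> I. h \<cdot> \<kappa> i = k i" using assms(3) by blast
  show "\<exists>!h. h \<in> hom C c d \<and> h \<cdot> \<rho> = g \<and> (\<forall>i \<in> I. h \<cdot> \<kappa> i = k i)"
  proof (rule ex1I[of _ h])
    fix h' assume "h' \<in> hom C c d \<and> h' \<cdot> \<rho> = g \<and> (\<forall>i \<in> I. h' \<cdot> \<kappa> i = k i)"
    then show "h' = h" using h assms(4)[of h' d h] by simp
  qed (use h in simp)
qed (use assms in auto)

lemma attaches_unique:
  assumes 1: "attaches C f I y s c \<rho> \<kappa>" and 2: "attaches C f I y s c' \<rho>' \<kappa>'"
  obtains h where "h \<in> hom C c c'" "is_iso C h" "h \<cdot> \<rho> = \<rho>'" "\<And>i. i \<in> I \<Longrightarrow> h \<cdot> \<kappa> i = \<kappa>' i"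
proof -
  obtain h where h: "h \<in> hom C c c'" "h \<cdot> \<rho> = \<rho>'" "\<And>i. i \<in> I \<Longrightarrow> h \<cdot> \<kappa> i = \<kappa>' i"
    using attaches_factor[OF 1 attachesD(2)[OF 2]] by blast
  obtain h' where h': "h' \<in> hom C c' c" "h' \<cdot> \<rho>' = \<rho>" "\<And>i. i \<in> I \<Longrightarrow> h' \<cdot> \<kappa>' i = \<kappa> i"
    using attaches_factor[OF 2 attachesD(2)[OF 1]] by blast
  note e1 = extends_cellsD[OF attachesD(2)[OF 1]] and e2 = extends_cellsD[OF attachesD(2)[OF 2]]
  have hA: "h \<in> Arr C" "Dom C h = c" "Cod C h = c'" "h' \<in> Arr C" "Dom C h' = c'" "Cod C h' = c"
    using h(1) h'(1) by (auto simp: hom_iff)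
  have cO: "c \<in> Obj C" "c' \<in> Obj C" using hA(1-3) Dom_Obj Cod_Obj by blast+
  have "h' \<cdot> h = Id C c"
    by (rule attaches_eqI[OF 1, of _ c]) (use h h' hA cO e1 in \<open>simp_all add: hom_iff\<close>)
  moreover have "h \<cdot> h' = Id C c'"
    by (rule attaches_eqI[OF 2, of _ c']) (use h h' hA cO e2 in \<open>simp_all add: hom_iff\<close>)
  ultimately have "is_iso C h" using hA by (auto simp: is_iso_def hom_iff)
  then show ?thesis using h that by blast
qed

lemma attaches_empty:
  assumes "f \<in> Obj C"
  shows "attaches C f {} y s f (Id C f) \<kappa>"
  by (rule attachesI) (use assms in \<open>auto simp: attaching_def extends_cells_def hom_iff\<close>)

text \<open>A pushout attaches a single cell, so results on cell attachment (preservation by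
  functors, stability of isomorphisms) transfer to pushouts.\<close>

lemma is_pushout_iff_attaches:
  assumes "f \<in> Arr C" "g \<in> Arr C" "Dom C f = Dom C g"
  shows "is_pushout C f g f' g' \<longleftrightarrow>
    attaches C (Cod C g) {()} (\<lambda>_. f) (\<lambda>_. g) (Cod C f') f' (\<lambda>_. g')"
proof
  assume p: "is_pushout C f g f' g'"
  then have p': "f' \<in> Arr C" "g' \<in> Arr C" "Dom C g' = Cod C f" "Dom C f' = Cod C g" "Cod C g' = Cod C f'" "g' \<cdot> f = f' \<cdot> g"
    by (auto simp: is_pushout_def)
  have U: "\<exists>!h. h \<in> hom C (Cod C f') (Cod C p) \<and> h \<cdot> g' = p \<and> h \<cdot> f' = q"
    if "p \<in> Arr C" "q \<in> Arr C" "Dom C p = Cod C f" "Dom C q = Cod C g" "Cod C p = Cod C q" "p \<cdot> f = q \<cdot> g" for p q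
    using p that unfolding is_pushout_def by blast
  show "attaches C (Cod C g) {()} (\<lambda>_. f) (\<lambda>_. g) (Cod C f') f' (\<lambda>_. g')"
    unfolding attaches_def
  proof (intro conjI allI impI)
    fix d q k assume e: "extends_cells C (Cod C g) {()} (\<lambda>_. f) (\<lambda>_. g) d q k"
    note e' = extends_cellsD[OF e] extends_cellsD(4-)[OF e, of "()", simplified]
    have "\<exists>!h. h \<in> hom C (Cod C f') (Cod C (k ())) \<and> h \<cdot> g' = k () \<and> h \<cdot> f' = q"
      using e' by (intro U) simp_all
    then show "\<exists>!h. h \<in> hom C (Cod C f') d \<and> h \<cdot> f' = q \<and> (\<forall>i \<in> {()}. h \<cdot> g' = k i)"
      using e' by (simp add: conj_ac)
  qed (use p' assms in \<open>auto simp: attaching_def extends_cells_def hom_iff\<close>)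
next
  assume a: "attaches C (Cod C g) {()} (\<lambda>_. f) (\<lambda>_. g) (Cod C f') f' (\<lambda>_. g')"
  note e = extends_cellsD[OF attachesD(2)[OF a]]
  show "is_pushout C f g f' g'"
    unfolding is_pushout_def
  proof (intro conjI ballI impI)
    fix p q assume pq: "p \<in> Arr C" "q \<in> Arr C"
      "Dom C p = Cod C f \<and> Dom C q = Cod C g \<and> Cod C p = Cod C q \<and> p \<cdot> f = q \<cdot> g"
    then have "extends_cells C (Cod C g) {()} (\<lambda>_. f) (\<lambda>_. g) (Cod C p) q (\<lambda>_. p)"
      by (auto simp: extends_cells_def hom_iff)
    then have "\<exists>!h. h \<in> hom C (Cod C f') (Cod C p) \<and> h \<cdot> f' = q \<and> (\<forall>i \<in> {()}. h \<cdot> g' = p)"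
      using a unfolding attaches_def by blast
    then show "\<exists>!h. h \<in> hom C (Cod C f') (Cod C p) \<and> h \<cdot> g' = p \<and> h \<cdot> f' = q"
      by (simp add: conj_ac)
  qed (use e(1-3) e(4-)[of "()"] assms in auto)
qed

definition cell_diagram where
  "cell_diagram f y s =
     \<lparr>Fobj = (\<lambda>p. case p of None \<Rightarrow> f | Some (i, b) \<Rightarrow> if b then Cod C (y i) else Dom C (y i)),
      Farr = (\<lambda>(p, q). case (p, q) of
          (None, _) \<Rightarrow> Id C f
        | (Some (i, b), None) \<Rightarrow> s i
        | (Some (i, b), Some (j, b')) \<Rightarrow>
            if b then Id C (Cod C (y i)) else if b' then y i else Id C (Dom C (y i)))\<rparr>"

text \<open>At the domain of a cell the value is forced to be \<open>\<rho> \<cdot> s i\<close>,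
  through the base.\<close>

definition cell_cocone where
  "cell_cocone s \<rho> \<kappa> p = (case p of None \<Rightarrow> \<rho> | Some (i, b) \<Rightarrow> if b then \<kappa> i else \<rho> \<cdot> s i)"

lemma cell_diagram_functor:
  assumes "attaching C f I y s"
  shows "is_functor (poset_category (cell_poset I)) C (cell_diagram f y s)"
proof -
  note [simp] = attachingD[OF assms]
  show ?thesis
  proof (rule diagramI[OF cat])
    show "Refl (cell_poset I)" unfolding Field_cell_poset by (auto simp: refl_on_def cell_poset_def)
    show "trans (cell_poset I)" by (rule transI) (auto simp: cell_poset_def)
    fix p q assume pq: "(p, q) \<in> cell_poset I"
    then show "Farr (cell_diagram f y s) (p, q) \<in> hom C (Fobj (cell_diagram f y s) p) (Fobj (cell_diagram f y s) q)"
      by (cases rule: cell_poset_cases) (auto simp: cell_diagram_def hom_iff)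
    fix x assume "(q, x) \<in> cell_poset I"
    then show "Farr (cell_diagram f y s) (q, x) \<cdot> Farr (cell_diagram f y s) (p, q) = Farr (cell_diagram f y s) (p, x)"
      using pq by (cases rule: cell_poset_cases; elim cell_poset_cases) (auto simp: cell_diagram_def)
  qed (auto simp: Field_cell_poset cell_diagram_def)
qed

lemma cell_cocone:
  assumes "attaching C f I y s" "extends_cells C f I y s c \<rho> \<kappa>"
  shows "is_cocone (poset_category (cell_poset I)) C (cell_diagram f y s) c (cell_cocone s \<rho> \<kappa>)"
  unfolding cocone_poset_iff
proof (intro conjI allI impI ballI)
  note [simp] = attachingD[OF assms(1)] extends_cellsD[OF assms(2)]
  show "c \<in> Obj C" using Cod_Obj[of \<rho>] by simp
  show "cell_cocone s \<rho> \<kappa> q \<cdot> Farr (cell_diagram f y s) (p, q) = cell_cocone s \<rho> \<kappa> p"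
    if "(p, q) \<in> cell_poset I" for p q
    using that by (cases rule: cell_poset_cases) (auto simp: cell_diagram_def cell_cocone_def)
  show "cell_cocone s \<rho> \<kappa> p \<in> hom C (Fobj (cell_diagram f y s) p) c" if "p \<in> Field (cell_poset I)" for p
    using that by (auto simp: cell_diagram_def cell_cocone_def Field_cell_poset hom_iff)
qed

lemma cell_cocone_conv:
  assumes "attaching C f I y s" "is_cocone (poset_category (cell_poset I)) C (cell_diagram f y s) c t"
  shows "extends_cells C f I y s c (t None) (\<lambda>i. t (Some (i, True)))"
    and "p \<in> Field (cell_poset I) \<Longrightarrow> t p = cell_cocone s (t None) (\<lambda>i. t (Some (i, True))) p"
proof -
  note t = cocone_posetD[OF assms(2)]
  have F: "None \<in> Field (cell_poset I)" "i \<in> I \<Longrightarrow> Some (i, b) \<in> Field (cell_poset I)" for i b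
    by (auto simp: Field_cell_poset)
  have eq: "t None \<cdot> s i = t (Some (i, False))" "t (Some (i, True)) \<cdot> y i = t (Some (i, False))" if "i \<in> I" for i
    using t(5)[of "Some (i, False)" None] t(5)[of "Some (i, False)" "Some (i, True)"] that
    by (auto simp: cell_poset_def cell_diagram_def)
  show "extends_cells C f I y s c (t None) (\<lambda>i. t (Some (i, True)))"
    using t(2,3,4)[OF F(1)] t(2,3,4)[OF F(2)] eq
    by (auto simp: extends_cells_def hom_iff cell_diagram_def)
  show "p \<in> Field (cell_poset I) \<Longrightarrow> t p = cell_cocone s (t None) (\<lambda>i. t (Some (i, True))) p"
    using eq by (auto simp: Field_cell_poset cell_cocone_def)
qed

text \<open>Together with its converse this identifies attachment with a colimit over
  \<open>cell_poset I\<close>: existence then comes from cocompleteness, and functors that preserve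
  the colimit preserve the attachment.\<close>

lemma attaches_colimit:
  assumes a: "attaches C f I y s c \<rho> \<kappa>"
  shows "is_colimit (poset_category (cell_poset I)) C (cell_diagram f y s) c (cell_cocone s \<rho> \<kappa>)"
proof (rule colimitI)
  note at = attachesD(1)[OF a] and e = extends_cellsD[OF attachesD(2)[OF a]]
  show "is_functor (poset_category (cell_poset I)) C (cell_diagram f y s)" by (rule cell_diagram_functor[OF at])
  show "is_cocone (poset_category (cell_poset I)) C (cell_diagram f y s) c (cell_cocone s \<rho> \<kappa>)"
    by (rule cell_cocone[OF attachesD[OF a]])
  fix d t assume t: "is_cocone (poset_category (cell_poset I)) C (cell_diagram f y s) d t"
  note t' = cell_cocone_conv[OF at t]
  obtain h where h: "h \<in> hom C c d" "h \<cdot> \<rho> = t None" "\<And>i. i \<in> I \<Longrightarrow> h \<cdot> \<kappa> i = t (Some (i, True))"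
    using attaches_factor[OF a t'(1)] by blast
  have "h \<cdot> cell_cocone s \<rho> \<kappa> p = t p" if p: "p \<in> Field (cell_poset I)" for p
  proof -
    have "h \<cdot> (\<rho> \<cdot> s i) = t None \<cdot> s i" if "i \<in> I" for i
      using comp_assoc_eq[OF h(2), of "s i"] e h(1) that attachingD[OF at] by (simp add: hom_iff)
    then show ?thesis
      using p h(2,3) t'(2)[OF p] by (auto simp: Field_cell_poset cell_cocone_def)
  qed
  then show "\<exists>h. h \<in> hom C c d \<and> (\<forall>j \<in> Obj (poset_category (cell_poset I)). h \<cdot> cell_cocone s \<rho> \<kappa> j = t j)"
    using h(1) by auto
next
  fix d h h' assume h: "h \<in> hom C c d" "h' \<in> hom C c d"
    and eq: "\<And>p. p \<in> Obj (poset_category (cell_poset I)) \<Longrightarrow> h \<cdot> cell_cocone s \<rho> \<kappa> p = h' \<cdot> cell_cocone s \<rho> \<kappa> p"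
  show "h = h'"
    using eq[of None] eq[of "Some (i, True)" for i]
    by (intro attaches_eqI[OF a h]) (auto simp: Field_cell_poset cell_cocone_def)
qed

lemma colimit_attaches:
  assumes at: "attaching C f I y s"
    and c: "is_colimit (poset_category (cell_poset I)) C (cell_diagram f y s) c t"
  shows "attaches C f I y s c (t None) (\<lambda>i. t (Some (i, True)))"
proof (rule attachesI[OF at])
  note t = cell_cocone_conv[OF at colimitD(2)[OF c]]
  have F: "None \<in> Field (cell_poset I)" "i \<in> I \<Longrightarrow> Some (i, b) \<in> Field (cell_poset I)" for i b
    by (auto simp: Field_cell_poset)
  show "extends_cells C f I y s c (t None) (\<lambda>i. t (Some (i, True)))" by (rule t)
  show "\<exists>h. h \<in> hom C c d \<and> h \<cdot> t None = g \<and> (\<forall>i \<in> I. h \<cdot> t (Some (i, True)) = k i)"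
    if ext: "extends_cells C f I y s d g k" for d g k
  proof -
    obtain h where "h \<in> hom C c d" "\<And>p. p \<in> Field (cell_poset I) \<Longrightarrow> h \<cdot> t p = cell_cocone s g k p"
      using colimit_factor[OF c cell_cocone[OF at ext]] by auto
    then show ?thesis using F by (intro exI[of _ h]) (auto simp: cell_cocone_def)
  qed
  fix d h h' assume h: "h \<in> hom C c d" "h' \<in> hom C c d" "h \<cdot> t None = h' \<cdot> t None"
    "\<And>i. i \<in> I \<Longrightarrow> h \<cdot> t (Some (i, True)) = h' \<cdot> t (Some (i, True))"
  note tA = extends_cellsD[OF t(1)] and sA = attachingD[OF at]
  have hs: "h \<cdot> (t None \<cdot> s i) = h' \<cdot> (t None \<cdot> s i)" if "i \<in> I" for i
    using comp_assoc_eq[OF h(3), of "s i"] h(1,2) tA(1-3) sA(2-)[OF that] by (simp add: hom_iff)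
  show "h = h'"
  proof (rule colimit_eqI[OF c h(1,2)])
    fix p assume p: "p \<in> Obj (poset_category (cell_poset I))"
    then show "h \<cdot> t p = h' \<cdot> t p"
      using h hs t(2)[of p] by (auto simp: Field_cell_poset cell_cocone_def split: if_splits)
  qed
qed

end

lemma (in univ) attaches_exists:
  assumes C: "is_category C" "cocomplete TYPE('u) C" and "small TYPE('u) I" "attaching C f I y s"
  shows "\<exists>c \<rho> \<kappa>. attaches C f I y s c \<rho> \<kappa>"
proof -
  interpret cat C by unfold_locales (rule C)
  have "small TYPE('u) (Field (cell_poset I))"
    unfolding Field_cell_poset using small_Times[OF assms(3) finite_small[of "UNIV :: bool set"]]
    by (intro small_insert small_image) simp
  from cocomplete_poset_colimit[OF C(2) this cell_diagram_functor[OF assms(4)]]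
  show ?thesis using colimit_attaches[OF assms(4)] by metis
qed

definition cell_closed :: "'u itself \<Rightarrow> ('o, 'a) category \<Rightarrow> 'a set \<Rightarrow> bool" where
  "cell_closed U C L \<longleftrightarrow> {f. is_iso C f} \<subseteq> L \<and> stable_under_pushout C L \<and> closed_transfinite_composition U C L"

lemma cell_closedD:
  assumes "cell_closed U C L"
  shows "is_iso C f \<Longrightarrow> f \<in> L" "f \<in> L \<Longrightarrow> g \<in> L \<Longrightarrow> Cod C f = Dom C g \<Longrightarrow> g \<cdot>\<^bsub>C\<^esub> f \<in> L"
    "f \<in> L \<Longrightarrow> is_pushout C f g f' g' \<Longrightarrow> f' \<in> L"
  using assms unfolding cell_closed_def stable_under_pushout_def closed_transfinite_composition_def by blast+

text \<open>Attaching the cells one at a time along a well-ordering exhibits the result as a transfinite composition.\<close>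

lemma (in univ) attaches_closed:
  assumes C: "is_category C" "cocomplete TYPE('u) C" and L: "cell_closed TYPE('u) C L"
    and I: "small TYPE('u) (I :: 'i set)" and att: "attaches C f I y s c \<rho> \<kappa>" and y: "\<And>i. i \<in> I \<Longrightarrow> y i \<in> L"
  shows "\<rho> \<in> L"
proof -
  interpret cat C by unfold_locales (rule C)
  obtain \<phi> :: "'i \<Rightarrow> 'u" where \<phi>: "inj_on \<phi> I" using small_inj[OF I] by blast
  note at = attachingD[OF attachesD(1)[OF att]]
  \<comment> \<open>\<open>S a\<close> holds the cells whose code comes before \<open>a\<close>;
    injectivity of \<open>\<phi>\<close> means that at most one cell is added when passing to a
    successor.\<close>
  define S where "S a = {i \<in> I. \<phi> i \<in> underS ordinals a}" for a
  have S_mono: "S a \<subseteq> S b" if "(a, b) \<in> ordinals" for a b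
    using ordinals_underS_trans(1)[OF _ that] by (auto simp: S_def)
  have at': "attaching C f (S a) y s" for a
    using attachesD(1)[OF att] by (auto simp: attaching_def S_def)
  have "\<exists>c \<rho> \<kappa>. attaches C f (S a) y s c \<rho> \<kappa>" for a
    using small_subset[OF I, of "S a"] by (intro attaches_exists[OF C _ at']) (auto simp: S_def)
  then obtain c' \<rho>' \<kappa>' where a': "\<And>a. attaches C f (S a) y s (c' a) (\<rho>' a) (\<kappa>' a)" by metis
  note e' = extends_cellsD[OF attachesD(2)[OF a']]
  have "\<exists>h. h \<in> hom C (c' a) (c' b) \<and> h \<cdot>\<^bsub>C\<^esub> \<rho>' a = \<rho>' b \<and> (\<forall>i \<in> S a. h \<cdot>\<^bsub>C\<^esub> \<kappa>' a i = \<kappa>' b i)"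
    if "(a, b) \<in> ordinals" for a b
  proof -
    have "extends_cells C f (S a) y s (c' b) (\<rho>' b) (\<kappa>' b)"
      using attachesD(2)[OF a'[of b]] S_mono[OF that] by (auto simp: extends_cells_def)
    from attaches_factor[OF a' this] show ?thesis by metis
  qed
  then obtain m0 where m0: "\<And>a b. (a, b) \<in> ordinals \<Longrightarrow> m0 a b \<in> hom C (c' a) (c' b) \<and>
      m0 a b \<cdot>\<^bsub>C\<^esub> \<rho>' a = \<rho>' b \<and> (\<forall>i \<in> S a. m0 a b \<cdot>\<^bsub>C\<^esub> \<kappa>' a i = \<kappa>' b i)" by metis
  define m where "m p = m0 (fst p) (snd p)" for p
  have m: "\<And>a b. (a, b) \<in> ordinals \<Longrightarrow> m (a, b) \<in> hom C (c' a) (c' b)"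
    "\<And>a b. (a, b) \<in> ordinals \<Longrightarrow> m (a, b) \<cdot>\<^bsub>C\<^esub> \<rho>' a = \<rho>' b"
    "\<And>a b i. (a, b) \<in> ordinals \<Longrightarrow> i \<in> S a \<Longrightarrow> m (a, b) \<cdot>\<^bsub>C\<^esub> \<kappa>' a i = \<kappa>' b i"
    using m0 by (simp_all add: m_def)
  have mA: "m (a, b) \<in> Arr C" "Dom C (m (a, b)) = c' a" "Cod C (m (a, b)) = c' b" if "(a, b) \<in> ordinals" for a b
    using m(1)[OF that] by (auto simp: hom_iff)
  have c'_Obj: "c' a \<in> Obj C" for a using Cod_Obj[OF e'(1)[of a]] e'(3)[of a] by simp
  define A where "A = \<lparr>Fobj = c', Farr = m\<rparr>"
  have A: "is_functor (poset_category ordinals) C A"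
  proof (rule diagramI[OF cat])
    show "Refl ordinals" by (simp add: refl_on_def)
    show "trans ordinals" using ordinals_trans by (meson transI)
    show "Farr A (a, a) = Id C (Fobj A a)" for a
      unfolding A_def
      by (simp, rule attaches_eqI[OF a'[of a], of _ "c' a"]) (use m[of a a] e' c'_Obj in \<open>auto simp: hom_iff\<close>)
    show "Farr A (b, d) \<cdot>\<^bsub>C\<^esub> Farr A (a, b) = Farr A (a, d)" if ab: "(a, b) \<in> ordinals" and bd: "(b, d) \<in> ordinals" for a b d
    proof -
      have ad: "(a, d) \<in> ordinals" using ordinals_trans[OF ab bd] .
      have "m (b, d) \<cdot>\<^bsub>C\<^esub> m (a, b) = m (a, d)"
      proof (rule attaches_eqI[OF a'[of a], of _ "c' d"])
        show "m (b, d) \<cdot>\<^bsub>C\<^esub> m (a, b) \<cdot>\<^bsub>C\<^esub> \<kappa>' a i = m (a, d) \<cdot>\<^bsub>C\<^esub> \<kappa>' a i" if "i \<in> S a" for i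
          using that mA[OF ab] mA[OF bd] m(3)[OF ab that] m(3)[OF bd, of i] m(3)[OF ad that] S_mono[OF ab] e' by auto
      qed (use mA[OF ab] mA[OF bd] mA[OF ad] m(2)[OF ab] m(2)[OF bd] m(2)[OF ad] e' in \<open>auto simp: hom_iff\<close>)
      then show ?thesis by (simp add: A_def)
    qed
  qed (use c'_Obj m(1) in \<open>auto simp: A_def\<close>)
  have "smooth_sequence C A"
    unfolding smooth_sequence_def
  proof (intro conjI A allI impI)
    fix j assume j: "limit_element ordinals j"
    let ?R = "Restr ordinals (underS ordinals j)"
    have lt: "(a, j) \<in> ordinals" if "a \<in> underS ordinals j" for a using that by (simp add: underS_iff)
    obtain a0 where a0: "a0 \<in> underS ordinals j" using j by (auto simp: limit_element_def)
    \<comment> \<open>Nothing new is added at a limit: a code below \<open>j\<close> is below some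
      earlier stage. This makes the attachment of \<open>S j\<close> the colimit of the earlier
      ones.\<close>
    have S_lim: "\<exists>a \<in> underS ordinals j. i \<in> S a" if "i \<in> S j" for i
      using that j by (auto simp: S_def limit_element_def)
    show "is_colimit (poset_category ?R) C A (Fobj A j) (\<lambda>i. Farr A (i, j))"
    proof (rule colimitI)
      show "is_functor (poset_category ?R) C A"
        using diagramD[OF A] Refl_Restr_ordinals trans_Restr_ordinals by (intro diagramI) (auto simp: hom_iff)
      show "is_cocone (poset_category ?R) C A (Fobj A j) (\<lambda>i. Farr A (i, j))"
        using diagramD[OF A] lt by (auto simp: cocone_poset_iff hom_iff)
      fix d t assume "is_cocone (poset_category ?R) C A d t"
      note t = cocone_posetD[OF this, simplified]
      have t_eq: "t a \<cdot>\<^bsub>C\<^esub> \<rho>' a = t b \<cdot>\<^bsub>C\<^esub> \<rho>' b"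
        and t_eq2: "i \<in> S a \<Longrightarrow> t a \<cdot>\<^bsub>C\<^esub> \<kappa>' a i = t b \<cdot>\<^bsub>C\<^esub> \<kappa>' b i"
        if ab: "a \<in> underS ordinals j" "b \<in> underS ordinals j" "(a, b) \<in> ordinals" for a b i
      proof -
        have tm: "t b \<cdot>\<^bsub>C\<^esub> m (a, b) = t a" using t(5)[of a b] ab by (simp add: A_def)
        show "t a \<cdot>\<^bsub>C\<^esub> \<rho>' a = t b \<cdot>\<^bsub>C\<^esub> \<rho>' b"
          using comp_assoc_eq[OF tm, of "\<rho>' a"] mA[OF ab(3)] t(2,3)[OF ab(2)] m(2)[OF ab(3)] e' by (simp add: A_def)
        show "t a \<cdot>\<^bsub>C\<^esub> \<kappa>' a i = t b \<cdot>\<^bsub>C\<^esub> \<kappa>' b i" if "i \<in> S a"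
          using comp_assoc_eq[OF tm, of "\<kappa>' a i"] mA[OF ab(3)] t(2,3)[OF ab(2)] m(3)[OF ab(3) that] e' that by (simp add: A_def)
      qed
      have t_rho: "t a \<cdot>\<^bsub>C\<^esub> \<rho>' a = t b \<cdot>\<^bsub>C\<^esub> \<rho>' b" if "a \<in> underS ordinals j" "b \<in> underS ordinals j" for a b
        using t_eq[of a b] t_eq[of b a] ordinals_total[of a b] that by auto
      have t_kap: "t a \<cdot>\<^bsub>C\<^esub> \<kappa>' a i = t b \<cdot>\<^bsub>C\<^esub> \<kappa>' b i"
        if "a \<in> underS ordinals j" "b \<in> underS ordinals j" "i \<in> S a" "i \<in> S b" for a b i
        using t_eq2[of a b] t_eq2[of b a] ordinals_total[of a b] that by auto
      \<comment> \<open>\<open>\<psi> i\<close> is a stage at which the cell \<open>i\<close> is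
        already present; \<open>t_kap\<close> makes its choice immaterial.\<close>
      obtain \<psi> where \<psi>: "\<And>i. i \<in> S j \<Longrightarrow> \<psi> i \<in> underS ordinals j" "\<And>i. i \<in> S j \<Longrightarrow> i \<in> S (\<psi> i)"
        using S_lim by metis
      have "extends_cells C f (S j) y s d (t a0 \<cdot>\<^bsub>C\<^esub> \<rho>' a0) (\<lambda>i. t (\<psi> i) \<cdot>\<^bsub>C\<^esub> \<kappa>' (\<psi> i) i)"
        unfolding extends_cells_def
      proof (intro conjI ballI)
        fix i assume i: "i \<in> S j"
        note \<psi>' = \<psi>[OF i]
        have "t (\<psi> i) \<cdot>\<^bsub>C\<^esub> \<kappa>' (\<psi> i) i \<cdot>\<^bsub>C\<^esub> y i = t (\<psi> i) \<cdot>\<^bsub>C\<^esub> (\<rho>' (\<psi> i) \<cdot>\<^bsub>C\<^esub> s i)"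
          using t(2,3)[OF \<psi>'(1)] e'(4-7)[OF \<psi>'(2)] attachingD(2)[OF at' \<psi>'(2)] by (simp add: A_def)
        also have "\<dots> = t (\<psi> i) \<cdot>\<^bsub>C\<^esub> \<rho>' (\<psi> i) \<cdot>\<^bsub>C\<^esub> s i"
          using t(2,3)[OF \<psi>'(1)] e'(1-3)[of "\<psi> i"] attachingD(2-)[OF at' \<psi>'(2)] by (simp add: A_def)
        also have "\<dots> = t a0 \<cdot>\<^bsub>C\<^esub> \<rho>' a0 \<cdot>\<^bsub>C\<^esub> s i" using t_rho[OF \<psi>'(1) a0] by simp
        finally show "t (\<psi> i) \<cdot>\<^bsub>C\<^esub> \<kappa>' (\<psi> i) i \<cdot>\<^bsub>C\<^esub> y i = t a0 \<cdot>\<^bsub>C\<^esub> \<rho>' a0 \<cdot>\<^bsub>C\<^esub> s i" .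
      qed (use t a0 e' \<psi> in \<open>auto simp: hom_iff A_def\<close>)
      from attaches_factor[OF a' this] obtain h where h: "h \<in> hom C (c' j) d" "h \<cdot>\<^bsub>C\<^esub> \<rho>' j = t a0 \<cdot>\<^bsub>C\<^esub> \<rho>' a0"
        "\<And>i. i \<in> S j \<Longrightarrow> h \<cdot>\<^bsub>C\<^esub> \<kappa>' j i = t (\<psi> i) \<cdot>\<^bsub>C\<^esub> \<kappa>' (\<psi> i) i" by blast
      have "h \<cdot>\<^bsub>C\<^esub> m (a, j) = t a" if a: "a \<in> underS ordinals j" for a
      proof (rule attaches_eqI[OF a'[of a], of _ d])
        show "h \<cdot>\<^bsub>C\<^esub> m (a, j) \<cdot>\<^bsub>C\<^esub> \<rho>' a = t a \<cdot>\<^bsub>C\<^esub> \<rho>' a"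
          using h(1,2) mA[OF lt[OF a]] m(2)[OF lt[OF a]] e' t_rho[OF a a0] by (simp add: hom_iff)
        show "h \<cdot>\<^bsub>C\<^esub> m (a, j) \<cdot>\<^bsub>C\<^esub> \<kappa>' a i = t a \<cdot>\<^bsub>C\<^esub> \<kappa>' a i" if i: "i \<in> S a" for i
        proof -
          have "i \<in> S j" using i S_mono[OF lt[OF a]] by blast
          then show ?thesis
            using h(1) h(3)[of i] mA[OF lt[OF a]] m(3)[OF lt[OF a] i] e' t_kap[OF a \<psi>(1) i \<psi>(2)] i by (simp add: hom_iff)
        qed
      qed (use h(1) mA[OF lt[OF a]] t(2,3,4)[OF a] in \<open>auto simp: hom_iff A_def\<close>)
      then show "\<exists>h. h \<in> hom C (Fobj A j) d \<and> (\<forall>a \<in> Obj (poset_category ?R). h \<cdot>\<^bsub>C\<^esub> Farr A (a, j) = t a)"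
        using h(1) by (intro exI[of _ h]) (auto simp: A_def)
    next
      fix d h h' assume h: "h \<in> hom C (Fobj A j) d" "h' \<in> hom C (Fobj A j) d"
        and "\<And>a. a \<in> Obj (poset_category ?R) \<Longrightarrow> h \<cdot>\<^bsub>C\<^esub> Farr A (a, j) = h' \<cdot>\<^bsub>C\<^esub> Farr A (a, j)"
      then have eq: "h \<cdot>\<^bsub>C\<^esub> m (a, j) = h' \<cdot>\<^bsub>C\<^esub> m (a, j)" if "a \<in> underS ordinals j" for a
        using that by (simp add: A_def)
      have hA: "h \<in> Arr C" "Dom C h = c' j" "h' \<in> Arr C" "Dom C h' = c' j" using h by (auto simp: hom_iff A_def)
      have *: "h \<cdot>\<^bsub>C\<^esub> (m (a, j) \<cdot>\<^bsub>C\<^esub> x) = h' \<cdot>\<^bsub>C\<^esub> (m (a, j) \<cdot>\<^bsub>C\<^esub> x)"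
        if "a \<in> underS ordinals j" "x \<in> Arr C" "Cod C x = c' a" for a x
        using comp_assoc_eq[OF eq[OF that(1)], of x] mA[OF lt[OF that(1)]] that hA by simp
      show "h = h'"
      proof (rule attaches_eqI[OF a'[of j], of _ d])
        show "h \<cdot>\<^bsub>C\<^esub> \<rho>' j = h' \<cdot>\<^bsub>C\<^esub> \<rho>' j"
          using *[OF a0, of "\<rho>' a0"] m(2)[OF lt[OF a0]] e' by simp
        fix i assume "i \<in> S j"
        then obtain a where "a \<in> underS ordinals j" "i \<in> S a" using S_lim by blast
        then show "h \<cdot>\<^bsub>C\<^esub> \<kappa>' j i = h' \<cdot>\<^bsub>C\<^esub> \<kappa>' j i"
          using *[of a "\<kappa>' a i"] m(3)[OF lt, of a i] e' by simp
      qed (use h in \<open>auto simp: A_def\<close>)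
    qed
  qed
  moreover have "Farr A (a, b) \<in> L" if ab: "is_succ ordinals a b" for a b
  proof -
    have le: "(a, b) \<in> ordinals" and ltab: "a \<in> underS ordinals b" using ab by (auto simp: is_succ_def underS_iff)
    have underS_b: "underS ordinals b = insert a (underS ordinals a)"
    proof (intro equalityI subsetI)
      fix x assume "x \<in> underS ordinals b"
      then have "(x, a) \<in> ordinals" using ab by (simp add: is_succ_def)
      then show "x \<in> insert a (underS ordinals a)" by (auto simp: underS_iff)
    next
      fix x assume "x \<in> insert a (underS ordinals a)"
      then show "x \<in> underS ordinals b" using ordinals_underS_trans(1)[OF _ le] ltab by blast
    qed
    \<comment> \<open>If \<open>a\<close> codes no cell, the two attachments solve the same problem
      and the connecting map is an isomorphism. Otherwise it is the pushout of the new cell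
      \<open>y i0\<close> along its attaching map carried to stage \<open>a\<close>.\<close>
    have "m (a, b) \<in> L"
    proof (cases "\<exists>i \<in> I. \<phi> i = a")
      case False
      then have "S b = S a" using underS_b by (auto simp: S_def)
      then have "attaches C f (S a) y s (c' b) (\<rho>' b) (\<kappa>' b)" using a'[of b] by simp
      from attaches_unique[OF a'[of a] this] obtain h where
        h: "h \<in> hom C (c' a) (c' b)" "is_iso C h" "h \<cdot>\<^bsub>C\<^esub> \<rho>' a = \<rho>' b" "\<And>i. i \<in> S a \<Longrightarrow> h \<cdot>\<^bsub>C\<^esub> \<kappa>' a i = \<kappa>' b i" by blast
      have "m (a, b) = h"
        by (rule attaches_eqI[OF a'[of a], of _ "c' b"]) (use h m[OF le] in auto)
      then show ?thesis using h(2) cell_closedD(1)[OF L] by simp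
    next
      case True
      then obtain i0 where i0: "i0 \<in> I" "\<phi> i0 = a" by blast
      have Sb: "S b = insert i0 (S a)" using i0 \<phi> by (auto simp: S_def underS_b inj_on_def)
      have i0': "i0 \<in> S b" by (simp add: Sb)
      have "is_pushout C (y i0) (\<rho>' a \<cdot>\<^bsub>C\<^esub> s i0) (m (a, b)) (\<kappa>' b i0)"
        unfolding is_pushout_def
      proof (intro conjI ballI impI)
        show "\<kappa>' b i0 \<cdot>\<^bsub>C\<^esub> y i0 = m (a, b) \<cdot>\<^bsub>C\<^esub> (\<rho>' a \<cdot>\<^bsub>C\<^esub> s i0)"
          using e'(7)[OF i0'] comp_assoc_eq[OF m(2)[OF le], of "s i0"] mA[OF le] e'(1-3) at(2-)[OF i0(1)] by simp
        fix p q assume p: "p \<in> Arr C" and q: "q \<in> Arr C"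
          and pq: "Dom C p = Cod C (y i0) \<and> Dom C q = Cod C (\<rho>' a \<cdot>\<^bsub>C\<^esub> s i0) \<and> Cod C p = Cod C q \<and>
            p \<cdot>\<^bsub>C\<^esub> y i0 = q \<cdot>\<^bsub>C\<^esub> (\<rho>' a \<cdot>\<^bsub>C\<^esub> s i0)"
        have qd: "Dom C q = c' a" using pq e'(1-3)[of a] at(2-)[OF i0(1)] by simp
        have "extends_cells C f (S b) y s (Cod C p) (q \<cdot>\<^bsub>C\<^esub> \<rho>' a) (\<lambda>i. if i = i0 then p else q \<cdot>\<^bsub>C\<^esub> \<kappa>' a i)"
          unfolding extends_cells_def
        proof (intro conjI ballI)
          fix i assume i: "i \<in> S b"
          have iI: "i \<in> I" using i by (simp add: S_def)
          show "(if i = i0 then p else q \<cdot>\<^bsub>C\<^esub> \<kappa>' a i) \<cdot>\<^bsub>C\<^esub> y i = q \<cdot>\<^bsub>C\<^esub> \<rho>' a \<cdot>\<^bsub>C\<^esub> s i"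
          proof (cases "i = i0")
            case True
            have "q \<cdot>\<^bsub>C\<^esub> \<rho>' a \<cdot>\<^bsub>C\<^esub> s i0 = q \<cdot>\<^bsub>C\<^esub> (\<rho>' a \<cdot>\<^bsub>C\<^esub> s i0)"
              using q qd e'(1-3)[of a] at(3-5)[OF i0(1)] by (intro comp_assoc) simp_all
            then show ?thesis using pq True by simp
          next
            case False
            then have "i \<in> S a" using i Sb by simp
            then show ?thesis using False q qd e'(1-3)[of a] e'(4-7)[of i a] at(2-)[OF iI] by simp
          qed
          show "(if i = i0 then p else q \<cdot>\<^bsub>C\<^esub> \<kappa>' a i) \<in> hom C (Cod C (y i)) (Cod C p)"
            using i p pq q qd e'(4-6)[of i a] Sb by (auto simp: hom_iff)
        qed (use q qd pq e'(1-3)[of a] in \<open>auto simp: hom_iff\<close>)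
        from attaches_factor[OF a' this] obtain h where h: "h \<in> hom C (c' b) (Cod C p)"
          "h \<cdot>\<^bsub>C\<^esub> \<rho>' b = q \<cdot>\<^bsub>C\<^esub> \<rho>' a" "\<And>i. i \<in> S b \<Longrightarrow> h \<cdot>\<^bsub>C\<^esub> \<kappa>' b i = (if i = i0 then p else q \<cdot>\<^bsub>C\<^esub> \<kappa>' a i)" by blast
        have i0S: "i \<noteq> i0" if "i \<in> S a" for i using that i0 by (auto simp: S_def underS_iff)
        have hm: "h \<cdot>\<^bsub>C\<^esub> m (a, b) = q"
        proof (rule attaches_eqI[OF a'[of a], of _ "Cod C p"])
          show "h \<cdot>\<^bsub>C\<^esub> m (a, b) \<cdot>\<^bsub>C\<^esub> \<kappa>' a i = q \<cdot>\<^bsub>C\<^esub> \<kappa>' a i" if i: "i \<in> S a" for i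
            using h(1) h(3)[of i] mA[OF le] m(3)[OF le i] e'(4-6)[OF i] i0S[OF i] i Sb by (simp add: hom_iff)
        qed (use h mA[OF le] m(2)[OF le] e'(1-3)[of a] q qd pq in \<open>auto simp: hom_iff\<close>)
        show "\<exists>!h. h \<in> hom C (Cod C (m (a, b))) (Cod C p) \<and> h \<cdot>\<^bsub>C\<^esub> \<kappa>' b i0 = p \<and> h \<cdot>\<^bsub>C\<^esub> m (a, b) = q"
        proof (rule ex1I[of _ h])
          fix h' assume h': "h' \<in> hom C (Cod C (m (a, b))) (Cod C p) \<and> h' \<cdot>\<^bsub>C\<^esub> \<kappa>' b i0 = p \<and> h' \<cdot>\<^bsub>C\<^esub> m (a, b) = q"
          have h'A: "h' \<in> Arr C" "Dom C h' = c' b" "Cod C h' = Cod C p" using h' mA[OF le] by (auto simp: hom_iff)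
          have *: "h' \<cdot>\<^bsub>C\<^esub> (m (a, b) \<cdot>\<^bsub>C\<^esub> x) = q \<cdot>\<^bsub>C\<^esub> x" if "x \<in> Arr C" "Cod C x = c' a" for x
            using comp_assoc_eq[of h' "m (a, b)" q x] h' h'A mA[OF le] that by simp
          show "h' = h"
          proof (rule attaches_eqI[OF a'[of b], of _ "Cod C p"])
            show "h' \<cdot>\<^bsub>C\<^esub> \<rho>' b = h \<cdot>\<^bsub>C\<^esub> \<rho>' b" using *[of "\<rho>' a"] m(2)[OF le] e'(1-3)[of a] h(2) by simp
            show "h' \<cdot>\<^bsub>C\<^esub> \<kappa>' b i = h \<cdot>\<^bsub>C\<^esub> \<kappa>' b i" if i: "i \<in> S b" for i
            proof (cases "i = i0")
              case True
              then show ?thesis using h' h(3)[OF i] by simp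
            next
              case False
              then have "i \<in> S a" using i Sb by simp
              then show ?thesis using *[of "\<kappa>' a i"] m(3)[OF le] e'(4-6)[of i a] h(3)[OF i] False by simp
            qed
          qed (use h'A h in \<open>auto simp: hom_iff\<close>)
        qed (use h hm h(3)[OF i0'] mA[OF le] in auto)
      qed (use at(2-)[OF i0(1)] e'(1-3)[of a] e'(4-6)[OF i0'] mA[OF le] in auto)
      then show ?thesis using cell_closedD(3)[OF L y[OF i0(1)]] by blast
    qed
    then show ?thesis by (simp add: A_def)
  qed
  ultimately have all: "Farr A (a, b) \<in> L" if "(a, b) \<in> ordinals" for a b
    using smooth_sequence_composition[of C A L a b] L that by (auto simp: cell_closed_def)
  obtain z where z: "\<And>a. (z, a) \<in> ordinals" using ordinals_zero by blast
  have "small TYPE('u) (\<phi> ` I)" using I by (rule small_image)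
  \<comment> \<open>At stage \<open>l\<close> all cells are attached, whereas at the least ordinal
    \<open>z\<close> none is; hence \<open>\<rho>\<close> is the map from stage \<open>z\<close> to
    stage \<open>l\<close> up to isomorphisms.\<close>
  then obtain l where l: "\<phi> ` I \<subseteq> underS ordinals l" using small_bounded by blast
  then have "S l = I" by (auto simp: S_def)
  then have "attaches C f I y s (c' l) (\<rho>' l) (\<kappa>' l)" using a'[of l] by simp
  from attaches_unique[OF this att] obtain h where h: "h \<in> hom C (c' l) c" "is_iso C h" "h \<cdot>\<^bsub>C\<^esub> \<rho>' l = \<rho>" by blast
  have "underS ordinals z = {}" using z ordinals_antisym by (auto simp: underS_iff)
  then have Sz: "S z = {}" by (simp add: S_def)
  then have "attaches C f {} y s (c' z) (\<rho>' z) (\<kappa>' z)" using a'[of z] by simp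
  from attaches_unique[OF attaches_empty[OF at(1)] this] obtain k where
    k: "k \<in> hom C f (c' z)" "is_iso C k" "k \<cdot>\<^bsub>C\<^esub> Id C f = \<rho>' z" by blast
  then have "\<rho>' z \<in> L" using cell_closedD(1)[OF L] by (simp add: hom_iff)
  moreover have "m (z, l) \<in> L" using all[OF z] by (simp add: A_def)
  ultimately have "\<rho>' l \<in> L" using cell_closedD(2)[OF L, of "\<rho>' z" "m (z, l)"] m(2)[OF z] mA[OF z] e'(3) by simp
  moreover have "h \<in> L" using cell_closedD(1)[OF L h(2)] .
  ultimately show ?thesis using cell_closedD(2)[OF L, of "\<rho>' l" h] h e'(3) by (simp add: hom_iff)
qed

section \<open>The small object argument\<close>

text \<open>The argument is run in an arbitrary cocomplete \<open>E\<close> for injectivity against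
  \<open>Y\<close>. Compactness is asked of the domains in \<open>Y\<close>, since cells are
  attached along maps out of them.\<close>

locale small_object = univ U + cat E
  for U :: "'u itself" and E :: "('o, 'a) category" (structure) +
  fixes Y :: "'a set" and mu :: "'u rel"
  assumes cocomplete: "cocomplete TYPE('u) E" and locally_small: "locally_small TYPE('u) E"
    and Y: "Y \<subseteq> Arr E" "small TYPE('u) Y" and mu: "regular_cardinal mu"
    and Dom_compact: "y \<in> Y \<Longrightarrow> compact_object mu E (Dom E y)"
begin

text \<open>Every attaching map is used, without selection: composition with a map from
  \<open>f\<close> to \<open>g\<close> then carries cells over \<open>f\<close> to cells over
  \<open>g\<close>, which makes the step a functor.\<close>

definition cells :: "'o \<Rightarrow> ('a \<times> 'a) set" where
  "cells f = {(y, s). y \<in> Y \<and> s \<in> hom E (Dom E y) f}"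

lemma small_cells: "f \<in> Obj E \<Longrightarrow> small TYPE('u) (cells f)"
proof -
  assume f: "f \<in> Obj E"
  have "cells f = (SIGMA y:Y. hom E (Dom E y) f)" by (auto simp: cells_def)
  moreover have "small TYPE('u) (hom E (Dom E y) f)" if "y \<in> Y" for y
    using locally_small that Y(1) f Dom_Obj[of y] by (auto simp: locally_small_def)
  ultimately show ?thesis using small_Sigma[OF Y(2), of "\<lambda>y. hom E (Dom E y) f"] by simp
qed

lemma attaching_cells: "f \<in> Obj E \<Longrightarrow> attaching E f (cells f) fst snd"
  using Y by (auto simp: attaching_def cells_def)

definition step_data :: "'o \<Rightarrow> 'o \<times> 'a \<times> ('a \<times> 'a \<Rightarrow> 'a)" where
  "step_data f = (SOME p. attaches E f (cells f) fst snd (fst p) (fst (snd p)) (snd (snd p)))"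

definition "step_obj f = fst (step_data f)"
definition "unit f = fst (snd (step_data f))"
definition "cell f y s = snd (snd (step_data f)) (y, s)"

lemma attaches_step:
  assumes "f \<in> Obj E"
  shows "attaches E f (cells f) fst snd (step_obj f) (unit f) (\<lambda>p. cell f (fst p) (snd p))"
proof -
  obtain c \<rho> \<kappa> where "attaches E f (cells f) fst snd c \<rho> \<kappa>"
    using attaches_exists[OF cat cocomplete small_cells[OF assms] attaching_cells[OF assms]] by blast
  then have "\<exists>p. attaches E f (cells f) fst snd (fst p) (fst (snd p)) (snd (snd p))" by (metis fst_conv snd_conv)
  from someI_ex[OF this] show ?thesis
    by (simp add: step_obj_def unit_def cell_def step_data_def)
qed

lemma step_simps [simp]:
  assumes "f \<in> Obj E"
  shows "unit f \<in> Arr E" "Dom E (unit f) = f" "Cod E (unit f) = step_obj f" "step_obj f \<in> Obj E"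
  using extends_cellsD(1-3)[OF attachesD(2)[OF attaches_step[OF assms]]] Cod_Obj[of "unit f"] by auto

lemma cell_simps [simp]:
  assumes "f \<in> Obj E" "y \<in> Y" "s \<in> Arr E" "Dom E s = Dom E y" "Cod E s = f"
  shows "cell f y s \<in> Arr E" "Dom E (cell f y s) = Cod E y" "Cod E (cell f y s) = step_obj f"
    "cell f y s \<cdot> y = unit f \<cdot> s"
  using extends_cellsD(4-7)[OF attachesD(2)[OF attaches_step[OF assms(1)]], of "(y, s)"] assms
  by (auto simp: cells_def hom_iff)

lemma step_eqI:
  assumes "f \<in> Obj E" "h \<in> hom E (step_obj f) d" "h' \<in> hom E (step_obj f) d" "h \<cdot> unit f = h' \<cdot> unit f"
    and "\<And>y s. y \<in> Y \<Longrightarrow> s \<in> hom E (Dom E y) f \<Longrightarrow> h \<cdot> cell f y s = h' \<cdot> cell f y s"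
  shows "h = h'"
  using attaches_eqI[OF attaches_step[OF assms(1)] assms(2-4)] assms(5) by (auto simp: cells_def)

lemma step_factor:
  assumes "f \<in> Obj E" "g \<in> hom E f d"
    and "\<And>y s. y \<in> Y \<Longrightarrow> s \<in> hom E (Dom E y) f \<Longrightarrow> k y s \<in> hom E (Cod E y) d \<and> k y s \<cdot> y = g \<cdot> s"
  obtains h where "h \<in> hom E (step_obj f) d" "h \<cdot> unit f = g"
    "\<And>y s. y \<in> Y \<Longrightarrow> s \<in> hom E (Dom E y) f \<Longrightarrow> h \<cdot> cell f y s = k y s"
proof -
  have "extends_cells E f (cells f) fst snd d g (\<lambda>p. k (fst p) (snd p))"
    using assms by (auto simp: extends_cells_def cells_def)
  from attaches_factor[OF attaches_step[OF assms(1)] this] obtain h where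
    "h \<in> hom E (step_obj f) d" "h \<cdot> unit f = g"
    "\<And>p. p \<in> cells f \<Longrightarrow> h \<cdot> cell f (fst p) (snd p) = k (fst p) (snd p)" by blast
  then show ?thesis using that by (force simp: cells_def)
qed

text \<open>A map out of \<open>step_obj\<close> is determined by its values on \<open>unit\<close>
  and on the cells, so the condition has a unique solution and functoriality reduces to checking it
  for identities and composites.\<close>

definition is_step_arr :: "'a \<Rightarrow> 'a \<Rightarrow> bool" where
  "is_step_arr h x \<longleftrightarrow> x \<in> hom E (step_obj (Dom E h)) (step_obj (Cod E h)) \<and>
     x \<cdot> unit (Dom E h) = unit (Cod E h) \<cdot> h \<and>
     (\<forall>y \<in> Y. \<forall>s \<in> hom E (Dom E y) (Dom E h). x \<cdot> cell (Dom E h) y s = cell (Cod E h) y (h \<cdot> s))"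

definition step_arr :: "'a \<Rightarrow> 'a" where "step_arr h = (SOME x. is_step_arr h x)"

lemma is_step_arr:
  assumes h: "h \<in> Arr E"
  shows "is_step_arr h (step_arr h)"
proof -
  let ?f = "Dom E h" and ?g = "Cod E h"
  have "unit ?g \<cdot> h \<in> hom E ?f (step_obj ?g)" using h by (simp add: hom_iff)
  moreover have "cell ?g y (h \<cdot> s) \<in> hom E (Cod E y) (step_obj ?g) \<and> cell ?g y (h \<cdot> s) \<cdot> y = unit ?g \<cdot> h \<cdot> s"
    if "y \<in> Y" "s \<in> hom E (Dom E y) ?f" for y s
    using that h by (simp add: hom_iff)
  ultimately obtain x where "x \<in> hom E (step_obj ?f) (step_obj ?g)" "x \<cdot> unit ?f = unit ?g \<cdot> h"
    "\<And>y s. y \<in> Y \<Longrightarrow> s \<in> hom E (Dom E y) ?f \<Longrightarrow> x \<cdot> cell ?f y s = cell ?g y (h \<cdot> s)"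
    using step_factor[of ?f "unit ?g \<cdot> h" "step_obj ?g" "\<lambda>y s. cell ?g y (h \<cdot> s)"] h by auto
  then have "\<exists>x. is_step_arr h x" unfolding is_step_arr_def by blast
  then show ?thesis unfolding step_arr_def by (rule someI_ex)
qed

lemma step_arr_simps [simp]:
  assumes "h \<in> Arr E"
  shows "step_arr h \<in> Arr E" "Dom E (step_arr h) = step_obj (Dom E h)" "Cod E (step_arr h) = step_obj (Cod E h)"
  using is_step_arr[OF assms] by (auto simp: is_step_arr_def hom_iff)

lemma step_arr_unit: "h \<in> hom E f g \<Longrightarrow> step_arr h \<cdot> unit f = unit g \<cdot> h"
  using is_step_arr[of h] by (auto simp: is_step_arr_def hom_iff)

lemma step_arr_cell:
  "h \<in> hom E f g \<Longrightarrow> y \<in> Y \<Longrightarrow> s \<in> hom E (Dom E y) f \<Longrightarrow> step_arr h \<cdot> cell f y s = cell g y (h \<cdot> s)"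
  using is_step_arr[of h] by (auto simp: is_step_arr_def hom_iff)

lemma is_step_arr_unique:
  assumes "h \<in> Arr E" "is_step_arr h x"
  shows "step_arr h = x"
  using assms is_step_arr[OF assms(1)]
  by - (rule step_eqI[of "Dom E h" _ "step_obj (Cod E h)"]; simp add: is_step_arr_def)

definition step_functor :: "('o, 'a, 'o, 'a) cat_functor" where
  "step_functor = \<lparr>Fobj = step_obj, Farr = step_arr\<rparr>"

lemma step_functor_simps [simp]: "Fobj step_functor = step_obj" "Farr step_functor = step_arr"
  by (simp_all add: step_functor_def)

lemma step_functor_functor: "is_functor E E step_functor"
  unfolding is_functor_def
proof (intro conjI ballI impI)
  show "Farr step_functor (Id E a) = Id E (Fobj step_functor a)" if "a \<in> Obj E" for a
    using that by (auto intro!: is_step_arr_unique simp: is_step_arr_def hom_iff)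
  fix f g assume fg: "f \<in> Arr E" "g \<in> Arr E" "Cod E f = Dom E g"
  have "step_arr (g \<cdot> f) = step_arr g \<cdot> step_arr f"
  proof (rule is_step_arr_unique)
    have f: "f \<in> hom E (Dom E f) (Dom E g)" and g: "g \<in> hom E (Dom E g) (Cod E g)" using fg by (auto simp: hom_iff)
    have u: "step_arr g \<cdot> (step_arr f \<cdot> unit (Dom E f)) = unit (Cod E g) \<cdot> (g \<cdot> f)"
      using step_arr_unit[OF f] comp_assoc_eq[OF step_arr_unit[OF g], of f] fg by simp
    have c: "step_arr g \<cdot> (step_arr f \<cdot> cell (Dom E f) y s) = cell (Cod E g) y (g \<cdot> (f \<cdot> s))"
      if "y \<in> Y" "s \<in> hom E (Dom E y) (Dom E f)" for y s
      using step_arr_cell[OF f that] step_arr_cell[OF g that(1), of "f \<cdot> s"] that fg by (simp add: hom_iff)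
    show "is_step_arr (g \<cdot> f) (step_arr g \<cdot> step_arr f)"
      using u c fg by (simp add: is_step_arr_def hom_iff)
  qed (use fg in simp)
  then show "Farr step_functor (g \<cdot> f) = Farr step_functor g \<cdot> Farr step_functor f" by simp
qed (auto simp: cat hom_iff)

lemma unit_closed:
  assumes "cell_closed TYPE('u) E L" "Y \<subseteq> L" "f \<in> Obj E"
  shows "unit f \<in> L"
  by (rule attaches_closed[OF cat cocomplete assms(1) small_cells[OF assms(3)] attaches_step[OF assms(3)]])
    (use assms(2) in \<open>auto simp: cells_def\<close>)

text \<open>Because domains in \<open>Y\<close> are \<open>mu\<close>-compact, the cells over a
  \<open>mu\<close>-directed colimit are the colimit of the cells over the stages: each attaching
  map comes from a stage, and two origins of it merge.\<close>

lemma step_preserves: "preserves_directed_colimits mu E E step_functor"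
  unfolding preserves_directed_colimits_def
proof (intro allI impI)
  fix r D c t assume "directed_poset mu r \<and> is_colimit (poset_category r) E D c t"
  then have r: "directed_poset mu r" and colim: "is_colimit (poset_category r) E D c t" by auto
  note D = diagramD[OF colimitD(1)[OF colim]] and t = cocone_posetD[OF colimitD(2)[OF colim]]
  have rField: "\<And>i j. (i, j) \<in> r \<Longrightarrow> i \<in> Field r \<and> j \<in> Field r" by (auto simp: Field_def)
  have th: "t i \<in> hom E (Fobj D i) c" if "i \<in> Field r" for i using t(2-4)[OF that] by (simp add: hom_iff)
  have Dh: "Farr D (i, j) \<in> hom E (Fobj D i) (Fobj D j)" if "(i, j) \<in> r" for i j using D(2-4)[OF that] by (simp add: hom_iff)
  note T = functorD[OF step_functor_functor, simplified]
  show "is_colimit (poset_category r) E (functor_comp step_functor D) (Fobj step_functor c) (\<lambda>i. Farr step_functor (t i))"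
  proof (rule colimitI)
    show "is_functor (poset_category r) E (functor_comp step_functor D)"
      using functor_compI[OF colimitD(1)[OF colim] step_functor_functor] .
    show "is_cocone (poset_category r) E (functor_comp step_functor D) (Fobj step_functor c) (\<lambda>i. Farr step_functor (t i))"
      unfolding cocone_poset_iff
    proof (intro conjI allI impI ballI)
      show "Farr step_functor (t j) \<cdot> Farr (functor_comp step_functor D) (i, j) = Farr step_functor (t i)"
        if ij: "(i, j) \<in> r" for i j
        using T(8)[of "Farr D (i, j)" "t j"] t(5)[OF ij] D(2-4)[OF ij] t(2-4)[of j] rField[OF ij] by simp
    qed (use t in \<open>auto simp: hom_iff\<close>)
    fix d w assume w0: "is_cocone (poset_category r) E (functor_comp step_functor D) d w"
    note w = cocone_posetD[OF w0, simplified]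
    have "is_cocone (poset_category r) E D d (\<lambda>i. w i \<cdot> unit (Fobj D i))"
      unfolding cocone_poset_iff
    proof (intro conjI allI impI ballI)
      fix i j assume ij: "(i, j) \<in> r"
      note ij' = conjunct1[OF rField[OF ij]] conjunct2[OF rField[OF ij]]
      have "w j \<cdot> unit (Fobj D j) \<cdot> Farr D (i, j) = w j \<cdot> (step_arr (Farr D (i, j)) \<cdot> unit (Fobj D i))"
        using step_arr_unit[OF Dh[OF ij]] D(2-4)[OF ij] w(2-4)[OF ij'(2)] D(1)[OF ij'(2)] by simp
      also have "\<dots> = w i \<cdot> unit (Fobj D i)"
        using D(2-4)[OF ij] w(2-4)[OF ij'(2)] D(1)[OF ij'(1)] w(5)[OF ij] by (intro comp_assoc_eq) simp_all
      finally show "w j \<cdot> unit (Fobj D j) \<cdot> Farr D (i, j) = w i \<cdot> unit (Fobj D i)" .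
    qed (use w D(1) in \<open>auto simp: hom_iff\<close>)
    from colimit_factor[OF colim this] obtain a where
      a: "a \<in> hom E c d" "\<And>i. i \<in> Field r \<Longrightarrow> a \<cdot> t i = w i \<cdot> unit (Fobj D i)" by auto
    have indep: "w i \<cdot> cell (Fobj D i) y s = w j \<cdot> cell (Fobj D j) y (Farr D (i, j) \<cdot> s)"
      if ij: "(i, j) \<in> r" and y: "y \<in> Y" and s: "s \<in> hom E (Dom E y) (Fobj D i)" for i j y s
    proof -
      note ij' = conjunct1[OF rField[OF ij]] conjunct2[OF rField[OF ij]]
      have "w i \<cdot> cell (Fobj D i) y s = w j \<cdot> (step_arr (Farr D (i, j)) \<cdot> cell (Fobj D i) y s)"
        using comp_assoc_eq[OF w(5)[OF ij], of "cell (Fobj D i) y s"] D(2-4)[OF ij] w(2-4)[OF ij'(2)] D(1)[OF ij'(1)] y s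
        by (simp add: hom_iff)
      then show ?thesis using step_arr_cell[OF Dh[OF ij] y s] by simp
    qed
    have "\<exists>i s'. i \<in> Field r \<and> s' \<in> hom E (Dom E y) (Fobj D i) \<and> t i \<cdot> s' = s"
      if "y \<in> Y" "s \<in> hom E (Dom E y) c" for y s
      using compact_factor[OF Dom_compact[OF that(1)] r colim that(2)] by metis
    \<comment> \<open>\<open>I y s\<close> is a chosen stage from which the attaching map
      \<open>s\<close> comes, and \<open>S y s\<close> its chosen origin there.\<close>
    then obtain I S where IS: "\<And>y s. y \<in> Y \<Longrightarrow> s \<in> hom E (Dom E y) c \<Longrightarrow>
      I y s \<in> Field r \<and> S y s \<in> hom E (Dom E y) (Fobj D (I y s)) \<and> t (I y s) \<cdot> S y s = s" by metis
    define k where "k y s = w (I y s) \<cdot> cell (Fobj D (I y s)) y (S y s)" for y s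
    \<comment> \<open>Independence of the choice: two origins of one attaching map merge at a stage
      \<open>m\<close>, and \<open>indep\<close> moves cells forward to it.\<close>
    have k: "k y (t i \<cdot> s) = w i \<cdot> cell (Fobj D i) y s"
      if i: "i \<in> Field r" and y: "y \<in> Y" and s: "s \<in> hom E (Dom E y) (Fobj D i)" for i y s
    proof -
      have ts: "t i \<cdot> s \<in> hom E (Dom E y) c" using t(2-4)[OF i] s by (simp add: hom_iff)
      note IS' = IS[OF y ts]
      obtain m where "(I y (t i \<cdot> s), m) \<in> r" "(i, m) \<in> r"
        "Farr D (I y (t i \<cdot> s), m) \<cdot> S y (t i \<cdot> s) = Farr D (i, m) \<cdot> s"
        using compact_merge2[OF mu Dom_compact[OF y] r colim _ i _ s, of "I y (t i \<cdot> s)" "S y (t i \<cdot> s)"] IS' by metis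
      then show ?thesis using indep[OF _ y] IS' s by (metis k_def)
    qed
    have "k y s \<in> hom E (Cod E y) d \<and> k y s \<cdot> y = a \<cdot> s" if y: "y \<in> Y" and s: "s \<in> hom E (Dom E y) c" for y s
    proof -
      let ?i = "I y s" and ?s = "S y s"
      have i: "?i \<in> Field r" and s': "?s \<in> hom E (Dom E y) (Fobj D ?i)" "t ?i \<cdot> ?s = s" using IS[OF y s] by auto
      note [simp] = D(1)[OF i] w(2-4)[OF i] t(2-4)[OF i]
      have yA: "y \<in> Arr E" using y Y by blast
      have sA: "?s \<in> Arr E" "Dom E ?s = Dom E y" "Cod E ?s = Fobj D ?i" using s'(1) by (auto simp: hom_iff)
      have "k y s \<cdot> y = w ?i \<cdot> (unit (Fobj D ?i) \<cdot> ?s)"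
        using yA sA y by (simp add: k_def)
      also have "\<dots> = a \<cdot> t ?i \<cdot> ?s" unfolding a(2)[OF i] using sA by simp
      also have "\<dots> = a \<cdot> s" using a(1) sA s'(2) by (simp add: hom_iff)
      finally show ?thesis using sA y yA by (simp add: k_def hom_iff)
    qed
    from step_factor[OF t(1) a(1) this] obtain h where h: "h \<in> hom E (step_obj c) d" "h \<cdot> unit c = a"
      "\<And>y s. y \<in> Y \<Longrightarrow> s \<in> hom E (Dom E y) c \<Longrightarrow> h \<cdot> cell c y s = k y s" by blast
    have "h \<cdot> step_arr (t i) = w i" if i: "i \<in> Field r" for i
    proof (rule step_eqI[OF D(1)[OF i], of _ d])
      note [simp] = D(1)[OF i] w(2-4)[OF i] t(1) t(2-4)[OF i]
      have hA: "h \<in> Arr E" "Dom E h = step_obj c" "Cod E h = d" using h(1) by (auto simp: hom_iff)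
      show "h \<cdot> step_arr (t i) \<cdot> unit (Fobj D i) = w i \<cdot> unit (Fobj D i)"
        using step_arr_unit[OF th[OF i]] comp_assoc_eq[OF h(2), of "t i"] hA a(2)[OF i] by simp
      show "h \<cdot> step_arr (t i) \<cdot> cell (Fobj D i) y s = w i \<cdot> cell (Fobj D i) y s"
        if y: "y \<in> Y" and s: "s \<in> hom E (Dom E y) (Fobj D i)" for y s
        using step_arr_cell[OF th[OF i] y s] h(3)[OF y, of "t i \<cdot> s"] k[OF i y s] hA y s by (simp add: hom_iff)
      show "h \<cdot> step_arr (t i) \<in> hom E (step_obj (Fobj D i)) d" "w i \<in> hom E (step_obj (Fobj D i)) d"
        using hA by (auto simp: hom_iff)
    qed
    then show "\<exists>h. h \<in> hom E (Fobj step_functor c) d \<and>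
        (\<forall>j\<in>Obj (poset_category r). h \<cdot> Farr step_functor (t j) = w j)"
      using h(1) by auto
  next
    fix d h h' assume h: "h \<in> hom E (Fobj step_functor c) d" "h' \<in> hom E (Fobj step_functor c) d"
      and "\<And>j. j \<in> Obj (poset_category r) \<Longrightarrow> h \<cdot> Farr step_functor (t j) = h' \<cdot> Farr step_functor (t j)"
    then have eq: "h \<cdot> step_arr (t j) = h' \<cdot> step_arr (t j)" if "j \<in> Field r" for j using that by simp
    have hA: "h \<in> Arr E" "Dom E h = step_obj c" "Cod E h = d" "h' \<in> Arr E" "Dom E h' = step_obj c" "Cod E h' = d"
      using h by (auto simp: hom_iff)
    have *: "h \<cdot> (step_arr (t i) \<cdot> x) = h' \<cdot> (step_arr (t i) \<cdot> x)"
      if i: "i \<in> Field r" and x: "x \<in> Arr E" "Cod E x = step_obj (Fobj D i)" for i x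
      using comp_assoc_eq[OF eq[OF i], of x] hA x t(2-4)[OF i] by simp
    show "h = h'"
    proof (rule step_eqI[OF t(1), of _ d])
      show "h \<cdot> unit c = h' \<cdot> unit c"
      proof (rule colimit_eqI[OF colim, of _ d])
        fix i assume "i \<in> Obj (poset_category r)"
        then have i: "i \<in> Field r" by simp
        show "h \<cdot> unit c \<cdot> t i = h' \<cdot> unit c \<cdot> t i"
          using *[OF i, of "unit (Fobj D i)"] step_arr_unit[OF th[OF i]] hA t(1) t(2-4)[OF i] D(1)[OF i] by simp
      qed (use hA t(1) in \<open>auto simp: hom_iff\<close>)
      fix y s assume y: "y \<in> Y" and s: "s \<in> hom E (Dom E y) c"
      obtain i s' where i: "i \<in> Field r" "s' \<in> hom E (Dom E y) (Fobj D i)" "t i \<cdot> s' = s"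
        using compact_factor[OF Dom_compact[OF y] r colim s] by metis
      show "h \<cdot> cell c y s = h' \<cdot> cell c y s"
        using *[OF i(1), of "cell (Fobj D i) y s'"] step_arr_cell[OF th[OF i(1)] y i(2)] i D(1)[OF i(1)] y
        by (simp add: hom_iff)
    qed (use h in auto)
  qed
qed

end

subsection \<open>Iterating a pointed endofunctor\<close>

text \<open>
  Components are extensional, so that natural transformations agreeing on objects are equal.
\<close>

definition functor_category ::
  "('o, 'a) category \<Rightarrow> ('p, 'b) category \<Rightarrow> (('o, 'a, 'p, 'b) cat_functor,
    ('o, 'a, 'p, 'b) cat_functor \<times> ('o \<Rightarrow> 'b) \<times> ('o, 'a, 'p, 'b) cat_functor) category" where
  "functor_category C D =
     \<lparr>Obj = {F. is_functor C D F},
      Arr = {(F, t, G). is_functor C D F \<and> is_functor C D G \<and> t \<in> extensional (Obj C) \<and>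
               (\<forall>a \<in> Obj C. t a \<in> hom D (Fobj F a) (Fobj G a)) \<and>
               (\<forall>f \<in> Arr C. Farr G f \<cdot>\<^bsub>D\<^esub> t (Dom C f) = t (Cod C f) \<cdot>\<^bsub>D\<^esub> Farr F f)},
      Dom = (\<lambda>(F, t, G). F), Cod = (\<lambda>(F, t, G). G),
      Id = (\<lambda>F. (F, \<lambda>a\<in>Obj C. Id D (Fobj F a), F)),
      Comp = (\<lambda>(G, t', H) (F, t, G'). (F, \<lambda>a\<in>Obj C. t' a \<cdot>\<^bsub>D\<^esub> t a, H))\<rparr>"

lemma functor_category_simps [simp]:
  "F \<in> Obj (functor_category C D) \<longleftrightarrow> is_functor C D F"
  "(F, t, G) \<in> Arr (functor_category C D) \<longleftrightarrow> is_functor C D F \<and> is_functor C D G \<and> t \<in> extensional (Obj C) \<and>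
     (\<forall>a \<in> Obj C. t a \<in> hom D (Fobj F a) (Fobj G a)) \<and>
     (\<forall>f \<in> Arr C. Farr G f \<cdot>\<^bsub>D\<^esub> t (Dom C f) = t (Cod C f) \<cdot>\<^bsub>D\<^esub> Farr F f)"
  "Dom (functor_category C D) (F, t, G) = F" "Cod (functor_category C D) (F, t, G) = G"
  "Id (functor_category C D) F = (F, \<lambda>a\<in>Obj C. Id D (Fobj F a), F)"
  "(G', t', H) \<cdot>\<^bsub>functor_category C D\<^esub> (F, t, G) = (F, \<lambda>a\<in>Obj C. t' a \<cdot>\<^bsub>D\<^esub> t a, H)"
  by (simp_all add: functor_category_def)

definition component :: "'f \<times> ('o \<Rightarrow> 'b) \<times> 'g \<Rightarrow> 'o \<Rightarrow> 'b" where
  "component w = fst (snd w)"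

lemma component_simp [simp]: "component (F, t, G) = t"
  by (simp add: component_def)

lemma functor_category_ArrD:
  assumes "w \<in> Arr (functor_category C D)"
  shows "is_functor C D (Dom (functor_category C D) w)" "is_functor C D (Cod (functor_category C D) w)"
    "a \<in> Obj C \<Longrightarrow> component w a \<in> Arr D"
    "a \<in> Obj C \<Longrightarrow> Dom D (component w a) = Fobj (Dom (functor_category C D) w) a"
    "a \<in> Obj C \<Longrightarrow> Cod D (component w a) = Fobj (Cod (functor_category C D) w) a"
    "f \<in> Arr C \<Longrightarrow> Farr (Cod (functor_category C D) w) f \<cdot>\<^bsub>D\<^esub> component w (Dom C f) =
      component w (Cod C f) \<cdot>\<^bsub>D\<^esub> Farr (Dom (functor_category C D) w) f"
  using assms by (cases w; auto simp: hom_iff[of _ D])+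

lemma component_comp:
  "a \<in> Obj C \<Longrightarrow> component (w' \<cdot>\<^bsub>functor_category C D\<^esub> w) a = component w' a \<cdot>\<^bsub>D\<^esub> component w a"
  by (cases w, cases w') simp

lemma functor_category_category:
  assumes C: "is_category C" and D: "is_category D"
  shows "is_category (functor_category C D)"
proof -
  interpret C: cat C by unfold_locales (rule C)
  interpret D: cat D by unfold_locales (rule D)
  show ?thesis
    unfolding is_category_def
  proof (intro conjI ballI impI)
    fix w w' assume w: "w \<in> Arr (functor_category C D)" "w' \<in> Arr (functor_category C D)"
      "Cod (functor_category C D) w = Dom (functor_category C D) w'"
    obtain F t G where w1: "w = (F, t, G)" by (cases w)
    obtain t' H where w2: "w' = (G, t', H)" using w(3) w1 by (cases w') simp
    have F: "is_functor C D F" and G: "is_functor C D G" and H: "is_functor C D H"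
      using w by (auto simp: w1 w2)
    note [simp] = functorD[OF F] functorD[OF G] functorD[OF H]
    have "Farr H f \<cdot>\<^bsub>D\<^esub> (t' (Dom C f) \<cdot>\<^bsub>D\<^esub> t (Dom C f)) = t' (Cod C f) \<cdot>\<^bsub>D\<^esub> t (Cod C f) \<cdot>\<^bsub>D\<^esub> Farr F f"
      if f: "f \<in> Arr C" for f
    proof -
      have t: "t (Dom C f) \<in> hom D (Fobj F (Dom C f)) (Fobj G (Dom C f))"
        "t (Cod C f) \<in> hom D (Fobj F (Cod C f)) (Fobj G (Cod C f))"
        "t' (Dom C f) \<in> hom D (Fobj G (Dom C f)) (Fobj H (Dom C f))"
        "t' (Cod C f) \<in> hom D (Fobj G (Cod C f)) (Fobj H (Cod C f))"
        "Farr G f \<cdot>\<^bsub>D\<^esub> t (Dom C f) = t (Cod C f) \<cdot>\<^bsub>D\<^esub> Farr F f"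
        "Farr H f \<cdot>\<^bsub>D\<^esub> t' (Dom C f) = t' (Cod C f) \<cdot>\<^bsub>D\<^esub> Farr G f"
        using w f by (auto simp: w1 w2)
      have "Farr H f \<cdot>\<^bsub>D\<^esub> (t' (Dom C f) \<cdot>\<^bsub>D\<^esub> t (Dom C f)) = t' (Cod C f) \<cdot>\<^bsub>D\<^esub> Farr G f \<cdot>\<^bsub>D\<^esub> t (Dom C f)"
        using t(1-4) f by (intro D.comp_assoc_eq[OF t(6)]) (auto simp: hom_iff)
      also have "\<dots> = t' (Cod C f) \<cdot>\<^bsub>D\<^esub> t (Cod C f) \<cdot>\<^bsub>D\<^esub> Farr F f"
        using t(1-5) f by (simp add: hom_iff)
      finally show ?thesis .
    qed
    moreover have "t' a \<cdot>\<^bsub>D\<^esub> t a \<in> hom D (Fobj F a) (Fobj H a)" if "a \<in> Obj C" for a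
      using w that by (auto simp: w1 w2 intro: D.hom_comp)
    ultimately show "w' \<cdot>\<^bsub>functor_category C D\<^esub> w \<in>
        hom (functor_category C D) (Dom (functor_category C D) w) (Cod (functor_category C D) w')"
      using F H w(1,2) by (auto simp: w1 w2 hom_iff[of _ "functor_category C D"])
  next
    fix w w' w'' assume w: "w \<in> Arr (functor_category C D)" "w' \<in> Arr (functor_category C D)" "w'' \<in> Arr (functor_category C D)"
      "Cod (functor_category C D) w = Dom (functor_category C D) w' \<and> Cod (functor_category C D) w' = Dom (functor_category C D) w''"
    obtain F t G where w1: "w = (F, t, G)" by (cases w)
    obtain t' H where w2: "w' = (G, t', H)" using w(4) w1 by (cases w') simp
    obtain t'' K where w3: "w'' = (H, t'', K)" using w(4) w2 by (cases w'') simp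
    show "w'' \<cdot>\<^bsub>functor_category C D\<^esub> (w' \<cdot>\<^bsub>functor_category C D\<^esub> w)
        = w'' \<cdot>\<^bsub>functor_category C D\<^esub> w' \<cdot>\<^bsub>functor_category C D\<^esub> w"
      using w(1-3) by (auto simp: w1 w2 w3 hom_iff[of _ D] fun_eq_iff)
  next
    fix F assume "F \<in> Obj (functor_category C D)"
    then have F: "is_functor C D F" by simp
    note [simp] = functorD[OF F]
    show "Id (functor_category C D) F \<in> hom (functor_category C D) F F"
      using F by (auto simp: hom_iff)
  next
    fix w assume w: "w \<in> Arr (functor_category C D)"
    obtain F t G where w1: "w = (F, t, G)" by (cases w)
    have "(\<lambda>a\<in>Obj C. (\<lambda>a\<in>Obj C. Id D (Fobj G a)) a \<cdot>\<^bsub>D\<^esub> t a) = t" "(\<lambda>a\<in>Obj C. t a \<cdot>\<^bsub>D\<^esub> (\<lambda>a\<in>Obj C. Id D (Fobj F a)) a) = t"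
      using w by (auto simp: w1 fun_eq_iff hom_iff[of _ D] extensional_def)
    then show "w \<cdot>\<^bsub>functor_category C D\<^esub> Id (functor_category C D) (Dom (functor_category C D) w) = w"
      "Id (functor_category C D) (Cod (functor_category C D) w) \<cdot>\<^bsub>functor_category C D\<^esub> w = w"
      by (simp_all add: w1)
  qed (auto simp: functor_category_def)
qed

definition evaluation :: "'o \<Rightarrow> (('o, 'a, 'p, 'b) cat_functor, ('o, 'a, 'p, 'b) cat_functor \<times> ('o \<Rightarrow> 'b) \<times> ('o, 'a, 'p, 'b) cat_functor, 'p, 'b) cat_functor" where
  "evaluation a = \<lparr>Fobj = (\<lambda>F. Fobj F a), Farr = (\<lambda>w. component w a)\<rparr>"

lemma evaluation_simps [simp]: "Fobj (evaluation a) F = Fobj F a" "Farr (evaluation a) w = component w a"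
  by (simp_all add: evaluation_def)

lemma evaluation_functor:
  assumes "is_category C" "is_category D" "a \<in> Obj C"
  shows "is_functor (functor_category C D) D (evaluation a)"
  unfolding is_functor_def
  using assms functor_category_category[OF assms(1,2)] functorD(3)[of C D _ a]
  by (auto simp: hom_iff functor_category_ArrD component_comp)

text \<open>Universality at each object yields the action of \<open>F\<close> on arrows and its
  functor laws. The result keeps the universal property object by object, the form in which
  smoothness, preservation and injectivity are checked later.\<close>

lemma pointwise_cocone:
  assumes C: "is_category C" and D: "is_category D" and X: "is_functor J (functor_category C D) X"
    and pw: "\<And>a. a \<in> Obj C \<Longrightarrow> \<exists>c t. is_colimit J D (functor_comp (evaluation a) X) c t"
  obtains F t where "is_cocone J (functor_category C D) X F t"
    "\<And>a. a \<in> Obj C \<Longrightarrow> is_colimit J D (functor_comp (evaluation a) X) (Fobj F a) (\<lambda>j. component (t j) a)"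
proof -
  interpret C: cat C by unfold_locales (rule C)
  interpret D: cat D by unfold_locales (rule D)
  interpret J: cat J using functorD(1)[OF X] by unfold_locales
  note X' = functorD[OF X]
  have XF: "\<And>j. j \<in> Obj J \<Longrightarrow> is_functor C D (Fobj X j)" using X'(3) by simp
  note XF' = functorD[OF XF]
  obtain c t where ct: "\<And>a. a \<in> Obj C \<Longrightarrow> is_colimit J D (functor_comp (evaluation a) X) (c a) (t a)"
    using pw by metis
  note t = coconeD[OF colimitD(2)[OF ct], simplified]
  have XA: "component (Farr X k) a \<in> Arr D" "Dom D (component (Farr X k) a) = Fobj (Fobj X (Dom J k)) a"
    "Cod D (component (Farr X k) a) = Fobj (Fobj X (Cod J k)) a" if "k \<in> Arr J" "a \<in> Obj C" for k a
    using functor_category_ArrD(3-5)[OF X'(4)[OF that(1)] that(2)] X'(5,6)[OF that(1)] by simp_all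
  have nat: "Farr (Fobj X (Cod J k)) f \<cdot>\<^bsub>D\<^esub> component (Farr X k) (Dom C f)
      = component (Farr X k) (Cod C f) \<cdot>\<^bsub>D\<^esub> Farr (Fobj X (Dom J k)) f" if "k \<in> Arr J" "f \<in> Arr C" for k f
    using functor_category_ArrD(6)[OF X'(4)[OF that(1)] that(2)] X'(5,6)[OF that(1)] by simp
  have "\<exists>h. h \<in> hom D (c (Dom C f)) (c (Cod C f)) \<and> (\<forall>j \<in> Obj J. h \<cdot>\<^bsub>D\<^esub> t (Dom C f) j = t (Cod C f) j \<cdot>\<^bsub>D\<^esub> Farr (Fobj X j) f)"
    if f: "f \<in> Arr C" for f
  proof -
    have "is_cocone J D (functor_comp (evaluation (Dom C f)) X) (c (Cod C f)) (\<lambda>j. t (Cod C f) j \<cdot>\<^bsub>D\<^esub> Farr (Fobj X j) f)"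
      unfolding is_cocone_def
    proof (intro conjI ballI)
      fix k assume k: "k \<in> Arr J"
      note [simp] = XA[OF k] XF'[OF J.Dom_Obj[OF k]] XF'[OF J.Cod_Obj[OF k]] t(1-4)
      have "t (Cod C f) (Cod J k) \<cdot>\<^bsub>D\<^esub> Farr (Fobj X (Cod J k)) f \<cdot>\<^bsub>D\<^esub> component (Farr X k) (Dom C f)
          = t (Cod C f) (Cod J k) \<cdot>\<^bsub>D\<^esub> (component (Farr X k) (Cod C f) \<cdot>\<^bsub>D\<^esub> Farr (Fobj X (Dom J k)) f)"
        using f k nat[OF k f] by simp
      also have "\<dots> = t (Cod C f) (Dom J k) \<cdot>\<^bsub>D\<^esub> Farr (Fobj X (Dom J k)) f"
        using f k t(5)[OF C.Cod_Obj[OF f] k] by (intro D.comp_assoc_eq) simp_all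
      finally show "t (Cod C f) (Cod J k) \<cdot>\<^bsub>D\<^esub> Farr (Fobj X (Cod J k)) f \<cdot>\<^bsub>D\<^esub> Farr (functor_comp (evaluation (Dom C f)) X) k
          = t (Cod C f) (Dom J k) \<cdot>\<^bsub>D\<^esub> Farr (Fobj X (Dom J k)) f" by simp
    qed (use t(1-4) f XF' in \<open>auto simp: hom_iff\<close>)
    from colimit_factor[OF ct[OF C.Dom_Obj[OF f]] this] show ?thesis by metis
  qed
  then obtain m where m: "\<And>f. f \<in> Arr C \<Longrightarrow> m f \<in> hom D (c (Dom C f)) (c (Cod C f))"
    "\<And>f j. f \<in> Arr C \<Longrightarrow> j \<in> Obj J \<Longrightarrow> m f \<cdot>\<^bsub>D\<^esub> t (Dom C f) j = t (Cod C f) j \<cdot>\<^bsub>D\<^esub> Farr (Fobj X j) f"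
    by metis
  have mA: "m f \<in> Arr D" "Dom D (m f) = c (Dom C f)" "Cod D (m f) = c (Cod C f)" if "f \<in> Arr C" for f
    using m(1)[OF that] by (auto simp: hom_iff)
  define F where "F = \<lparr>Fobj = c, Farr = m\<rparr>"
  have F: "is_functor C D F"
    unfolding is_functor_def
  proof (intro conjI ballI impI C D)
    show "Farr F (Id C a) = Id D (Fobj F a)" if a: "a \<in> Obj C" for a
      unfolding F_def cat_functor.simps
    proof (rule colimit_eqI[OF ct[OF a], of _ "c a"])
      show "m (Id C a) \<cdot>\<^bsub>D\<^esub> t a j = Id D (c a) \<cdot>\<^bsub>D\<^esub> t a j" if "j \<in> Obj J" for j
        using m(2)[of "Id C a" j] a that t(1-4)[OF a] XF'(7)[OF that a] by simp
    qed (use m(1)[of "Id C a"] a t(1)[OF a] in \<open>auto simp: hom_iff\<close>)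
    show "Farr F (g \<cdot>\<^bsub>C\<^esub> f) = Farr F g \<cdot>\<^bsub>D\<^esub> Farr F f"
      if f: "f \<in> Arr C" and g: "g \<in> Arr C" and fg: "Cod C f = Dom C g" for f g
      unfolding F_def cat_functor.simps
    proof (rule colimit_eqI[OF ct[OF C.Dom_Obj[OF f]], of _ "c (Cod C g)"])
      fix j assume j: "j \<in> Obj J"
      note [simp] = mA t(1-4) XF'[OF j]
      have "m g \<cdot>\<^bsub>D\<^esub> m f \<cdot>\<^bsub>D\<^esub> t (Dom C f) j = m g \<cdot>\<^bsub>D\<^esub> (t (Dom C g) j \<cdot>\<^bsub>D\<^esub> Farr (Fobj X j) f)"
        using m(2)[OF f j] f g j fg by simp
      also have "\<dots> = t (Cod C g) j \<cdot>\<^bsub>D\<^esub> Farr (Fobj X j) g \<cdot>\<^bsub>D\<^esub> Farr (Fobj X j) f"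
        using m(2)[OF g j] f g j fg by (intro D.comp_assoc_eq) simp_all
      also have "\<dots> = m (g \<cdot>\<^bsub>C\<^esub> f) \<cdot>\<^bsub>D\<^esub> t (Dom C f) j"
        using m(2)[of "g \<cdot>\<^bsub>C\<^esub> f" j] f g fg j by simp
      finally show "m (g \<cdot>\<^bsub>C\<^esub> f) \<cdot>\<^bsub>D\<^esub> t (Dom C f) j = m g \<cdot>\<^bsub>D\<^esub> m f \<cdot>\<^bsub>D\<^esub> t (Dom C f) j" by simp
    qed (use mA f g fg in \<open>auto simp: hom_iff\<close>)
  qed (use m t(1) in \<open>auto simp: F_def\<close>)
  define s where "s j = (Fobj X j, \<lambda>a\<in>Obj C. t a j, F)" for j
  have "is_cocone J (functor_category C D) X F s"
    unfolding is_cocone_def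
  proof (intro conjI ballI)
    show "s j \<in> hom (functor_category C D) (Fobj X j) F" if j: "j \<in> Obj J" for j
    proof -
      have "m f \<cdot>\<^bsub>D\<^esub> t (Dom C f) j = t (Cod C f) j \<cdot>\<^bsub>D\<^esub> Farr (Fobj X j) f" if "f \<in> Arr C" for f
        using m(2)[OF that j] .
      then show ?thesis
        using F XF[OF j] t(2-4) j by (auto simp: s_def hom_iff F_def)
    qed
    fix k assume k: "k \<in> Arr J"
    obtain \<tau> where \<tau>: "Farr X k = (Fobj X (Dom J k), \<tau>, Fobj X (Cod J k))"
      using X'(5,6)[OF k] by (cases "Farr X k") simp
    have "t a (Cod J k) \<cdot>\<^bsub>D\<^esub> \<tau> a = t a (Dom J k)" if "a \<in> Obj C" for a
      using t(5)[OF that k] by (simp add: \<tau>)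
    then show "s (Cod J k) \<cdot>\<^bsub>functor_category C D\<^esub> Farr X k = s (Dom J k)"
      by (auto simp: s_def \<tau> fun_eq_iff)
  qed (use F in simp)
  moreover have "is_colimit J D (functor_comp (evaluation a) X) (Fobj F a) (\<lambda>j. component (s j) a)" if a: "a \<in> Obj C" for a
    using ct[OF a] a by (simp add: s_def F_def)
  ultimately show ?thesis using that by blast
qed

context univ
begin

section \<open>Transfinite recursion along the ordinals\<close>

lemma succ_not_limit:
  assumes "is_succ ordinals i j"
  shows "\<not> limit_element ordinals j"
proof
  assume "limit_element ordinals j"
  moreover have i: "i \<in> underS ordinals j" using assms by (simp add: is_succ_def)
  ultimately obtain k where k: "k \<in> underS ordinals j" "i \<in> underS ordinals k"
    unfolding limit_element_def by blast
  then have "(k, i) \<in> ordinals" using assms by (simp add: is_succ_def)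
  then show False using k(2) ordinals_antisym[of i k] by (simp add: underS_iff)
qed

text \<open>Transfinite recursion in a category where \<open>\<sigma>\<close> prescribes the
  successor step. The predicate \<open>Q\<close> abstracts what is asked of the cocone at a limit,
  since for endofunctors this is a pointwise colimit; \<open>Q_cong\<close> says that it sees the
  diagram below \<open>j\<close> only.\<close>

lemma sequence_exists:
  fixes C :: "('o, 'a) category"
  assumes C: "is_category C" and c0: "c0 \<in> Obj C"
    and \<sigma>: "\<And>c. c \<in> Obj C \<Longrightarrow> \<sigma> c \<in> Arr C" "\<And>c. c \<in> Obj C \<Longrightarrow> Dom C (\<sigma> c) = c"
    and Q: "\<And>j D. limit_element ordinals j \<Longrightarrow> is_functor (poset_category (Restr ordinals (underS ordinals j))) C D \<Longrightarrow>
      \<exists>c t. is_cocone (poset_category (Restr ordinals (underS ordinals j))) C D c t \<and> Q j D c t"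
    and Q_cong: "\<And>j D D' c t t'. Q j D c t \<Longrightarrow> is_functor (poset_category (Restr ordinals (underS ordinals j))) C D \<Longrightarrow>
      (\<And>i. i \<in> underS ordinals j \<Longrightarrow> Fobj D i = Fobj D' i) \<Longrightarrow>
      (\<And>i k. (i, k) \<in> Restr ordinals (underS ordinals j) \<Longrightarrow> Farr D (i, k) = Farr D' (i, k)) \<Longrightarrow>
      (\<And>i. i \<in> underS ordinals j \<Longrightarrow> t i = t' i) \<Longrightarrow> Q j D' c t'"
  obtains A where "is_functor (poset_category ordinals) C A"
    "\<And>z. underS ordinals z = {} \<Longrightarrow> Fobj A z = c0"
    "\<And>i j. is_succ ordinals i j \<Longrightarrow> Farr A (i, j) = \<sigma> (Fobj A i)"
    "\<And>j. limit_element ordinals j \<Longrightarrow> Q j A (Fobj A j) (\<lambda>i. Farr A (i, j))"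
proof -
  interpret cat C by unfold_locales (rule C)
  \<comment> \<open>The values already constructed, read as a diagram below \<open>j\<close>. The
    defaults \<open>c0\<close> and \<open>Id C c0\<close> make it depend only on values below
    \<open>j\<close>, which well-founded recursion demands.\<close>
  define diagram :: "'u \<Rightarrow> ('u \<Rightarrow> 'o \<times> ('u \<Rightarrow> 'a)) \<Rightarrow> ('u, 'u \<times> 'u, 'o, 'a) cat_functor" where
    "diagram j f = \<lparr>Fobj = (\<lambda>i. if i \<in> underS ordinals j then fst (f i) else c0),
       Farr = (\<lambda>(i, k). if k \<in> underS ordinals j then (if i = k then Id C (fst (f k)) else snd (f k) i) else Id C c0)\<rparr>" for j f
  \<comment> \<open>The value at \<open>j\<close> is an object together with all maps into it from
    earlier stages, \<open>snd p i\<close> being the map from stage \<open>i\<close>.\<close>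
  define P where "P f j p \<longleftrightarrow> fst p \<in> Obj C \<and> (\<forall>i \<in> underS ordinals j. snd p i \<in> hom C (fst (f i)) (fst p)) \<and>
      (\<forall>i \<in> underS ordinals j. \<forall>k \<in> underS ordinals i. snd p i \<cdot>\<^bsub>C\<^esub> snd (f i) k = snd p k) \<and>
      (underS ordinals j = {} \<longrightarrow> fst p = c0) \<and>
      (\<forall>i \<in> underS ordinals j. is_succ ordinals i j \<longrightarrow> fst p = Cod C (\<sigma> (fst (f i))) \<and> snd p i = \<sigma> (fst (f i))) \<and>
      (limit_element ordinals j \<longrightarrow> Q j (diagram j f) (fst p) (snd p))" for f j and p :: "'o \<times> ('u \<Rightarrow> 'a)"
  have "\<exists>f. \<forall>j. P f j (f j)"
  proof (rule dependent_wf_choice[OF ordinals_wf])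
    fix f g :: "'u \<Rightarrow> 'o \<times> ('u \<Rightarrow> 'a)" and j p assume "\<And>i. (i, j) \<in> ordinals - Relation.Id \<Longrightarrow> f i = g i"
    then have fg: "f i = g i" if "i \<in> underS ordinals j" for i using that by (auto simp: underS_iff)
    then have "diagram j f = diagram j g" by (auto simp: diagram_def fun_eq_iff)
    then show "P f j p = P g j p" using fg by (auto simp: P_def)
  next
    fix j and f :: "'u \<Rightarrow> 'o \<times> ('u \<Rightarrow> 'a)"
    assume "\<And>i. (i, j) \<in> ordinals - Relation.Id \<Longrightarrow> P f i (f i)"
    then have f: "P f i (f i)" if "i \<in> underS ordinals j" for i using that by (auto simp: underS_iff)
    have fO: "fst (f i) \<in> Obj C" if "i \<in> underS ordinals j" for i using f[OF that] by (simp add: P_def)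
    have fA: "snd (f i) k \<in> hom C (fst (f k)) (fst (f i))" if "i \<in> underS ordinals j" "k \<in> underS ordinals i" for i k
      using f[OF that(1)] that(2) by (simp add: P_def)
    have fC: "snd (f i) k \<cdot>\<^bsub>C\<^esub> snd (f k) l = snd (f i) l" if "i \<in> underS ordinals j" "k \<in> underS ordinals i" "l \<in> underS ordinals k" for i k l
      using f[OF that(1)] that(2,3) by (simp add: P_def)
    let ?R = "Restr ordinals (underS ordinals j)"
    have D: "is_functor (poset_category ?R) C (diagram j f)"
    proof (rule diagramI[OF C Refl_Restr_ordinals trans_Restr_ordinals])
      show "Farr (diagram j f) (i, k) \<in> hom C (Fobj (diagram j f) i) (Fobj (diagram j f) k)" if "(i, k) \<in> ?R" for i k
        using that fO fA by (auto simp: diagram_def hom_iff[of "Id C _"] underS_iff)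
      show "Farr (diagram j f) (k, l) \<cdot>\<^bsub>C\<^esub> Farr (diagram j f) (i, k) = Farr (diagram j f) (i, l)"
        if ik: "(i, k) \<in> ?R" and kl: "(k, l) \<in> ?R" for i k l
      proof (cases "i = k \<or> k = l")
        case True
        then show ?thesis using ik kl fO fA[of l i] by (auto simp: diagram_def hom_iff underS_iff)
      next
        case False
        then have k: "k \<in> underS ordinals l" "i \<in> underS ordinals k" using ik kl by (auto simp: underS_iff)
        moreover have "i \<noteq> l" using k ordinals_antisym by (auto simp: underS_iff)
        ultimately show ?thesis using False ik kl fC by (auto simp: diagram_def)
      qed
    qed (use fO in \<open>auto simp: diagram_def\<close>)
    show "\<exists>p. P f j p"
    proof (cases j rule: ordinals_cases)
      case zero
      then have "P f j (c0, undefined)" by (simp add: P_def c0 limit_element_def is_succ_def)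
      then show ?thesis by blast
    next
      case (succ i)
      then have i: "i \<in> underS ordinals j" by (simp add: is_succ_def)
      have below: "k = i \<or> k \<in> underS ordinals i" if "k \<in> underS ordinals j" for k
        using succ that by (auto simp: is_succ_def underS_iff)
      have not_limit: "\<not> limit_element ordinals j"
        using succ_not_limit[OF succ] .
      have uniq: "k = i" if "is_succ ordinals k j" for k
        using that succ ordinals_antisym by (auto simp: is_succ_def)
      note [simp] = \<sigma>(1)[OF fO[OF i]] \<sigma>(2)[OF fO[OF i]] fO[OF i]
      \<comment> \<open>The map from a stage before \<open>i\<close> is the one into stage
        \<open>i\<close> followed by \<open>\<sigma>\<close>.\<close>
      let ?p = "(Cod C (\<sigma> (fst (f i))), \<lambda>k. if k = i then \<sigma> (fst (f i)) else \<sigma> (fst (f i)) \<cdot>\<^bsub>C\<^esub> snd (f i) k)"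
      have ii: "i \<notin> underS ordinals i" by (simp add: underS_iff)
      have "snd ?p k \<in> hom C (fst (f k)) (fst ?p)" if "k \<in> underS ordinals j" for k
        using below[OF that] fA[OF i, of k] by (auto simp: hom_iff)
      moreover have "snd ?p k \<cdot>\<^bsub>C\<^esub> snd (f k) l = snd ?p l" if k: "k \<in> underS ordinals j" and l: "l \<in> underS ordinals k" for k l
      proof (cases "k = i")
        case True
        then show ?thesis using l by (auto simp: underS_iff)
      next
        case False
        then have k': "k \<in> underS ordinals i" using below[OF k] by blast
        then have l': "l \<in> underS ordinals i" using l ordinals_underS_trans(1) by (auto simp: underS_iff[of k])
        have "l \<noteq> i" using l' ii by blast
        then show ?thesis
          using fA[OF i k'] fA[OF k l] fC[OF i k' l] False by (simp add: hom_iff)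
      qed
      moreover have "underS ordinals j \<noteq> {}" using i by blast
      ultimately have "P f j ?p"
        using not_limit uniq unfolding P_def by auto
      then show ?thesis by blast
    next
      case limit
      then obtain c t where ct: "is_cocone (poset_category ?R) C (diagram j f) c t" "Q j (diagram j f) c t"
        using Q[OF limit D] by blast
      note t = cocone_posetD[OF ct(1), simplified]
      have no_succ: "\<not> is_succ ordinals i j" for i
        using limit succ_not_limit by blast
      have "t i \<in> hom C (fst (f i)) c" if "i \<in> underS ordinals j" for i
        using t(2-4)[OF that] that by (simp add: hom_iff diagram_def)
      moreover have "t i \<cdot>\<^bsub>C\<^esub> snd (f i) k = t k" if "i \<in> underS ordinals j" "k \<in> underS ordinals i" for i k
      proof -
        have "(k, i) \<in> ordinals" "k \<noteq> i" using that(2) by (auto simp: underS_iff)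
        moreover have "k \<in> underS ordinals j" using ordinals_underS_trans(2)[OF \<open>(k, i) \<in> ordinals\<close> that(1)] .
        ultimately show ?thesis using t(5)[of k i] that(1) by (simp add: diagram_def)
      qed
      ultimately have "P f j (c, t)"
        using t(1) ct(2) limit no_succ by (auto simp: P_def limit_element_def)
      then show ?thesis by blast
    qed
  qed
  then obtain f where f: "\<And>j. P f j (f j)" by blast
  define A where "A = \<lparr>Fobj = (\<lambda>i. fst (f i)), Farr = (\<lambda>(i, k). if i = k then Id C (fst (f k)) else snd (f k) i)\<rparr>"
  have A: "is_functor (poset_category ordinals) C A"
  proof (rule diagramI[OF C])
    show "Refl ordinals" by (simp add: refl_on_def)
    show "trans ordinals" using ordinals_trans by (meson transI)
    have fO: "fst (f i) \<in> Obj C" for i using f[of i] by (simp add: P_def)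
    have fA: "snd (f i) k \<in> hom C (fst (f k)) (fst (f i))" if "k \<in> underS ordinals i" for i k
      using f[of i] that by (simp add: P_def)
    show "Farr A (i, k) \<in> hom C (Fobj A i) (Fobj A k)" if "(i, k) \<in> ordinals" for i k
      using that fO fA by (auto simp: A_def hom_iff[of "Id C _"] underS_iff)
    show "Farr A (k, l) \<cdot>\<^bsub>C\<^esub> Farr A (i, k) = Farr A (i, l)" if ik: "(i, k) \<in> ordinals" and kl: "(k, l) \<in> ordinals" for i k l
    proof (cases "i = k \<or> k = l")
      case True
      then show ?thesis using ik kl fO fA[of i l] by (auto simp: A_def hom_iff underS_iff)
    next
      case False
      then have k: "k \<in> underS ordinals l" "i \<in> underS ordinals k" using ik kl by (auto simp: underS_iff)
      moreover have "i \<noteq> l" using k ordinals_antisym by (auto simp: underS_iff)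
      ultimately show ?thesis using False f[of l] by (auto simp: A_def P_def)
    qed
    show "Fobj A i \<in> Obj C" for i using fO by (simp add: A_def)
  qed (simp add: A_def)
  have 1: "Fobj A z = c0" if "underS ordinals z = {}" for z using f[of z] that by (simp add: A_def P_def)
  have 2: "Farr A (i, j) = \<sigma> (Fobj A i)" if ij: "is_succ ordinals i j" for i j
  proof -
    have "i \<in> underS ordinals j" using ij by (simp add: is_succ_def)
    then show ?thesis using f[of j] ij by (auto simp: A_def P_def underS_iff)
  qed
  \<comment> \<open>The recursion established \<open>Q\<close> for \<open>diagram j f\<close>, which
    agrees with \<open>A\<close> below \<open>j\<close>.\<close>
  have 3: "Q j A (Fobj A j) (\<lambda>i. Farr A (i, j))" if j: "limit_element ordinals j" for j
  proof -
    have "Q j (diagram j f) (Fobj A j) (snd (f j))" using f[of j] j by (simp add: A_def P_def)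
    moreover have "is_functor (poset_category (Restr ordinals (underS ordinals j))) C A"
      using diagramD[OF A] Refl_Restr_ordinals trans_Restr_ordinals by (intro diagramI) (auto simp: hom_iff)
    then have "is_functor (poset_category (Restr ordinals (underS ordinals j))) C (diagram j f)"
      by (rule functor_cong) (auto simp: diagram_def A_def)
    ultimately show ?thesis
      by (rule Q_cong) (auto simp: diagram_def A_def underS_iff)
  qed
  show ?thesis using that[OF A 1 2 3] by blast
qed

end

lemma functor_comp_assoc: "functor_comp H (functor_comp G F) = functor_comp (functor_comp H G) F"
  by (simp add: functor_comp_def comp_assoc)

lemma cocone_functor_comp:
  assumes F: "is_functor C D F" and X: "is_functor J C X" and t: "is_cocone J C X c t"
  shows "is_cocone J D (functor_comp F X) (Fobj F c) (\<lambda>j. Farr F (t j))"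
proof -
  interpret J: cat J using functorD(1)[OF X] by unfold_locales
  note t' = coconeD[OF t] and X' = functorD[OF X] and F' = functorD[OF F]
  have "Farr F (t (Cod J k)) \<cdot>\<^bsub>D\<^esub> Farr F (Farr X k) = Farr F (t (Dom J k))" if k: "k \<in> Arr J" for k
    using F'(8)[of "Farr X k" "t (Cod J k)"] t'(5)[OF k] X'(4-6)[OF k] t'(2,3)[of "Cod J k"] k by simp
  then show ?thesis using t' F' by (auto simp: is_cocone_def hom_iff)
qed

lemma preserves_comp:
  assumes "preserves_directed_colimits mu C D F" "preserves_directed_colimits mu D E G"
  shows "preserves_directed_colimits mu C E (functor_comp G F)"
  using assms unfolding preserves_directed_colimits_def by (simp flip: functor_comp_assoc)

lemma preserves_inclusion:
  "preserves_directed_colimits mu C C inclusion_functor"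
  unfolding preserves_directed_colimits_def
proof (intro allI impI)
  fix r X c t assume "directed_poset mu r \<and> is_colimit (poset_category r) C X c t"
  then show "is_colimit (poset_category r) C (functor_comp inclusion_functor X) (Fobj inclusion_functor c)
      (\<lambda>i. Farr inclusion_functor (t i))"
    using colimit_poset_cong[of r C X "functor_comp inclusion_functor X"] by (auto dest: colimitD(1))
qed

lemma inclusion_functor_functor: "is_category C \<Longrightarrow> is_functor C C inclusion_functor"
  by (auto simp: is_functor_def hom_iff cat.Dom_Obj cat.Cod_Obj cat.intro)

text \<open>Colimits commute with colimits: a cocone under \<open>P\<close> applied to
  \<open>Z\<close> restricts along each \<open>m i\<close> to one under \<open>Fobj X i\<close>
  applied to \<open>Z\<close>, which factors through the value at \<open>c\<close>; these
  factorizations form a cocone in \<open>i\<close> and so factor through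
  \<open>Fobj P c\<close>.\<close>

lemma preserves_pointwise_colimit:
  assumes X: "is_functor (poset_category s) (functor_category C D) X" and P: "is_functor C D P"
    and m: "is_cocone (poset_category s) (functor_category C D) X P m"
    and pw: "\<And>a. a \<in> Obj C \<Longrightarrow> is_colimit (poset_category s) D (functor_comp (evaluation a) X) (Fobj P a) (\<lambda>i. component (m i) a)"
    and pres: "\<And>i. i \<in> Field s \<Longrightarrow> preserves_directed_colimits mu C D (Fobj X i)"
  shows "preserves_directed_colimits mu C D P"
  unfolding preserves_directed_colimits_def
proof (intro allI impI)
  fix r Z c t assume "directed_poset mu r \<and> is_colimit (poset_category r) C Z c t"
  then have r: "directed_poset mu r" and colim: "is_colimit (poset_category r) C Z c t" by auto
  note F = colimitD(1)[OF colim]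
  note Z = diagramD[OF F] and t = cocone_posetD[OF colimitD(2)[OF colim]] and P' = functorD[OF P]
  interpret D: cat D using P'(2) by unfold_locales
  interpret C: cat C using P'(1) by unfold_locales
  have rField: "\<And>i j. (i, j) \<in> r \<Longrightarrow> i \<in> Field r \<and> j \<in> Field r" by (auto simp: Field_def)
  have sField: "\<And>i j. (i, j) \<in> s \<Longrightarrow> i \<in> Field s \<and> j \<in> Field s" by (auto simp: Field_def)
  have XF: "is_functor C D (Fobj X i)" if "i \<in> Field s" for i using diagramD(1)[OF X that] by simp
  note XF' = functorD[OF XF]
  note m' = cocone_posetD[OF m]
  have mA: "component (m i) a \<in> Arr D" "Dom D (component (m i) a) = Fobj (Fobj X i) a"
    "Cod D (component (m i) a) = Fobj P a" if "i \<in> Field s" "a \<in> Obj C" for i a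
    using functor_category_ArrD(3-5)[OF m'(2)[OF that(1)] that(2)] m'(3,4)[OF that(1)] by simp_all
  have mN: "Farr P f \<cdot>\<^bsub>D\<^esub> component (m i) a = component (m i) b \<cdot>\<^bsub>D\<^esub> Farr (Fobj X i) f"
    if "i \<in> Field s" "f \<in> hom C a b" for i f a b
    using functor_category_ArrD(6)[OF m'(2)[OF that(1)], of f] that(2) m'(3,4)[OF that(1)] by (auto simp: hom_iff)
  have xA: "component (Farr X (i, k)) a \<in> Arr D" "Dom D (component (Farr X (i, k)) a) = Fobj (Fobj X i) a"
    "Cod D (component (Farr X (i, k)) a) = Fobj (Fobj X k) a" if "(i, k) \<in> s" "a \<in> Obj C" for i k a
    using functor_category_ArrD(3-5)[OF diagramD(2)[OF X that(1)] that(2)] diagramD(3,4)[OF X that(1)] by simp_all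
  have xN: "Farr (Fobj X k) f \<cdot>\<^bsub>D\<^esub> component (Farr X (i, k)) a = component (Farr X (i, k)) b \<cdot>\<^bsub>D\<^esub> Farr (Fobj X i) f"
    if "(i, k) \<in> s" "f \<in> hom C a b" for i k f a b
    using functor_category_ArrD(6)[OF diagramD(2)[OF X that(1)], of f] that(2) diagramD(3,4)[OF X that(1)] by (auto simp: hom_iff)
  have xm: "component (m k) a \<cdot>\<^bsub>D\<^esub> component (Farr X (i, k)) a = component (m i) a" if "(i, k) \<in> s" "a \<in> Obj C" for i k a
    using m'(5)[OF that(1)] component_comp[OF that(2)] by metis
  have th: "t x \<in> hom C (Fobj Z x) c" if "x \<in> Field r" for x using t(2-4)[OF that] by (simp add: hom_iff)
  have Zh: "Farr Z (x, y) \<in> hom C (Fobj Z x) (Fobj Z y)" if "(x, y) \<in> r" for x y using Z(2-4)[OF that] by (simp add: hom_iff)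
  have colim_i: "is_colimit (poset_category r) D (functor_comp (Fobj X i) Z) (Fobj (Fobj X i) c) (\<lambda>x. Farr (Fobj X i) (t x))"
    if "i \<in> Field s" for i
    using pres[OF that] r colim unfolding preserves_directed_colimits_def by blast
  show "is_colimit (poset_category r) D (functor_comp P Z) (Fobj P c) (\<lambda>x. Farr P (t x))"
  proof (rule colimitI)
    show "is_functor (poset_category r) D (functor_comp P Z)" by (rule functor_compI[OF F P])
    show "is_cocone (poset_category r) D (functor_comp P Z) (Fobj P c) (\<lambda>x. Farr P (t x))"
      by (rule cocone_functor_comp[OF P F colimitD(2)[OF colim]])
    fix d w assume "is_cocone (poset_category r) D (functor_comp P Z) d w"
    note w = cocone_posetD[OF this, simplified]
    have "\<exists>h. h \<in> hom D (Fobj (Fobj X i) c) d \<and>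
        (\<forall>x \<in> Field r. h \<cdot>\<^bsub>D\<^esub> Farr (Fobj X i) (t x) = w x \<cdot>\<^bsub>D\<^esub> component (m i) (Fobj Z x))" if i: "i \<in> Field s" for i
    proof -
      have "is_cocone (poset_category r) D (functor_comp (Fobj X i) Z) d (\<lambda>x. w x \<cdot>\<^bsub>D\<^esub> component (m i) (Fobj Z x))"
        unfolding cocone_poset_iff
      proof (intro conjI ballI allI impI)
        fix x y assume xy: "(x, y) \<in> r"
        note xy' = conjunct1[OF rField[OF xy]] conjunct2[OF rField[OF xy]]
        note [simp] = Z(2-4)[OF xy] Z(1)[OF xy'(1)] Z(1)[OF xy'(2)] w(1) w(2-4)[OF xy'(2)] mA[OF i] XF'[OF i] P'
        have "w y \<cdot>\<^bsub>D\<^esub> component (m i) (Fobj Z y) \<cdot>\<^bsub>D\<^esub> Farr (Fobj X i) (Farr Z (x, y))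
            = w y \<cdot>\<^bsub>D\<^esub> (Farr P (Farr Z (x, y)) \<cdot>\<^bsub>D\<^esub> component (m i) (Fobj Z x))"
          using mN[OF i Zh[OF xy]] by simp
        also have "\<dots> = w x \<cdot>\<^bsub>D\<^esub> component (m i) (Fobj Z x)"
          using w(5)[OF xy] by (intro D.comp_assoc_eq) simp_all
        finally show "w y \<cdot>\<^bsub>D\<^esub> component (m i) (Fobj Z y) \<cdot>\<^bsub>D\<^esub> Farr (functor_comp (Fobj X i) Z) (x, y)
            = w x \<cdot>\<^bsub>D\<^esub> component (m i) (Fobj Z x)" by simp
      qed (use w mA[OF i] Z(1) in \<open>auto simp: hom_iff\<close>)
      from colimit_factor[OF colim_i[OF i] this] show ?thesis by (metis poset_category_simps(1))
    qed
    then obtain h where h: "\<And>i. i \<in> Field s \<Longrightarrow> h i \<in> hom D (Fobj (Fobj X i) c) d"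
      "\<And>i x. i \<in> Field s \<Longrightarrow> x \<in> Field r \<Longrightarrow> h i \<cdot>\<^bsub>D\<^esub> Farr (Fobj X i) (t x) = w x \<cdot>\<^bsub>D\<^esub> component (m i) (Fobj Z x)" by metis
    have hA: "h i \<in> Arr D" "Dom D (h i) = Fobj (Fobj X i) c" "Cod D (h i) = d" if "i \<in> Field s" for i
      using h(1)[OF that] by (auto simp: hom_iff)
    have "is_cocone (poset_category s) D (functor_comp (evaluation c) X) d h"
      unfolding cocone_poset_iff
    proof (intro conjI ballI allI impI)
      fix i k assume ik: "(i, k) \<in> s"
      note ik' = conjunct1[OF sField[OF ik]] conjunct2[OF sField[OF ik]]
      note [simp] = xA[OF ik] hA[OF ik'(1)] hA[OF ik'(2)] t(1)
      have "h k \<cdot>\<^bsub>D\<^esub> component (Farr X (i, k)) c = h i"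
      proof (rule colimit_eqI[OF colim_i[OF ik'(1)], of _ d])
        fix x assume "x \<in> Obj (poset_category r)"
        then have x: "x \<in> Field r" by simp
        note [simp] = t(2-4)[OF x] Z(1)[OF x] XF'[OF ik'(1)] XF'[OF ik'(2)] mA[OF ik'(1)] mA[OF ik'(2)] w(2-4)[OF x]
        have "h k \<cdot>\<^bsub>D\<^esub> component (Farr X (i, k)) c \<cdot>\<^bsub>D\<^esub> Farr (Fobj X i) (t x)
            = h k \<cdot>\<^bsub>D\<^esub> (Farr (Fobj X k) (t x) \<cdot>\<^bsub>D\<^esub> component (Farr X (i, k)) (Fobj Z x))"
          using xN[OF ik th[OF x]] by simp
        also have "\<dots> = w x \<cdot>\<^bsub>D\<^esub> component (m k) (Fobj Z x) \<cdot>\<^bsub>D\<^esub> component (Farr X (i, k)) (Fobj Z x)"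
          using h(2)[OF ik'(2) x] by (intro D.comp_assoc_eq) simp_all
        also have "\<dots> = w x \<cdot>\<^bsub>D\<^esub> component (m i) (Fobj Z x)" using xm[OF ik Z(1)[OF x]] by simp
        finally show "h k \<cdot>\<^bsub>D\<^esub> component (Farr X (i, k)) c \<cdot>\<^bsub>D\<^esub> Farr (Fobj X i) (t x) = h i \<cdot>\<^bsub>D\<^esub> Farr (Fobj X i) (t x)"
          using h(2)[OF ik'(1) x] by simp
      qed (simp_all add: hom_iff)
      then show "h k \<cdot>\<^bsub>D\<^esub> Farr (functor_comp (evaluation c) X) (i, k) = h i" by simp
    qed (use h(1) w(1) in auto)
    from colimit_factor[OF pw[OF t(1)] this] obtain g where
      g: "g \<in> hom D (Fobj P c) d" "\<And>i. i \<in> Field s \<Longrightarrow> g \<cdot>\<^bsub>D\<^esub> component (m i) c = h i" by auto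
    have gA: "g \<in> Arr D" "Dom D g = Fobj P c" "Cod D g = d" using g(1) by (auto simp: hom_iff)
    have "g \<cdot>\<^bsub>D\<^esub> Farr P (t x) = w x" if x: "x \<in> Field r" for x
    proof (rule colimit_eqI[OF pw[OF Z(1)[OF x]], of _ d])
      note [simp] = t(1) t(2-4)[OF x] Z(1)[OF x] w(2-4)[OF x] gA P'
      fix i assume "i \<in> Obj (poset_category s)"
      then have i: "i \<in> Field s" by simp
      note [simp] = XF'[OF i] mA[OF i]
      have "g \<cdot>\<^bsub>D\<^esub> Farr P (t x) \<cdot>\<^bsub>D\<^esub> component (m i) (Fobj Z x) = g \<cdot>\<^bsub>D\<^esub> (component (m i) c \<cdot>\<^bsub>D\<^esub> Farr (Fobj X i) (t x))"
        using mN[OF i th[OF x]] by simp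
      also have "\<dots> = h i \<cdot>\<^bsub>D\<^esub> Farr (Fobj X i) (t x)" using g(2)[OF i] by (intro D.comp_assoc_eq) simp_all
      finally show "g \<cdot>\<^bsub>D\<^esub> Farr P (t x) \<cdot>\<^bsub>D\<^esub> component (m i) (Fobj Z x) = w x \<cdot>\<^bsub>D\<^esub> component (m i) (Fobj Z x)"
        using h(2)[OF i x] by simp
    next
      show "g \<cdot>\<^bsub>D\<^esub> Farr P (t x) \<in> hom D (Fobj P (Fobj Z x)) d" "w x \<in> hom D (Fobj P (Fobj Z x)) d"
        using gA P'(4-6)[OF t(2)[OF x]] t(3,4)[OF x] w(2-4)[OF x] by (auto simp: hom_iff)
    qed
    then show "\<exists>g. g \<in> hom D (Fobj P c) d \<and> (\<forall>x \<in> Obj (poset_category r). g \<cdot>\<^bsub>D\<^esub> Farr P (t x) = w x)"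
      using g(1) by auto
  next
    fix d g g' assume g: "g \<in> hom D (Fobj P c) d" "g' \<in> hom D (Fobj P c) d"
      and eq: "\<And>x. x \<in> Obj (poset_category r) \<Longrightarrow> g \<cdot>\<^bsub>D\<^esub> Farr P (t x) = g' \<cdot>\<^bsub>D\<^esub> Farr P (t x)"
    have gA: "g \<in> Arr D" "Dom D g = Fobj P c" "Cod D g = d" "g' \<in> Arr D" "Dom D g' = Fobj P c" "Cod D g' = d"
      using g by (auto simp: hom_iff)
    show "g = g'"
    proof (rule colimit_eqI[OF pw[OF t(1)] g])
      fix i assume "i \<in> Obj (poset_category s)"
      then have i: "i \<in> Field s" by simp
      note [simp] = XF'[OF i] mA[OF i] gA t(1) P'
      show "g \<cdot>\<^bsub>D\<^esub> component (m i) c = g' \<cdot>\<^bsub>D\<^esub> component (m i) c"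
      proof (rule colimit_eqI[OF colim_i[OF i], of _ d])
        fix x assume x0: "x \<in> Obj (poset_category r)"
        then have x: "x \<in> Field r" by simp
        note [simp] = t(2-4)[OF x] Z(1)[OF x]
        have "g \<cdot>\<^bsub>D\<^esub> (Farr P (t x) \<cdot>\<^bsub>D\<^esub> component (m i) (Fobj Z x)) = g' \<cdot>\<^bsub>D\<^esub> (Farr P (t x) \<cdot>\<^bsub>D\<^esub> component (m i) (Fobj Z x))"
          using D.comp_assoc_eq[OF eq[OF x0], of "component (m i) (Fobj Z x)"] by simp
        then show "g \<cdot>\<^bsub>D\<^esub> component (m i) c \<cdot>\<^bsub>D\<^esub> Farr (Fobj X i) (t x) = g' \<cdot>\<^bsub>D\<^esub> component (m i) c \<cdot>\<^bsub>D\<^esub> Farr (Fobj X i) (t x)"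
          using mN[OF i th[OF x]] by simp
      qed (auto simp: hom_iff)
    qed
  qed
qed

context small_object
begin

definition injective_object :: "'o \<Rightarrow> bool" where
  "injective_object f \<longleftrightarrow> (\<forall>y \<in> Y. \<forall>s \<in> hom E (Dom E y) f. \<exists>g \<in> hom E (Cod E y) f. g \<cdot> y = s)"

abbreviation "endo \<equiv> functor_category E E"

text \<open>The unit whiskered with \<open>P\<close>: one stage of the iteration, as a morphism of
  endofunctors.\<close>

definition unit_step :: "('o, 'a, 'o, 'a) cat_functor \<Rightarrow>
    ('o, 'a, 'o, 'a) cat_functor \<times> ('o \<Rightarrow> 'a) \<times> ('o, 'a, 'o, 'a) cat_functor" where
  "unit_step P = (P, \<lambda>a\<in>Obj E. unit (Fobj P a), functor_comp step_functor P)"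

lemma unit_step_Arr:
  assumes P: "is_functor E E P"
  shows "unit_step P \<in> Arr endo"
proof -
  note [simp] = functorD[OF P]
  have "step_arr (Farr P f) \<cdot> unit (Fobj P (Dom E f)) = unit (Fobj P (Cod E f)) \<cdot> Farr P f" if "f \<in> Arr E" for f
    using that by (intro step_arr_unit) (simp add: hom_iff)
  then show ?thesis
    using functor_compI[OF P step_functor_functor] P by (auto simp: unit_step_def hom_iff)
qed

lemma restr_has_colimits:
  assumes "is_functor (poset_category (Restr ordinals (underS ordinals j))) E D"
  shows "\<exists>c t. is_colimit (poset_category (Restr ordinals (underS ordinals j))) E D c t"
proof -
  have "small TYPE('u) (Field (Restr ordinals (underS ordinals j)))" using small_underS by simp
  from cocomplete_poset_colimit[OF cocomplete this assms] show ?thesis by metis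
qed

text \<open>Recursion in the category of endofunctors makes all stages functors and all connecting
  maps natural at once; the cocones at limits come from colimits taken pointwise.\<close>

lemma unit_iteration_exists:
  obtains A where "is_functor (poset_category ordinals) endo A"
    "\<And>z. underS ordinals z = {} \<Longrightarrow> Fobj A z = inclusion_functor"
    "\<And>i j. is_succ ordinals i j \<Longrightarrow> Farr A (i, j) = unit_step (Fobj A i)"
    "\<And>j a. limit_element ordinals j \<Longrightarrow> a \<in> Obj E \<Longrightarrow>
      is_colimit (poset_category (Restr ordinals (underS ordinals j))) E (functor_comp (evaluation a) A)
        (Fobj (Fobj A j) a) (\<lambda>i. component (Farr A (i, j)) a)"
proof -
  define Q where "Q j D F t \<longleftrightarrow> (\<forall>a \<in> Obj E.
      is_colimit (poset_category (Restr ordinals (underS ordinals j))) E (functor_comp (evaluation a) D)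
        (Fobj F a) (\<lambda>i. component (t i) a))"
    for j :: 'u and D :: "('u, 'u \<times> 'u, ('o, 'a, 'o, 'a) cat_functor, ('o, 'a, 'o, 'a) cat_functor \<times> ('o \<Rightarrow> 'a) \<times> ('o, 'a, 'o, 'a) cat_functor) cat_functor"
      and F :: "('o, 'a, 'o, 'a) cat_functor"
      and t :: "'u \<Rightarrow> ('o, 'a, 'o, 'a) cat_functor \<times> ('o \<Rightarrow> 'a) \<times> ('o, 'a, 'o, 'a) cat_functor"
  have "\<exists>A. is_functor (poset_category ordinals) endo A \<and>
    (\<forall>z. underS ordinals z = {} \<longrightarrow> Fobj A z = inclusion_functor) \<and>
    (\<forall>i j. is_succ ordinals i j \<longrightarrow> Farr A (i, j) = unit_step (Fobj A i)) \<and>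
    (\<forall>j. limit_element ordinals j \<longrightarrow> Q j A (Fobj A j) (\<lambda>i. Farr A (i, j)))"
  proof (rule sequence_exists[where C = endo and ?c0.0 = inclusion_functor and \<sigma> = unit_step and Q = Q])
    show "is_category endo" by (rule functor_category_category[OF cat cat])
    show "inclusion_functor \<in> Obj endo" using inclusion_functor_functor[OF cat] by simp
    show "unit_step c \<in> Arr endo" if "c \<in> Obj endo" for c using unit_step_Arr that by simp
    show "Dom endo (unit_step c) = c" for c by (simp add: unit_step_def)
    show "\<exists>c t. is_cocone (poset_category (Restr ordinals (underS ordinals j))) endo D c t \<and> Q j D c t"
      if D: "is_functor (poset_category (Restr ordinals (underS ordinals j))) endo D" for j D
    proof -
      have "\<exists>c t. is_colimit (poset_category (Restr ordinals (underS ordinals j))) E (functor_comp (evaluation a) D) c t"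
        if "a \<in> Obj E" for a
        using restr_has_colimits functor_compI[OF D evaluation_functor[OF cat cat that]] by blast
      from pointwise_cocone[OF cat cat D this] show ?thesis unfolding Q_def by metis
    qed
    show "Q j D' c t'" if Q: "Q j D c t" and D: "is_functor (poset_category (Restr ordinals (underS ordinals j))) endo D"
      and eq: "\<And>i. i \<in> underS ordinals j \<Longrightarrow> Fobj D i = Fobj D' i"
        "\<And>i k. (i, k) \<in> Restr ordinals (underS ordinals j) \<Longrightarrow> Farr D (i, k) = Farr D' (i, k)"
        "\<And>i. i \<in> underS ordinals j \<Longrightarrow> t i = t' i" for j D D' c t t'
      unfolding Q_def
    proof
      fix a assume a: "a \<in> Obj E"
      have "is_colimit (poset_category (Restr ordinals (underS ordinals j))) E (functor_comp (evaluation a) D)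
          (Fobj c a) (\<lambda>i. component (t i) a)" using Q a by (simp add: Q_def)
      then show "is_colimit (poset_category (Restr ordinals (underS ordinals j))) E (functor_comp (evaluation a) D')
          (Fobj c a) (\<lambda>i. component (t' i) a)"
        using colimit_poset_cong[OF functor_compI[OF D evaluation_functor[OF cat cat a]],
            of "functor_comp (evaluation a) D'" "\<lambda>i. component (t i) a" "\<lambda>i. component (t' i) a"] eq by simp
    qed
  qed blast
  then show ?thesis using that unfolding Q_def by metis
qed

text \<open>\<open>R\<close> is the stage at a limit \<open>l\<close> whose segment is
  \<open>mu\<close>-directed. A map from the compact domain of \<open>y\<close> into
  \<open>R f\<close> comes from a stage \<open>i\<close>, and the cell attached to it at the
  successor of \<open>i\<close> extends it. All stages preserve \<open>mu\<close>-directed colimits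
  by induction, and \<open>\<rho>\<close> is a transfinite composite of units.\<close>

theorem small_object_argument:
  obtains R \<rho> where "is_functor E E R" "preserves_directed_colimits mu E E R"
    "\<And>f. f \<in> Obj E \<Longrightarrow> \<rho> f \<in> hom E f (Fobj R f)"
    "\<And>h. h \<in> Arr E \<Longrightarrow> Farr R h \<cdot> \<rho> (Dom E h) = \<rho> (Cod E h) \<cdot> h"
    "\<And>f. f \<in> Obj E \<Longrightarrow> injective_object (Fobj R f)"
    "\<And>f L. f \<in> Obj E \<Longrightarrow> cell_closed TYPE('u) E L \<Longrightarrow> Y \<subseteq> L \<Longrightarrow> \<rho> f \<in> L"
proof -
  obtain A where A: "is_functor (poset_category ordinals) endo A"
    and zero: "\<And>z. underS ordinals z = {} \<Longrightarrow> Fobj A z = inclusion_functor"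
    and succ: "\<And>i j. is_succ ordinals i j \<Longrightarrow> Farr A (i, j) = unit_step (Fobj A i)"
    and limit: "\<And>j a. limit_element ordinals j \<Longrightarrow> a \<in> Obj E \<Longrightarrow>
      is_colimit (poset_category (Restr ordinals (underS ordinals j))) E (functor_comp (evaluation a) A)
        (Fobj (Fobj A j) a) (\<lambda>i. component (Farr A (i, j)) a)"
    using unit_iteration_exists by blast
  note A' = diagramD[OF A, simplified]
  have eval: "is_functor (poset_category ordinals) E (functor_comp (evaluation a) A)" if "a \<in> Obj E" for a
    using functor_compI[OF A evaluation_functor[OF cat cat that]] .
  have smooth: "smooth_sequence E (functor_comp (evaluation a) A)" if a: "a \<in> Obj E" for a
    unfolding smooth_sequence_def using eval[OF a] limit[OF _ a] by simp
  have succ_obj: "Fobj A j = functor_comp step_functor (Fobj A i)" if ij: "is_succ ordinals i j" for i j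
  proof -
    have "(i, j) \<in> ordinals" using ij by (simp add: is_succ_def underS_iff)
    then show ?thesis using A'(4)[of i j] succ[OF ij] by (simp add: unit_step_def)
  qed
  have pres: "preserves_directed_colimits mu E E (Fobj A j)" for j
  proof (induction j rule: ordinals_induct)
    case (less j)
    show ?case
    proof (cases j rule: ordinals_cases)
      case zero': zero
      then show ?thesis using zero preserves_inclusion by simp
    next
      case (succ i)
      then have "preserves_directed_colimits mu E E (Fobj A i)" using less by (simp add: is_succ_def)
      then show ?thesis using preserves_comp step_preserves succ_obj[OF succ] by metis
    next
      case lim: limit
      let ?R = "Restr ordinals (underS ordinals j)"
      have AR: "is_functor (poset_category ?R) endo A"
        using diagramD[OF A] Refl_Restr_ordinals trans_Restr_ordinals by (intro diagramI) (auto simp: hom_iff[of _ endo])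
      show ?thesis
      proof (rule preserves_pointwise_colimit[OF AR])
        show "is_functor E E (Fobj A j)" using A'(1) by simp
        show "is_cocone (poset_category ?R) endo A (Fobj A j) (\<lambda>i. Farr A (i, j))"
          unfolding cocone_poset_iff
          using A'(1) A'(2-4)[of _ j] A'(6)[of _ _ j] by (auto simp: hom_iff[of _ endo] underS_iff)
      qed (use limit[OF lim] less in auto)
    qed
  qed
  obtain l where l: "limit_element ordinals l" "directed_poset mu (Restr ordinals (underS ordinals l))"
    using directed_underS[OF mu] by blast
  obtain z where z: "\<And>i. (z, i) \<in> ordinals" using ordinals_zero by blast
  then have "underS ordinals z = {}" using ordinals_antisym by (auto simp: underS_iff)
  then have Az: "Fobj A z = inclusion_functor" by (rule zero)
  have R: "is_functor E E (Fobj A l)" using A'(1) by simp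
  \<comment> \<open>Stage \<open>z\<close> is the identity functor, so the map from stage
    \<open>z\<close> to stage \<open>l\<close> is a transformation out of the identity.\<close>
  define \<rho> where "\<rho> f = component (Farr A (z, l)) f" for f
  have zl: "Farr A (z, l) \<in> Arr endo" "Dom endo (Farr A (z, l)) = inclusion_functor" "Cod endo (Farr A (z, l)) = Fobj A l"
    using A'(2-4)[OF z] Az by auto
  note zl' = functor_category_ArrD[OF zl(1), unfolded zl(2,3), folded \<rho>_def, simplified]
  have 1: "\<rho> f \<in> hom E f (Fobj (Fobj A l) f)" if "f \<in> Obj E" for f
    using zl'(3-5)[OF that] by (simp add: hom_iff)
  have 2: "Farr (Fobj A l) h \<cdot> \<rho> (Dom E h) = \<rho> (Cod E h) \<cdot> h" if "h \<in> Arr E" for h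
    using zl'(6)[OF that] .
  have 3: "\<rho> f \<in> L" if f: "f \<in> Obj E" and L: "cell_closed TYPE('u) E L" "Y \<subseteq> L" for f L
  proof -
    have "Farr (functor_comp (evaluation f) A) (i, j) \<in> L" if "is_succ ordinals i j" for i j
      using unit_closed[OF L, of "Fobj (Fobj A i) f"] succ[OF that] f functorD(3)[of E E "Fobj A i" f] A'(1)
      by (simp add: unit_step_def)
    then have "Farr (functor_comp (evaluation f) A) (z, l) \<in> L"
      using smooth_sequence_composition[OF smooth[OF f], of L z l] L(1) z by (simp add: cell_closed_def)
    then show ?thesis by (simp add: \<rho>_def)
  qed
  have 4: "injective_object (Fobj (Fobj A l) f)" if f: "f \<in> Obj E" for f
    unfolding injective_object_def
  proof (intro ballI)
    fix y s assume y: "y \<in> Y" and s: "s \<in> hom E (Dom E y) (Fobj (Fobj A l) f)"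
    note B = diagramD[OF eval[OF f], simplified]
    obtain i s' where i: "i \<in> underS ordinals l" and s': "s' \<in> hom E (Dom E y) (Fobj (Fobj A i) f)"
      "component (Farr A (i, l)) f \<cdot> s' = s"
      using compact_factor[OF Dom_compact[OF y] l(2) limit[OF l(1) f] s] by auto
    obtain j where j: "is_succ ordinals i j" using ordinals_succ by blast
    obtain k where k: "k \<in> underS ordinals l" "i \<in> underS ordinals k" using l(1) i by (auto simp: limit_element_def)
    \<comment> \<open>Since \<open>l\<close> is a limit, some \<open>k\<close> below it lies above
      \<open>i\<close>, and the successor \<open>j\<close> of \<open>i\<close> is at most
      \<open>k\<close>.\<close>
    have jk: "(j, k) \<in> ordinals"
    proof (rule ccontr)
      assume "(j, k) \<notin> ordinals"
      then have "k \<in> underS ordinals j" by (rule ordinals_not_le)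
      then have "(k, i) \<in> ordinals" using j by (simp add: is_succ_def)
      then show False using k(2) ordinals_antisym[of i k] by (simp add: underS_iff)
    qed
    then have jl: "(j, l) \<in> ordinals" using k(1) ordinals_trans[of j k l] by (simp add: underS_iff)
    have ij: "(i, j) \<in> ordinals" using j by (simp add: is_succ_def underS_iff)
    have Ai: "Fobj (Fobj A i) f \<in> Obj E" using B(1) .
    have s'A: "s' \<in> Arr E" "Dom E s' = Dom E y" "Cod E s' = Fobj (Fobj A i) f" using s'(1) by (auto simp: hom_iff)
    have comp_ij: "component (Farr A (i, j)) f = unit (Fobj (Fobj A i) f)"
      using succ[OF j] f by (simp add: unit_step_def)
    have Aj: "Fobj (Fobj A j) f = step_obj (Fobj (Fobj A i) f)" using succ_obj[OF j] by simp
    note c = cell_simps[OF Ai y s'A] and m = B(2-4)[OF jl] B(2-4)[OF ij]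
    have yA: "y \<in> Arr E" using y Y by blast
    let ?g = "component (Farr A (j, l)) f \<cdot> cell (Fobj (Fobj A i) f) y s'"
    have "?g \<cdot> y = component (Farr A (j, l)) f \<cdot> (component (Farr A (i, j)) f \<cdot> s')"
      using c m yA Aj s'A comp_ij by simp
    also have "\<dots> = component (Farr A (i, l)) f \<cdot> s'"
      using m s'A B(6)[OF ij jl] by (intro comp_assoc_eq) simp_all
    finally have "?g \<cdot> y = s" using s'(2) by simp
    moreover have "?g \<in> hom E (Cod E y) (Fobj (Fobj A l) f)" using c m Aj by (simp add: hom_iff)
    ultimately show "\<exists>g \<in> hom E (Cod E y) (Fobj (Fobj A l) f). g \<cdot> y = s" by blast
  qed
  show ?thesis using that[OF R pres 1 2 4 3] by blast
qed

end

section \<open>Split idempotent completions\<close>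

lemma full_subcategory_simps [simp]:
  "Obj (full_subcategory C S) = S"
  "f \<in> Arr (full_subcategory C S) \<longleftrightarrow> f \<in> Arr C \<and> Dom C f \<in> S \<and> Cod C f \<in> S"
  "Dom (full_subcategory C S) = Dom C" "Cod (full_subcategory C S) = Cod C"
  "Id (full_subcategory C S) = Id C" "Comp (full_subcategory C S) = Comp C"
  by (simp_all add: full_subcategory_def)

lemma full_subcategory_hom: "a \<in> S \<Longrightarrow> b \<in> S \<Longrightarrow> hom (full_subcategory C S) a b = hom C a b"
  by (auto simp: hom_iff)

lemma (in cat) full_subcategory_category: "S \<subseteq> Obj C \<Longrightarrow> is_category (full_subcategory C S)"
  unfolding is_category_def by (auto simp: hom_iff)

lemma (in cat) full_subcategory_inclusion:
  assumes "S \<subseteq> T" "T \<subseteq> Obj C"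
  shows "is_functor (full_subcategory C S) (full_subcategory C T) inclusion_functor"
  using assms full_subcategory_category[of S] full_subcategory_category[of T]
  by (auto simp: is_functor_def hom_iff)

lemma is_isoI:
  assumes "f \<in> hom C a b" "g \<in> hom C b a" "g \<cdot>\<^bsub>C\<^esub> f = Id C a" "f \<cdot>\<^bsub>C\<^esub> g = Id C b"
  shows "is_iso C f"
  using assms by (auto simp: is_iso_def hom_iff)

context cat
begin

text \<open>For every \<open>c\<close> in \<open>T\<close> the data exhibit \<open>c\<close> as a
  retract of \<open>\<sigma> c\<close> in \<open>S\<close>, and \<open>n c\<close> with
  \<open>j c\<close> and \<open>q c\<close> as a splitting in \<open>N\<close> of the idempotent
  that \<open>G\<close> assigns to \<open>i c \<cdot> p c\<close>. The extension of \<open>G\<close>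
  sends \<open>c\<close> to \<open>n c\<close>.\<close>

context
  fixes S T :: "'o set" and N :: "('p, 'b) category" and G :: "('o, 'a, 'p, 'b) cat_functor"
    and \<sigma> :: "'o \<Rightarrow> 'o" and i p :: "'o \<Rightarrow> 'a" and n :: "'o \<Rightarrow> 'p" and j q :: "'o \<Rightarrow> 'b"
  assumes ST: "S \<subseteq> T" "T \<subseteq> Obj C"
    and G: "is_functor (full_subcategory C S) N G"
    and \<sigma>: "\<And>c. c \<in> T \<Longrightarrow> \<sigma> c \<in> S" and i: "\<And>c. c \<in> T \<Longrightarrow> i c \<in> hom C c (\<sigma> c)"
    and p: "\<And>c. c \<in> T \<Longrightarrow> p c \<in> hom C (\<sigma> c) c" and pi: "\<And>c. c \<in> T \<Longrightarrow> p c \<cdot> i c = Id C c"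
    and n: "\<And>c. c \<in> T \<Longrightarrow> n c \<in> Obj N" and j: "\<And>c. c \<in> T \<Longrightarrow> j c \<in> hom N (n c) (Fobj G (\<sigma> c))"
    and q: "\<And>c. c \<in> T \<Longrightarrow> q c \<in> hom N (Fobj G (\<sigma> c)) (n c)"
    and qj: "\<And>c. c \<in> T \<Longrightarrow> q c \<cdot>\<^bsub>N\<^esub> j c = Id N (n c)"
    and jq: "\<And>c. c \<in> T \<Longrightarrow> j c \<cdot>\<^bsub>N\<^esub> q c = Farr G (i c \<cdot> p c)"
begin

interpretation N: cat N using functorD(2)[OF G] by unfold_locales

text \<open>An arrow of \<open>T\<close> is conjugated into \<open>S\<close>, where \<open>G\<close>
  is defined. Composition is respected, but an identity goes to the idempotent
  \<open>j c \<cdot> q c\<close>.\<close>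

definition transported :: "'a \<Rightarrow> 'b" where
  "transported f = Farr G (i (Cod C f) \<cdot> (f \<cdot> p (Dom C f)))"

definition extension :: "('o, 'a, 'p, 'b) cat_functor" where
  "extension = \<lparr>Fobj = n, Farr = (\<lambda>f. q (Cod C f) \<cdot>\<^bsub>N\<^esub> (transported f \<cdot>\<^bsub>N\<^esub> j (Dom C f)))\<rparr>"

lemma T_Obj: "c \<in> T \<Longrightarrow> c \<in> Obj C" using ST by blast

lemma ip_simps:
  assumes "c \<in> T"
  shows "i c \<in> Arr C" "Dom C (i c) = c" "Cod C (i c) = \<sigma> c" "p c \<in> Arr C" "Dom C (p c) = \<sigma> c" "Cod C (p c) = c"
    "\<sigma> c \<in> S" "\<sigma> c \<in> T" "\<sigma> c \<in> Obj C" "c \<in> Obj C"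
  using i[OF assms] p[OF assms] \<sigma>[OF assms] ST assms by (auto simp: hom_iff)

lemma jq_simps:
  assumes "c \<in> T"
  shows "j c \<in> Arr N" "Dom N (j c) = n c" "Cod N (j c) = Fobj G (\<sigma> c)"
    "q c \<in> Arr N" "Dom N (q c) = Fobj G (\<sigma> c)" "Cod N (q c) = n c"
  using j[OF assms] q[OF assms] by (auto simp: hom_iff)

lemma transported_simps:
  assumes "f \<in> Arr C" "Dom C f = c" "Cod C f = d" "c \<in> T" "d \<in> T"
  shows "transported f \<in> Arr N" "Dom N (transported f) = Fobj G (\<sigma> c)" "Cod N (transported f) = Fobj G (\<sigma> d)"
  using functorD(4-6)[OF G, of "i d \<cdot> (f \<cdot> p c)"] assms ip_simps[OF assms(4)] ip_simps[OF assms(5)]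
  by (auto simp: transported_def)

text \<open>The factor \<open>p d \<cdot> i d\<close> in the middle is an identity.\<close>

lemma transported_comp:
  assumes "f \<in> Arr C" "g \<in> Arr C" "Dom C f = c" "Cod C f = d" "Dom C g = d" "Cod C g = e" "c \<in> T" "d \<in> T" "e \<in> T"
  shows "transported g \<cdot>\<^bsub>N\<^esub> transported f = transported (g \<cdot> f)"
proof -
  note [simp] = assms ip_simps[OF assms(7)] ip_simps[OF assms(8)] ip_simps[OF assms(9)]
  have "i e \<cdot> (g \<cdot> p d) \<cdot> (i d \<cdot> (f \<cdot> p c)) = i e \<cdot> (g \<cdot> (p d \<cdot> i d) \<cdot> (f \<cdot> p c))" by simp
  also have "\<dots> = i e \<cdot> (g \<cdot> f \<cdot> p c)" unfolding pi[OF assms(8)] by simp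
  finally have "i e \<cdot> (g \<cdot> p d) \<cdot> (i d \<cdot> (f \<cdot> p c)) = i e \<cdot> (g \<cdot> f \<cdot> p c)" .
  then show ?thesis
    using functorD(8)[OF G, of "i d \<cdot> (f \<cdot> p c)" "i e \<cdot> (g \<cdot> p d)"] by (simp add: transported_def)
qed

lemma jq_transported: "c \<in> T \<Longrightarrow> j c \<cdot>\<^bsub>N\<^esub> q c = transported (Id C c)"
  using jq ip_simps by (simp add: transported_def)

text \<open>The idempotent at \<open>d\<close> is \<open>transported\<close> of an identity, hence
  is absorbed by anything transported.\<close>

lemma jq_transported_comp:
  assumes "f \<in> Arr C" "Dom C f = c" "Cod C f = d" "c \<in> T" "d \<in> T"
  shows "j d \<cdot>\<^bsub>N\<^esub> (q d \<cdot>\<^bsub>N\<^esub> transported f) = transported f"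
    "x \<in> Arr N \<Longrightarrow> Cod N x = Fobj G (\<sigma> c) \<Longrightarrow>
      j d \<cdot>\<^bsub>N\<^esub> (q d \<cdot>\<^bsub>N\<^esub> (transported f \<cdot>\<^bsub>N\<^esub> x)) = transported f \<cdot>\<^bsub>N\<^esub> x"
proof -
  note [simp] = assms T_Obj[OF assms(4)] T_Obj[OF assms(5)] jq_simps[OF assms(5)] transported_simps[OF assms]
  show 1: "j d \<cdot>\<^bsub>N\<^esub> (q d \<cdot>\<^bsub>N\<^esub> transported f) = transported f"
    using N.comp_assoc_eq[OF jq_transported[OF assms(5)], of "transported f"]
      transported_comp[of f "Id C d" c d d] by simp
  show "j d \<cdot>\<^bsub>N\<^esub> (q d \<cdot>\<^bsub>N\<^esub> (transported f \<cdot>\<^bsub>N\<^esub> x)) = transported f \<cdot>\<^bsub>N\<^esub> x"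
    if "x \<in> Arr N" "Cod N x = Fobj G (\<sigma> c)"
    using N.comp_assoc[of x "q d \<cdot>\<^bsub>N\<^esub> transported f" "j d"] that 1 by simp
qed

lemma transported_jq_comp:
  assumes "f \<in> Arr C" "Dom C f = c" "Cod C f = d" "c \<in> T" "d \<in> T"
  shows "x \<in> Arr N \<Longrightarrow> Cod N x = Fobj G (\<sigma> c) \<Longrightarrow>
      transported f \<cdot>\<^bsub>N\<^esub> (j c \<cdot>\<^bsub>N\<^esub> (q c \<cdot>\<^bsub>N\<^esub> x)) = transported f \<cdot>\<^bsub>N\<^esub> x"
proof -
  assume x: "x \<in> Arr N" "Cod N x = Fobj G (\<sigma> c)"
  note [simp] = assms x T_Obj[OF assms(4)] jq_simps[OF assms(4)] transported_simps[OF assms]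
  have [simp]: "transported (Id C c) \<in> Arr N" "Dom N (transported (Id C c)) = Fobj G (\<sigma> c)"
    "Cod N (transported (Id C c)) = Fobj G (\<sigma> c)"
    using transported_simps[of "Id C c" c c] by simp_all
  have "j c \<cdot>\<^bsub>N\<^esub> (q c \<cdot>\<^bsub>N\<^esub> x) = transported (Id C c) \<cdot>\<^bsub>N\<^esub> x"
    by (intro N.comp_assoc_eq[OF jq_transported[OF assms(4)]]) simp_all
  then have "transported f \<cdot>\<^bsub>N\<^esub> (j c \<cdot>\<^bsub>N\<^esub> (q c \<cdot>\<^bsub>N\<^esub> x)) = transported f \<cdot>\<^bsub>N\<^esub> (transported (Id C c) \<cdot>\<^bsub>N\<^esub> x)" by simp
  also have "\<dots> = transported f \<cdot>\<^bsub>N\<^esub> x"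
    using transported_comp[of "Id C c" f c c d] by (intro N.comp_assoc_eq) simp_all
  finally show ?thesis .
qed

lemma transported_Id_absorb:
  assumes "c \<in> T"
  shows "q c \<cdot>\<^bsub>N\<^esub> (transported (Id C c) \<cdot>\<^bsub>N\<^esub> j c) = Id N (n c)"
proof -
  note [simp] = jq_simps[OF assms] n[OF assms]
  show ?thesis
    unfolding jq_transported[OF assms, symmetric]
    using N.comp_assoc_eq[OF qj[OF assms], of "q c \<cdot>\<^bsub>N\<^esub> j c"] qj[OF assms] by simp
qed

lemma extension_functor: "is_functor (full_subcategory C T) N extension"
  unfolding is_functor_def
proof (intro conjI ballI impI)
  show "is_category (full_subcategory C T)" using ST(2) by (rule full_subcategory_category)
  show "is_category N" by (rule N.cat)
  show "Fobj extension a \<in> Obj N" if "a \<in> Obj (full_subcategory C T)" for a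
    using n that by (simp add: extension_def)
  show "Farr extension (Id (full_subcategory C T) a) = Id N (Fobj extension a)" if "a \<in> Obj (full_subcategory C T)" for a
    using transported_Id_absorb[of a] T_Obj[of a] that by (simp add: extension_def)
  show "Farr extension f \<in> hom N (Fobj extension (Dom (full_subcategory C T) f)) (Fobj extension (Cod (full_subcategory C T) f))"
    if "f \<in> Arr (full_subcategory C T)" for f
    using that jq_simps transported_simps[OF _ refl refl, of f] by (simp add: extension_def hom_iff)
  fix f g assume "f \<in> Arr (full_subcategory C T)" "g \<in> Arr (full_subcategory C T)"
    "Cod (full_subcategory C T) f = Dom (full_subcategory C T) g"
  then have fg: "f \<in> Arr C" "g \<in> Arr C" "Cod C f = Dom C g" "Dom C f \<in> T" "Dom C g \<in> T" "Cod C g \<in> T" by auto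
  note [simp] = fg jq_simps[OF fg(4)] jq_simps[OF fg(5)] jq_simps[OF fg(6)]
    transported_simps[OF fg(1) refl fg(3) fg(4,5)] transported_simps[OF fg(2) refl refl fg(5,6)]
  have "transported g \<cdot>\<^bsub>N\<^esub> (j (Dom C g) \<cdot>\<^bsub>N\<^esub> (q (Dom C g) \<cdot>\<^bsub>N\<^esub> (transported f \<cdot>\<^bsub>N\<^esub> j (Dom C f))))
      = transported g \<cdot>\<^bsub>N\<^esub> (transported f \<cdot>\<^bsub>N\<^esub> j (Dom C f))"
    by (rule transported_jq_comp[OF fg(2) refl refl fg(5,6)]) simp_all
  also have "\<dots> = transported (g \<cdot> f) \<cdot>\<^bsub>N\<^esub> j (Dom C f)"
    using transported_comp[of f g "Dom C f" "Dom C g" "Cod C g"] by (intro N.comp_assoc_eq) simp_all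
  finally show "Farr extension (g \<cdot>\<^bsub>full_subcategory C T\<^esub> f) = Farr extension g \<cdot>\<^bsub>N\<^esub> Farr extension f"
    by (simp add: extension_def)
qed

lemma G_simps:
  assumes "f \<in> Arr C" "Dom C f \<in> S" "Cod C f \<in> S"
  shows "Farr G f \<in> Arr N" "Dom N (Farr G f) = Fobj G (Dom C f)" "Cod N (Farr G f) = Fobj G (Cod C f)"
  using functorD(4-6)[OF G, of f] assms by auto

lemma G_comp:
  assumes "f \<in> Arr C" "g \<in> Arr C" "Cod C f = Dom C g" "Dom C f \<in> S" "Dom C g \<in> S" "Cod C g \<in> S"
  shows "Farr G g \<cdot>\<^bsub>N\<^esub> Farr G f = Farr G (g \<cdot> f)"
  using functorD(8)[OF G, of f g] assms by simp

text \<open>For \<open>s\<close> in \<open>S\<close> the idempotent assigned to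
  \<open>i s \<cdot> p s\<close> has two splittings, through \<open>n s\<close> and through
  \<open>Fobj G s\<close> by means of the images of \<open>i s\<close> and \<open>p s\<close>.
  Splittings are unique up to isomorphism; \<open>t s\<close> is the comparison.\<close>

lemma extension_restricts:
  "naturally_isomorphic (full_subcategory C S) N (functor_comp extension inclusion_functor) G"
proof -
  define t where "t s = Farr G (p s) \<cdot>\<^bsub>N\<^esub> j s" for s
  have "t s \<in> hom N (n s) (Fobj G s) \<and> is_iso N (t s)" if s: "s \<in> S" for s
  proof -
    have sT: "s \<in> T" using s ST by blast
    note [simp] = s ip_simps[OF sT] jq_simps[OF sT] n[OF sT]
    note Gp = G_simps[of "p s", simplified] and Gi = G_simps[of "i s", simplified]
    note [simp] = Gp Gi
    have GO: "Fobj G s \<in> Obj N" using functorD(3)[OF G, of s] by simp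
    have GI: "Farr G (Id C s) = Id N (Fobj G s)" using functorD(7)[OF G, of s] by simp
    have pi_G: "Farr G (p s) \<cdot>\<^bsub>N\<^esub> Farr G (i s) = Id N (Fobj G s)"
      using G_comp[of "i s" "p s"] pi[OF sT] GI by simp
    have ip_G: "Farr G (i s) \<cdot>\<^bsub>N\<^esub> Farr G (p s) = transported (Id C s)"
      using G_comp[of "p s" "i s"] by (simp add: transported_def)
    have 1: "t s \<in> hom N (n s) (Fobj G s)" by (simp add: t_def hom_iff)
    have 2: "q s \<cdot>\<^bsub>N\<^esub> Farr G (i s) \<in> hom N (Fobj G s) (n s)" by (simp add: hom_iff)
    have "Farr G (i s) \<cdot>\<^bsub>N\<^esub> (Farr G (p s) \<cdot>\<^bsub>N\<^esub> j s) = transported (Id C s) \<cdot>\<^bsub>N\<^esub> j s"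
      by (intro N.comp_assoc_eq[OF ip_G]) simp_all
    then have 3: "q s \<cdot>\<^bsub>N\<^esub> Farr G (i s) \<cdot>\<^bsub>N\<^esub> t s = Id N (n s)"
      using transported_Id_absorb[OF sT] by (simp add: t_def)
    have "j s \<cdot>\<^bsub>N\<^esub> (q s \<cdot>\<^bsub>N\<^esub> Farr G (i s)) = Farr G (i s) \<cdot>\<^bsub>N\<^esub> Farr G (p s) \<cdot>\<^bsub>N\<^esub> Farr G (i s)"
      unfolding ip_G by (intro N.comp_assoc_eq[OF jq_transported[OF sT]]) simp_all
    also have "\<dots> = Farr G (i s)" using pi_G by simp
    finally have "t s \<cdot>\<^bsub>N\<^esub> (q s \<cdot>\<^bsub>N\<^esub> Farr G (i s)) = Id N (Fobj G s)"
      using pi_G by (simp add: t_def)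
    then show ?thesis using is_isoI[OF 1 2 3] 1 by blast
  qed
  moreover have "Farr G f \<cdot>\<^bsub>N\<^esub> t (Dom C f) = t (Cod C f) \<cdot>\<^bsub>N\<^esub> Farr extension f"
    if "f \<in> Arr C" "Dom C f \<in> S" "Cod C f \<in> S" for f
  proof -
    have fT: "Dom C f \<in> T" "Cod C f \<in> T" using that ST by auto
    note [simp] = that fT ip_simps[OF fT(1)] ip_simps[OF fT(2)] jq_simps[OF fT(1)] jq_simps[OF fT(2)]
      transported_simps[OF that(1) refl refl fT] G_simps[OF that]
    note [simp] = G_simps[of "p (Dom C f)", simplified] G_simps[of "p (Cod C f)", simplified]
    have pf: "p (Cod C f) \<cdot> (i (Cod C f) \<cdot> (f \<cdot> p (Dom C f))) = f \<cdot> p (Dom C f)"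
      using comp_assoc_eq[OF pi[OF fT(2)], of "f \<cdot> p (Dom C f)"] by simp
    have nat: "Farr G f \<cdot>\<^bsub>N\<^esub> Farr G (p (Dom C f)) = Farr G (p (Cod C f)) \<cdot>\<^bsub>N\<^esub> transported f"
      using G_comp[of "p (Dom C f)" f] G_comp[of "i (Cod C f) \<cdot> (f \<cdot> p (Dom C f))" "p (Cod C f)"] pf
      by (simp add: transported_def)
    have "Farr G f \<cdot>\<^bsub>N\<^esub> t (Dom C f) = Farr G (p (Cod C f)) \<cdot>\<^bsub>N\<^esub> transported f \<cdot>\<^bsub>N\<^esub> j (Dom C f)"
      unfolding t_def by (rule N.comp_assoc_eq[OF nat]) simp_all
    then show ?thesis
      using jq_transported_comp(2)[OF that(1) refl refl fT, of "j (Dom C f)"]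
      by (simp add: t_def extension_def)
  qed
  ultimately show ?thesis
    unfolding naturally_isomorphic_def by (intro exI[of _ t]) (auto simp: extension_def)
qed

text \<open>\<open>Fobj G'' c\<close> splits the image under \<open>G''\<close> of
  \<open>i c \<cdot> p c\<close>, which \<open>\<tau>\<close> identifies with the idempotent split
  by \<open>n c\<close>. The comparison \<open>t c\<close> passes through \<open>\<tau>\<close> at
  \<open>\<sigma> c\<close>, with inverse \<open>?u\<close>.\<close>

lemma extension_unique:
  assumes G'': "is_functor (full_subcategory C T) N G''"
    and iso: "naturally_isomorphic (full_subcategory C S) N (functor_comp G'' inclusion_functor) G"
  shows "naturally_isomorphic (full_subcategory C T) N G'' extension"
proof -
  obtain \<tau> where \<tau>0: "\<forall>s \<in> S. \<tau> s \<in> hom N (Fobj G'' s) (Fobj G s) \<and> is_iso N (\<tau> s)"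
    "\<forall>f \<in> Arr (full_subcategory C S). Farr G f \<cdot>\<^bsub>N\<^esub> \<tau> (Dom C f) = \<tau> (Cod C f) \<cdot>\<^bsub>N\<^esub> Farr G'' f"
    using iso unfolding naturally_isomorphic_def by auto
  have \<tau>: "\<And>s. s \<in> S \<Longrightarrow> \<tau> s \<in> hom N (Fobj G'' s) (Fobj G s)" "\<And>s. s \<in> S \<Longrightarrow> is_iso N (\<tau> s)"
    "\<And>f. f \<in> Arr C \<Longrightarrow> Dom C f \<in> S \<Longrightarrow> Cod C f \<in> S \<Longrightarrow> Farr G f \<cdot>\<^bsub>N\<^esub> \<tau> (Dom C f) = \<tau> (Cod C f) \<cdot>\<^bsub>N\<^esub> Farr G'' f"
    using \<tau>0 by simp_all
  have \<tau>A: "\<tau> s \<in> Arr N" "Dom N (\<tau> s) = Fobj G'' s" "Cod N (\<tau> s) = Fobj G s" if "s \<in> S" for s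
    using \<tau>(1)[OF that] by (auto simp: hom_iff)
  have "\<exists>g. g \<in> hom N (Fobj G s) (Fobj G'' s) \<and> g \<cdot>\<^bsub>N\<^esub> \<tau> s = Id N (Fobj G'' s) \<and> \<tau> s \<cdot>\<^bsub>N\<^esub> g = Id N (Fobj G s)" if "s \<in> S" for s
    using \<tau>(2)[OF that] \<tau>A[OF that] by (auto simp: is_iso_def)
  then obtain \<tau>' where \<tau>': "\<And>s. s \<in> S \<Longrightarrow> \<tau>' s \<in> hom N (Fobj G s) (Fobj G'' s)"
    "\<And>s. s \<in> S \<Longrightarrow> \<tau>' s \<cdot>\<^bsub>N\<^esub> \<tau> s = Id N (Fobj G'' s)" "\<And>s. s \<in> S \<Longrightarrow> \<tau> s \<cdot>\<^bsub>N\<^esub> \<tau>' s = Id N (Fobj G s)" by metis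
  have \<tau>'A: "\<tau>' s \<in> Arr N" "Dom N (\<tau>' s) = Fobj G s" "Cod N (\<tau>' s) = Fobj G'' s" if "s \<in> S" for s
    using \<tau>'(1)[OF that] by (auto simp: hom_iff)
  have G''A: "Farr G'' f \<in> Arr N" "Dom N (Farr G'' f) = Fobj G'' (Dom C f)" "Cod N (Farr G'' f) = Fobj G'' (Cod C f)"
    if "f \<in> Arr C" "Dom C f \<in> T" "Cod C f \<in> T" for f
    using functorD(4-6)[OF G'', of f] that by auto
  have G''C: "Farr G'' g \<cdot>\<^bsub>N\<^esub> Farr G'' f = Farr G'' (g \<cdot> f)"
    if "f \<in> Arr C" "g \<in> Arr C" "Cod C f = Dom C g" "Dom C f \<in> T" "Dom C g \<in> T" "Cod C g \<in> T" for f g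
    using functorD(8)[OF G'', of f g] that by simp
  have G''O: "c \<in> T \<Longrightarrow> Fobj G'' c \<in> Obj N" "c \<in> T \<Longrightarrow> Farr G'' (Id C c) = Id N (Fobj G'' c)" for c
    using functorD(3)[OF G'', of c] functorD(7)[OF G'', of c] by auto
  define t where "t c = q c \<cdot>\<^bsub>N\<^esub> (\<tau> (\<sigma> c) \<cdot>\<^bsub>N\<^esub> Farr G'' (i c))" for c
  have tr: "transported f \<cdot>\<^bsub>N\<^esub> (\<tau> (\<sigma> (Dom C f)) \<cdot>\<^bsub>N\<^esub> Farr G'' (i (Dom C f))) = \<tau> (\<sigma> (Cod C f)) \<cdot>\<^bsub>N\<^esub> Farr G'' (i (Cod C f) \<cdot> f)"
    if f: "f \<in> Arr C" "Dom C f \<in> T" "Cod C f \<in> T" for f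
  proof -
    note [simp] = f ip_simps[OF f(2)] ip_simps[OF f(3)]
    note [simp] = \<tau>A[of "\<sigma> (Dom C f)", simplified] \<tau>A[of "\<sigma> (Cod C f)", simplified]
    let ?e = "i (Cod C f) \<cdot> (f \<cdot> p (Dom C f))"
    have nat: "transported f \<cdot>\<^bsub>N\<^esub> \<tau> (\<sigma> (Dom C f)) = \<tau> (\<sigma> (Cod C f)) \<cdot>\<^bsub>N\<^esub> Farr G'' ?e"
      using \<tau>(3)[of ?e] by (simp add: transported_def)
    note [simp] = G''A[of ?e, simplified] G''A[of "i (Dom C f)", simplified] transported_simps[OF f(1) refl refl f(2,3)]
    have "?e \<cdot> i (Dom C f) = i (Cod C f) \<cdot> (f \<cdot> (p (Dom C f) \<cdot> i (Dom C f)))" by simp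
    then have e: "?e \<cdot> i (Dom C f) = i (Cod C f) \<cdot> f" using pi[OF f(2)] by simp
    have "transported f \<cdot>\<^bsub>N\<^esub> (\<tau> (\<sigma> (Dom C f)) \<cdot>\<^bsub>N\<^esub> Farr G'' (i (Dom C f)))
        = \<tau> (\<sigma> (Cod C f)) \<cdot>\<^bsub>N\<^esub> Farr G'' ?e \<cdot>\<^bsub>N\<^esub> Farr G'' (i (Dom C f))"
      by (rule N.comp_assoc_eq[OF nat]) simp_all
    also have "\<dots> = \<tau> (\<sigma> (Cod C f)) \<cdot>\<^bsub>N\<^esub> (Farr G'' ?e \<cdot>\<^bsub>N\<^esub> Farr G'' (i (Dom C f)))"
      by (rule N.comp_assoc) simp_all
    also have "Farr G'' ?e \<cdot>\<^bsub>N\<^esub> Farr G'' (i (Dom C f)) = Farr G'' (i (Cod C f) \<cdot> f)"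
      using G''C[of "i (Dom C f)" ?e] e by simp
    finally show ?thesis .
  qed
  have "t c \<in> hom N (Fobj G'' c) (n c) \<and> is_iso N (t c)" if c: "c \<in> T" for c
  proof -
    note [simp] = c ip_simps[OF c] jq_simps[OF c] n[OF c] G''O(1)
    note [simp] = \<tau>A[of "\<sigma> c", simplified] \<tau>'A[of "\<sigma> c", simplified] G''A[of "i c", simplified] G''A[of "p c", simplified]
    have G\<sigma>: "Fobj G (\<sigma> c) \<in> Obj N" using functorD(3)[OF G, of "\<sigma> c"] by simp
    have tI: "transported (Id C c) \<in> Arr N" "Dom N (transported (Id C c)) = Fobj G (\<sigma> c)" "Cod N (transported (Id C c)) = Fobj G (\<sigma> c)"
      using transported_simps[of "Id C c" c c] by simp_all
    note [simp] = tI
    let ?u = "Farr G'' (p c) \<cdot>\<^bsub>N\<^esub> (\<tau>' (\<sigma> c) \<cdot>\<^bsub>N\<^esub> j c)"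
    have 1: "t c \<in> hom N (Fobj G'' c) (n c)" by (simp add: t_def hom_iff)
    have 2: "?u \<in> hom N (n c) (Fobj G'' c)" by (simp add: hom_iff)
    have "j c \<cdot>\<^bsub>N\<^esub> t c = transported (Id C c) \<cdot>\<^bsub>N\<^esub> (\<tau> (\<sigma> c) \<cdot>\<^bsub>N\<^esub> Farr G'' (i c))"
      unfolding t_def by (rule N.comp_assoc_eq[OF jq_transported[OF c]]) simp_all
    also have "\<dots> = \<tau> (\<sigma> c) \<cdot>\<^bsub>N\<^esub> Farr G'' (i c)" using tr[of "Id C c"] by simp
    finally have "\<tau>' (\<sigma> c) \<cdot>\<^bsub>N\<^esub> (j c \<cdot>\<^bsub>N\<^esub> t c) = Farr G'' (i c)"
      using N.comp_assoc_eq[OF \<tau>'(2)[of "\<sigma> c"], of "Farr G'' (i c)"] by simp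
    then have 3: "?u \<cdot>\<^bsub>N\<^esub> t c = Id N (Fobj G'' c)"
      using 1 G''C[of "i c" "p c"] pi[OF c] G''O(2)[OF c] by (simp add: hom_iff)
    have ip_nat: "\<tau> (\<sigma> c) \<cdot>\<^bsub>N\<^esub> Farr G'' (i c \<cdot> p c) = transported (Id C c) \<cdot>\<^bsub>N\<^esub> \<tau> (\<sigma> c)"
      using \<tau>(3)[of "i c \<cdot> p c"] by (simp add: transported_def)
    note [simp] = G''A[of "i c \<cdot> p c", simplified]
    have "Farr G'' (i c) \<cdot>\<^bsub>N\<^esub> ?u = Farr G'' (i c \<cdot> p c) \<cdot>\<^bsub>N\<^esub> (\<tau>' (\<sigma> c) \<cdot>\<^bsub>N\<^esub> j c)"
      by (rule N.comp_assoc_eq) (use G''C[of "p c" "i c"] in simp_all)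
    then have "\<tau> (\<sigma> c) \<cdot>\<^bsub>N\<^esub> (Farr G'' (i c) \<cdot>\<^bsub>N\<^esub> ?u) = transported (Id C c) \<cdot>\<^bsub>N\<^esub> \<tau> (\<sigma> c) \<cdot>\<^bsub>N\<^esub> (\<tau>' (\<sigma> c) \<cdot>\<^bsub>N\<^esub> j c)"
      using N.comp_assoc_eq[OF ip_nat, of "\<tau>' (\<sigma> c) \<cdot>\<^bsub>N\<^esub> j c"] by simp
    also have "\<dots> = transported (Id C c) \<cdot>\<^bsub>N\<^esub> j c"
      using N.comp_assoc_eq[OF \<tau>'(3)[of "\<sigma> c"], of "j c"] G\<sigma> by simp
    finally have "t c \<cdot>\<^bsub>N\<^esub> ?u = Id N (n c)"
      using transported_Id_absorb[OF c] by (simp add: t_def)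
    then show ?thesis using is_isoI[OF 1 2 3] 1 by blast
  qed
  moreover have "Farr extension f \<cdot>\<^bsub>N\<^esub> t (Dom C f) = t (Cod C f) \<cdot>\<^bsub>N\<^esub> Farr G'' f"
    if f: "f \<in> Arr C" "Dom C f \<in> T" "Cod C f \<in> T" for f
  proof -
    note [simp] = f ip_simps[OF f(2)] ip_simps[OF f(3)] jq_simps[OF f(2)] jq_simps[OF f(3)]
      transported_simps[OF f(1) refl refl f(2,3)] G''A[OF f]
    note [simp] = \<tau>A[of "\<sigma> (Dom C f)", simplified] \<tau>A[of "\<sigma> (Cod C f)", simplified]
      G''A[of "i (Dom C f)", simplified] G''A[of "i (Cod C f)", simplified]
    have "transported f \<cdot>\<^bsub>N\<^esub> (j (Dom C f) \<cdot>\<^bsub>N\<^esub> t (Dom C f)) = \<tau> (\<sigma> (Cod C f)) \<cdot>\<^bsub>N\<^esub> (Farr G'' (i (Cod C f)) \<cdot>\<^bsub>N\<^esub> Farr G'' f)"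
      using transported_jq_comp[OF f(1) refl refl f(2,3), of "\<tau> (\<sigma> (Dom C f)) \<cdot>\<^bsub>N\<^esub> Farr G'' (i (Dom C f))"]
        tr[OF f] G''C[of f "i (Cod C f)"] by (simp add: t_def)
    then show ?thesis by (simp add: extension_def t_def)
  qed
  ultimately show ?thesis
    unfolding naturally_isomorphic_def by (intro exI[of _ t]) (auto simp: extension_def)
qed

end

lemma split_idempotent_completion_retracts:
  assumes ST: "S \<subseteq> T" "T \<subseteq> Obj C" and split: "idempotents_split (full_subcategory C T)"
    and retract: "\<And>c. c \<in> T \<Longrightarrow> \<exists>s \<in> S. is_retract C c s"
  shows "split_idempotent_completion U (full_subcategory C S) (full_subcategory C T) inclusion_functor"
  unfolding split_idempotent_completion_def
proof (intro conjI allI impI)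
  show "is_functor (full_subcategory C S) (full_subcategory C T) inclusion_functor"
    by (rule full_subcategory_inclusion[OF ST])
  show "idempotents_split (full_subcategory C T)" by (rule split)
  fix N :: "('c, 'c) category" and G assume "idempotents_split N \<and> is_functor (full_subcategory C S) N G"
  then have N: "idempotents_split N" and G: "is_functor (full_subcategory C S) N G" by auto
  obtain \<sigma> i p where r: "\<And>c. c \<in> T \<Longrightarrow> \<sigma> c \<in> S" "\<And>c. c \<in> T \<Longrightarrow> i c \<in> hom C c (\<sigma> c)"
    "\<And>c. c \<in> T \<Longrightarrow> p c \<in> hom C (\<sigma> c) c" "\<And>c. c \<in> T \<Longrightarrow> p c \<cdot> i c = Id C c"
    using retract unfolding is_retract_def by metis
  \<comment> \<open>The idempotent \<open>i c \<cdot> p c\<close> is an arrow of \<open>S\<close>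
    even when \<open>c\<close> lies outside, so \<open>G\<close> applies to it, and its image splits
    in \<open>N\<close>.\<close>
  have "\<exists>x a b. x \<in> Obj N \<and> a \<in> hom N x (Fobj G (\<sigma> c)) \<and> b \<in> hom N (Fobj G (\<sigma> c)) x \<and>
      b \<cdot>\<^bsub>N\<^esub> a = Id N x \<and> a \<cdot>\<^bsub>N\<^esub> b = Farr G (i c \<cdot> p c)" if c: "c \<in> T" for c
  proof -
    have A: "i c \<in> Arr C" "Dom C (i c) = c" "Cod C (i c) = \<sigma> c" "p c \<in> Arr C" "Dom C (p c) = \<sigma> c" "Cod C (p c) = c" "c \<in> Obj C" "\<sigma> c \<in> S"
      using r(1-3)[OF c] c ST by (auto simp: hom_iff)
    have idem: "i c \<cdot> p c \<cdot> (i c \<cdot> p c) = i c \<cdot> p c"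
      using comp_assoc_eq[OF r(4)[OF c], of "p c"] A by simp
    have "Farr G (i c \<cdot> p c) \<cdot>\<^bsub>N\<^esub> Farr G (i c \<cdot> p c) = Farr G (i c \<cdot> p c)"
      using functorD(8)[OF G, of "i c \<cdot> p c" "i c \<cdot> p c"] idem A by simp
    moreover have "Farr G (i c \<cdot> p c) \<in> hom N (Fobj G (\<sigma> c)) (Fobj G (\<sigma> c))"
      using functorD(4-6)[OF G, of "i c \<cdot> p c"] A by (simp add: hom_iff)
    moreover have "Fobj G (\<sigma> c) \<in> Obj N" using functorD(3)[OF G, of "\<sigma> c"] A by simp
    ultimately show ?thesis using N unfolding idempotents_split_def by blast
  qed
  then obtain n j q where s: "\<And>c. c \<in> T \<Longrightarrow> n c \<in> Obj N" "\<And>c. c \<in> T \<Longrightarrow> j c \<in> hom N (n c) (Fobj G (\<sigma> c))"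
    "\<And>c. c \<in> T \<Longrightarrow> q c \<in> hom N (Fobj G (\<sigma> c)) (n c)" "\<And>c. c \<in> T \<Longrightarrow> q c \<cdot>\<^bsub>N\<^esub> j c = Id N (n c)"
    "\<And>c. c \<in> T \<Longrightarrow> j c \<cdot>\<^bsub>N\<^esub> q c = Farr G (i c \<cdot> p c)" by metis
  note ctx = ST G r s
  show "\<exists>G'. is_functor (full_subcategory C T) N G' \<and>
      naturally_isomorphic (full_subcategory C S) N (functor_comp G' inclusion_functor) G \<and>
      (\<forall>G''. is_functor (full_subcategory C T) N G'' \<and>
        naturally_isomorphic (full_subcategory C S) N (functor_comp G'' inclusion_functor) G \<longrightarrow>
        naturally_isomorphic (full_subcategory C T) N G'' G')"
    using extension_functor[OF ctx] extension_restricts[OF ctx] extension_unique[OF ctx] by blast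
qed

text \<open>A splitting of \<open>e\<close> is a colimit of the diagram consisting of
  \<open>k\<close> and its endomorphism \<open>e\<close>: the cocone \<open>p\<close> has
  \<open>p \<cdot> e = p\<close>, and \<open>e\<close> itself is a cocone, which factors as
  \<open>i \<cdot> p\<close>.\<close>

lemma cocomplete_idempotents_split:
  assumes univ: "universe TYPE('u)" and "cocomplete TYPE('u) C"
    and k: "k \<in> Obj C" and e: "e \<in> hom C k k" "e \<cdot> e = e"
  shows "\<exists>x \<in> Obj C. \<exists>i \<in> hom C x k. \<exists>p \<in> hom C k x. p \<cdot> i = Id C x \<and> i \<cdot> p = e"
proof -
  interpret univ "TYPE('u)" by unfold_locales (rule univ)
  \<comment> \<open>The monoid of truth values under conjunction, as a category with one object:
    \<open>True\<close> is the identity and \<open>False\<close> stands for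
    \<open>e\<close>.\<close>
  define J :: "(unit, bool) category" where
    "J = \<lparr>Obj = UNIV, Arr = UNIV, Dom = (\<lambda>_. ()), Cod = (\<lambda>_. ()), Id = (\<lambda>_. True), Comp = (\<and>)\<rparr>"
  define D :: "(unit, bool, 'o, 'a) cat_functor" where
    "D = \<lparr>Fobj = (\<lambda>_. k), Farr = (\<lambda>b. if b then Id C k else e)\<rparr>"
  have eA: "e \<in> Arr C" "Dom C e = k" "Cod C e = k" using e by (auto simp: hom_iff)
  have J: "is_category J" by (auto simp: J_def is_category_def hom_iff)
  then have small: "small_category TYPE('u) J" by (simp add: small_category_def J_def finite_small)
  have "is_functor J C D"
    using J cat k e(2) eA by (auto simp: is_functor_def J_def D_def hom_iff)
  from cocomplete_colimit[OF assms(2) small this] obtain x t where colim: "is_colimit J C D x t" by blast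
  define p where "p = t ()"
  note t = coconeD[OF colimitD(2)[OF colim]]
  have p: "p \<in> Arr C" "Dom C p = k" "Cod C p = x" "x \<in> Obj C" "p \<cdot> e = p"
    using t(1) t(2-4)[of "()"] t(5)[of False] by (auto simp: J_def D_def p_def)
  have "is_cocone J C D k (\<lambda>_. e)"
    using k eA e(2) by (auto simp: is_cocone_def J_def D_def hom_iff)
  from colimit_factor[OF colim this] obtain i where i: "i \<in> hom C x k" "i \<cdot> p = e"
    by (auto simp: J_def p_def)
  have "p \<cdot> i = Id C x"
  proof (rule colimit_eqI[OF colim, of _ x])
    show "p \<cdot> i \<cdot> t a = Id C x \<cdot> t a" for a
      using i p by (simp add: hom_iff p_def[symmetric])
  qed (use i p in \<open>auto simp: hom_iff\<close>)
  moreover have "p \<in> hom C k x" using p by (simp add: hom_iff)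
  ultimately show ?thesis using i p(4) by blast
qed

end

section \<open>Lifting properties and the class cof\<close>

definition lifts_against :: "('o, 'a) category \<Rightarrow> 'a \<Rightarrow> 'a \<Rightarrow> bool" where
  "lifts_against C f g \<longleftrightarrow> (\<forall>u \<in> hom C (Dom C f) (Dom C g). \<forall>v \<in> hom C (Cod C f) (Cod C g).
     v \<cdot>\<^bsub>C\<^esub> f = g \<cdot>\<^bsub>C\<^esub> u \<longrightarrow> (\<exists>d \<in> hom C (Cod C f) (Dom C g). d \<cdot>\<^bsub>C\<^esub> f = u \<and> g \<cdot>\<^bsub>C\<^esub> d = v))"

lemma cell_closed_chain:
  fixes r :: "'u rel"
  assumes "cell_closed TYPE('u) C L" "small TYPE('u) (Field r)" "smooth_chain C r l A"
    and "\<And>i j. (i, j) \<in> r \<Longrightarrow> j \<noteq> l \<Longrightarrow> Farr A (i, j) \<in> L"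
    and "z \<in> Field r" "\<And>i. i \<in> Field r \<Longrightarrow> (z, i) \<in> r"
  shows "Farr A (z, l) \<in> L"
proof -
  have "small TYPE('u) (Field r) \<and> smooth_chain C r l A \<and>
      (\<forall>i j. (i, j) \<in> r \<and> j \<noteq> l \<longrightarrow> Farr A (i, j) \<in> L) \<and> z \<in> Field r \<and> (\<forall>i \<in> Field r. (z, i) \<in> r)"
    using assms(2-) by blast
  then show ?thesis
    using assms(1) unfolding cell_closed_def closed_transfinite_composition_def by blast
qed

definition left_lifting :: "('o, 'a) category \<Rightarrow> 'a \<Rightarrow> 'a set" where
  "left_lifting C g = {f \<in> Arr C. lifts_against C f g}"

context cat
begin

lemma left_liftingD:
  assumes "f \<in> left_lifting C g" "u \<in> hom C (Dom C f) (Dom C g)" "v \<in> hom C (Cod C f) (Cod C g)" "v \<cdot> f = g \<cdot> u"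
  obtains d where "d \<in> hom C (Cod C f) (Dom C g)" "d \<cdot> f = u" "g \<cdot> d = v"
  using assms unfolding left_lifting_def lifts_against_def by blast

lemma left_liftingI:
  assumes "f \<in> Arr C"
    and "\<And>u v. u \<in> hom C (Dom C f) (Dom C g) \<Longrightarrow> v \<in> hom C (Cod C f) (Cod C g) \<Longrightarrow> v \<cdot> f = g \<cdot> u \<Longrightarrow>
      \<exists>d. d \<in> hom C (Cod C f) (Dom C g) \<and> d \<cdot> f = u \<and> g \<cdot> d = v"
  shows "f \<in> left_lifting C g"
  using assms unfolding left_lifting_def lifts_against_def by blast

lemma left_lifting_iso:
  assumes "is_iso C f" "g \<in> Arr C"
  shows "f \<in> left_lifting C g"
proof (rule left_liftingI)
  show f: "f \<in> Arr C" using assms by (simp add: is_iso_def)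
  obtain f' where f': "f' \<in> hom C (Cod C f) (Dom C f)" "f' \<cdot> f = Id C (Dom C f)" "f \<cdot> f' = Id C (Cod C f)"
    using assms by (auto simp: is_iso_def)
  fix u v assume uv: "u \<in> hom C (Dom C f) (Dom C g)" "v \<in> hom C (Cod C f) (Cod C g)" "v \<cdot> f = g \<cdot> u"
  have "g \<cdot> (u \<cdot> f') = v"
    using comp_assoc_eq[OF uv(3)[symmetric], of f'] f f' uv(1,2) assms(2) by (simp add: hom_iff)
  moreover have "u \<cdot> f' \<cdot> f = u" using f f' uv by (simp add: hom_iff)
  ultimately show "\<exists>d. d \<in> hom C (Cod C f) (Dom C g) \<and> d \<cdot> f = u \<and> g \<cdot> d = v"
    using f' uv by (intro exI[of _ "u \<cdot> f'"]) (simp add: hom_iff)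
qed

text \<open>The lift for \<open>f\<close> and the given \<open>u\<close> agree on the common domain,
  so they glue; that the glued map lifts \<open>v\<close> is checked on the two legs.\<close>

lemma left_lifting_pushout:
  assumes f: "f \<in> left_lifting C g" and g: "g \<in> Arr C" and p: "is_pushout C f a f' a'"
  shows "f' \<in> left_lifting C g"
proof (rule left_liftingI)
  have p': "f \<in> Arr C" "a \<in> Arr C" "f' \<in> Arr C" "a' \<in> Arr C" "Dom C f = Dom C a" "Dom C a' = Cod C f"
    "Dom C f' = Cod C a" "Cod C f' = Cod C a'" "a' \<cdot> f = f' \<cdot> a"
    using p by (auto simp: is_pushout_def)
  have at: "attaches C (Cod C a) {()} (\<lambda>_. f) (\<lambda>_. a) (Cod C f') f' (\<lambda>_. a')"
    using is_pushout_iff_attaches[OF p'(1,2,5)] p by blast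
  show "f' \<in> Arr C" by (rule p')
  fix u v assume uv: "u \<in> hom C (Dom C f') (Dom C g)" "v \<in> hom C (Cod C f') (Cod C g)" "v \<cdot> f' = g \<cdot> u"
  have uvA: "u \<in> Arr C" "Dom C u = Cod C a" "Cod C u = Dom C g" "v \<in> Arr C" "Dom C v = Cod C a'" "Cod C v = Cod C g"
    using uv p' by (auto simp: hom_iff)
  have "v \<cdot> a' \<cdot> f = v \<cdot> (f' \<cdot> a)" using p' uvA by simp
  also have "\<dots> = g \<cdot> u \<cdot> a" using p' uvA by (intro comp_assoc_eq[OF uv(3)]) simp_all
  finally have sq: "v \<cdot> a' \<cdot> f = g \<cdot> (u \<cdot> a)" using p' uvA g by simp
  obtain d where d: "d \<in> hom C (Cod C f) (Dom C g)" "d \<cdot> f = u \<cdot> a" "g \<cdot> d = v \<cdot> a'"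
    by (rule left_liftingD[OF f _ _ sq]) (use p' uvA in \<open>auto simp: hom_iff\<close>)
  have "extends_cells C (Cod C a) {()} (\<lambda>_. f) (\<lambda>_. a) (Dom C g) u (\<lambda>_. d)"
    using d uvA by (simp add: extends_cells_def hom_iff)
  from attaches_factor[OF at this] obtain h where h: "h \<in> hom C (Cod C f') (Dom C g)" "h \<cdot> f' = u" "h \<cdot> a' = d" by auto
  have hA: "h \<in> Arr C" "Dom C h = Cod C a'" "Cod C h = Dom C g" using h(1) p' by (auto simp: hom_iff)
  have "g \<cdot> h = v"
    by (rule attaches_eqI[OF at, of _ "Cod C g"]) (use g h(2,3) d(3) hA p' uvA uv(3) in \<open>simp_all add: hom_iff\<close>)
  then show "\<exists>d. d \<in> hom C (Cod C f') (Dom C g) \<and> d \<cdot> f' = u \<and> g \<cdot> d = v"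
    using h by blast
qed

lemma left_lifting_retract:
  assumes k: "k \<in> left_lifting C g" and g: "g \<in> Arr C" and r: "is_retract arrows f k"
  shows "f \<in> left_lifting C g"
proof -
  obtain i p where i: "i \<in> hom arrows f k" and p: "p \<in> hom arrows k f" and pi: "p \<cdot>\<^bsub>arrows\<^esub> i = Id arrows f"
    and f: "f \<in> Arr C" and kA: "k \<in> Arr C"
    using r by (auto simp: is_retract_def)
  have iA: "i \<in> Arr arrows" and pA: "p \<in> Arr arrows" using i p by (auto simp: hom_iff)
  have i': "dom_part i \<in> Arr C" "Dom C (dom_part i) = Dom C f" "Cod C (dom_part i) = Dom C k"
    "cod_part i \<in> Arr C" "Dom C (cod_part i) = Cod C f" "Cod C (cod_part i) = Cod C k"
    "cod_part i \<cdot> f = k \<cdot> dom_part i"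
    using arrow_ArrD[OF iA] i by (auto simp: hom_iff)
  have p': "dom_part p \<in> Arr C" "Dom C (dom_part p) = Dom C k" "Cod C (dom_part p) = Dom C f"
    "cod_part p \<in> Arr C" "Dom C (cod_part p) = Cod C k" "Cod C (cod_part p) = Cod C f"
    "cod_part p \<cdot> k = f \<cdot> dom_part p"
    using arrow_ArrD[OF pA] p by (auto simp: hom_iff)
  have pi': "dom_part p \<cdot> dom_part i = Id C (Dom C f)" "cod_part p \<cdot> cod_part i = Id C (Cod C f)"
    using arg_cong[OF pi, of dom_part] arg_cong[OF pi, of cod_part] by simp_all
  show ?thesis
  proof (rule left_liftingI[OF f])
    fix u v assume uv: "u \<in> hom C (Dom C f) (Dom C g)" "v \<in> hom C (Cod C f) (Cod C g)" "v \<cdot> f = g \<cdot> u"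
    note [simp] = f kA g i'(1-6) p'(1-6)
    have uvA: "u \<in> Arr C" "Dom C u = Dom C f" "Cod C u = Dom C g" "v \<in> Arr C" "Dom C v = Cod C f" "Cod C v = Cod C g"
      using uv by (auto simp: hom_iff)
    note [simp] = uvA
    have "v \<cdot> cod_part p \<cdot> k = v \<cdot> (f \<cdot> dom_part p)" using p'(7) by simp
    also have "\<dots> = g \<cdot> u \<cdot> dom_part p" by (intro comp_assoc_eq[OF uv(3)]) simp_all
    finally have sq: "v \<cdot> cod_part p \<cdot> k = g \<cdot> (u \<cdot> dom_part p)" by simp
    obtain d where d: "d \<in> hom C (Cod C k) (Dom C g)" "d \<cdot> k = u \<cdot> dom_part p" "g \<cdot> d = v \<cdot> cod_part p"
      by (rule left_liftingD[OF k _ _ sq]) (auto simp: hom_iff)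
    have dA: "d \<in> Arr C" "Dom C d = Cod C k" "Cod C d = Dom C g" using d(1) by (auto simp: hom_iff)
    note [simp] = dA
    have "d \<cdot> cod_part i \<cdot> f = d \<cdot> (k \<cdot> dom_part i)" using i'(7) by simp
    also have "\<dots> = u \<cdot> dom_part p \<cdot> dom_part i" by (intro comp_assoc_eq[OF d(2)]) simp_all
    also have "\<dots> = u" using pi'(1) by simp
    finally have 1: "d \<cdot> cod_part i \<cdot> f = u" .
    have "g \<cdot> (d \<cdot> cod_part i) = v \<cdot> cod_part p \<cdot> cod_part i" by (intro comp_assoc_eq[OF d(3)]) simp_all
    also have "\<dots> = v" using pi'(2) by simp
    finally show "\<exists>d. d \<in> hom C (Cod C f) (Dom C g) \<and> d \<cdot> f = u \<and> g \<cdot> d = v"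
      using 1 by (intro exI[of _ "d \<cdot> cod_part i"]) (simp add: hom_iff)
  qed
qed

lemma left_lifting_comp:
  assumes f: "f \<in> left_lifting C g" and k: "k \<in> left_lifting C g" and fk: "Cod C f = Dom C k" and g: "g \<in> Arr C"
  shows "k \<cdot> f \<in> left_lifting C g"
proof -
  have [simp]: "f \<in> Arr C" "k \<in> Arr C" "Cod C f = Dom C k" "g \<in> Arr C" using f k fk g by (auto simp: left_lifting_def)
  show ?thesis
  proof (rule left_liftingI)
    fix u v assume uv: "u \<in> hom C (Dom C (k \<cdot> f)) (Dom C g)" "v \<in> hom C (Cod C (k \<cdot> f)) (Cod C g)" "v \<cdot> (k \<cdot> f) = g \<cdot> u"
    then have [simp]: "u \<in> Arr C" "Dom C u = Dom C f" "Cod C u = Dom C g" "v \<in> Arr C" "Dom C v = Cod C k" "Cod C v = Cod C g"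
      by (auto simp: hom_iff)
    have "v \<cdot> k \<cdot> f = g \<cdot> u" using uv(3) by simp
    then obtain d where d: "d \<in> hom C (Cod C f) (Dom C g)" "d \<cdot> f = u" "g \<cdot> d = v \<cdot> k"
      by (rule left_liftingD[OF f, rotated 2]) (auto simp: hom_iff)
    obtain e where e: "e \<in> hom C (Cod C k) (Dom C g)" "e \<cdot> k = d" "g \<cdot> e = v"
      by (rule left_liftingD[OF k _ _ d(3)[symmetric]]) (use d(1) in \<open>auto simp: hom_iff\<close>)
    have "e \<cdot> (k \<cdot> f) = u" using comp_assoc_eq[OF e(2), of f] e(1) d(2) by (simp add: hom_iff)
    then show "\<exists>d. d \<in> hom C (Cod C (k \<cdot> f)) (Dom C g) \<and> d \<cdot> (k \<cdot> f) = u \<and> g \<cdot> d = v"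
      using e(1,3) by auto
  qed simp
qed

lemma smooth_chainD:
  assumes "smooth_chain C r l A"
  shows "Well_order r" "limit_element r l" "i \<in> Field r \<Longrightarrow> (i, l) \<in> r" "is_functor (poset_category r) C A"
    "limit_element r j \<Longrightarrow>
      is_colimit (poset_category (Restr r (underS r j))) C A (Fobj A j) (\<lambda>i. Farr A (i, j))"
  using assms by (auto simp: smooth_chain_def)

lemma Field_Restr_underS:
  assumes "Well_order r"
  shows "Field (Restr r (underS r j)) = underS r j"
proof -
  have "Refl r" using assms by (simp add: well_order_on_def linear_order_on_def partial_order_on_def preorder_on_def)
  then show ?thesis by (auto simp: Field_def refl_on_def underS_def)
qed

text \<open>The lifts along the stages of a chain are chosen by recursion, each one extending the previous ones.\<close>

lemma left_lifting_chain:
  fixes r :: "'i rel"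
  assumes g: "g \<in> Arr C" and A: "smooth_chain C r l A"
    and step: "\<And>i j. (i, j) \<in> r \<Longrightarrow> j \<noteq> l \<Longrightarrow> Farr A (i, j) \<in> left_lifting C g"
    and z: "z \<in> Field r" "\<And>i. i \<in> Field r \<Longrightarrow> (z, i) \<in> r"
  shows "Farr A (z, l) \<in> left_lifting C g"
proof -
  note ch = smooth_chainD[OF A] and A' = diagramD[OF smooth_chainD(4)[OF A]]
  interpret r: wo_rel r using ch(1) by (simp add: wo_rel_def)
  have lF: "l \<in> Field r" using ch(2) by (simp add: limit_element_def)
  have lS: "(i, l) \<in> r" if "i \<in> Field r" for i using ch(3) that .
  have rF: "\<And>i j. (i, j) \<in> r \<Longrightarrow> i \<in> Field r \<and> j \<in> Field r" by (auto simp: Field_def)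
  have rtrans: "\<And>i j k. (i, j) \<in> r \<Longrightarrow> (j, k) \<in> r \<Longrightarrow> (i, k) \<in> r" using r.TRANS by (meson transD)
  have ranti: "\<And>i j. (i, j) \<in> r \<Longrightarrow> (j, i) \<in> r \<Longrightarrow> i = j" using r.ANTISYM by (meson antisymD)
  have rrefl: "\<And>i. i \<in> Field r \<Longrightarrow> (i, i) \<in> r" using r.REFL by (simp add: refl_on_def)
  show ?thesis
  proof (rule left_liftingI)
    have zl: "(z, l) \<in> r" using lS z(1) .
    show "Farr A (z, l) \<in> Arr C" using A'(2)[OF zl] .
    fix u v assume "u \<in> hom C (Dom C (Farr A (z, l))) (Dom C g)" "v \<in> hom C (Cod C (Farr A (z, l))) (Cod C g)"
      and uv: "v \<cdot> Farr A (z, l) = g \<cdot> u"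
    then have uA: "u \<in> Arr C" "Dom C u = Fobj A z" "Cod C u = Dom C g" and vA: "v \<in> Arr C" "Dom C v = Fobj A l" "Cod C v = Cod C g"
      using A'(2-4)[OF zl] by (auto simp: hom_iff)
    \<comment> \<open>\<open>e\<close> is a partial diagonal on stage \<open>i\<close>: it lifts
      \<open>v\<close> over \<open>g\<close>, equals \<open>u\<close> at the start and restricts to
      all lifts chosen before.\<close>
    define P where "P d i e \<longleftrightarrow> (i \<in> Field r \<longrightarrow> e \<in> hom C (Fobj A i) (Dom C g) \<and> g \<cdot> e = v \<cdot> Farr A (i, l) \<and>
      (i = z \<longrightarrow> e = u) \<and> (\<forall>k \<in> Order_Relation.underS r i. e \<cdot> Farr A (k, i) = d k))" for d i e
    have "\<exists>d. \<forall>i. P d i (d i)"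
    proof (rule dependent_wf_choice[OF r.WF])
      fix d d' :: "'i \<Rightarrow> 'a" and i e assume "\<And>k. (k, i) \<in> r - Relation.Id \<Longrightarrow> d k = d' k"
      then show "P d i e = P d' i e" by (auto simp: P_def underS_iff)
    next
      fix i and d :: "'i \<Rightarrow> 'a" assume "\<And>k. (k, i) \<in> r - Relation.Id \<Longrightarrow> P d k (d k)"
      then have d: "P d k (d k)" if "k \<in> Order_Relation.underS r i" for k using that by (auto simp: underS_iff)
      have dA: "d k \<in> Arr C" "Dom C (d k) = Fobj A k" "Cod C (d k) = Dom C g" "g \<cdot> d k = v \<cdot> Farr A (k, l)"
        if "k \<in> Order_Relation.underS r i" for k
        using d[OF that] that rF[of k i] by (auto simp: P_def underS_iff hom_iff)
      have dC: "d k \<cdot> Farr A (m, k) = d m" if "k \<in> Order_Relation.underS r i" "m \<in> Order_Relation.underS r k" for k m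
        using d[OF that(1)] that rF[of k i] by (auto simp: P_def underS_iff)
      show "\<exists>e. P d i e"
      proof (cases "i \<in> Field r")
        case False
        then show ?thesis by (simp add: P_def)
      next
        case i: True
        have il: "(i, l) \<in> r" using lS i .
        show ?thesis
        proof (cases rule: well_order_cases[OF ch(1) i])
          case 1
          have "i = z" using 1 z(2)[OF i] by (auto simp: underS_iff)
          then have "P d i u" using 1 uA uv by (auto simp: P_def hom_iff)
          then show ?thesis by blast
        next
          case (2 k)
          then have k: "k \<in> Order_Relation.underS r i" "(k, i) \<in> r" by (auto simp: is_succ_def underS_iff)
          have kl: "(k, l) \<in> r" using rtrans[OF k(2) il] .
          \<comment> \<open>The hypothesis \<open>step\<close> excludes maps into \<open>l\<close>;
            it applies here because \<open>l\<close> is a limit and hence no successor.\<close>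
          have "i \<noteq> l"
          proof
            assume "i = l"
            then obtain m where "m \<in> Order_Relation.underS r i" "k \<in> Order_Relation.underS r m"
              using ch(2) k(1) by (auto simp: limit_element_def)
            then show False using 2 ranti[of k m] by (auto simp: is_succ_def underS_iff)
          qed
          then have lift: "Farr A (k, i) \<in> left_lifting C g" using step k(2) by blast
          have "v \<cdot> Farr A (i, l) \<cdot> Farr A (k, i) = g \<cdot> d k"
            using A'(6)[OF k(2) il] A'(2-4)[OF k(2)] A'(2-4)[OF il] vA dA(4)[OF k(1)] by simp
          then obtain e where e: "e \<in> hom C (Cod C (Farr A (k, i))) (Dom C g)" "e \<cdot> Farr A (k, i) = d k" "g \<cdot> e = v \<cdot> Farr A (i, l)"
            by (rule left_liftingD[OF lift, rotated 2])
              (use A'(2-4)[OF k(2)] A'(2-4)[OF il] vA dA(1-3)[OF k(1)] in \<open>auto simp: hom_iff\<close>)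
          have eA: "e \<in> Arr C" "Dom C e = Fobj A i" "Cod C e = Dom C g" using e(1) A'(4)[OF k(2)] by (auto simp: hom_iff)
          have "e \<cdot> Farr A (m, i) = d m" if m: "m \<in> Order_Relation.underS r i" for m
          proof (cases "m = k")
            case True
            then show ?thesis using e(2) by simp
          next
            case False
            then have mk: "(m, k) \<in> r" "m \<in> Order_Relation.underS r k" using 2 m by (auto simp: is_succ_def underS_iff)
            have "e \<cdot> Farr A (m, i) = e \<cdot> (Farr A (k, i) \<cdot> Farr A (m, k))" using A'(6)[OF mk(1) k(2)] by simp
            also have "\<dots> = d k \<cdot> Farr A (m, k)"
              using eA A'(2-4)[OF mk(1)] A'(2-4)[OF k(2)] by (intro comp_assoc_eq[OF e(2)]) simp_all
            finally show ?thesis using dC[OF k(1) mk(2)] by simp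
          qed
          moreover have "i \<noteq> z"
            using z(2)[of k] ranti[of k z] k rF[OF k(2)] by (auto simp: underS_iff)
          ultimately have "P d i e" using eA e(3) by (auto simp: P_def hom_iff)
          then show ?thesis by blast
        next
          case 3
          let ?R = "Restr r (Order_Relation.underS r i)"
          note FR = Field_Restr_underS[OF ch(1), of i]
          have less: "(k, i) \<in> r" if "k \<in> Order_Relation.underS r i" for k using that by (simp add: underS_iff)
          note colim = ch(5)[OF 3]
          \<comment> \<open>At a limit the earlier lifts form a cocone; that the induced map lifts
            \<open>v\<close> can be tested on the earlier stages.\<close>
          have "is_cocone (poset_category ?R) C A (Dom C g) d"
            unfolding cocone_poset_iff FR
          proof (intro conjI ballI allI impI)
            fix k m assume km: "(k, m) \<in> ?R"
            show "d m \<cdot> Farr A (k, m) = d k"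
            proof (cases "k = m")
              case True
              then show ?thesis using A'(5)[of m] dA[of m] km rF[of k m] by auto
            next
              case False
              then show ?thesis using dC[of m k] km by (auto simp: underS_iff)
            qed
          qed (use g dA in \<open>auto simp: hom_iff\<close>)
          from colimit_factor[OF colim this] obtain e where e: "e \<in> hom C (Fobj A i) (Dom C g)"
            "\<And>k. k \<in> Order_Relation.underS r i \<Longrightarrow> e \<cdot> Farr A (k, i) = d k" using FR by auto
          have eA: "e \<in> Arr C" "Dom C e = Fobj A i" "Cod C e = Dom C g" using e(1) by (auto simp: hom_iff)
          have "g \<cdot> e = v \<cdot> Farr A (i, l)"
          proof (rule colimit_eqI[OF colim, of _ "Cod C g"])
            fix k assume "k \<in> Obj (poset_category ?R)"
            then have k: "k \<in> Order_Relation.underS r i" using FR by simp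
            show "g \<cdot> e \<cdot> Farr A (k, i) = v \<cdot> Farr A (i, l) \<cdot> Farr A (k, i)"
              using g eA e(2)[OF k] dA(4)[OF k] A'(2-4)[OF less[OF k]] A'(2-4)[OF il] vA A'(6)[OF less[OF k] il] by simp
          qed (use g eA vA A'(2-4)[OF il] in \<open>auto simp: hom_iff\<close>)
          moreover have "i \<noteq> z"
          proof -
            obtain k where k: "k \<in> Order_Relation.underS r i" using 3 by (auto simp: limit_element_def)
            then show ?thesis using z(2)[of k] ranti[of k z] less[OF k] rF[OF less[OF k]] by (auto simp: underS_iff)
          qed
          ultimately have "P d i e" using e by (auto simp: P_def)
          then show ?thesis by blast
        qed
      qed
    qed
    then obtain d where d: "\<And>i. P d i (d i)" by blast
    obtain k where k: "k \<in> Order_Relation.underS r l" using ch(2) by (auto simp: limit_element_def)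
    then have "(z, k) \<in> r" "(k, l) \<in> r" "k \<noteq> l" using z(2)[of k] rF[of k l] by (auto simp: underS_iff)
    then have "z \<noteq> l" using ranti[of k l] by blast
    then have zl': "z \<in> Order_Relation.underS r l" using zl by (simp add: underS_iff)
    have "d l \<cdot> Farr A (z, l) = d z" "d z = u" using d[of l] d[of z] lF z(1) zl' by (auto simp: P_def)
    moreover have "d l \<in> hom C (Fobj A l) (Dom C g)" "g \<cdot> d l = v \<cdot> Farr A (l, l)" using d[of l] lF by (auto simp: P_def)
    ultimately show "\<exists>d. d \<in> hom C (Cod C (Farr A (z, l))) (Dom C g) \<and> d \<cdot> Farr A (z, l) = u \<and> g \<cdot> d = v"
      using A'(4)[OF zl] A'(5)[OF lF] vA by (intro exI[of _ "d l"]) auto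
  qed
qed

lemma left_lifting_closed:
  assumes "g \<in> Arr C"
  shows "cell_closed TYPE('u) C (left_lifting C g)" "closed_under_retracts C (left_lifting C g)"
proof -
  have "closed_transfinite_composition TYPE('u) C (left_lifting C g)"
    unfolding closed_transfinite_composition_def
  proof (intro conjI ballI allI impI)
    fix r :: "'u rel" and l A z
    assume a: "small TYPE('u) (Field r) \<and> smooth_chain C r l A \<and>
      (\<forall>i j. (i, j) \<in> r \<and> j \<noteq> l \<longrightarrow> Farr A (i, j) \<in> left_lifting C g) \<and> z \<in> Field r \<and> (\<forall>i\<in>Field r. (z, i) \<in> r)"
    show "Farr A (z, l) \<in> left_lifting C g"
      by (rule left_lifting_chain[OF assms]) (use a in auto)
  qed (rule left_lifting_comp[OF _ _ _ assms])
  then show "cell_closed TYPE('u) C (left_lifting C g)"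
    using left_lifting_iso[OF _ assms] left_lifting_pushout[OF _ assms]
    unfolding cell_closed_def stable_under_pushout_def by auto
  show "closed_under_retracts C (left_lifting C g)"
    using left_lifting_retract[OF _ assms] unfolding closed_under_retracts_def by auto
qed

section \<open>The class cof as the smallest closed class\<close>

lemma cof_subset:
  assumes "L \<subseteq> Arr C" "X \<subseteq> L" "cell_closed TYPE('u) C L" "closed_under_retracts C L"
  shows "cof TYPE('u) C X \<subseteq> L"
  using assms unfolding cof_def cell_closed_def by blast

lemma cof_lifts:
  assumes "g \<in> Arr C" "X \<subseteq> left_lifting C g"
  shows "cof TYPE('u) C X \<subseteq> left_lifting C g"
  by (rule cof_subset[OF _ assms(2) left_lifting_closed[OF assms(1)]]) (auto simp: left_lifting_def)

text \<open>Closure conditions pass to intersections: premises that hold in the intersection hold in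
  each member of \<open>\<L>\<close>, and so do the conclusions.\<close>

lemma cof_closed:
  "cell_closed TYPE('u) C (cof TYPE('u) C X)" "closed_under_retracts C (cof TYPE('u) C X)" "X \<subseteq> cof TYPE('u) C X"
proof -
  define \<L> where "\<L> = {L. L \<subseteq> Arr C \<and> X \<subseteq> L \<and> {f. is_iso C f} \<subseteq> L \<and>
    stable_under_pushout C L \<and> closed_transfinite_composition TYPE('u) C L \<and> closed_under_retracts C L}"
  have cof: "cof TYPE('u) C X = \<Inter> \<L>" by (simp add: cof_def \<L>_def)
  have L: "cell_closed TYPE('u) C L" "closed_under_retracts C L" "X \<subseteq> L" if "L \<in> \<L>" for L
    using that by (auto simp: \<L>_def cell_closed_def)
  show "X \<subseteq> cof TYPE('u) C X" using L(3) by (auto simp: cof)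
  show "closed_under_retracts C (cof TYPE('u) C X)"
    using L(2) unfolding cof closed_under_retracts_def by blast
  show "cell_closed TYPE('u) C (cof TYPE('u) C X)"
    unfolding cell_closed_def
  proof (intro conjI)
    show "{f. is_iso C f} \<subseteq> cof TYPE('u) C X" using L(1) by (auto simp: cof cell_closed_def)
    show "stable_under_pushout C (cof TYPE('u) C X)"
      using L(1) unfolding cof cell_closed_def stable_under_pushout_def by blast
    show "closed_transfinite_composition TYPE('u) C (cof TYPE('u) C X)"
      unfolding closed_transfinite_composition_def
    proof (intro conjI ballI allI impI)
      fix f k assume "f \<in> cof TYPE('u) C X" "k \<in> cof TYPE('u) C X" "Cod C f = Dom C k"
      then show "k \<cdot> f \<in> cof TYPE('u) C X" using cell_closedD(2)[OF L(1)] by (auto simp: cof)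
    next
      fix r :: "'u rel" and l A z
      assume a: "small TYPE('u) (Field r) \<and> smooth_chain C r l A \<and>
        (\<forall>i j. (i, j) \<in> r \<and> j \<noteq> l \<longrightarrow> Farr A (i, j) \<in> cof TYPE('u) C X) \<and> z \<in> Field r \<and> (\<forall>i\<in>Field r. (z, i) \<in> r)"
      have "Farr A (z, l) \<in> L" if "L \<in> \<L>" for L
        by (rule cell_closed_chain[OF L(1)[OF that]]) (use a that cof in blast)+
      then show "Farr A (z, l) \<in> cof TYPE('u) C X" by (simp add: cof)
    qed
  qed
qed

text \<open>Makes \<open>Arr C\<close> one of the classes intersected in \<open>cof\<close> whenever
  it contains \<open>X\<close>.\<close>

lemma Arr_closed: "cell_closed TYPE('u) C (Arr C)" "closed_under_retracts C (Arr C)"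
proof -
  have "Farr A (z, l) \<in> Arr C" if "smooth_chain C r l A" "z \<in> Field r" for r :: "'u rel" and l A z
    using smooth_chainD(3)[OF that] diagramD(2)[OF smooth_chainD(4)[OF that(1)]] by blast
  then show "cell_closed TYPE('u) C (Arr C)"
    unfolding cell_closed_def stable_under_pushout_def closed_transfinite_composition_def
    by (auto simp: is_iso_def is_pushout_def)
  show "closed_under_retracts C (Arr C)" by (simp add: closed_under_retracts_def is_retract_def)
qed

lemma cof_Arr: "X \<subseteq> Arr C \<Longrightarrow> cof TYPE('u) C X \<subseteq> Arr C"
  by (rule cof_subset[OF _ _ Arr_closed]) auto

text \<open>The inverses of the maps out of the least stage form a cocone on
  \<open>Fobj A z\<close>, and the map it induces inverts the composite. This keeps codomain parts
  invertible along chains of squares.\<close>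

lemma iso_chain:
  fixes r :: "'i rel"
  assumes A: "smooth_chain C r l A" and iso: "\<And>i j. (i, j) \<in> r \<Longrightarrow> j \<noteq> l \<Longrightarrow> is_iso C (Farr A (i, j))"
    and z: "z \<in> Field r" "\<And>i. i \<in> Field r \<Longrightarrow> (z, i) \<in> r"
  shows "is_iso C (Farr A (z, l))"
proof -
  note ch = smooth_chainD[OF A] and A' = diagramD[OF smooth_chainD(4)[OF A]]
  interpret r: wo_rel r using ch(1) by (simp add: wo_rel_def)
  let ?S = "Order_Relation.underS r l"
  let ?R = "Restr r ?S"
  note FR = Field_Restr_underS[OF ch(1), of l] and colim = ch(5)[OF ch(2)]
  have S: "(i, l) \<in> r" "i \<noteq> l" "i \<in> Field r" "(z, i) \<in> r" if "i \<in> ?S" for i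
    using that z(2)[of i] by (auto simp: underS_iff Field_def)
  obtain k where k: "k \<in> ?S" using ch(2) by (auto simp: limit_element_def)
  have zl: "(z, l) \<in> r" using ch(3)[OF z(1)] .
  have "z \<noteq> l" using S[OF k] r.ANTISYM by (auto dest: antisymD)
  then have zS: "z \<in> ?S" using zl by (simp add: underS_iff)
  have "\<exists>g. g \<in> hom C (Fobj A i) (Fobj A z) \<and> g \<cdot> Farr A (z, i) = Id C (Fobj A z) \<and> Farr A (z, i) \<cdot> g = Id C (Fobj A i)"
    if "i \<in> ?S" for i
    using iso[OF S(4)[OF that] S(2)[OF that]] A'(2-4)[OF S(4)[OF that]] by (auto simp: is_iso_def)
  then obtain g where g: "\<And>i. i \<in> ?S \<Longrightarrow> g i \<in> hom C (Fobj A i) (Fobj A z)"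
    "\<And>i. i \<in> ?S \<Longrightarrow> g i \<cdot> Farr A (z, i) = Id C (Fobj A z)" "\<And>i. i \<in> ?S \<Longrightarrow> Farr A (z, i) \<cdot> g i = Id C (Fobj A i)" by metis
  have gA: "g i \<in> Arr C" "Dom C (g i) = Fobj A i" "Cod C (g i) = Fobj A z" if "i \<in> ?S" for i
    using g(1)[OF that] by (auto simp: hom_iff)
  have "is_cocone (poset_category ?R) C A (Fobj A z) g"
    unfolding cocone_poset_iff FR
  proof (intro conjI ballI allI impI)
    fix i j assume ij: "(i, j) \<in> ?R"
    then have iS: "i \<in> ?S" and jS: "j \<in> ?S" and ij': "(i, j) \<in> r" by auto
    note [simp] = gA[OF iS] gA[OF jS] A'(2-4)[OF ij'] A'(2-4)[OF S(4)[OF iS]] A'(2-4)[OF S(4)[OF jS]] A'(1)[OF S(3)[OF iS]]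
    have "g j \<cdot> Farr A (i, j) = g j \<cdot> (Farr A (i, j) \<cdot> (Farr A (z, i) \<cdot> g i))" using g(3)[OF iS] by simp
    also have "\<dots> = g j \<cdot> (Farr A (z, j) \<cdot> g i)"
      using comp_assoc_eq[OF A'(6)[OF S(4)[OF iS] ij'], of "g i"] by simp
    also have "\<dots> = g i" using comp_assoc_eq[OF g(2)[OF jS], of "g i"] by simp
    finally show "g j \<cdot> Farr A (i, j) = g i" .
  qed (use A'(1)[OF z(1)] g(1) in auto)
  from colimit_factor[OF colim this] obtain h where h: "h \<in> hom C (Fobj A l) (Fobj A z)"
    "\<And>i. i \<in> ?S \<Longrightarrow> h \<cdot> Farr A (i, l) = g i" using FR by auto
  have hA: "h \<in> Arr C" "Dom C h = Fobj A l" "Cod C h = Fobj A z" using h(1) by (auto simp: hom_iff)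
  note [simp] = hA A'(2-4)[OF zl]
  have 1: "h \<cdot> Farr A (z, l) = Id C (Fobj A z)"
    using h(2)[OF zS] g(2)[OF zS] A'(5)[OF z(1)] gA[OF zS] by simp
  have lO: "Fobj A l \<in> Obj C" using Cod_Obj[of "Farr A (z, l)"] by simp
  have "Farr A (z, l) \<cdot> h = Id C (Fobj A l)"
  proof (rule colimit_eqI[OF colim, of _ "Fobj A l"])
    fix i assume "i \<in> Obj (poset_category ?R)"
    then have iS: "i \<in> ?S" using FR by simp
    note [simp] = gA[OF iS] A'(2-4)[OF S(1)[OF iS]] A'(2-4)[OF S(4)[OF iS]]
    have "Farr A (z, l) \<cdot> h \<cdot> Farr A (i, l) = Farr A (z, l) \<cdot> g i" using h(2)[OF iS] by simp
    also have "\<dots> = Farr A (i, l) \<cdot> (Farr A (z, i) \<cdot> g i)"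
      using comp_assoc_eq[OF A'(6)[OF S(4)[OF iS] S(1)[OF iS]], of "g i"] by simp
    also have "\<dots> = Id C (Fobj A l) \<cdot> Farr A (i, l)" using g(3)[OF iS] by simp
    finally show "Farr A (z, l) \<cdot> h \<cdot> Farr A (i, l) = Id C (Fobj A l) \<cdot> Farr A (i, l)" .
  qed (use lO in \<open>auto simp: hom_iff\<close>)
  with 1 show ?thesis by (intro is_isoI[of _ C "Fobj A z" "Fobj A l" h]) (auto simp: hom_iff)
qed

text \<open>Cells that are isomorphisms extend over the base by \<open>s i \<cdot> y' i\<close>; the
  resulting retraction \<open>h\<close> of \<open>\<rho>\<close> is inverse to it because both sides
  agree on base and cells.\<close>

lemma attaches_iso:
  assumes a: "attaches C f I y s c \<rho> \<kappa>" and y: "\<And>i. i \<in> I \<Longrightarrow> is_iso C (y i)"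
  shows "is_iso C \<rho>"
proof -
  note at = attachingD[OF attachesD(1)[OF a]] and e = extends_cellsD[OF attachesD(2)[OF a]]
  have "\<exists>g. g \<in> hom C (Cod C (y i)) (Dom C (y i)) \<and> g \<cdot> y i = Id C (Dom C (y i)) \<and> y i \<cdot> g = Id C (Cod C (y i))" if "i \<in> I" for i
    using y[OF that] by (auto simp: is_iso_def)
  then obtain y' where y': "\<And>i. i \<in> I \<Longrightarrow> y' i \<in> hom C (Cod C (y i)) (Dom C (y i))"
    "\<And>i. i \<in> I \<Longrightarrow> y' i \<cdot> y i = Id C (Dom C (y i))" "\<And>i. i \<in> I \<Longrightarrow> y i \<cdot> y' i = Id C (Cod C (y i))" by metis
  have y'A: "y' i \<in> Arr C" "Dom C (y' i) = Cod C (y i)" "Cod C (y' i) = Dom C (y i)" if "i \<in> I" for i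
    using y'(1)[OF that] by (auto simp: hom_iff)
  have "extends_cells C f I y s f (Id C f) (\<lambda>i. s i \<cdot> y' i)"
    using at y'A y'(2) by (auto simp: extends_cells_def hom_iff)
  from attaches_factor[OF a this] obtain h where h: "h \<in> hom C c f" "h \<cdot> \<rho> = Id C f" "\<And>i. i \<in> I \<Longrightarrow> h \<cdot> \<kappa> i = s i \<cdot> y' i" by blast
  have hA: "h \<in> Arr C" "Dom C h = c" "Cod C h = f" using h(1) by (auto simp: hom_iff)
  have cO: "c \<in> Obj C" using Cod_Obj[OF e(1)] e(3) by simp
  have "\<rho> \<cdot> h = Id C c"
  proof (rule attaches_eqI[OF a, of _ c])
    fix i assume i: "i \<in> I"
    have "\<rho> \<cdot> h \<cdot> \<kappa> i = \<rho> \<cdot> (s i \<cdot> y' i)" using hA e(1-3) e(4-6)[OF i] h(3)[OF i] by simp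
    also have "\<dots> = \<kappa> i \<cdot> y i \<cdot> y' i" using e(7)[OF i] e(1-3) at(2-)[OF i] y'A[OF i] by simp
    also have "\<dots> = \<kappa> i" using e(4-6)[OF i] at(2)[OF i] y'A[OF i] y'(3)[OF i] by simp
    finally show "\<rho> \<cdot> h \<cdot> \<kappa> i = Id C c \<cdot> \<kappa> i" using e(4-6)[OF i] by simp
  qed (use hA e(1-3) h(2) cO in \<open>simp_all add: hom_iff\<close>)
  then show ?thesis using h hA e(1-3) by (intro is_isoI[of _ C f c h]) (auto simp: hom_iff)
qed

end

section \<open>The functorial factorization in the arrow category\<close>

text \<open>The image of the cell diagram is the cell diagram of the images, so preserving this one
  colimit preserves the attachment.\<close>

lemma attaches_image:
  assumes E: "is_category E" and F: "is_functor E C F" and a: "attaches E f I y s c \<rho> \<kappa>"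
    and pres: "is_colimit (poset_category (cell_poset I)) C (functor_comp F (cat.cell_diagram E f y s))
      (Fobj F c) (\<lambda>p. Farr F (cat.cell_cocone E s \<rho> \<kappa> p))"
  shows "attaches C (Fobj F f) I (\<lambda>i. Farr F (y i)) (\<lambda>i. Farr F (s i)) (Fobj F c) (Farr F \<rho>) (\<lambda>i. Farr F (\<kappa> i))"
proof -
  interpret E: cat E by unfold_locales (rule E)
  interpret C: cat C using functorD(2)[OF F] by unfold_locales
  note at = attachingD[OF attachesD(1)[OF a]] and F' = functorD[OF F]
  have at': "attaching C (Fobj F f) I (\<lambda>i. Farr F (y i)) (\<lambda>i. Farr F (s i))"
    using at F' by (auto simp: attaching_def hom_iff)
  have "is_colimit (poset_category (cell_poset I)) C
      (C.cell_diagram (Fobj F f) (\<lambda>i. Farr F (y i)) (\<lambda>i. Farr F (s i)))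
      (Fobj F c) (\<lambda>p. Farr F (E.cell_cocone s \<rho> \<kappa> p))"
  proof (rule iffD1[OF colimit_poset_cong pres])
    show "is_functor (poset_category (cell_poset I)) C (functor_comp F (E.cell_diagram f y s))"
      using colimitD(1)[OF pres] .
    show "Fobj (functor_comp F (E.cell_diagram f y s)) p = Fobj (C.cell_diagram (Fobj F f) (\<lambda>i. Farr F (y i)) (\<lambda>i. Farr F (s i))) p"
      if "p \<in> Field (cell_poset I)" for p
      using that at F' by (cases p) (auto simp: Field_cell_poset E.cell_diagram_def C.cell_diagram_def)
    show "Farr (functor_comp F (E.cell_diagram f y s)) (p, q) = Farr (C.cell_diagram (Fobj F f) (\<lambda>i. Farr F (y i)) (\<lambda>i. Farr F (s i))) (p, q)"
      if "(p, q) \<in> cell_poset I" for p q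
      using that by (cases rule: cell_poset_cases) (use at F' in \<open>auto simp: E.cell_diagram_def C.cell_diagram_def\<close>)
  qed simp
  from C.colimit_attaches[OF at' this] show ?thesis by (simp add: E.cell_cocone_def)
qed

context cat
begin

interpretation arr: cat arrows by unfold_locales (rule arrow_category_category)

text \<open>Colimits of the parts exist by cocompleteness, hence a colimit in the arrow category is
  computed componentwise. The disjunction treats both projections at once.\<close>

lemma part_preserves:
  assumes univ: "universe TYPE('u)" and C: "cocomplete TYPE('u) C" and F: "F = dom_functor C \<or> F = cod_functor C"
    and small: "small TYPE('u) (Field r)" and colim: "is_colimit (poset_category r) arrows D c t"
  shows "is_colimit (poset_category r) C (functor_comp F D) (Fobj F c) (\<lambda>i. Farr F (t i))"
proof -
  interpret univ "TYPE('u)" by unfold_locales (rule univ)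
  note D = colimitD(1)[OF colim]
  obtain a \<alpha> where a: "is_colimit (poset_category r) C (functor_comp (dom_functor C) D) a \<alpha>"
    using cocomplete_poset_colimit[OF C small functor_compI[OF D dom_functor_functor]] by blast
  obtain b \<beta> where b: "is_colimit (poset_category r) C (functor_comp (cod_functor C) D) b \<beta>"
    using cocomplete_poset_colimit[OF C small functor_compI[OF D cod_functor_functor]] by blast
  show ?thesis using arrow_colimit_parts[OF colim a b] F by auto
qed

lemma part_functor: "F = dom_functor C \<or> F = cod_functor C \<Longrightarrow> is_functor arrows C F"
  using dom_functor_functor cod_functor_functor by blast

lemma part_pushout:
  assumes univ: "universe TYPE('u)" and C: "cocomplete TYPE('u) C" and F: "F = dom_functor C \<or> F = cod_functor C"
    and p: "is_pushout arrows w s w' k"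
  shows "is_pushout C (Farr F w) (Farr F s) (Farr F w') (Farr F k)"
proof -
  interpret univ "TYPE('u)" by unfold_locales (rule univ)
  note F' = functorD[OF part_functor[OF F]]
  have wA: "w \<in> Arr arrows" "s \<in> Arr arrows" "Dom arrows w = Dom arrows s" "w' \<in> Arr arrows" "k \<in> Arr arrows"
    using p by (auto simp: is_pushout_def)
  have a: "attaches arrows (Cod arrows s) {()} (\<lambda>_. w) (\<lambda>_. s) (Cod arrows w') w' (\<lambda>_. k)"
    using arr.is_pushout_iff_attaches[OF wA(1-3)] p by blast
  have "small TYPE('u) (Field (cell_poset {()}))"
    unfolding Field_cell_poset by (intro finite_small) auto
  from attaches_image[OF arrow_category_category part_functor[OF F] a
      part_preserves[OF univ C F this arr.attaches_colimit[OF a]]]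
  have "attaches C (Cod C (Farr F s)) {()} (\<lambda>_. Farr F w) (\<lambda>_. Farr F s) (Cod C (Farr F w')) (Farr F w') (\<lambda>_. Farr F k)"
    using F'(6) wA by simp
  then show ?thesis
    using is_pushout_iff_attaches[of "Farr F w" "Farr F s"] F' wA by simp
qed

lemma part_smooth_chain:
  fixes r :: "'u rel"
  assumes univ: "universe TYPE('u)" and C: "cocomplete TYPE('u) C" and F: "F = dom_functor C \<or> F = cod_functor C"
    and small: "small TYPE('u) (Field r)" and A: "smooth_chain arrows r l A"
  shows "smooth_chain C r l (functor_comp F A)"
proof -
  note ch = arr.smooth_chainD[OF A]
  have "is_colimit (poset_category (Restr r (underS r j))) C (functor_comp F A) (Fobj (functor_comp F A) j)
      (\<lambda>i. Farr (functor_comp F A) (i, j))" if "limit_element r j" for j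
  proof -
    have "Field (Restr r (underS r j)) \<subseteq> Field r" by (auto simp: Field_def)
    then show ?thesis
      using part_preserves[OF univ C F small_subset[OF small] ch(5)[OF that]] by simp
  qed
  then show ?thesis
    using ch functor_compI[OF ch(4) part_functor[OF F]] unfolding smooth_chain_def by blast
qed

text \<open>Both conditions can be tested on parts, because pushouts and smooth chains project to
  pushouts and smooth chains: domain parts stay in \<open>L\<close> by its closure, codomain parts
  stay invertible. With cof(X) for \<open>L\<close>, the class contains every
  \<open>to_identity x\<close> and therefore all values of \<open>\<rho>\<close>.\<close>

lemma arrow_cells_closed:
  assumes univ: "universe TYPE('u)" and C: "cocomplete TYPE('u) C" and L: "cell_closed TYPE('u) C L"
  shows "cell_closed TYPE('u) arrows {w \<in> Arr arrows. dom_part w \<in> L \<and> is_iso C (cod_part w)}"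
    (is "cell_closed _ _ ?L")
  unfolding cell_closed_def
proof (intro conjI)
  show "{w. is_iso arrows w} \<subseteq> ?L"
  proof
    fix w assume "w \<in> {w. is_iso arrows w}"
    then have w: "is_iso arrows w" by simp
    then have "w \<in> Arr arrows" by (simp add: is_iso_def)
    then show "w \<in> ?L" using arrow_iso_parts[OF w] cell_closedD(1)[OF L] by simp
  qed
  show "stable_under_pushout arrows ?L"
    unfolding stable_under_pushout_def
  proof (intro allI impI)
    fix w s w' k assume a: "w \<in> ?L \<and> is_pushout arrows w s w' k"
    then have p: "is_pushout arrows w s w' k" by blast
    have "dom_part w' \<in> L"
      using cell_closedD(3)[OF L] part_pushout[OF univ C _ p, of "dom_functor C"] a by auto
    moreover have "is_iso C (cod_part w')"
    proof -
      have p': "is_pushout C (cod_part w) (cod_part s) (cod_part w') (cod_part k)"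
        using part_pushout[OF univ C _ p, of "cod_functor C"] by simp
      then have "attaches C (Cod C (cod_part s)) {()} (\<lambda>_. cod_part w) (\<lambda>_. cod_part s) (Cod C (cod_part w')) (cod_part w') (\<lambda>_. cod_part k)"
      proof -
        have "cod_part w \<in> Arr C" "cod_part s \<in> Arr C" "Dom C (cod_part w) = Dom C (cod_part s)"
          using p' by (simp_all add: is_pushout_def)
        from is_pushout_iff_attaches[OF this] show ?thesis using p' by blast
      qed
      from attaches_iso[OF this] show ?thesis using a by blast
    qed
    ultimately show "w' \<in> ?L" using p by (auto simp: is_pushout_def)
  qed
  show "closed_transfinite_composition TYPE('u) arrows ?L"
    unfolding closed_transfinite_composition_def
  proof (intro conjI ballI allI impI)
    fix w w' assume w: "w \<in> ?L" "w' \<in> ?L" "Cod arrows w = Dom arrows w'"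
    then have A: "w \<in> Arr arrows" "w' \<in> Arr arrows" by auto
    have "dom_part w' \<cdot> dom_part w \<in> L" "is_iso C (cod_part w' \<cdot> cod_part w)"
      using w arrow_ArrD[OF A(1)] arrow_ArrD[OF A(2)] by (auto intro: cell_closedD(2)[OF L] is_iso_comp)
    then show "w' \<cdot>\<^bsub>arrows\<^esub> w \<in> ?L" using arr.comp_Arr[OF A w(3)] by simp
  next
    fix r :: "'u rel" and l A z
    assume a: "small TYPE('u) (Field r) \<and> smooth_chain arrows r l A \<and>
      (\<forall>i j. (i, j) \<in> r \<and> j \<noteq> l \<longrightarrow> Farr A (i, j) \<in> ?L) \<and> z \<in> Field r \<and> (\<forall>i\<in>Field r. (z, i) \<in> r)"
    then have r: "small TYPE('u) (Field r)" "smooth_chain arrows r l A" "z \<in> Field r" "\<And>i. i \<in> Field r \<Longrightarrow> (z, i) \<in> r"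
      and step: "\<And>i j. (i, j) \<in> r \<Longrightarrow> j \<noteq> l \<Longrightarrow> Farr A (i, j) \<in> ?L" by auto
    have zl: "(z, l) \<in> r" using arr.smooth_chainD(3)[OF r(2,3)] .
    have "Farr (functor_comp (dom_functor C) A) (z, l) \<in> L"
      using part_smooth_chain[OF univ C _ r(1,2), of "dom_functor C"] step
      by (intro cell_closed_chain[OF L r(1) _ _ r(3,4)]) auto
    moreover have "is_iso C (Farr (functor_comp (cod_functor C) A) (z, l))"
      using part_smooth_chain[OF univ C _ r(1,2), of "cod_functor C"] step
      by (intro iso_chain[OF _ _ r(3,4)]) auto
    moreover have "Farr A (z, l) \<in> Arr arrows" using diagramD(2)[OF arr.smooth_chainD(4)[OF r(2)] zl] .
    ultimately show "Farr A (z, l) \<in> ?L" by simp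
  qed
qed

text \<open>Extending a square \<open>x \<rightarrow> g\<close> along this morphism amounts to finding a diagonal of it.\<close>

definition to_identity :: "'a \<Rightarrow> 'a \<times> 'a \<times> 'a \<times> 'a" where
  "to_identity x = (x, x, Id C (Cod C x), Id C (Cod C x))"

lemma to_identity_simps [simp]:
  assumes "x \<in> Arr C"
  shows "to_identity x \<in> Arr arrows" "Dom arrows (to_identity x) = x" "Cod arrows (to_identity x) = Id C (Cod C x)"
    "dom_part (to_identity x) = x" "cod_part (to_identity x) = Id C (Cod C x)"
  using assms by (simp_all add: to_identity_def hom_iff)

text \<open>An extension of the square has parts \<open>a\<close> and \<open>b\<close> with
  \<open>b = g \<cdot> a\<close>, as its source is an identity; so \<open>a\<close> is the
  diagonal.\<close>

lemma injective_lifts: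
  assumes x: "x \<in> Arr C" and g: "g \<in> Arr C"
    and inj: "\<And>s. s \<in> hom arrows x g \<Longrightarrow> \<exists>k \<in> hom arrows (Id C (Cod C x)) g. k \<cdot>\<^bsub>arrows\<^esub> to_identity x = s"
  shows "x \<in> left_lifting C g"
proof (rule left_liftingI[OF x])
  fix u v assume uv: "u \<in> hom C (Dom C x) (Dom C g)" "v \<in> hom C (Cod C x) (Cod C g)" "v \<cdot> x = g \<cdot> u"
  then have "(x, u, v, g) \<in> hom arrows x g" using x g by (simp add: hom_iff)
  then obtain k where k: "k \<in> hom arrows (Id C (Cod C x)) g" "k \<cdot>\<^bsub>arrows\<^esub> to_identity x = (x, u, v, g)" using inj by blast
  obtain a b where kab: "k = (Id C (Cod C x), a, b, g)" using k(1) by (cases k) (auto simp: hom_iff)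
  have kA: "a \<in> hom C (Cod C x) (Dom C g)" "b \<in> hom C (Cod C x) (Cod C g)" "b \<cdot> Id C (Cod C x) = g \<cdot> a"
    using k(1) x by (auto simp: kab hom_iff)
  have "a \<cdot> x = u" "b \<cdot> Id C (Cod C x) = v" using k(2) by (auto simp: kab to_identity_def)
  then show "\<exists>d. d \<in> hom C (Cod C x) (Dom C g) \<and> d \<cdot> x = u \<and> g \<cdot> d = v" using kA by auto
qed

text \<open>The usual retract argument, with a factorization of \<open>f\<close> only up to the
  isomorphism \<open>b\<close>: the diagonal \<open>d\<close> gives the section, \<open>g\<close>
  followed by the inverse of \<open>b\<close> the retraction, and both are identities on
  domains.\<close>

lemma retract_argument:
  assumes w: "w \<in> Arr arrows" "is_iso C (cod_part w)" and lift: "Dom arrows w \<in> left_lifting C (Cod arrows w)"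
  shows "is_retract arrows (Dom arrows w) (dom_part w)"
proof -
  define f where "f = Dom arrows w"
  define g where "g = Cod arrows w"
  define a where "a = dom_part w"
  define b where "b = cod_part w"
  have A: "f \<in> Arr C" "g \<in> Arr C" "a \<in> Arr C" "Dom C a = Dom C f" "Cod C a = Dom C g" "b \<in> Arr C"
    "Dom C b = Cod C f" "Cod C b = Cod C g" "b \<cdot> f = g \<cdot> a"
    using arrow_ArrD[OF w(1)] by (auto simp: f_def g_def a_def b_def)
  have b: "is_iso C b" using w(2) by (simp add: b_def)
  note [simp] = A(1-8)
  obtain b' where b': "b' \<in> hom C (Cod C g) (Cod C f)" "b' \<cdot> b = Id C (Cod C f)"
    using b A by (auto simp: is_iso_def)
  have b'A: "b' \<in> Arr C" "Dom C b' = Cod C g" "Cod C b' = Cod C f" using b'(1) by (auto simp: hom_iff)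
  note [simp] = b'A
  obtain d where d: "d \<in> hom C (Cod C f) (Dom C g)" "d \<cdot> f = a" "g \<cdot> d = b"
    by (rule left_liftingD[OF lift[folded f_def g_def] _ _ A(9)]) (auto simp: hom_iff)
  have dA: "d \<in> Arr C" "Dom C d = Cod C f" "Cod C d = Dom C g" using d(1) by (auto simp: hom_iff)
  note [simp] = dA
  let ?i = "(f, Id C (Dom C f), d, a)" and ?p = "(a, Id C (Dom C f), b' \<cdot> g, f)"
  have "b' \<cdot> (g \<cdot> a) = f"
    using comp_assoc_eq[OF b'(2), of f] A(9) by simp
  then have "?i \<in> hom arrows f a" "?p \<in> hom arrows a f"
    using d by (auto simp: hom_iff)
  moreover have "?p \<cdot>\<^bsub>arrows\<^esub> ?i = Id arrows f" using d(3) b'(2) by simp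
  ultimately show ?thesis
    unfolding is_retract_def f_def[symmetric] a_def[symmetric] using A by (intro conjI bexI[of _ ?i] bexI[of _ ?p]) simp_all
qed

end

text \<open>Meant for a natural transformation \<open>\<rho>\<close> from the identity functor of the arrow category to \<open>R\<close>.\<close>

definition left_part where
  "left_part C R \<rho> = \<lparr>Fobj = (\<lambda>f. dom_part (\<rho> f)),
     Farr = (\<lambda>h. (dom_part (\<rho> (Dom (arrow_category C) h)), dom_part h, dom_part (Farr R h),
       dom_part (\<rho> (Cod (arrow_category C) h))))\<rparr>"

context cat
begin

interpretation arr: cat arrows by unfold_locales (rule arrow_category_category)

lemma left_part_functor:
  assumes R: "is_functor arrows arrows R" and \<rho>: "\<And>f. f \<in> Arr C \<Longrightarrow> \<rho> f \<in> hom arrows f (Fobj R f)"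
    and nat: "\<And>h. h \<in> Arr arrows \<Longrightarrow> Farr R h \<cdot>\<^bsub>arrows\<^esub> \<rho> (Dom arrows h) = \<rho> (Cod arrows h) \<cdot>\<^bsub>arrows\<^esub> h"
  shows "is_functor arrows arrows (left_part C R \<rho>)"
proof -
  note R' = functorD[OF R]
  have \<rho>A: "\<rho> f \<in> Arr arrows" "Dom arrows (\<rho> f) = f" "Cod arrows (\<rho> f) = Fobj R f" if "f \<in> Arr C" for f
    using \<rho>[OF that] by (auto simp: hom_iff)
  have a: "dom_part (\<rho> f) \<in> Arr C" "Dom C (dom_part (\<rho> f)) = Dom C f" "Cod C (dom_part (\<rho> f)) = Dom C (Fobj R f)" if "f \<in> Arr C" for f
    using arrow_ArrD(1-3)[OF \<rho>A(1)[OF that]] \<rho>A[OF that] by auto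
  have nat': "dom_part (Farr R h) \<cdot> dom_part (\<rho> (Dom arrows h)) = dom_part (\<rho> (Cod arrows h)) \<cdot> dom_part h"
    if "h \<in> Arr arrows" for h
    using arg_cong[OF nat[OF that], of dom_part] by simp
  show ?thesis
    unfolding is_functor_def
  proof (intro conjI ballI impI)
    show "Farr (left_part C R \<rho>) h \<in> hom arrows (Fobj (left_part C R \<rho>) (Dom arrows h)) (Fobj (left_part C R \<rho>) (Cod arrows h))"
      if h: "h \<in> Arr arrows" for h
    proof -
      have RA: "Farr R h \<in> Arr arrows" using R'(4)[OF h] .
      show ?thesis
        using a[OF arrow_ArrD(8)[OF h]] a[OF arrow_ArrD(9)[OF h]] nat'[OF h] arrow_ArrD(1-3)[OF h] arrow_ArrD(1-3)[OF RA] R'(5,6)[OF h]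
        by (simp add: left_part_def hom_iff)
    qed
    show "Farr (left_part C R \<rho>) (Id arrows f) = Id arrows (Fobj (left_part C R \<rho>) f)" if "f \<in> Obj arrows" for f
    proof -
      have "dom_part (Farr R (Id arrows f)) = Id C (Dom C (Fobj R f))" using R'(7)[OF that] by simp
      then show ?thesis using that a[of f] by (simp add: left_part_def)
    qed
    show "Farr (left_part C R \<rho>) (k \<cdot>\<^bsub>arrows\<^esub> h) = Farr (left_part C R \<rho>) k \<cdot>\<^bsub>arrows\<^esub> Farr (left_part C R \<rho>) h"
      if "h \<in> Arr arrows" "k \<in> Arr arrows" "Cod arrows h = Dom arrows k" for h k
      using R'(8)[OF that] arr.Dom_comp[OF that] arr.Cod_comp[OF that] by (simp add: left_part_def)
  qed (use a in \<open>auto simp: arrow_category_category left_part_def\<close>)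
qed

text \<open>On domains the functor is the domain projection, on codomains it is \<open>R\<close>
  followed by the domain projection; both preserve \<open>mu\<close>-directed colimits, and
  componentwise colimits are colimits of arrows.\<close>

lemma left_part_preserves:
  fixes mu :: "'u rel"
  assumes univ: "universe TYPE('u)" and C: "cocomplete TYPE('u) C"
    and R: "is_functor arrows arrows R" and \<rho>: "\<And>f. f \<in> Arr C \<Longrightarrow> \<rho> f \<in> hom arrows f (Fobj R f)"
    and nat: "\<And>h. h \<in> Arr arrows \<Longrightarrow> Farr R h \<cdot>\<^bsub>arrows\<^esub> \<rho> (Dom arrows h) = \<rho> (Cod arrows h) \<cdot>\<^bsub>arrows\<^esub> h"
    and pres: "preserves_directed_colimits mu arrows arrows R"
  shows "preserves_directed_colimits mu arrows arrows (left_part C R \<rho>)"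
  unfolding preserves_directed_colimits_def
proof (intro allI impI)
  fix r X c t assume "directed_poset mu r \<and> is_colimit (poset_category r) arrows X c t"
  then have r: "directed_poset mu r" and colim: "is_colimit (poset_category r) arrows X c t" by auto
  note small = directed_posetD(5)[OF r]
  note L = left_part_functor[OF R \<rho> nat]
  note X = colimitD(1)[OF colim]
  note X' = diagramD[OF X] and t = cocone_posetD[OF colimitD(2)[OF colim]]
  have colimR: "is_colimit (poset_category r) arrows (functor_comp R X) (Fobj R c) (\<lambda>i. Farr R (t i))"
    using pres r colim unfolding preserves_directed_colimits_def by blast
  have a: "Dom C (dom_part (\<rho> f)) = Dom C f" "Cod C (dom_part (\<rho> f)) = Dom C (Fobj R f)" if "f \<in> Arr C" for f
    using arrow_ArrD(2,3)[of "\<rho> f" C] \<rho>[OF that] by (auto simp: hom_iff)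
  have cO: "c \<in> Arr C" using t(1) by simp
  have XO: "Fobj X i \<in> Arr C" if "i \<in> Field r" for i using X'(1)[OF that] by simp
  let ?L = "left_part C R \<rho>"
  show "is_colimit (poset_category r) arrows (functor_comp ?L X) (Fobj ?L c) (\<lambda>i. Farr ?L (t i))"
  proof (rule arrow_colimit_of_parts)
    show "is_functor (poset_category r) arrows (functor_comp ?L X)" by (rule functor_compI[OF X L])
    show "is_cocone (poset_category r) arrows (functor_comp ?L X) (Fobj ?L c) (\<lambda>i. Farr ?L (t i))"
      by (rule cocone_functor_comp[OF L X colimitD(2)[OF colim]])
    have "is_colimit (poset_category r) C (functor_comp (dom_functor C) (functor_comp ?L X)) (Dom C c) (\<lambda>i. dom_part (t i))"
      by (rule iffD1[OF colimit_poset_cong[OF functor_compI[OF X dom_functor_functor]]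
            part_preserves[OF univ C disjI1[OF refl] small colim, simplified]])
        (use XO a(1) in \<open>auto simp: left_part_def\<close>)
    then show "is_colimit (poset_category r) C (functor_comp (dom_functor C) (functor_comp ?L X)) (Dom C (Fobj ?L c)) (\<lambda>i. dom_part (Farr ?L (t i)))"
      using a(1)[OF cO] by (simp add: left_part_def)
    have "is_colimit (poset_category r) C (functor_comp (cod_functor C) (functor_comp ?L X)) (Dom C (Fobj R c)) (\<lambda>i. dom_part (Farr R (t i)))"
      by (rule iffD1[OF colimit_poset_cong[OF functor_compI[OF colimitD(1)[OF colimR] dom_functor_functor]]
            part_preserves[OF univ C disjI1[OF refl] small colimR, simplified]])
        (use XO a(2) in \<open>auto simp: left_part_def\<close>)
    then show "is_colimit (poset_category r) C (functor_comp (cod_functor C) (functor_comp ?L X)) (Cod C (Fobj ?L c)) (\<lambda>i. cod_part (Farr ?L (t i)))"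
      using a(2)[OF cO] by (simp add: left_part_def)
  qed
qed

end

section \<open>Transport of accessibility along an isomorphism of categories\<close>

lemma compact_image_iso:
  assumes iso: "cat_isomorphism M E \<Phi> \<Psi>" and u: "compact_object lam E u"
  shows "compact_object lam M (Fobj \<Psi> u)"
  unfolding compact_object_def
proof (intro conjI allI impI ballI)
  have F: "is_functor M E \<Phi>" and G: "is_functor E M \<Psi>" using iso by (auto simp: cat_isomorphism_def)
  interpret M: cat M using functorD(1)[OF F] by unfold_locales
  have inv: "\<And>a. a \<in> Obj E \<Longrightarrow> Fobj \<Phi> (Fobj \<Psi> a) = a" "\<And>f. f \<in> Arr M \<Longrightarrow> Farr \<Psi> (Farr \<Phi> f) = f"
    "\<And>f. f \<in> Arr E \<Longrightarrow> Farr \<Phi> (Farr \<Psi> f) = f" "\<And>a. a \<in> Obj M \<Longrightarrow> Fobj \<Psi> (Fobj \<Phi> a) = a"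
    using iso by (auto simp: cat_isomorphism_def)
  note F' = functorD[OF F] and G' = functorD[OF G]
  have uO: "u \<in> Obj E" using u by (simp add: compact_object_def)
  then show "Fobj \<Psi> u \<in> Obj M" by (rule G')
  fix r D c t assume "directed_poset lam r \<and> is_colimit (poset_category r) M D c t"
  then have r: "directed_poset lam r" and colim: "is_colimit (poset_category r) M D c t" by auto
  note colimE = colimit_image_iso[OF iso colim]
  note D = diagramD[OF colimitD(1)[OF colim]] and t = cocone_posetD[OF colimitD(2)[OF colim]]
  have \<Phi>hom: "Farr \<Phi> f \<in> hom E u (Fobj \<Phi> b)" if "f \<in> hom M (Fobj \<Psi> u) b" for f b
    using that F'(4-6)[of f] inv(1)[OF uO] by (auto simp: hom_iff)
  have \<Phi>eq: "f = g" if "Farr \<Phi> f = Farr \<Phi> g" "f \<in> Arr M" "g \<in> Arr M" for f g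
    using that inv(2) by metis
  {
    fix f assume f: "f \<in> hom M (Fobj \<Psi> u) c"
    obtain i g where i: "i \<in> Field r" and g: "g \<in> hom E u (Fobj \<Phi> (Fobj D i))" "Farr \<Phi> (t i) \<cdot>\<^bsub>E\<^esub> g = Farr \<Phi> f"
      using compact_factor[OF u r colimE \<Phi>hom[OF f]] by auto
    have gA: "g \<in> Arr E" "Dom E g = u" "Cod E g = Fobj \<Phi> (Fobj D i)" using g(1) by (auto simp: hom_iff)
    have g': "Farr \<Psi> g \<in> hom M (Fobj \<Psi> u) (Fobj D i)" using G'(4-6)[OF gA(1)] gA inv(4)[OF D(1)[OF i]] by (simp add: hom_iff)
    have "Farr \<Phi> (t i \<cdot>\<^bsub>M\<^esub> Farr \<Psi> g) = Farr \<Phi> f"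
      using F'(8)[of "Farr \<Psi> g" "t i"] g' g(2) inv(3)[OF gA(1)] t(2,3)[OF i] by (simp add: hom_iff)
    then have "t i \<cdot>\<^bsub>M\<^esub> Farr \<Psi> g = f"
      using g' f t(2,3)[OF i] by (intro \<Phi>eq) (auto simp: hom_iff)
    then show "\<exists>i\<in>Field r. \<exists>g\<in>hom M (Fobj \<Psi> u) (Fobj D i). t i \<cdot>\<^bsub>M\<^esub> g = f" using i g' by blast
  }
  fix i g g' assume i: "i \<in> Field r" and g: "g \<in> hom M (Fobj \<Psi> u) (Fobj D i)" "g' \<in> hom M (Fobj \<Psi> u) (Fobj D i)"
    and eq: "t i \<cdot>\<^bsub>M\<^esub> g = t i \<cdot>\<^bsub>M\<^esub> g'"
  have gA: "g \<in> Arr M" "Dom M g = Fobj \<Psi> u" "Cod M g = Fobj D i" "g' \<in> Arr M" "Dom M g' = Fobj \<Psi> u" "Cod M g' = Fobj D i"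
    using g by (auto simp: hom_iff)
  have "Farr \<Phi> (t i) \<cdot>\<^bsub>E\<^esub> Farr \<Phi> g = Farr \<Phi> (t i) \<cdot>\<^bsub>E\<^esub> Farr \<Phi> g'"
    using F'(8)[of g "t i"] F'(8)[of g' "t i"] gA t(2,3)[OF i] eq by simp
  then obtain j where j: "(i, j) \<in> r" "Farr \<Phi> (Farr D (i, j)) \<cdot>\<^bsub>E\<^esub> Farr \<Phi> g = Farr \<Phi> (Farr D (i, j)) \<cdot>\<^bsub>E\<^esub> Farr \<Phi> g'"
    using compact_merge[OF u r colimE i, of "Farr \<Phi> g" "Farr \<Phi> g'"] \<Phi>hom[OF g(1)] \<Phi>hom[OF g(2)] by auto
  have "Farr \<Phi> (Farr D (i, j) \<cdot>\<^bsub>M\<^esub> g) = Farr \<Phi> (Farr D (i, j) \<cdot>\<^bsub>M\<^esub> g')"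
    using F'(8)[of g "Farr D (i, j)"] F'(8)[of g' "Farr D (i, j)"] gA D(2,3)[OF j(1)] j(2) by simp
  then have "Farr D (i, j) \<cdot>\<^bsub>M\<^esub> g = Farr D (i, j) \<cdot>\<^bsub>M\<^esub> g'"
    using gA D(2,3)[OF j(1)] by (intro \<Phi>eq) auto
  then show "\<exists>j. (i, j) \<in> r \<and> Farr D (i, j) \<cdot>\<^bsub>M\<^esub> g = Farr D (i, j) \<cdot>\<^bsub>M\<^esub> g'" using j(1) by blast
qed

text \<open>The source of the functor must have objects and arrows in \<open>'u\<close>, whereas the
  arrows of the arrow category are quadruples; accessibility has to be carried over to a coded copy.
  The distinct elements enter through the characterization of presentable objects on both
  sides.\<close>

lemma (in univ) lam_accessible_iso:
  fixes M :: "('o, 'a) category" and E :: "('p, 'b) category" and lam :: "'u rel"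
  assumes iso: "cat_isomorphism M E \<Phi> \<Psi>" and lam: "regular_cardinal lam" and E: "lam_accessible lam E"
    and y: "y0 \<noteq> (y1 :: 'b)" and x: "x0 \<noteq> (x1 :: 'a)"
  shows "lam_accessible lam M"
proof -
  have F: "is_functor M E \<Phi>" and G: "is_functor E M \<Psi>" using iso by (auto simp: cat_isomorphism_def)
  have inv: "\<And>a. a \<in> Obj E \<Longrightarrow> Fobj \<Phi> (Fobj \<Psi> a) = a" "\<And>f. f \<in> Arr M \<Longrightarrow> Farr \<Psi> (Farr \<Phi> f) = f"
    "\<And>a. a \<in> Obj M \<Longrightarrow> Fobj \<Psi> (Fobj \<Phi> a) = a"
    using iso by (auto simp: cat_isomorphism_def)
  note F' = functorD[OF F] and G' = functorD[OF G]
  note iso' = cat_isomorphism_sym[OF iso]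
  have ls: "locally_small TYPE('u) E" and dir: "has_directed_colimits lam E" using E by (auto simp: lam_accessible_def)
  have ls': "locally_small TYPE('u) M"
    unfolding locally_small_def
  proof (intro conjI ballI)
    fix a b assume ab: "a \<in> Obj M" "b \<in> Obj M"
    have "hom M a b \<subseteq> Farr \<Psi> ` hom E (Fobj \<Phi> a) (Fobj \<Phi> b)"
    proof
      fix f assume "f \<in> hom M a b"
      then show "f \<in> Farr \<Psi> ` hom E (Fobj \<Phi> a) (Fobj \<Phi> b)"
        using inv(2)[of f] F'(4-6)[of f] by (intro image_eqI[of _ _ "Farr \<Phi> f"]) (auto simp: hom_iff)
    qed
    moreover have "small TYPE('u) (hom E (Fobj \<Phi> a) (Fobj \<Phi> b))" using ls F'(3) ab by (simp add: locally_small_def)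
    ultimately show "small TYPE('u) (hom M a b)" using small_subset small_image by blast
  qed (rule F')
  have "has_directed_colimits lam M"
    unfolding has_directed_colimits_def
  proof (intro allI impI)
    fix r D assume rD: "directed_poset lam r \<and> is_functor (poset_category r) M D"
    then obtain c t where c: "is_colimit (poset_category r) E (functor_comp \<Phi> D) c t"
      using dir functor_compI[OF _ F] unfolding has_directed_colimits_def by blast
    have "is_colimit (poset_category r) M D (Fobj \<Psi> c) (\<lambda>i. Farr \<Psi> (t i))"
      by (rule iffD1[OF colimit_poset_cong[OF functor_compI[OF colimitD(1)[OF c] G]] colimit_image_iso[OF iso' c]])
        (use diagramD(1,2)[OF conjunct2[OF rD]] inv(2,3) in auto)
    then show "\<exists>c t. is_colimit (poset_category r) M D c t" by blast
  qed
  moreover obtain A where A: "small TYPE('u) A" "\<And>a. a \<in> A \<Longrightarrow> presentable_object lam E a"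
    "\<And>c. c \<in> Obj E \<Longrightarrow> \<exists>r D t. directed_poset lam r \<and> (\<forall>i \<in> Field r. Fobj D i \<in> A) \<and>
           is_colimit (poset_category r) E D c t"
    using E unfolding lam_accessible_def by blast
  have "presentable_object lam M a" if "a \<in> Fobj \<Psi> ` A" for a
    using that A(2) compact_image_iso[OF iso] presentable_iff_compact[OF ls lam y] presentable_iff_compact[OF ls' lam x] by auto
  moreover have "\<exists>r D t. directed_poset lam r \<and> (\<forall>i \<in> Field r. Fobj D i \<in> Fobj \<Psi> ` A) \<and> is_colimit (poset_category r) M D c t"
    if c: "c \<in> Obj M" for c
  proof -
    obtain r D t where r: "directed_poset lam r" "\<forall>i \<in> Field r. Fobj D i \<in> A" "is_colimit (poset_category r) E D (Fobj \<Phi> c) t"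
      using A(3)[OF F'(3)[OF c]] by blast
    have "is_colimit (poset_category r) M (functor_comp \<Psi> D) c (\<lambda>i. Farr \<Psi> (t i))"
      using colimit_image_iso[OF iso' r(3)] inv(3)[OF c] by simp
    moreover have "\<forall>i \<in> Field r. Fobj (functor_comp \<Psi> D) i \<in> Fobj \<Psi> ` A" using r(2) by simp
    ultimately show ?thesis using r(1) by blast
  qed
  moreover have "small TYPE('u) (Fobj \<Psi> ` A)" using A(1) by (rule small_image)
  ultimately show ?thesis using ls' unfolding lam_accessible_def by blast
qed

theorem proposition3p4:
  fixes K :: "('u, 'u) category" and X :: "'u set"
  assumes "universe TYPE('u)"
    and "locally_presentable TYPE('u) K"
    and "X \<subseteq> Arr K" and "small TYPE('u) X"
  shows "\<exists>(M :: ('u, 'u) category) F.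
    accessible_functor TYPE('u) M (arrow_category K) F \<and>
    split_idempotent_completion TYPE('u)
      (full_image M (arrow_category K) F)
      (full_subcategory (arrow_category K) (cof TYPE('u) K X))
      inclusion_functor"
proof -
  interpret univ "TYPE('u)" by unfold_locales (rule assms(1))
  have cocomplete: "cocomplete TYPE('u) K" using assms(2) by (simp add: locally_presentable_def)
  obtain lam :: "'u rel" where lam: "regular_cardinal lam" "lam_accessible lam K"
    using assms(2) by (auto simp: locally_presentable_def accessible_category_def)
  interpret cat K using lam(2) by (simp add: lam_accessible_def locally_small_def cat_def)
  interpret arr: cat arrows by unfold_locales (rule arrow_category_category)
  obtain y0 y1 :: 'u where y: "y0 \<noteq> y1" using infinite_univ by (metis (full_types) UNIV_I finite.simps finite_subset insert_iff subsetI)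
  then have y': "(y0, y0, y0, y0) \<noteq> (y1, y0, y0, y0)" by simp
  have acc: "lam_accessible lam arrows" by (rule arrow_accessible[OF lam y])
  \<comment> \<open>The domain of \<open>to_identity x\<close> is \<open>x\<close> itself, seen as
    an object of the arrow category; \<open>mu\<close> makes all of these compact.\<close>
  obtain mu :: "'u rel" where mu: "regular_cardinal mu" "\<And>x. x \<in> X \<Longrightarrow> compact_object mu arrows x"
  proof -
    have "X \<subseteq> Obj arrows" using assms(3) by simp
    from accessible_compact_bound[OF lam(1) acc y' assms(4) this] show ?thesis using that by metis
  qed
  have XA: "x \<in> Arr K" if "x \<in> X" for x using assms(3) that by blast
  interpret so: small_object "TYPE('u)" arrows "to_identity ` X" mu
  proof
    show "cocomplete TYPE('u) arrows" by (rule arrow_cocomplete[OF cocomplete])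
    show "locally_small TYPE('u) arrows" using acc by (simp add: lam_accessible_def)
    show "to_identity ` X \<subseteq> Arr arrows" using XA by auto
    show "small TYPE('u) (to_identity ` X)" using assms(4) by (rule small_image)
    show "compact_object mu arrows (Dom arrows y)" if "y \<in> to_identity ` X" for y
      using that mu(2) XA by auto
  qed (rule mu(1))
  let ?cof = "cof TYPE('u) K X"
  note cof = cof_closed[of X]
  obtain R \<rho> where R: "is_functor arrows arrows R" "preserves_directed_colimits mu arrows arrows R"
    and \<rho>: "\<And>f. f \<in> Obj arrows \<Longrightarrow> \<rho> f \<in> hom arrows f (Fobj R f)"
      "\<And>h. h \<in> Arr arrows \<Longrightarrow> Farr R h \<cdot>\<^bsub>arrows\<^esub> \<rho> (Dom arrows h) = \<rho> (Cod arrows h) \<cdot>\<^bsub>arrows\<^esub> h"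
    and inj: "\<And>f. f \<in> Obj arrows \<Longrightarrow> so.injective_object (Fobj R f)"
    and closed: "\<And>f L. f \<in> Obj arrows \<Longrightarrow> cell_closed TYPE('u) arrows L \<Longrightarrow> to_identity ` X \<subseteq> L \<Longrightarrow> \<rho> f \<in> L"
    using so.small_object_argument by blast
  have \<rho>': "\<rho> f \<in> hom arrows f (Fobj R f)" if "f \<in> Arr K" for f using \<rho>(1) that by simp
  have \<rho>_cof: "dom_part (\<rho> f) \<in> ?cof" "is_iso K (cod_part (\<rho> f))" if f: "f \<in> Arr K" for f
  proof -
    have "to_identity ` X \<subseteq> {w \<in> Arr arrows. dom_part w \<in> ?cof \<and> is_iso K (cod_part w)}"
      using XA cof(3) by auto
    then have "\<rho> f \<in> {w \<in> Arr arrows. dom_part w \<in> ?cof \<and> is_iso K (cod_part w)}"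
      using closed[OF _ arrow_cells_closed[OF assms(1) cocomplete cof(1)]] f by simp
    then show "dom_part (\<rho> f) \<in> ?cof" "is_iso K (cod_part (\<rho> f))" by auto
  qed
  have R_lift: "?cof \<subseteq> left_lifting K (Fobj R f)" if f: "f \<in> Arr K" for f
  proof (rule cof_lifts)
    show g: "Fobj R f \<in> Arr K" using functorD(3)[OF R(1), of f] f by simp
    show "X \<subseteq> left_lifting K (Fobj R f)"
    proof
      fix x assume x: "x \<in> X"
      show "x \<in> left_lifting K (Fobj R f)"
      proof (rule injective_lifts[OF XA[OF x] g])
        fix s assume "s \<in> hom arrows x (Fobj R f)"
        then show "\<exists>k \<in> hom arrows (Id K (Cod K x)) (Fobj R f). k \<cdot>\<^bsub>arrows\<^esub> to_identity x = s"
          using inj[of f] f x XA[OF x] unfolding so.injective_object_def by auto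
      qed
    qed
  qed
  let ?L = "left_part K R \<rho>"
  have L: "is_functor arrows arrows ?L" by (rule left_part_functor[OF R(1) \<rho>' \<rho>(2)])
  have L_pres: "preserves_directed_colimits mu arrows arrows ?L"
    by (rule left_part_preserves[OF assms(1) cocomplete R(1) \<rho>' \<rho>(2) R(2)])
  obtain p :: "'u \<times> 'u \<Rightarrow> 'u" where p: "inj p" by (rule pairing_inj)
  \<comment> \<open>Quadruples are coded by iterating an injection of pairs into \<open>'u\<close>;
    the objects of the arrow category already lie in \<open>'u\<close>.\<close>
  define e where "e w = p (fst w, p (fst (snd w), p (snd (snd w))))" for w :: "'u \<times> 'u \<times> 'u \<times> 'u"
  have e: "inj e" by (rule injI) (simp add: e_def inj_eq[OF p] prod_eq_iff)
  define M where "M = recode (\<lambda>f. f) e arrows"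
  define \<Phi> :: "('u, 'u, 'u, 'u \<times> 'u \<times> 'u \<times> 'u) cat_functor"
    where "\<Phi> = \<lparr>Fobj = inv_into (Obj arrows) (\<lambda>f. f), Farr = inv_into (Arr arrows) e\<rparr>"
  define \<Psi> :: "('u, 'u \<times> 'u \<times> 'u \<times> 'u, 'u, 'u) cat_functor" where "\<Psi> = \<lparr>Fobj = (\<lambda>f. f), Farr = e\<rparr>"
  have iso: "cat_isomorphism M arrows \<Phi> \<Psi>"
    unfolding M_def \<Phi>_def \<Psi>_def
    by (rule recode_isomorphism[OF arrow_category_category]) (use e in \<open>auto intro: inj_on_subset\<close>)
  have \<Phi>: "is_functor M arrows \<Phi>" using iso by (simp add: cat_isomorphism_def)
  have \<Phi>_Obj: "Fobj \<Phi> ` Obj M = Arr K"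
  proof -
    have "Fobj \<Phi> f = f" if "f \<in> Arr K" for f using that f_inv_into_f[of f "\<lambda>f. f" "Arr K"] by (simp add: \<Phi>_def)
    moreover have "Obj M = Arr K" by (simp add: M_def recode_def)
    ultimately show ?thesis by auto
  qed
  have M: "lam_accessible lam M" by (rule lam_accessible_iso[OF iso lam(1) acc y' y])
  let ?F = "functor_comp ?L \<Phi>"
  have \<Phi>_pres: "preserves_directed_colimits mu M arrows \<Phi>"
    using colimit_image_iso[OF iso] unfolding preserves_directed_colimits_def by blast
  \<comment> \<open>Both categories are accessible for \<open>lam\<close>, while preservation holds
    for \<open>mu\<close>; the definition lets these cardinals differ.\<close>
  have "accessible_functor TYPE('u) M arrows ?F"
    unfolding accessible_functor_def accessible_category_def
    using lam(1) M acc mu(1) functor_compI[OF \<Phi> L] preserves_comp[OF \<Phi>_pres L_pres] by blast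
  moreover have "split_idempotent_completion TYPE('u) (full_image M arrows ?F) (full_subcategory arrows ?cof) inclusion_functor"
  proof -
    have image: "Fobj ?F ` Obj M = (\<lambda>f. dom_part (\<rho> f)) ` Arr K"
      unfolding \<Phi>_Obj[symmetric] image_image by (simp add: left_part_def)
    show ?thesis
      unfolding full_image_def image
    proof (rule arr.split_idempotent_completion_retracts)
      show "(\<lambda>f. dom_part (\<rho> f)) ` Arr K \<subseteq> ?cof" using \<rho>_cof(1) by blast
      show cof_Obj: "?cof \<subseteq> Obj arrows" using cof_Arr[OF assms(3)] by simp
      show "\<exists>s\<in>(\<lambda>f. dom_part (\<rho> f)) ` Arr K. is_retract arrows f s" if "f \<in> ?cof" for f
      proof -
        have f: "f \<in> Arr K" using that cof_Obj by auto
        have w: "\<rho> f \<in> Arr arrows" "Dom arrows (\<rho> f) = f" "Cod arrows (\<rho> f) = Fobj R f" using \<rho>'[OF f] by (auto simp: hom_iff)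
        \<comment> \<open>As a member of the class, \<open>f\<close> lifts against
          \<open>Fobj R f\<close>, the target of \<open>\<rho> f\<close>.\<close>
        have "is_retract arrows f (dom_part (\<rho> f))"
          using retract_argument[OF w(1) \<rho>_cof(2)[OF f]] R_lift[OF f] that w by auto
        then show ?thesis using f by blast
      qed
      show "idempotents_split (full_subcategory arrows ?cof)"
        unfolding idempotents_split_def
      proof (intro ballI impI)
        fix k f assume k: "k \<in> Obj (full_subcategory arrows ?cof)" and f: "f \<in> hom (full_subcategory arrows ?cof) k k"
          and idem: "f \<cdot>\<^bsub>full_subcategory arrows ?cof\<^esub> f = f"
        have k': "k \<in> ?cof" "k \<in> Obj arrows" using k cof_Obj by auto
        have f': "f \<in> hom arrows k k" "f \<cdot>\<^bsub>arrows\<^esub> f = f" using f idem by (auto simp: hom_iff)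
        \<comment> \<open>The splitting exists in the cocomplete arrow category; its middle object
          is a retract of \<open>k\<close>, so closure under retracts keeps it in the class.\<close>
        obtain x i q where x: "x \<in> Obj arrows" "i \<in> hom arrows x k" "q \<in> hom arrows k x" "q \<cdot>\<^bsub>arrows\<^esub> i = Id arrows x" "i \<cdot>\<^bsub>arrows\<^esub> q = f"
          using arr.cocomplete_idempotents_split[OF assms(1) arrow_cocomplete[OF cocomplete] k'(2) f'] by blast
        have "is_retract arrows x k" using x k'(2) by (auto simp: is_retract_def)
        then have xc: "x \<in> ?cof" using cof(2) k'(1) unfolding closed_under_retracts_def by blast
        show "\<exists>x\<in>Obj (full_subcategory arrows ?cof). \<exists>i\<in>hom (full_subcategory arrows ?cof) x k.
            \<exists>p\<in>hom (full_subcategory arrows ?cof) k x.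
              p \<cdot>\<^bsub>full_subcategory arrows ?cof\<^esub> i = Id (full_subcategory arrows ?cof) x \<and>
              i \<cdot>\<^bsub>full_subcategory arrows ?cof\<^esub> p = f"
          using x xc k'(1) by (auto simp: full_subcategory_hom)
      qed
    qed
  qed
  ultimately show ?thesis by blast
qed

end
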